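(* There is a tight non-orientably regular polyhedron of type $\{p,q\}$ if and only if one of the following holds, for some positive integers $k$ and $r$: (a) $p=4$ and $q=3k$; (b) $p=4r$ and $q=6k$, with $r>1$ odd and $k$ odd; (c) $q=4$ and $p=3k$; (d) $q=4r$ and $p=6k$, with $r>1$ odd and $k$ odd. Furthermore, in each case there is a unique such polyhedron up to isomorphism, except when $p=4$ and $q=6k$, or $q=4$ and $p=6k$, in which cases there are two isomorphism types.
   Context: An (abstract) polyhedron is a partially ordered set whose elements have rank 0 (vertices), 1 (edges) or 2 (faces) such that: every flag (maximal chain) consists of one vertex, one edge and one face; each edge is incident with exactly two vertices and exactly two faces; the vertex–edge graph is connected; and for every vertex $F_0$ the poset $\{G:G>F_0\}$ is isomorphic to the vertex–edge incidence poset of a connected 2-regular graph. $\Phi^i$ is the flag differing from flag $\Phi$ only in its rank-$i$ element. Type $\{p,q\}$: faces have $p$ edges, vertices lie on $q$ edges. Regular: automorphism group $\Gamma$ transitive on flags; with base flag $\Phi$, $\Gamma=\langle\rho_0,\rho_1,\rho_2\rangle$ with $\rho_i:\Phi\mapsto\Phi^i$; $\Gamma^+=\langle\rho_0\rho_1,\rho_1\rho_2\rangle$; non-orientably regular means $\Gamma^+=\Gamma$. A finite polyhedron of type $\{p,q\}$ has at least $2pq$ flags and is tight if it has exactly $2pq$.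
   Formalization: A polyhedron is also required to have polygonal faces: for each face, the vertices and edges below it form the incidence poset of a connected 2-regular graph. Without this the claim fails, e.g. for a type {240,3} example whose faces are unions of disjoint 20-gons. *)

theory Defs
  imports
    "HOL-Algebra.Bij"
    "HOL-Algebra.Generated_Groups"
    "HOL-Library.Infinite_Typeclass"
begin

section \<open>Posets and incidence posets of graphs\<close>

text \<open>Posets are represented by their reflexive order relation; the carrier is its field.\<close>

definition poset_iso_map :: "'a rel \<Rightarrow> 'b rel \<Rightarrow> ('a \<Rightarrow> 'b) \<Rightarrow> bool" where
  "poset_iso_map r s f \<longleftrightarrow>
     bij_betw f (Field r) (Field s) \<and>
     (\<forall>x\<in>Field r. \<forall>y\<in>Field r. (x, y) \<in> r \<longleftrightarrow> (f x, f y) \<in> s)"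

definition poset_isomorphic :: "'a rel \<Rightarrow> 'b rel \<Rightarrow> bool" where
  "poset_isomorphic r s \<longleftrightarrow> (\<exists>f. poset_iso_map r s f)"

text \<open>Undirected graphs without loops.  Parallel edges are allowed, so that the
  2-regular graph with two vertices (the digon) is covered.\<close>

record ('v, 'e) multigraph =
  gverts :: "'v set"
  gedges :: "'e set"
  gends :: "'e \<Rightarrow> 'v set"

definition wf_multigraph :: "('v, 'e) multigraph \<Rightarrow> bool" where
  "wf_multigraph G \<longleftrightarrow> (\<forall>e\<in>gedges G. gends G e \<subseteq> gverts G \<and> card (gends G e) = 2)"

definition graph_adjacency :: "('v, 'e) multigraph \<Rightarrow> 'v rel" where
  "graph_adjacency G = {(u, v). \<exists>e\<in>gedges G. gends G e = {u, v}}"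

definition connected_multigraph :: "('v, 'e) multigraph \<Rightarrow> bool" where
  "connected_multigraph G \<longleftrightarrow>
     gverts G \<noteq> {} \<and> (\<forall>u\<in>gverts G. \<forall>v\<in>gverts G. (u, v) \<in> (graph_adjacency G)\<^sup>*)"

definition regular_multigraph :: "nat \<Rightarrow> ('v, 'e) multigraph \<Rightarrow> bool" where
  "regular_multigraph d G \<longleftrightarrow>
     (\<forall>v\<in>gverts G. finite {e \<in> gedges G. v \<in> gends G e} \<and>
                    card {e \<in> gedges G. v \<in> gends G e} = d)"

definition incidence_poset :: "('v, 'e) multigraph \<Rightarrow> ('v + 'e) rel" where
  "incidence_poset G =
     Id_on (gverts G <+> gedges G) \<union>
     {(Inl v, Inr e) |v e. v \<in> gverts G \<and> e \<in> gedges G \<and> v \<in> gends G e}"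

text \<open>It is no restriction that the vertices and edges of the graph are taken from
  the type of the elements of the poset.\<close>

definition is_polygon :: "'a rel \<Rightarrow> bool" where
  "is_polygon r \<longleftrightarrow>
     (\<exists>G :: ('a, 'a) multigraph.
        wf_multigraph G \<and> connected_multigraph G \<and> regular_multigraph 2 G \<and>
        poset_isomorphic r (incidence_poset G))"


section \<open>Abstract polyhedra\<close>

record 'a ranked_poset =
  leq :: "'a rel"
  rk :: "'a \<Rightarrow> nat"

definition elems :: "'a ranked_poset \<Rightarrow> 'a set" where
  "elems P = Field (leq P)"

definition vertices :: "'a ranked_poset \<Rightarrow> 'a set" where
  "vertices P = {x \<in> elems P. rk P x = 0}"

definition edges :: "'a ranked_poset \<Rightarrow> 'a set" where
  "edges P = {x \<in> elems P. rk P x = 1}"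

definition faces :: "'a ranked_poset \<Rightarrow> 'a set" where
  "faces P = {x \<in> elems P. rk P x = 2}"

definition wf_ranked_poset :: "'a ranked_poset \<Rightarrow> bool" where
  "wf_ranked_poset P \<longleftrightarrow>
     Partial_order (leq P) \<and>
     (\<forall>x\<in>elems P. rk P x \<in> {0, 1, 2}) \<and>
     (\<forall>x y. (x, y) \<in> leq P \<and> x \<noteq> y \<longrightarrow> rk P x < rk P y)"

definition flags :: "'a ranked_poset \<Rightarrow> 'a set set" where
  "flags P = {C \<in> Chains (leq P). \<forall>D\<in>Chains (leq P). C \<subseteq> D \<longrightarrow> D = C}"

definition skeleton :: "'a ranked_poset \<Rightarrow> ('a, 'a) multigraph" where
  "skeleton P =
     \<lparr>gverts = vertices P, gedges = edges P,
      gends = (\<lambda>e. {v \<in> vertices P. (v, e) \<in> leq P})\<rparr>"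

definition above :: "'a ranked_poset \<Rightarrow> 'a \<Rightarrow> 'a rel" where
  "above P x = Restr (leq P) {y. (x, y) \<in> leq P \<and> y \<noteq> x}"

definition below :: "'a ranked_poset \<Rightarrow> 'a \<Rightarrow> 'a rel" where
  "below P x = Restr (leq P) {y. (y, x) \<in> leq P \<and> y \<noteq> x}"

text \<open>The last conjunct, dual to the condition on vertices, says that the faces are
  polygons; it is part of the usual definition of abstract polyhedra (where it
  follows from strong connectedness).  The other conjuncts do not imply it: they would
  admit a face that is a union of several disjoint polygons.\<close>

definition polyhedron :: "'a ranked_poset \<Rightarrow> bool" where
  "polyhedron P \<longleftrightarrow>
     wf_ranked_poset P \<and>
     (\<forall>C\<in>flags P. \<exists>v\<in>vertices P. \<exists>e\<in>edges P. \<exists>f\<in>faces P. C = {v, e, f}) \<and>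
     (\<forall>e\<in>edges P. card {v \<in> vertices P. (v, e) \<in> leq P} = 2 \<and>
                   card {f \<in> faces P. (e, f) \<in> leq P} = 2) \<and>
     connected_multigraph (skeleton P) \<and>
     (\<forall>v\<in>vertices P. is_polygon (above P v)) \<and>
     (\<forall>f\<in>faces P. is_polygon (below P f))"

definition has_type :: "'a ranked_poset \<Rightarrow> nat \<Rightarrow> nat \<Rightarrow> bool" where
  "has_type P p q \<longleftrightarrow>
     (\<forall>f\<in>faces P. finite {e \<in> edges P. (e, f) \<in> leq P} \<and>
                   card {e \<in> edges P. (e, f) \<in> leq P} = p) \<and>
     (\<forall>v\<in>vertices P. finite {e \<in> edges P. (v, e) \<in> leq P} \<and>
                      card {e \<in> edges P. (v, e) \<in> leq P} = q)"

definition tight :: "'a ranked_poset \<Rightarrow> nat \<Rightarrow> nat \<Rightarrow> bool" where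
  "tight P p q \<longleftrightarrow>
     polyhedron P \<and> finite (elems P) \<and> has_type P p q \<and> card (flags P) = 2 * p * q"


section \<open>Automorphisms and non-orientable regularity\<close>

definition aut_group :: "'a ranked_poset \<Rightarrow> ('a \<Rightarrow> 'a) monoid" where
  "aut_group P =
     (BijGroup (elems P))
       \<lparr>carrier := {f \<in> Bij (elems P). poset_iso_map (leq P) (leq P) f}\<rparr>"

definition regular_polyhedron :: "'a ranked_poset \<Rightarrow> bool" where
  "regular_polyhedron P \<longleftrightarrow>
     polyhedron P \<and>
     (\<forall>\<Phi>\<in>flags P. \<forall>\<Psi>\<in>flags P. \<exists>\<gamma>\<in>carrier (aut_group P). \<gamma> ` \<Phi> = \<Psi>)"

text \<open>In a polyhedron, each flag \<open>\<Phi>\<close> has exactly one \<open>i\<close>-adjacent flag for each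
  \<open>i \<le> 2\<close>; if the polyhedron is regular, exactly one automorphism maps \<open>\<Phi>\<close> to it.\<close>

definition adjacent_flag :: "'a ranked_poset \<Rightarrow> nat \<Rightarrow> 'a set \<Rightarrow> 'a set" where
  "adjacent_flag P i \<Phi> =
     (THE \<Psi>. \<Psi> \<in> flags P \<and> \<Psi> \<noteq> \<Phi> \<and>
             {x \<in> \<Psi>. rk P x \<noteq> i} = {x \<in> \<Phi>. rk P x \<noteq> i})"

definition flag_reflection :: "'a ranked_poset \<Rightarrow> 'a set \<Rightarrow> nat \<Rightarrow> 'a \<Rightarrow> 'a" where
  "flag_reflection P \<Phi> i =
     (THE \<gamma>. \<gamma> \<in> carrier (aut_group P) \<and> \<gamma> ` \<Phi> = adjacent_flag P i \<Phi>)"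

definition rotation_subgroup :: "'a ranked_poset \<Rightarrow> 'a set \<Rightarrow> ('a \<Rightarrow> 'a) set" where
  "rotation_subgroup P \<Phi> =
     generate (aut_group P)
       {flag_reflection P \<Phi> 0 \<otimes>\<^bsub>aut_group P\<^esub> flag_reflection P \<Phi> 1,
        flag_reflection P \<Phi> 1 \<otimes>\<^bsub>aut_group P\<^esub> flag_reflection P \<Phi> 2}"

text \<open>The condition does not depend on the choice of the base flag \<open>\<Phi>\<close>, since all
  flags are equivalent under automorphisms.\<close>

definition nonorientably_regular :: "'a ranked_poset \<Rightarrow> bool" where
  "nonorientably_regular P \<longleftrightarrow>
     regular_polyhedron P \<and>
     (\<forall>\<Phi>\<in>flags P. rotation_subgroup P \<Phi> = carrier (aut_group P))"


section \<open>Isomorphism types\<close>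

text \<open>The polyhedra considered here are finite, so every infinite type \<open>'a\<close> contains
  a representative of each isomorphism type.\<close>

definition tight_nonorientable :: "nat \<Rightarrow> nat \<Rightarrow> 'a ranked_poset set" where
  "tight_nonorientable p q = {P. tight P p q \<and> nonorientably_regular P}"

definition isomorphism_types :: "'a ranked_poset set \<Rightarrow> 'a ranked_poset set set" where
  "isomorphism_types \<P> =
     \<P> // {(P, Q). P \<in> \<P> \<and> Q \<in> \<P> \<and> poset_isomorphic (leq P) (leq Q)}"

definition admissible_type :: "nat \<Rightarrow> nat \<Rightarrow> bool" where
  "admissible_type p q \<longleftrightarrow>
     (\<exists>k r. k > 0 \<and> r > 0 \<and>
        (p = 4 \<and> q = 3 * k \<or>
         p = 4 * r \<and> q = 6 * k \<and> r > 1 \<and> odd r \<and> odd k \<or>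
         q = 4 \<and> p = 3 * k \<or>
         q = 4 * r \<and> p = 6 * k \<and> r > 1 \<and> odd r \<and> odd k))"

end

theory Submission imports Defs "HOL-Combinatorics.Perm" begin

text \<open>The flags of a regular polyhedron form a regular orbit of its monodromy group, which is generated
  by the involutions \<open>a\<close>, \<open>b\<close>, \<open>c\<close> that replace the vertex, edge and face of a flag; the set of words
  in the three letters that are trivial in this group determines the polyhedron.  A polyhedron is tight iff
  every element is a product of an element of \<open>\<langle>a, b\<rangle>\<close> and one of \<open>\<langle>c, b\<rangle>\<close>, and non-orientable iff some
  word of odd length is trivial.

  To classify such triples put \<open>s = a b\<close>, \<open>t = c b\<close> and assume \<open>p \<le> q\<close> by duality.  Counting the
  neighbours of a vertex shows that either some \<open>\<langle>t ^ m\<rangle>\<close> with \<open>m < p\<close> is normal, and one passes to the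
  quotient by induction on \<open>p + q\<close>, or \<open>a t ^ (q div 2) a = t ^ (q div 2) c\<close>, which forces \<open>q = 4\<close>.
  It follows that, up to duality, \<open>a = v y w\<close> where \<open>v\<close> and its conjugates generate a normal Klein
  four-group (as in the hemicube), \<open>y\<close> has order \<open>r\<close> with \<open>p = 4 r\<close>, and \<open>w\<close> is \<open>1\<close> or \<open>t ^ (q div 2)\<close>.
  The resulting normal form of words shows that \<open>r\<close>, \<open>q\<close> and the choice of \<open>w\<close> determine the trivial words.
  Conversely each admissible choice is realised by permutations, and the cosets of
  \<open>\<langle>b, c\<rangle>\<close>, \<open>\<langle>a, c\<rangle>\<close>, \<open>\<langle>a, b\<rangle>\<close> form the polyhedron.\<close>

section \<open>Involutions and dihedral groups\<close>

text \<open>The arithmetic conditions come from the action of \<open>t\<close> by conjugation. It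
  permutes the three involutions of the Klein four-group cyclically, so 3 divides \<open>q\<close>.
  For \<open>r > 1\<close>, \<open>a\<close> inverts \<open>s ^ 4\<close> while \<open>v\<close>
  centralises it, so the factor \<open>w\<close> has to invert it; \<open>w = 1\<close> cannot do
  so, and \<open>t ^ (q div 2)\<close> does so only when \<open>q div 2\<close> is odd. An even
  \<open>r\<close> is excluded because the lifted relations contradict each other already in the
  quotient with \<open>p = 8\<close>. The main obstacle is the alternative in which no proper power
  of \<open>t\<close> is seen to be normal. That it forces the value 4 is proved dually: a count of
  the common neighbours of two adjacent faces gives \<open>p \<le> q\<close>, and this inequality,
  inherited by quotients, closes the argument. Isomorphism types are compared through sets of
  trivial words because these live in one fixed type, whatever group or polyhedron they come from;
  uniqueness then needs no presentation of the group, only a count showing that normal forms are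
  unique.\<close>

lemma perm_left_inverse [simp]: "inverse g * g = (1::'x perm)"
  by (simp add: perm_eq_iff apply_times apply_inverse)

lemma perm_right_inverse [simp]: "g * inverse g = (1::'x perm)"
  by (simp add: perm_eq_iff apply_times apply_inverse)

lemma perm_left_inverse_assoc [simp]: "inverse g * (g * h) = (h::'x perm)"
  by (simp flip: mult.assoc)

lemma perm_right_inverse_assoc [simp]: "g * (inverse g * h) = (h::'x perm)"
  by (simp flip: mult.assoc)

lemma perm_mult_left_cancel [simp]: "g * h = g * k \<longleftrightarrow> h = (k::'x perm)"
  by (metis perm_left_inverse_assoc)

lemma perm_mult_right_cancel [simp]: "h * g = k * g \<longleftrightarrow> h = (k::'x perm)"
  by (metis mult.assoc mult.right_neutral perm_right_inverse)

lemma perm_inverse_unique: "g * h = 1 \<Longrightarrow> inverse g = (h::'x perm)"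
  by (metis mult.right_neutral perm_left_inverse_assoc)

lemma perm_inverse_mult: "inverse (g * h) = inverse h * inverse (g::'x perm)"
  by (rule perm_inverse_unique) (simp add: mult.assoc)

lemma perm_inverse_inverse [simp]: "inverse (inverse g) = (g::'x perm)"
  by (rule perm_inverse_unique) simp

lemma perm_inverse_one [simp]: "inverse 1 = (1::'x perm)"
  by (rule perm_inverse_unique) simp

lemma conj_power: "(g * h * inverse g) ^ n = g * h ^ n * inverse (g::'x perm)"
  by (induction n) (simp_all add: mult.assoc)

lemma invol_inverse: "x * x = 1 \<Longrightarrow> inverse x = (x::'x perm)"
  by (rule perm_inverse_unique)

lemma invol_conj_power: "x * x = 1 \<Longrightarrow> (x * h * x) ^ n = x * h ^ n * (x::'x perm)"
  using conj_power[of x h n] by (simp add: invol_inverse)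

lemma power_commute_elem: "x * y = y * (x::'x perm) \<Longrightarrow> x ^ n * y = y * x ^ n"
  by (rule power_commuting_commutes)

lemma invol_cancel: "x * x = 1 \<Longrightarrow> x * (x * h) = (h::'x perm)"
  by (simp flip: mult.assoc)

section \<open>Words in three generators, their values and duality\<close>

datatype letter = R0 | R1 | R2

fun letter_val :: "'g \<Rightarrow> 'g \<Rightarrow> 'g \<Rightarrow> letter \<Rightarrow> 'g" where
  "letter_val a b c R0 = a"
| "letter_val a b c R1 = b"
| "letter_val a b c R2 = c"

primrec ev :: "'g::monoid_mult \<Rightarrow> 'g \<Rightarrow> 'g \<Rightarrow> letter list \<Rightarrow> 'g" where
  "ev a b c [] = 1"
| "ev a b c (x # w) = letter_val a b c x * ev a b c w"

definition word_kernel :: "'g::monoid_mult \<Rightarrow> 'g \<Rightarrow> 'g \<Rightarrow> letter list set" where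
  "word_kernel a b c = {w. ev a b c w = 1}"

definition word_dual :: "letter list \<Rightarrow> letter list" where
  "word_dual = map (letter_val R2 R1 R0)"

lemma ev_append: "ev a b c (u @ v) = ev a b c u * ev a b c v"
  by (induction u) (simp_all add: mult.assoc)

lemma letter_val_dual: "letter_val c b a (letter_val R2 R1 R0 x) = letter_val a b c x"
  by (cases x) simp_all

lemma ev_dual: "ev c b a (word_dual w) = ev a b c w"
  by (induction w) (simp_all add: word_dual_def letter_val_dual)

lemma word_dual_dual [simp]: "word_dual (word_dual w) = w"
proof -
  have "letter_val R2 R1 R0 \<circ> letter_val R2 R1 R0 = id"
  proof
    fix x show "(letter_val R2 R1 R0 \<circ> letter_val R2 R1 R0) x = id x" by (cases x) simp_all
  qed
  then show ?thesis by (simp add: word_dual_def)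
qed

lemma length_word_dual [simp]: "length (word_dual w) = length w"
  by (simp add: word_dual_def)

definition nonorientable_triple :: "'g::monoid_mult \<Rightarrow> 'g \<Rightarrow> 'g \<Rightarrow> bool" where
  "nonorientable_triple a b c \<longleftrightarrow> (\<exists>w. odd (length w) \<and> ev a b c w = 1)"

lemma nonorientable_triple_dual: "nonorientable_triple a b c \<Longrightarrow> nonorientable_triple c b a"
  unfolding nonorientable_triple_def by (metis ev_dual length_word_dual)

text \<open>Exponents are natural numbers, so this set is a group only once \<open>x * y\<close> is
  known to have finite order.\<close>

definition dih :: "'g::monoid_mult \<Rightarrow> 'g \<Rightarrow> 'g set" where
  "dih x y = {g. \<exists>i. g = (x * y) ^ i \<or> g = (x * y) ^ i * y}"

lemma dihI: "(x * y) ^ i \<in> dih x y" "(x * y) ^ i * y \<in> dih x y"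
  by (auto simp: dih_def)

text \<open>The last assumption keeps rotations and reflections apart. For \<open>n\<close> equal to
  1 or 2 this does not follow from the orders, and it is what gives the group exactly
  \<open>2 * n\<close> elements.\<close>

locale dihedral =
  fixes x y :: "'x perm" and n :: nat
  assumes xx: "x * x = 1" and yy: "y * y = 1" and n_pos: "n > 0"
    and ord: "\<And>i. (x * y) ^ i = 1 \<longleftrightarrow> n dvd i"
    and not_refl: "\<And>i. (x * y) ^ i \<noteq> y"
begin

abbreviation (input) "\<rho> \<equiv> x * y"

lemma x_x [simp]: "x * (x * h) = h" and y_y [simp]: "y * (y * h) = h"
  using invol_cancel xx yy by auto

lemma inv_x: "inverse x = x" and inv_y: "inverse y = y"
  using invol_inverse xx yy by auto

lemma pow_n [simp]: "\<rho> ^ n = 1"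
  by (simp add: ord)

lemma pow_mod: "\<rho> ^ (i mod n) = \<rho> ^ i"
proof -
  have "\<rho> ^ i = \<rho> ^ (n * (i div n) + i mod n)" by simp
  also have "\<dots> = \<rho> ^ (i mod n)" by (simp only: power_add power_mult pow_n power_one mult_1)
  finally show ?thesis by simp
qed

lemma pow_eq_le: "i \<le> j \<Longrightarrow> \<rho> ^ i = \<rho> ^ j \<longleftrightarrow> n dvd (j - i)"
proof -
  assume "i \<le> j"
  then have "\<rho> ^ j = \<rho> ^ i * \<rho> ^ (j - i)" by (simp flip: power_add)
  then have "\<rho> ^ i = \<rho> ^ j \<longleftrightarrow> \<rho> ^ i * 1 = \<rho> ^ i * \<rho> ^ (j - i)" by simp
  also have "\<dots> \<longleftrightarrow> n dvd (j - i)" unfolding perm_mult_left_cancel using ord by metis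
  finally show ?thesis .
qed

lemma pow_eq: "\<rho> ^ i = \<rho> ^ j \<longleftrightarrow> i mod n = j mod n"
proof (cases "i \<le> j")
  case True
  then show ?thesis using pow_eq_le[OF True] mod_eq_dvd_iff_nat[of i j n] by metis
next
  case False
  then have "j \<le> i" by simp
  then show ?thesis using pow_eq_le[of j i] mod_eq_dvd_iff_nat[of j i n] by metis
qed

text \<open>The exponent \<open>(n - 1) * i\<close> plays the part of \<open>- i\<close> here and in
  all later formulas with natural exponents.\<close>

lemma pow_inv: "\<rho> ^ i * \<rho> ^ ((n - 1) * i) = 1"
proof -
  have "i + (n - 1) * i = n * i" using n_pos by (cases n) auto
  then show ?thesis by (simp add: ord flip: power_add)
qed

lemma inverse_pow: "inverse (\<rho> ^ i) = \<rho> ^ ((n - 1) * i)"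
  by (rule perm_inverse_unique) (rule pow_inv)

lemma y_pow: "y * \<rho> ^ i = inverse (\<rho> ^ i) * y"
proof -
  have "(y * \<rho> * y) ^ i = y * \<rho> ^ i * y" by (rule invol_conj_power) (rule yy)
  moreover have "y * \<rho> * y = inverse \<rho>" by (simp add: perm_inverse_mult inv_x inv_y mult.assoc yy)
  moreover have "inverse \<rho> ^ i = inverse (\<rho> ^ i)"
    by (rule perm_power_inverse)
  ultimately have "y * \<rho> ^ i * y = inverse (\<rho> ^ i)" by simp
  then have "y * \<rho> ^ i * y * y = inverse (\<rho> ^ i) * y" by simp
  then show ?thesis by (simp add: mult.assoc yy)
qed

lemma x_pow: "x * \<rho> ^ i = inverse (\<rho> ^ i) * x"
proof -
  have "(x * \<rho> * x) ^ i = x * \<rho> ^ i * x" by (rule invol_conj_power) (rule xx)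
  moreover have "x * \<rho> * x = inverse \<rho>" by (simp add: perm_inverse_mult inv_x inv_y mult.assoc xx)
  moreover have "inverse \<rho> ^ i = inverse (\<rho> ^ i)"
    by (rule perm_power_inverse)
  ultimately have "x * \<rho> ^ i * x = inverse (\<rho> ^ i)" by simp
  then have "x * \<rho> ^ i * x * x = inverse (\<rho> ^ i) * x" by simp
  then show ?thesis by (simp add: mult.assoc xx)
qed

lemma y_pow': "y * \<rho> ^ i = \<rho> ^ ((n - 1) * i) * y"
  by (simp add: y_pow inverse_pow)

lemma pow_ne_refl: "\<rho> ^ i \<noteq> \<rho> ^ j * y"
proof
  assume "\<rho> ^ i = \<rho> ^ j * y"
  then have "inverse (\<rho> ^ j) * \<rho> ^ i = y" by simp
  then have "\<rho> ^ ((n - 1) * j + i) = y" by (simp add: inverse_pow power_add)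
  then show False using not_refl by blast
qed

lemma refl_sq: "(\<rho> ^ i * y) * (\<rho> ^ i * y) = 1"
proof -
  have "(\<rho> ^ i * y) * (\<rho> ^ i * y) = \<rho> ^ i * (y * \<rho> ^ i) * y" by (simp only: mult.assoc)
  also have "\<dots> = \<rho> ^ i * inverse (\<rho> ^ i) * (y * y)" by (simp only: y_pow mult.assoc)
  finally show ?thesis by (simp only: yy perm_right_inverse mult_1)
qed

lemma dih_x: "x \<in> dih x y" and dih_y: "y \<in> dih x y" and dih_1: "1 \<in> dih x y"
  and dih_r: "\<rho> \<in> dih x y"
  using dihI(2)[of x y 1] dihI(2)[of x y 0] dihI(1)[of x y 0] dihI(1)[of x y 1]
  by (simp_all add: mult.assoc yy)

lemma dih_mult: assumes "g \<in> dih x y" "h \<in> dih x y" shows "g * h \<in> dih x y"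
proof -
  obtain i where g: "g = \<rho> ^ i \<or> g = \<rho> ^ i * y" using assms(1) by (auto simp: dih_def)
  obtain j where h: "h = \<rho> ^ j \<or> h = \<rho> ^ j * y" using assms(2) by (auto simp: dih_def)
  have 1: "\<rho> ^ i * \<rho> ^ j = \<rho> ^ (i + j)" by (simp add: power_add)
  have 2: "\<rho> ^ i * (\<rho> ^ j * y) = \<rho> ^ (i + j) * y" by (simp add: power_add mult.assoc)
  have 3: "\<rho> ^ i * y * \<rho> ^ j = \<rho> ^ (i + (n - 1) * j) * y"
    by (simp only: power_add mult.assoc y_pow')
  have 4: "\<rho> ^ i * y * (\<rho> ^ j * y) = \<rho> ^ (i + (n - 1) * j)"
    using arg_cong[OF 3, of "\<lambda>g. g * y"] by (simp add: mult.assoc yy)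
  show ?thesis using g h 1 2 3 4 dihI[of x y] by metis
qed

lemma dih_inverse: assumes "g \<in> dih x y" shows "inverse g \<in> dih x y"
proof -
  obtain i where g: "g = \<rho> ^ i \<or> g = \<rho> ^ i * y" using assms(1) by (auto simp: dih_def)
  then show ?thesis
  proof
    assume "g = \<rho> ^ i" then show ?thesis by (simp add: inverse_pow dihI)
  next
    assume g: "g = \<rho> ^ i * y"
    then have "inverse g = g" by (intro perm_inverse_unique) (simp only: refl_sq)
    then show ?thesis using assms by simp
  qed
qed

lemma dih_cancel_left: "g \<in> dih x y \<Longrightarrow> g * h \<in> dih x y \<longleftrightarrow> h \<in> dih x y"
  using dih_mult dih_inverse by (metis perm_left_inverse_assoc)

lemma dih_cancel_right: "g \<in> dih x y \<Longrightarrow> h * g \<in> dih x y \<longleftrightarrow> h \<in> dih x y"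
  using dih_mult dih_inverse by (metis perm_right_inverse mult.assoc mult.right_neutral)

lemma dih_translate: assumes "g \<in> dih x y" shows "(*) g ` dih x y = dih x y"
proof
  show "(*) g ` dih x y \<subseteq> dih x y" using dih_mult assms by blast
  show "dih x y \<subseteq> (*) g ` dih x y"
  proof
    fix h assume "h \<in> dih x y"
    then have "inverse g * h \<in> dih x y" using dih_mult dih_inverse assms by blast
    then show "h \<in> (*) g ` dih x y"
      by (intro image_eqI[of _ _ "inverse g * h"]) (simp only: perm_right_inverse_assoc)
  qed
qed

lemma dih_eq: "dih x y = (\<lambda>i. \<rho> ^ i) ` {..<n} \<union> (\<lambda>i. \<rho> ^ i * y) ` {..<n}"
proof
  show "dih x y \<subseteq> (\<lambda>i. \<rho> ^ i) ` {..<n} \<union> (\<lambda>i. \<rho> ^ i * y) ` {..<n}"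
  proof
    fix g assume "g \<in> dih x y"
    then obtain i where g: "g = \<rho> ^ i \<or> g = \<rho> ^ i * y" by (auto simp: dih_def)
    then have "g = \<rho> ^ (i mod n) \<or> g = \<rho> ^ (i mod n) * y" by (simp add: pow_mod)
    then show "g \<in> (\<lambda>i. \<rho> ^ i) ` {..<n} \<union> (\<lambda>i. \<rho> ^ i * y) ` {..<n}"
      using mod_less_divisor[OF n_pos, of i] by blast
  qed
qed (auto simp: dih_def)

lemma inj_pow: "inj_on (\<lambda>i. \<rho> ^ i) {..<n}"
  by (auto simp: inj_on_def pow_eq)

lemma inj_pow_refl: "inj_on (\<lambda>i. \<rho> ^ i * y) {..<n}"
  by (auto simp: inj_on_def pow_eq)

lemma finite_dih: "finite (dih x y)"
  by (simp add: dih_eq)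

lemma card_dih: "card (dih x y) = 2 * n"
proof -
  have "(\<lambda>i. \<rho> ^ i) ` {..<n} \<inter> (\<lambda>i. \<rho> ^ i * y) ` {..<n} = {}"
    using pow_ne_refl by auto
  then show ?thesis
    by (simp add: dih_eq card_Un_disjoint card_image inj_pow inj_pow_refl)
qed

end

section \<open>Tight triples of involutions\<close>

lemma dih_range: "dih x y = range (\<lambda>i. (x * y) ^ i) \<union> range (\<lambda>i. (x * y) ^ i * y)"
  by (auto simp: dih_def)

text \<open>The group acts on the left cosets of the normal subgroup by left multiplication, and the
  kernel of this action is the subgroup. Numbering the finitely many cosets gives permutations of
  \<open>nat\<close> with finite support, whatever the original type of points.\<close>

lemma quotient_perm:
  fixes G N :: "'x perm set"
  assumes fin: "finite G" and one: "1 \<in> N" and mult: "\<And>g h. g \<in> G \<Longrightarrow> h \<in> G \<Longrightarrow> g * h \<in> G"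
    and inverse: "\<And>g. g \<in> G \<Longrightarrow> inverse g \<in> G" and sub: "N \<subseteq> G"
    and N_mult: "\<And>g h. g \<in> N \<Longrightarrow> h \<in> N \<Longrightarrow> g * h \<in> N"
    and N_inverse: "\<And>g. g \<in> N \<Longrightarrow> inverse g \<in> N"
    and normal: "\<And>g n. g \<in> G \<Longrightarrow> n \<in> N \<Longrightarrow> g * n * inverse g \<in> N"
  obtains \<phi> :: "'x perm \<Rightarrow> nat perm" where
    "\<And>g h. g \<in> G \<Longrightarrow> h \<in> G \<Longrightarrow> \<phi> (g * h) = \<phi> g * \<phi> h" "\<And>g. g \<in> G \<Longrightarrow> \<phi> g = 1 \<longleftrightarrow> g \<in> N"
proof -
  define C where "C = (\<lambda>g. (*) g ` N) ` G"
  have finC: "finite C" using fin by (simp add: C_def)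
  obtain h where h: "bij_betw h C {0..<card C}" using ex_bij_betw_finite_nat[OF finC] by blast
  define k where "k = the_inv_into C h"
  have kC: "k i \<in> C" "h (k i) = i" if "i < card C" for i
    using h that by (auto simp: k_def bij_betw_def intro: the_inv_into_into f_the_inv_into_f)
  have hC: "h X < card C" "k (h X) = X" if "X \<in> C" for X
    using h that by (auto simp: k_def bij_betw_def the_inv_into_f_f)
  have act: "(*) g ` X \<in> C" if "g \<in> G" "X \<in> C" for g X
  proof -
    obtain x where x: "x \<in> G" "X = (*) x ` N" using \<open>X \<in> C\<close> by (auto simp: C_def)
    then have "(*) g ` X = (*) (g * x) ` N" by (simp add: image_image mult.assoc)
    then show ?thesis using x mult[OF \<open>g \<in> G\<close>] by (auto simp: C_def)
  qed
  define f where "f g i = (if i < card C then h ((*) g ` k i) else i)" for g i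
  have f_mult: "f (g * g') i = f g (f g' i)" if "g \<in> G" "g' \<in> G" for g g' i
    using act[OF that(2) kC(1)] by (simp add: f_def hC image_image mult.assoc)
  have G1: "1 \<in> G" using one sub by blast
  have f_one: "f 1 i = i" for i by (simp add: f_def kC)
  have bij: "bij (f g)" if "g \<in> G" for g
  proof (rule o_bij[of "f (inverse g)"])
    show "f (inverse g) \<circ> f g = id" "f g \<circ> f (inverse g) = id"
      using f_mult[OF inverse[OF that] that] f_mult[OF that inverse[OF that]] by (auto simp: f_one)
  qed
  define \<phi> :: "'x perm \<Rightarrow> nat perm" where "\<phi> g = Perm (f g)" for g
  have app: "apply (\<phi> g) = f g" if "g \<in> G" for g
  proof -
    have "{i. f g i \<noteq> i} \<subseteq> {..<card C}" by (auto simp: f_def)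
    then have "f g \<in> {f. bij f \<and> finite {a. f a \<noteq> a}}" using bij[OF that] finite_subset by auto
    then show ?thesis unfolding \<phi>_def by (rule Perm_inverse)
  qed
  have NC: "N \<in> C" using G1 by (auto simp: C_def image_iff intro!: bexI[of _ 1])
  show thesis
  proof
    fix g g' assume "g \<in> G" "g' \<in> G"
    then show "\<phi> (g * g') = \<phi> g * \<phi> g'"
      by (intro perm_eqI) (simp add: app mult f_mult apply_times)
  next
    fix g assume g: "g \<in> G"
    show "\<phi> g = 1 \<longleftrightarrow> g \<in> N"
    proof
      assume "\<phi> g = 1"
      then have "f g (h N) = h N" using app[OF g] by simp
      then have "h ((*) g ` N) = h N" using hC[OF NC] by (simp add: f_def)
      then have "(*) g ` N = N" using act[OF g NC] NC hC by metis
      then show "g \<in> N" using one by (metis image_eqI mult.right_neutral)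
    next
      assume gN: "g \<in> N"
      have "(*) g ` X = X" if "X \<in> C" for X
      proof -
        obtain x where x: "x \<in> G" "X = (*) x ` N" using \<open>X \<in> C\<close> by (auto simp: C_def)
        have *: "(*) y ` X \<subseteq> X" if "y \<in> N" for y
        proof -
          have "inverse x * y * x \<in> N" using normal[OF inverse[OF x(1)] that] by simp
          then have "y * (x * n) \<in> X" if "n \<in> N" for n
            unfolding x(2) using N_mult[OF _ that, of "inverse x * y * x"]
            by (intro image_eqI[of _ _ "inverse x * y * x * n"]) (simp_all add: mult.assoc)
          then show ?thesis using x(2) by auto
        qed
        have "X \<subseteq> (*) g ` X"
        proof
          fix z assume "z \<in> X"
          then have "inverse g * z \<in> X" using *[OF N_inverse[OF gN]] by blast
          then show "z \<in> (*) g ` X" by (intro image_eqI[of _ _ "inverse g * z"]) simp_all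
        qed
        then show ?thesis using *[OF gN] by blast
      qed
      then have "f g i = i" for i using kC by (simp add: f_def)
      then show "\<phi> g = 1" by (intro perm_eqI) (simp add: app[OF g])
    qed
  qed
qed

text \<open>The vertices are the left cosets of \<open>dih c b\<close> and the faces those of
  \<open>dih a b\<close>. The last two assumptions together say that there are exactly
  \<open>p\<close> vertices and \<open>q\<close> faces, hence \<open>2 * p * q\<close> group
  elements.\<close>

locale tight_triple =
  fixes a b c :: "'x perm" and p q :: nat
  assumes aa: "a * a = 1" and bb: "b * b = 1" and cc: "c * c = 1" and ca: "c * a = a * c"
    and p_ge: "2 \<le> p" and q_ge: "2 \<le> q"
    and s_ord: "\<And>i. (a * b) ^ i = 1 \<longleftrightarrow> p dvd i"
    and t_ord: "\<And>i. (c * b) ^ i = 1 \<longleftrightarrow> q dvd i"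
    and s_not_refl: "\<And>i. (a * b) ^ i \<noteq> b"
    and t_not_refl: "\<And>i. (c * b) ^ i \<noteq> b"
    and dih_Int: "dih a b \<inter> dih c b \<subseteq> {1, b}"
    and ev_dih: "\<And>w. \<exists>d\<in>dih a b. \<exists>e\<in>dih c b. ev a b c w = d * e"
begin

sublocale D: dihedral a b p
  using aa bb p_ge s_ord s_not_refl by unfold_locales auto

sublocale E: dihedral c b q
  using bb cc q_ge t_ord t_not_refl by unfold_locales auto

abbreviation "s \<equiv> a * b"
abbreviation "t \<equiv> c * b"

section \<open>The generated group as a product of two dihedral groups\<close>

definition G :: "'x perm set" where "G = range (ev a b c)"

lemma cax: "c * (a * h) = a * (c * h)"
  by (metis ca mult.assoc)

lemma a_G: "a \<in> G" and b_G: "b \<in> G" and c_G: "c \<in> G" and one_G: "1 \<in> G"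
proof -
  have "ev a b c [R0] = a" "ev a b c [R1] = b" "ev a b c [R2] = c" "ev a b c [] = 1" by simp_all
  then show "a \<in> G" "b \<in> G" "c \<in> G" "1 \<in> G" unfolding G_def by (metis rangeI)+
qed

lemma mult_G: "g \<in> G \<Longrightarrow> h \<in> G \<Longrightarrow> g * h \<in> G"
  unfolding G_def by (auto simp flip: ev_append)

lemma pow_G: "g \<in> G \<Longrightarrow> g ^ n \<in> G"
  by (induction n) (auto intro: one_G mult_G)

lemma inverse_G: assumes "g \<in> G" shows "inverse g \<in> G"
proof -
  have *: "inverse (ev a b c w) \<in> G" for w
  proof (induction w)
    case (Cons x w)
    have "letter_val a b c x \<in> G" by (cases x) (simp_all add: a_G b_G c_G)
    moreover have "inverse (letter_val a b c x) = letter_val a b c x"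
      by (cases x) (simp_all add: D.inv_x D.inv_y E.inv_x)
    ultimately show ?case using Cons by (simp add: perm_inverse_mult mult_G)
  qed (simp add: one_G)
  show ?thesis using assms * by (auto simp: G_def)
qed

lemmas G_intros = a_G b_G c_G one_G mult_G pow_G inverse_G

lemma D_sub_G: "dih a b \<subseteq> G" and E_sub_G: "dih c b \<subseteq> G"
  by (auto simp: dih_def intro!: G_intros)

lemma G_DE: "g \<in> G \<Longrightarrow> \<exists>d\<in>dih a b. \<exists>e\<in>dih c b. g = d * e"
  using ev_dih unfolding G_def by auto

text \<open>Inverting a factorisation exchanges its factors; this makes tightness self-dual.\<close>

lemma G_ED: assumes "g \<in> G" shows "\<exists>d\<in>dih a b. \<exists>e\<in>dih c b. g = e * d"
proof -
  obtain d e where "d \<in> dih a b" "e \<in> dih c b" "inverse g = d * e"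
    using G_DE[OF inverse_G[OF assms]] by blast
  then have "g = inverse e * inverse d" by (metis perm_inverse_inverse perm_inverse_mult)
  then show ?thesis using D.dih_inverse E.dih_inverse \<open>d \<in> _\<close> \<open>e \<in> _\<close> by blast
qed

lemma dual: "tight_triple c b a q p"
proof
  show "a * c = c * a" using ca by simp
  show "dih c b \<inter> dih a b \<subseteq> {1, b}" using dih_Int by blast
  fix w
  have "ev c b a w \<in> G" unfolding G_def by (metis ev_dual rangeI word_dual_dual)
  then show "\<exists>d\<in>dih c b. \<exists>e\<in>dih a b. ev c b a w = d * e" using G_ED by blast
qed (fact aa bb cc p_ge q_ge s_ord t_ord s_not_refl t_not_refl)+

lemma G_dual: "tight_triple.G c b a = G"
proof -
  interpret du: tight_triple c b a q p by (rule dual)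
  have "ev c b a w \<in> G" for w unfolding G_def by (metis ev_dual rangeI word_dual_dual)
  moreover have "ev a b c w \<in> du.G" for w unfolding du.G_def by (metis ev_dual rangeI)
  ultimately show ?thesis unfolding du.G_def G_def by blast
qed

lemma finite_G: "finite G"
proof -
  have "G \<subseteq> (\<lambda>(d, e). d * e) ` (dih a b \<times> dih c b)" using G_DE by force
  then show ?thesis by (rule finite_subset) (simp add: D.finite_dih E.finite_dih)
qed

text \<open>The intersection is at most \<open>{1, b}\<close> and no power of \<open>s\<close> is
  \<open>b\<close>. Consequently dividing out a subgroup of \<open>dih c b\<close> does not change
  the order of \<open>s\<close>.\<close>

lemma pow_Int: assumes "s ^ i \<in> dih c b" shows "s ^ i = 1"
proof -
  have "s ^ i \<in> {1, b}" using assms dihI(1)[of a b i] dih_Int by blast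
  then show ?thesis using s_not_refl by blast
qed

lemma a_notin_E: "a \<notin> dih c b"
proof
  assume "a \<in> dih c b"
  then have "a = 1 \<or> a = b" using D.dih_x dih_Int by blast
  then have "s = b \<or> s = 1" using bb by auto
  then show False using s_not_refl[of 1] s_ord[of 1] p_ge by auto
qed

text \<open>Since \<open>b\<close> lies in both factors, the reflection in the first factor can be
  moved into the second; so the powers of \<open>s\<close> represent all vertices.\<close>

lemma coset_rep_s: assumes "g \<in> G" shows "\<exists>i<p. \<exists>e\<in>dih c b. g = s ^ i * e"
proof -
  obtain d e where de: "d \<in> dih a b" "e \<in> dih c b" "g = d * e" using G_DE assms by blast
  obtain i where "d = s ^ i \<or> d = s ^ i * b" using de(1) by (auto simp: dih_def)
  then obtain e' where "e' \<in> dih c b" "g = s ^ i * e'"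
    using de E.dih_mult[OF E.dih_y de(2)] by (auto simp: mult.assoc)
  moreover have "s ^ i = s ^ (i mod p)" by (simp add: D.pow_mod)
  moreover have "i mod p < p" using D.n_pos by simp
  ultimately show ?thesis by metis
qed

text \<open>Counting the neighbours of the base vertex: the vertex \<open>t ^ i a E\<close> runs through \<open>m\<close>
  vertices different from \<open>E\<close>, of which there are only \<open>p - 1\<close>.\<close>

lemma neighbour_count: assumes "\<And>i. 0 < i \<Longrightarrow> i < m \<Longrightarrow> a * t ^ i * a \<notin> dih c b" shows "m < p"
proof -
  have "\<exists>j. j < p \<and> (\<exists>e\<in>dih c b. t ^ i * a = s ^ j * e)" for i
    using coset_rep_s[of "t ^ i * a"] by (auto intro!: G_intros)
  then obtain f where f: "\<And>i. f i < p" "\<And>i. \<exists>e\<in>dih c b. t ^ i * a = s ^ f i * e" by metis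
  have f0: "f i \<noteq> 0" for i
  proof
    assume "f i = 0"
    then obtain e where "e \<in> dih c b" "t ^ i * a = e" using f(2)[of i] by auto
    then have "t ^ i * a \<in> dih c b" by simp
    then show False using a_notin_E E.dih_cancel_left[OF dihI(1)[of c b i]] by simp
  qed
  have ne: "f i \<noteq> f j" if "i < j" "j < m" for i j
  proof
    assume eq: "f i = f j"
    obtain e where e: "e \<in> dih c b" "t ^ i * a = s ^ f i * e" using f(2) by blast
    obtain e' where e': "e' \<in> dih c b" "t ^ j * a = s ^ f i * e'" using f(2)[of j] eq by auto
    have "inverse (t ^ i * a) * (t ^ j * a) = inverse e * e'"
      by (simp add: e(2) e'(2) perm_inverse_mult mult.assoc)
    moreover have "t ^ j = t ^ i * t ^ (j - i)" using that by (simp flip: power_add)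
    then have "inverse (t ^ i * a) * (t ^ j * a) = a * t ^ (j - i) * a"
      by (simp add: perm_inverse_mult mult.assoc D.inv_x)
    moreover have "inverse e * e' \<in> dih c b" using e e' E.dih_mult E.dih_inverse by blast
    ultimately show False using assms[of "j - i"] that by auto
  qed
  have "inj_on f {..<m}" unfolding inj_on_def using ne by (metis lessThan_iff nat_neq_iff)
  moreover have "f ` {..<m} \<subseteq> {1..<p}" using f(1) f0 by (auto simp: Suc_le_eq)
  ultimately have "card {..<m} \<le> card {1..<p}" by (metis card_image card_mono finite_atLeastLessThan)
  then show ?thesis using p_ge by simp
qed

text \<open>The condition on \<open>i\<close> says that \<open>t ^ i\<close> fixes the other vertex
  of the base edge, the coset of \<open>a\<close>. The exponents with this property are the
  multiples of the number \<open>m\<close> of neighbours of the base vertex, and there are fewer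
  than \<open>p\<close> of these.\<close>

lemma edge_stabiliser:
  obtains m where "0 < m" "m < p" "m dvd q"
    "\<And>i. a * t ^ i * a \<in> dih c b \<longleftrightarrow> m dvd i"
proof -
  define P where "P m \<longleftrightarrow> 0 < m \<and> a * t ^ m * a \<in> dih c b" for m
  have Pq: "P q" using q_ge by (simp add: P_def aa E.dih_1)
  define m where "m = (LEAST m. P m)"
  have Pm: "P m" unfolding m_def by (rule LeastI) (rule Pq)
  have least: "m \<le> i" if "P i" for i unfolding m_def by (rule Least_le) (rule that)
  have iff: "a * t ^ i * a \<in> dih c b \<longleftrightarrow> m dvd i" for i
  proof -
    have mk: "a * t ^ (m * k) * a \<in> dih c b" for k
    proof (induction k)
      case (Suc k)
      have "a * t ^ (m * Suc k) * a = (a * t ^ m * a) * (a * t ^ (m * k) * a)"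
        by (simp add: power_add mult.assoc)
      then show ?case using Suc Pm E.dih_mult by (simp add: P_def)
    qed (simp add: aa E.dih_1)
    have "a * t ^ i * a = (a * t ^ (m * (i div m)) * a) * (a * t ^ (i mod m) * a)"
    proof -
      have "t ^ i = t ^ (m * (i div m)) * t ^ (i mod m)" by (simp flip: power_add)
      then show ?thesis by (simp add: mult.assoc)
    qed
    then have "a * t ^ i * a \<in> dih c b \<longleftrightarrow> a * t ^ (i mod m) * a \<in> dih c b"
      using E.dih_cancel_left mk by presburger
    also have "\<dots> \<longleftrightarrow> i mod m = 0"
    proof
      assume "a * t ^ (i mod m) * a \<in> dih c b"
      then show "i mod m = 0" using least[of "i mod m"] Pm mod_less_divisor[of m i]
        by (metis P_def gr0I leD)
    qed (simp add: aa E.dih_1)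
    finally show ?thesis by (simp add: mod_eq_0_iff_dvd)
  qed
  have "m < p"
  proof (rule neighbour_count)
    fix i assume "0 < i" "i < m" then show "a * t ^ i * a \<notin> dih c b"
      unfolding iff by (simp add: nat_dvd_not_less)
  qed
  moreover have "m dvd q" using Pq iff[of q] by (simp add: P_def)
  ultimately show thesis using Pm iff that by (auto simp: P_def)
qed

text \<open>If \<open>a\<close> conjugates \<open>t ^ m\<close> to a rotation, the criterion for
  \<open>m\<close> applies to this rotation as well, so its exponent is a multiple of
  \<open>m\<close> and the powers of \<open>t ^ m\<close> are normalised by \<open>a\<close>. If it
  is conjugated to a reflection, then \<open>t ^ m\<close> is an involution, which leaves only
  \<open>m = q div 2\<close>.\<close>

lemma vertex_multiplicity:
  assumes "p \<le> q"
  shows "(\<exists>m i. 0 < m \<and> m < p \<and> m dvd q \<and> a * t ^ m * a = t ^ (m * i)) \<or>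
    (even q \<and> q div 2 < p \<and> a * t ^ (q div 2) * a = t ^ (q div 2) * c)"
proof -
  obtain m where m: "0 < m" "m < p" "m dvd q" "\<And>i. a * t ^ i * a \<in> dih c b \<longleftrightarrow> m dvd i"
    using edge_stabiliser by metis
  define u where "u = a * t ^ m * a"
  have u: "u \<in> dih c b" "a * u * a = t ^ m"
    using m(4)[of m] by (simp_all add: u_def mult.assoc aa)
  obtain i where i: "u = t ^ i \<or> u = t ^ i * b" using u(1) by (auto simp: dih_def)
  show ?thesis
  proof (cases "u = t ^ i")
    case True
    then have "a * t ^ i * a \<in> dih c b" using u(2) dihI(1) by metis
    then obtain k where "i = m * k" using m(4) by (auto elim: dvdE)
    then show ?thesis using True m unfolding u_def by metis
  next
    case False
    then have ui: "u = t ^ i * b" using i by blast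
    then have uu: "u * u = 1" by (simp only: E.refl_sq)
    have "t ^ (m + m) = (a * u * a) * (a * u * a)" by (simp add: u(2) power_add)
    also have "\<dots> = 1" using uu by (simp add: mult.assoc aa invol_cancel)
    finally have "q dvd m + m" using t_ord by blast
    have "\<not> q dvd m" using m(1,2) assms by (auto dest: dvd_imp_le)
    have q: "q = m + m"
    proof -
      obtain k where k: "q = m * k" using m(3) by (auto elim: dvdE)
      then have "m * k dvd m * 2" using \<open>q dvd m + m\<close> by (simp add: mult_2_right)
      then have "k dvd 2" using m(1) by simp
      then have "k \<le> 2" by (rule dvd_imp_le) simp
      moreover have "k \<noteq> 1" "k \<noteq> 0" using k \<open>\<not> q dvd m\<close> q_ge by (auto intro: gr0I)
      ultimately have "k = 2" by simp
      then show ?thesis using k by simp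
    qed
    have "c = t * b" by (simp add: mult.assoc bb)
    \<comment> \<open>Because \<open>c = t * b\<close>, the reflection \<open>t ^ i * b\<close> is
      \<open>t ^ (i - 1) * c\<close>; the summand \<open>q\<close> keeps the exponent from being
      truncated at \<open>i = 0\<close>.\<close>
    define j where "j = i + q - 1"
    have tq: "t ^ (i + q) = t ^ i" by (simp add: power_add)
    have "t ^ (j + 1) * b = t ^ j * (t * b)" by (simp only: power_add power_one_right mult.assoc)
    then have "t ^ j * c = t ^ (j + 1) * b" using \<open>c = t * b\<close> by simp
    moreover have "j + 1 = i + q" using q_ge by (simp add: j_def)
    ultimately have uj: "u = t ^ j * c" using ui tq by metis
    \<comment> \<open>Multiplying by \<open>c\<close>, which commutes with \<open>a\<close>, turns
      the reflection into a rotation whose conjugate is known to lie in \<open>dih c b\<close>; so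
      \<open>m\<close> divides \<open>j\<close>, and \<open>t ^ j\<close> is 1 or
      \<open>t ^ m\<close>.\<close>
    have "a * t ^ j * a = a * u * a * c" by (simp add: uj mult.assoc cc ca)
    then have "a * t ^ j * a = t ^ m * c" using u(2) by simp
    then have "a * t ^ j * a \<in> dih c b" using E.dih_mult[OF dihI(1) E.dih_x] by simp
    then obtain k where k: "j = m * k" using m(4) by (auto elim: dvdE)
    have "u \<noteq> c"
    proof
      assume "u = c" then have "t ^ m = c" using u(2) ca by (metis D.x_x ca mult.assoc)
      then show False using E.pow_ne_refl[of m 1] \<open>c = t * b\<close> by simp
    qed
    then have "t ^ j \<noteq> 1" using uj by auto
    have "t ^ j = t ^ m"
    proof (cases "even k")
      case True
      then obtain l where "k = 2 * l" by (auto elim: evenE)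
      then have "j = q * l" using k q by (simp add: algebra_simps)
      then have "q dvd j" by simp
      then show ?thesis using \<open>t ^ j \<noteq> 1\<close> t_ord by blast
    next
      case False
      then obtain l where "k = 2 * l + 1" by (auto elim: oddE)
      then have "j = q * l + m" using k q by (simp add: algebra_simps)
      then show ?thesis by (simp add: power_add power_mult)
    qed
    then show ?thesis using q m uj by (simp add: u_def)
  qed
qed

text \<open>For \<open>p = 2\<close> the element \<open>a\<close> commutes with both other
  generators. Collecting a word into \<open>a ^ i * t ^ j * b ^ k\<close> preserves the parity of
  its length, \<open>t\<close> counting as two letters. A trivial word of odd length would thus make
  \<open>b\<close> a power of \<open>t\<close> or put \<open>a\<close> into
  \<open>dih c b\<close>.\<close>

lemma p_ge_3: assumes "nonorientable_triple a b c" shows "3 \<le> p"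
proof (rule ccontr)
  assume "\<not> 3 \<le> p"
  then have "p = 2" using p_ge by simp
  then have "s ^ 2 = 1" using s_ord by simp
  then have "a * b * (a * b) = 1" by (simp add: power2_eq_square)
  then have "a * (a * b * (a * b)) * b = a * b" by simp
  then have ba: "b * a = a * b" by (simp add: mult.assoc bb)
  have ab: "b * (a * h) = a * (b * h)" for h using ba by (metis mult.assoc)
  have bpow: "b * a ^ i = a ^ i * b" for i using power_commute_elem[of a b i] ba by simp
  have cpow: "c * a ^ i = a ^ i * c" for i using power_commute_elem[of a c i] ca by simp
  have cE: "c = t * b" by (simp add: mult.assoc bb)
  have wit: "\<exists>i j k. g = a ^ i * t ^ j * b ^ k \<and> even (l + i + k)"
    if "g = a ^ i * t ^ j * b ^ k" "even (l + i + k)" for g l i j k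
    using that by blast
  have *: "\<exists>i j k. ev a b c w = a ^ i * t ^ j * b ^ k \<and> even (length w + i + k)" for w
  proof (induction w)
    case Nil
    have "ev a b c [] = a ^ 0 * t ^ 0 * b ^ 0 \<and> even (length ([] :: letter list) + 0 + 0)" by simp
    then show ?case by blast
  next
    case (Cons x w)
    then obtain i j k where w: "ev a b c w = a ^ i * t ^ j * b ^ k" "even (length w + i + k)" by blast
    show ?case
    proof (cases x)
      case R0
      have "ev a b c (x # w) = a ^ (i + 1) * t ^ j * b ^ k" by (simp add: R0 w(1) mult.assoc)
      then show ?thesis by (rule wit) (use w(2) in simp)
    next
      case R1
      have "ev a b c (x # w) = a ^ i * (b * t ^ j) * b ^ k"
        using bpow by (simp add: R1 w(1)) (metis mult.assoc)
      also have "\<dots> = a ^ i * t ^ ((q - 1) * j) * b ^ (k + 1)"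
        by (subst E.y_pow') (simp add: mult.assoc)
      finally show ?thesis by (rule wit) (use w(2) in simp)
    next
      case R2
      have "ev a b c (x # w) = a ^ i * (c * t ^ j) * b ^ k"
        using cpow by (simp add: R2 w(1)) (metis mult.assoc)
      also have "c * t ^ j = t ^ ((q - 1) * j) * (t * b)"
        unfolding E.x_pow E.inverse_pow using cE by simp
      also have "a ^ i * (t ^ ((q - 1) * j) * (t * b)) * b ^ k = a ^ i * (t ^ ((q - 1) * j) * t) * b ^ (k + 1)"
        by (simp add: mult.assoc)
      also have "t ^ ((q - 1) * j) * t = t ^ ((q - 1) * j + 1)" by (simp only: power_add power_one_right)
      finally show ?thesis by (rule wit) (use w(2) in simp)
    qed
  qed
  obtain w where w: "odd (length w)" "ev a b c w = 1"
    using assms by (auto simp: nonorientable_triple_def)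
  obtain i j k where e: "a ^ i * t ^ j * b ^ k = 1" "even (length w + i + k)" using *[of w] w(2) by metis
  have apow: "a ^ i = (if even i then 1 else a)" for i by (induction i) (simp_all add: aa)
  have bpw: "b ^ i = (if even i then 1 else b)" for i by (induction i) (simp_all add: bb)
  show False
  proof (cases "even i")
    case True
    then have "t ^ j * b = 1" using e w(1) by (simp add: apow bpw)
    then have "t ^ j = b" by (metis E.inv_y perm_inverse_inverse perm_inverse_unique)
    then show False using t_not_refl by blast
  next
    case False
    then have "a * (t ^ j * b ^ k) = 1" using e by (simp add: apow mult.assoc)
    then have "a = t ^ j * b ^ k" by (metis D.inv_x perm_inverse_unique)
    then have "a \<in> dih c b" using dihI[of c b j] by (auto simp: bpw split: if_splits)
    then show False using a_notin_E by simp
  qed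
qed

text \<open>The powers of \<open>t ^ m\<close> are normalised by \<open>a\<close> by hypothesis and
  inverted by \<open>b\<close> and \<open>c\<close>. They meet the powers of \<open>s\<close>
  trivially, so the image is a tight triple with the same \<open>p\<close> and with \<open>m\<close>
  for \<open>q\<close>. Equality of images is spelled out as congruence modulo \<open>t ^ m\<close>,
  which is the form needed for lifting relations.\<close>

lemma quotient:
  assumes m: "m dvd q" "2 \<le> m" and conj: "a * t ^ m * a = t ^ (m * k)"
  obtains \<phi> :: "'x perm \<Rightarrow> nat perm" where
    "tight_triple (\<phi> a) (\<phi> b) (\<phi> c) p m"
    "\<forall>g\<in>G. \<forall>h\<in>G. \<phi> (g * h) = \<phi> g * \<phi> h"
    "\<forall>g\<in>G. \<forall>i. \<phi> (g ^ i) = \<phi> g ^ i"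
    "\<forall>g\<in>G. \<forall>h\<in>G. \<phi> g = \<phi> h \<longleftrightarrow> (\<exists>i. g = h * t ^ (m * i))"
    "nonorientable_triple a b c \<longrightarrow> nonorientable_triple (\<phi> a) (\<phi> b) (\<phi> c)"
proof -
  define N where "N = {t ^ (m * i) |i. True}"
  have one: "1 \<in> N" unfolding N_def by (auto intro!: exI[of _ 0])
  have N_mult: "g * h \<in> N" if "g \<in> N" "h \<in> N" for g h
  proof -
    obtain i j where "g = t ^ (m * i)" "h = t ^ (m * j)" using \<open>g \<in> N\<close> \<open>h \<in> N\<close> by (auto simp: N_def)
    then have "g * h = t ^ (m * (i + j))" by (simp only: power_add distrib_left)
    then show ?thesis by (auto simp: N_def)
  qed
  have N_inv: "inverse g \<in> N" if "g \<in> N" for g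
  proof -
    obtain i where "g = t ^ (m * i)" using \<open>g \<in> N\<close> by (auto simp: N_def)
    then have "inverse g = t ^ (m * ((q - 1) * i))" by (simp add: E.inverse_pow mult.left_commute)
    then show ?thesis by (auto simp: N_def)
  qed
  have NE: "N \<subseteq> dih c b" by (auto simp: N_def dihI)
  have cb: "c * g * c \<in> N" "b * g * b \<in> N" if "g \<in> N" for g
  proof -
    obtain i where i: "g = t ^ (m * i)" using \<open>g \<in> N\<close> by (auto simp: N_def)
    have "c * g * c = inverse g" "b * g * b = inverse g"
      unfolding i E.x_pow E.y_pow by (simp_all add: mult.assoc cc bb)
    then show "c * g * c \<in> N" "b * g * b \<in> N" using N_inv[OF that] by simp_all
  qed
  have aN: "a * g * a \<in> N" if "g \<in> N" for g
  proof -
    obtain i where "g = t ^ (m * i)" using \<open>g \<in> N\<close> by (auto simp: N_def)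
    then have "a * g * a = (a * t ^ m * a) ^ i" by (simp add: invol_conj_power aa power_mult)
    also have "\<dots> = t ^ (m * (k * i))" unfolding conj by (simp only: power_mult[symmetric] mult.assoc)
    finally show ?thesis by (auto simp: N_def)
  qed
  have normal: "g * n * inverse g \<in> N" if "g \<in> G" "n \<in> N" for g n
  proof -
    have "ev a b c w * n * inverse (ev a b c w) \<in> N" for w
    proof (induction w)
      case (Cons x w)
      define n' where "n' = ev a b c w * n * inverse (ev a b c w)"
      have "letter_val a b c x * n' * letter_val a b c x \<in> N"
        using Cons aN cb by (cases x) (simp_all add: n'_def)
      moreover have "inverse (letter_val a b c x) = letter_val a b c x"
        by (cases x) (simp_all add: D.inv_x D.inv_y E.inv_x)
      ultimately show ?case by (simp add: n'_def perm_inverse_mult mult.assoc)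
    qed (simp add: \<open>n \<in> N\<close>)
    then show ?thesis using that by (auto simp: G_def)
  qed
  obtain \<phi> :: "'x perm \<Rightarrow> nat perm" where
    hom: "\<And>g h. g \<in> G \<Longrightarrow> h \<in> G \<Longrightarrow> \<phi> (g * h) = \<phi> g * \<phi> h" and
    ker: "\<And>g. g \<in> G \<Longrightarrow> \<phi> g = 1 \<longleftrightarrow> g \<in> N"
    using quotient_perm[OF finite_G one mult_G inverse_G _ N_mult N_inv normal] NE E_sub_G by blast
  have \<phi>1: "\<phi> 1 = 1" using ker one_G one by blast
  have pow: "\<phi> (g ^ i) = \<phi> g ^ i" if "g \<in> G" for g i
    by (induction i) (simp_all add: \<phi>1 hom that pow_G)
  have inj: "\<phi> g = \<phi> h \<longleftrightarrow> (\<exists>n\<in>N. g = h * n)" if "g \<in> G" "h \<in> G" for g h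
  proof -
    have "\<phi> h * \<phi> (inverse h * g) = \<phi> g" using hom[of h "inverse h * g"] that by (simp add: G_intros)
    then have "\<phi> g = \<phi> h \<longleftrightarrow> \<phi> (inverse h * g) = 1" by (metis mult.right_neutral perm_mult_left_cancel)
    also have "\<dots> \<longleftrightarrow> inverse h * g \<in> N" by (rule ker) (simp add: that G_intros)
    also have "\<dots> \<longleftrightarrow> (\<exists>n\<in>N. g = h * n)" by (metis perm_left_inverse_assoc perm_right_inverse_assoc)
    finally show ?thesis .
  qed
  have tN: "t ^ i \<in> N \<longleftrightarrow> m dvd i" for i
  proof
    assume "t ^ i \<in> N"
    then obtain j where "t ^ i = t ^ (m * j)" by (auto simp: N_def)
    then have "i mod q = (m * j) mod q" by (simp add: E.pow_eq)
    then have "(i mod q) mod m = ((m * j) mod q) mod m" by simp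
    then show "m dvd i" by (simp add: mod_mod_cancel m(1) mod_eq_0_iff_dvd)
  qed (auto simp: N_def elim!: dvdE)
  have \<phi>s: "\<phi> a * \<phi> b = \<phi> s" and \<phi>t: "\<phi> c * \<phi> b = \<phi> t" by (simp_all add: hom G_intros)
  have ev: "ev (\<phi> a) (\<phi> b) (\<phi> c) w = \<phi> (ev a b c w)" for w
  proof (induction w)
    case (Cons x w)
    have "letter_val (\<phi> a) (\<phi> b) (\<phi> c) x = \<phi> (letter_val a b c x)" by (cases x) simp_all
    moreover have "letter_val a b c x \<in> G" by (cases x) (simp_all add: G_intros)
    moreover have "ev a b c w \<in> G" by (simp add: G_def)
    ultimately show ?case using Cons by (simp add: hom)
  qed (simp add: \<phi>1)
  have tq: "tight_triple (\<phi> a) (\<phi> b) (\<phi> c) p m"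
  proof
    show "\<phi> a * \<phi> a = 1" "\<phi> b * \<phi> b = 1" "\<phi> c * \<phi> c = 1" "\<phi> c * \<phi> a = \<phi> a * \<phi> c"
      by (simp_all add: aa bb cc ca \<phi>1 G_intros flip: hom)
    show "2 \<le> p" "2 \<le> m" by (fact p_ge, fact m(2))
    show "(\<phi> a * \<phi> b) ^ i = 1 \<longleftrightarrow> p dvd i" for i
    proof -
      have "s ^ i \<in> N \<longleftrightarrow> s ^ i = 1" using pow_Int NE one by (metis subsetD)
      then show ?thesis using ker[of "s ^ i"] by (simp add: \<phi>s s_ord G_intros flip: pow)
    qed
    show "(\<phi> c * \<phi> b) ^ i = 1 \<longleftrightarrow> m dvd i" for i
      using ker[of "t ^ i"] by (simp add: \<phi>t tN G_intros flip: pow)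
    show "(\<phi> a * \<phi> b) ^ i \<noteq> \<phi> b" for i
    proof
      assume "(\<phi> a * \<phi> b) ^ i = \<phi> b"
      then have "\<phi> b = \<phi> (s ^ i)" by (simp add: \<phi>s pow G_intros)
      then obtain n where n: "n \<in> N" "b = s ^ i * n" using inj[of b "s ^ i"] b_G pow_G[OF mult_G[OF a_G b_G]] by metis
      then have "s ^ i \<in> dih c b" using NE E.dih_cancel_right E.dih_y by (metis subsetD)
      then have s1: "s ^ i = 1" by (rule pow_Int)
      have "b = n" using n(2) unfolding s1 by simp
      obtain j where "n = t ^ (m * j)" using n(1) by (auto simp: N_def)
      then have "t ^ (m * j) = b" using \<open>b = n\<close> by (simp only:)
      then show False using t_not_refl by blast
    qed
    show "(\<phi> c * \<phi> b) ^ i \<noteq> \<phi> b" for i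
    proof
      assume "(\<phi> c * \<phi> b) ^ i = \<phi> b"
      then have "\<phi> b = \<phi> (t ^ i)" by (simp add: \<phi>t pow G_intros)
      then obtain n where n: "n \<in> N" "b = t ^ i * n" using inj[of b "t ^ i"] b_G pow_G[OF mult_G[OF c_G b_G]] by metis
      obtain j where "n = t ^ (m * j)" using n(1) unfolding N_def by blast
      then have "t ^ (i + m * j) = b" using n(2) unfolding power_add by metis
      then show False using t_not_refl by blast
    qed
    have dD: "dih (\<phi> a) (\<phi> b) = \<phi> ` dih a b" "dih (\<phi> c) (\<phi> b) = \<phi> ` dih c b"
    proof -
      have "\<phi> (s ^ i) = (\<phi> a * \<phi> b) ^ i" "\<phi> (t ^ i) = (\<phi> c * \<phi> b) ^ i" for i
        using \<phi>s \<phi>t pow[OF mult_G[OF a_G b_G]] pow[OF mult_G[OF c_G b_G]] by metis+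
      moreover have "\<phi> (s ^ i * b) = \<phi> (s ^ i) * \<phi> b" "\<phi> (t ^ i * b) = \<phi> (t ^ i) * \<phi> b" for i
        by (rule hom; intro G_intros)+
      ultimately show "dih (\<phi> a) (\<phi> b) = \<phi> ` dih a b" "dih (\<phi> c) (\<phi> b) = \<phi> ` dih c b"
        by (simp_all only: dih_range image_Un image_image)
    qed
    show "dih (\<phi> a) (\<phi> b) \<inter> dih (\<phi> c) (\<phi> b) \<subseteq> {1, \<phi> b}"
    proof
      fix g assume "g \<in> dih (\<phi> a) (\<phi> b) \<inter> dih (\<phi> c) (\<phi> b)"
      then obtain d e where de: "d \<in> dih a b" "e \<in> dih c b" "g = \<phi> d" "\<phi> d = \<phi> e" by (auto simp: dD)
      then obtain n where "n \<in> N" "d = e * n" using inj[of d e] D_sub_G E_sub_G by blast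
      then have "d \<in> dih c b" using de(2) NE E.dih_mult by blast
      then have "d \<in> {1, b}" using de(1) dih_Int by blast
      then show "g \<in> {1, \<phi> b}" using de(3) \<phi>1 by auto
    qed
    fix w
    obtain d e where "d \<in> dih a b" "e \<in> dih c b" "ev a b c w = d * e" using ev_dih by blast
    moreover from this have "\<phi> (ev a b c w) = \<phi> d * \<phi> e" using hom D_sub_G E_sub_G by (metis subsetD)
    ultimately show "\<exists>d\<in>dih (\<phi> a) (\<phi> b). \<exists>e\<in>dih (\<phi> c) (\<phi> b). ev (\<phi> a) (\<phi> b) (\<phi> c) w = d * e"
      unfolding ev dD by blast
  qed
  show thesis
  proof (rule that[OF tq])
    show "\<forall>g\<in>G. \<forall>h\<in>G. \<phi> (g * h) = \<phi> g * \<phi> h" "\<forall>g\<in>G. \<forall>i. \<phi> (g ^ i) = \<phi> g ^ i"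
      using hom pow by blast+
    show "\<forall>g\<in>G. \<forall>h\<in>G. \<phi> g = \<phi> h \<longleftrightarrow> (\<exists>i. g = h * t ^ (m * i))"
      using inj unfolding N_def by blast
    show "nonorientable_triple a b c \<longrightarrow> nonorientable_triple (\<phi> a) (\<phi> b) (\<phi> c)"
      using \<phi>1 unfolding nonorientable_triple_def ev by metis
  qed
qed

end

section \<open>The exceptional relation\<close>

context tight_triple begin

text \<open>The faces are the cosets of the powers \<open>t ^ i\<close> with \<open>i < q\<close>,
  and no nontrivial power of \<open>t\<close> lies in \<open>dih a b\<close>.\<close>

lemma card_G: "card G = q * (2 * p)"
proof -
  interpret du: tight_triple c b a q p by (rule dual)
  have G: "G = (\<Union>i\<in>{..<q}. (*) (t ^ i) ` dih a b)"
  proof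
    show "G \<subseteq> (\<Union>i\<in>{..<q}. (*) (t ^ i) ` dih a b)"
      using du.coset_rep_s unfolding G_dual by fast
    show "(\<Union>i\<in>{..<q}. (*) (t ^ i) ` dih a b) \<subseteq> G"
      using D_sub_G by (auto intro!: G_intros)
  qed
  have disj: "(*) (t ^ i) ` dih a b \<inter> (*) (t ^ j) ` dih a b = {}" if "i < j" "j < q" for i j
  proof (rule ccontr)
    assume "(*) (t ^ i) ` dih a b \<inter> (*) (t ^ j) ` dih a b \<noteq> {}"
    then obtain d e where de: "d \<in> dih a b" "e \<in> dih a b" "t ^ i * d = t ^ j * e" by blast
    have "t ^ j = t ^ i * t ^ (j - i)" using that by (simp flip: power_add)
    then have "d = t ^ (j - i) * e" using de(3) by (simp add: mult.assoc)
    then have "t ^ (j - i) \<in> dih a b" using de D.dih_cancel_right by simp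
    then have "q dvd j - i" using du.pow_Int t_ord by blast
    then show False using that by (auto dest: dvd_imp_le)
  qed
  have "card G = (\<Sum>i<q. card ((*) (t ^ i) ` dih a b))"
    unfolding G
  proof (rule card_UN_disjoint)
    show "\<forall>i\<in>{..<q}. \<forall>j\<in>{..<q}. i \<noteq> j \<longrightarrow> (*) (t ^ i) ` dih a b \<inter> (*) (t ^ j) ` dih a b = {}"
      using disj by (metis Int_commute lessThan_iff nat_neq_iff)
  qed (simp_all add: D.finite_dih)
  also have "\<dots> = (\<Sum>i<q. 2 * p)"
    by (intro sum.cong refl) (simp add: card_image inj_on_def D.card_dih)
  finally show ?thesis by simp
qed

end

text \<open>This is the second alternative of the neighbour count with vertices and faces exchanged.
  The bound on \<open>n\<close> is what is to be refuted: \<open>n = 1\<close> is easily impossible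
  and \<open>n = 2\<close> is the wanted case \<open>p = 4\<close>.\<close>

locale exceptional = tight_triple +
  fixes n
  assumes p_n: "p = 2 * n" and n3: "3 \<le> n" and czc: "c * s ^ n * c = s ^ n * a"
begin

abbreviation "z \<equiv> s ^ n"

lemma zz: "z * z = 1" using s_ord[of "n + n"] p_n by (simp add: power_add mult_2)

lemma inv_z: "inverse z = z" using zz by (rule perm_inverse_unique)

lemma bz: "b * z = z * b" using D.y_pow[of n] inv_z by simp

lemma az: "a * z = z * a" using D.x_pow[of n] inv_z by simp

lemma sz: "s ^ i * z = z * s ^ i" by (simp add: add.commute flip: power_add)

lemma z_central: "d \<in> dih a b \<Longrightarrow> d * z = z * d"
proof -
  assume "d \<in> dih a b"
  then obtain i where "d = s ^ i \<or> d = s ^ i * b" by (auto simp: dih_def)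
  moreover have "s ^ i * b * z = z * (s ^ i * b)" using sz[of i] bz by (metis mult.assoc)
  ultimately show ?thesis using sz by metis
qed

lemma a_refl: "a = s ^ 1 * b" by (simp add: mult.assoc bb)

lemma czc_D: "c * z * c \<in> dih a b" unfolding czc
  using D.dih_mult[OF dihI(1) D.dih_x] by simp

text \<open>The dual of \<open>edge_stabiliser\<close> gives the multiples of some divisor
  \<open>m\<close> of \<open>n\<close>. If \<open>c * s ^ m * c\<close> were a rotation, so would be
  its power \<open>c * z * c\<close>, contrary to \<open>czc\<close>. Hence it is a reflection and
  \<open>s ^ m\<close> is an involution, which leaves only \<open>m = n\<close>.\<close>

lemma face_stabiliser: "c * s ^ i * c \<in> dih a b \<longleftrightarrow> n dvd i"
proof -
  interpret du: tight_triple c b a q p by (rule dual)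
  obtain m where m: "0 < m" "m < q" "m dvd p" "\<And>i. c * s ^ i * c \<in> dih a b \<longleftrightarrow> m dvd i"
    using du.edge_stabiliser by metis
  have mn: "m dvd n" using m(4) czc_D by blast
  have "c * s ^ m * c \<in> dih a b" using m(4) by simp
  then obtain i where i: "c * s ^ m * c = s ^ i \<or> c * s ^ m * c = s ^ i * b" by (auto simp: dih_def)
  have "n dvd m"
  proof (cases "c * s ^ m * c = s ^ i")
    case True
    obtain k where k: "n = m * k" using mn by (auto elim: dvdE)
    have "z * a = (c * s ^ m * c) ^ k" using czc by (simp add: k invol_conj_power cc power_mult)
    then have "z * (s ^ 1 * b) = s ^ (i * k)" using True a_refl by (simp add: power_mult)
    then have "s ^ (n + 1) * b = s ^ (i * k)" by (simp only: power_add mult.assoc)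
    then show ?thesis using D.pow_ne_refl by metis
  next
    case False
    then have "(c * s ^ m * c) * (c * s ^ m * c) = 1" using i D.refl_sq by metis
    then have "c * (s ^ m * s ^ m) * c = c * 1 * c" by (simp add: mult.assoc cc)
    then have "s ^ (m + m) = 1" unfolding perm_mult_right_cancel perm_mult_left_cancel power_add .
    then have "2 * n dvd 2 * m" using s_ord p_n by (simp add: mult_2)
    then show ?thesis by simp
  qed
  then have "m = n" using mn by (simp add: dvd_antisym)
  then show ?thesis using m(4) by simp
qed

text \<open>The union of the cosets that represent the faces sharing an edge with the base face.
  Likewise \<open>N1\<close> collects the neighbours of the face of \<open>c\<close>, which itself
  is a neighbour of the base face.\<close>

definition N0 where "N0 = {s ^ i * c * d |i d. d \<in> dih a b}"

abbreviation "N1 \<equiv> (*) c ` N0"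

lemma N0I: "d \<in> dih a b \<Longrightarrow> s ^ i * c * d \<in> N0"
  by (auto simp: N0_def)

lemma N0_left: assumes "g \<in> N0" "d \<in> dih a b" shows "d * g \<in> N0"
proof -
  obtain i e where g: "g = s ^ i * c * e" "e \<in> dih a b" using assms(1) by (auto simp: N0_def)
  obtain j where d: "d = s ^ j \<or> d = s ^ j * b" using assms(2) by (auto simp: dih_def)
  show ?thesis
  proof (cases "d = s ^ j")
    case True
    then have "d * g = s ^ (j + i) * c * e" by (simp add: g power_add mult.assoc)
    then show ?thesis using N0I g(2) by simp
  next
    case False
    \<comment> \<open>To carry \<open>b\<close> past \<open>c\<close>, it is written as
      \<open>s ^ (p - 1) * a\<close>, whose second factor commutes with \<open>c\<close>.\<close>
    have "s ^ p = s ^ (p - 1) * s" using p_ge by (cases p) (simp_all add: power_commutes)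
    then have "s ^ (p - 1) * a * b = 1" using D.pow_n by (simp add: mult.assoc)
    then have beq: "b = s ^ (p - 1) * a"
      by (metis D.inv_y mult.assoc perm_inverse_inverse perm_inverse_unique bb mult.right_neutral mult_1)
    have bh: "b * (c * e) = s ^ (p - 1) * (c * (a * e))"
      using arg_cong[OF beq, of "\<lambda>x. x * (c * e)"] by (simp only: mult.assoc cax)
    have "d * g = s ^ j * ((b * s ^ i) * (c * e))" using d False by (simp add: g mult.assoc)
    also have "\<dots> = s ^ j * (s ^ ((p - 1) * i) * (b * (c * e)))"
      unfolding D.y_pow' mult.assoc by (rule refl)
    also have "\<dots> = s ^ (j + ((p - 1) * i + (p - 1))) * c * (a * e)"
      unfolding bh by (simp only: power_add mult.assoc)
    finally show ?thesis using N0I D.dih_mult[OF D.dih_x g(2)] by simp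
  qed
qed

text \<open>By \<open>face_stabiliser\<close> the power \<open>s ^ n\<close> fixes the face of
  \<open>c\<close>, so the face of \<open>s ^ i * c\<close> depends on \<open>i\<close> modulo
  \<open>n\<close> only.\<close>

lemma shift_eq:
  assumes "i mod n = j mod n" "d \<in> dih a b" shows "\<exists>e\<in>dih a b. s ^ i * c * d = s ^ j * c * e"
proof -
  have *: "\<exists>u\<in>dih a b. s ^ i * c = s ^ (i mod n) * c * u" for i
  proof -
    have "s ^ i = s ^ (i mod n) * s ^ (n * (i div n))" by (simp flip: power_add)
    then have "s ^ i * c = s ^ (i mod n) * c * (c * s ^ (n * (i div n)) * c)" by (simp add: mult.assoc)
    moreover have "c * s ^ (n * (i div n)) * c \<in> dih a b" by (simp add: face_stabiliser)
    ultimately show ?thesis by blast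
  qed
  obtain u where u: "u \<in> dih a b" "s ^ i * c = s ^ (i mod n) * c * u" using * by blast
  obtain v where v: "v \<in> dih a b" "s ^ j * c = s ^ (i mod n) * c * v" using *[of j] assms(1) by auto
  have "s ^ i * c * d = s ^ (i mod n) * c * u * d"
    using u(2) by (rule arg_cong[where f = "\<lambda>x. x * d"])
  moreover have "s ^ j * c * (inverse v * (u * d)) = s ^ (i mod n) * c * v * (inverse v * (u * d))"
    using v(2) by (rule arg_cong[where f = "\<lambda>x. x * (inverse v * (u * d))"])
  moreover have "s ^ (i mod n) * c * v * (inverse v * (u * d)) = s ^ (i mod n) * c * u * d"
    by (simp only: mult.assoc perm_right_inverse_assoc)
  ultimately have eq: "s ^ i * c * d = s ^ j * c * (inverse v * (u * d))"
    by (simp only:)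
  have "inverse v * (u * d) \<in> dih a b"
    by (intro D.dih_mult D.dih_inverse) (fact v(1), fact u(1), fact assms(2))
  with eq show ?thesis by (rule bexI)
qed

lemma card_N0: "card N0 = n * (2 * p)"
proof -
  define K where "K i = (*) (s ^ i * c) ` dih a b" for i
  have N0: "N0 = (\<Union>i\<in>{..<n}. K i)"
  proof
    show "N0 \<subseteq> (\<Union>i\<in>{..<n}. K i)"
    proof
      fix g assume "g \<in> N0"
      then obtain i d where "g = s ^ i * c * d" "d \<in> dih a b" by (auto simp: N0_def)
      then obtain e where "e \<in> dih a b" "g = s ^ (i mod n) * c * e"
        using shift_eq[of i "i mod n" d] by auto
      moreover have "i mod n < n" using n3 by simp
      ultimately show "g \<in> (\<Union>i\<in>{..<n}. K i)" unfolding K_def by blast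
    qed
  qed (auto simp: K_def N0I)
  have disj: "K i \<inter> K j = {}" if "i < j" "j < n" for i j
  proof (rule ccontr)
    assume "K i \<inter> K j \<noteq> {}"
    then obtain d e where de: "d \<in> dih a b" "e \<in> dih a b" "s ^ i * c * d = s ^ j * c * e"
      unfolding K_def by blast
    have "s ^ j = s ^ i * s ^ (j - i)" using that by (simp flip: power_add)
    then have "c * d = s ^ (j - i) * c * e" using de(3) by (simp add: mult.assoc)
    then have "d = c * s ^ (j - i) * c * e" by (metis E.x_x mult.assoc)
    then have "c * s ^ (j - i) * c \<in> dih a b" using de D.dih_cancel_right by simp
    then have "n dvd j - i" using face_stabiliser by simp
    then show False using that by (auto dest: dvd_imp_le)
  qed
  have "card N0 = (\<Sum>i<n. card (K i))"
    unfolding N0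
  proof (rule card_UN_disjoint)
    show "\<forall>i\<in>{..<n}. \<forall>j\<in>{..<n}. i \<noteq> j \<longrightarrow> K i \<inter> K j = {}"
      using disj by (metis Int_commute lessThan_iff nat_neq_iff)
  qed (simp_all add: D.finite_dih K_def)
  also have "\<dots> = (\<Sum>i<n. 2 * p)"
    by (intro sum.cong refl) (simp add: card_image inj_on_def D.card_dih K_def)
  finally show ?thesis by simp
qed

lemma N0_sub: "N0 \<subseteq> G" and N1_sub: "N1 \<subseteq> G"
  using D_sub_G by (auto simp: N0_def intro!: G_intros)

lemma card_N1: "card N1 = n * (2 * p)"
  using card_N0 by (simp add: card_image inj_on_def)

lemma finite_N: "finite N0" "finite N1"
  using finite_G N0_sub N1_sub finite_subset by blast+

text \<open>As \<open>z\<close> is central in \<open>dih a b\<close>, the conjugate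
  \<open>g * z * inverse g\<close> depends only on the face of \<open>g\<close>. Computing it from
  both descriptions of \<open>g\<close> determines \<open>i\<close> modulo \<open>n\<close>; so the
  base face and the face of \<open>c\<close> have at most one common neighbour.\<close>

lemma common_neighbour:
  assumes "g \<in> N0" "g \<in> N1"
  shows "even n \<and> g \<in> (*) (s ^ (n div 2) * c) ` dih a b"
proof -
  obtain i d where g: "g = s ^ i * c * d" "d \<in> dih a b" using assms(1) by (auto simp: N0_def)
  obtain j e where g': "g = c * (s ^ j * c * e)" "e \<in> dih a b" using assms(2) by (auto simp: N0_def)
  have dz: "d * z * inverse d = z" "e * z * inverse e = z"
    using z_central g(2) g'(2) by (simp_all add: mult.assoc)
  have conj: "s ^ i * (z * a) * inverse (s ^ i) = z * s ^ (i + i) * a" for i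
  proof -
    have "a * s ^ i = inverse (s ^ i) * a" by (rule D.x_pow)
    then have "s ^ i * a * s ^ i * inverse (s ^ i) = s ^ i * inverse (s ^ i) * a * inverse (s ^ i)"
      by (simp add: mult.assoc)
    then have "a * inverse (s ^ i) = s ^ i * a"
      by (metis D.x_pow D.inverse_pow perm_inverse_inverse)
    then show ?thesis using sz[of i] by (simp add: power_add) (metis mult.assoc)
  qed
  have "g * z * inverse g = s ^ i * (c * (d * z * inverse d) * c) * inverse (s ^ i)"
    by (simp add: g perm_inverse_mult mult.assoc E.inv_x)
  then have 1: "g * z * inverse g = z * s ^ (i + i) * a" by (simp only: dz czc conj)
  have "g * z * inverse g = c * (s ^ j * (c * (e * z * inverse e) * c) * inverse (s ^ j)) * c"
    by (simp add: g' perm_inverse_mult mult.assoc E.inv_x)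
  then have 2: "g * z * inverse g = c * (z * s ^ (j + j) * a) * c" by (simp only: dz czc conj)
  have "c * (z * s ^ (j + j) * a) * c = (c * z * c) * (c * s ^ (j + j) * c) * a"
    by (simp add: mult.assoc invol_cancel cc ca cax)
  then have "z * s ^ (i + i) * a = z * a * (c * s ^ (j + j) * c) * a" using 1 2 czc by simp
  then have "z * s ^ (i + i) = z * a * (c * s ^ (j + j) * c)"
    unfolding perm_mult_right_cancel .
  then have *: "s ^ (i + i) = a * (c * s ^ (j + j) * c)"
    by (simp add: mult.assoc)
  then have "a * (c * s ^ (j + j) * c) \<in> dih a b" using dihI(1) by metis
  then have "c * s ^ (j + j) * c \<in> dih a b" using D.dih_cancel_left D.dih_x by blast
  then have "n dvd j + j" using face_stabiliser by blast
  then obtain k where k: "j + j = n * k" by (auto elim: dvdE)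
  have zk: "z ^ k = (if even k then 1 else z)" by (induction k) (auto simp: zz)
  \<comment> \<open>If \<open>s ^ (j + j)\<close> were trivial, the rotation
    \<open>s ^ (i + i)\<close> would equal the reflection \<open>a\<close>. So it is
    \<open>z\<close>, and then \<open>2 * i\<close> is congruent to \<open>n\<close> modulo
    \<open>2 * n\<close>.\<close>
  have "\<not> even k"
  proof
    assume "even k"
    then have "s ^ (j + j) = 1" unfolding k power_mult using zk by simp
    then have "s ^ (i + i) = s ^ 1 * b" using * a_refl cc by simp
    then show False using D.pow_ne_refl by blast
  qed
  then have "s ^ (j + j) = z" unfolding k power_mult using zk by simp
  then have "s ^ (i + i) = a * (z * a)" using * czc by simp
  then have "s ^ (i + i) = z" using az by (simp add: aa mult.assoc) (metis aa az mult.assoc mult.right_neutral)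
  then have mod: "(i + i) mod (2 * n) = n mod (2 * n)" using D.pow_eq p_n by simp
  then have "(i + i) mod (2 * n) = n" using n3 by simp
  then have ev: "even n" by (metis dvd_mod_iff dvd_triv_left even_add)
  then have "2 * (n div 2) = n" by simp
  moreover have "(2 * i) mod (2 * n) = n" using \<open>(i + i) mod (2 * n) = n\<close> by (simp add: mult_2)
  then have "2 * (i mod n) = n" by (simp only: mod_mult_mult1)
  ultimately have "i mod n = n div 2" by simp
  then have "i mod n = (n div 2) mod n" using n3 by simp
  then obtain d' where "d' \<in> dih a b" "g = s ^ (n div 2) * c * d'" using shift_eq g by metis
  then show ?thesis using ev by auto
qed

section \<open>Counting the neighbours of two adjacent faces\<close>

lemma D_N0: "d \<in> dih a b \<Longrightarrow> (*) d ` N0 = N0"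
proof
  assume d: "d \<in> dih a b"
  show "(*) d ` N0 \<subseteq> N0" using N0_left d by blast
  show "N0 \<subseteq> (*) d ` N0"
  proof
    fix g assume "g \<in> N0"
    then have "inverse d * g \<in> N0" using N0_left D.dih_inverse d by blast
    then show "g \<in> (*) d ` N0" by (intro image_eqI[of _ _ "inverse d * g"]) simp_all
  qed
qed

lemma c_N1: "(*) c ` N1 = N0"
  by (simp add: image_image)

lemma c_Int: "(*) c ` (N0 \<inter> N1) = N0 \<inter> N1"
proof -
  have "(*) c ` (N0 \<inter> N1) = (*) c ` N0 \<inter> (*) c ` N1" by (rule image_Int) (simp add: inj_on_def)
  then show ?thesis unfolding c_N1 by blast
qed

lemma card_union_bound: "n * (2 * p) + n * (2 * p) \<le> q * (2 * p) + card (N0 \<inter> N1)"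
proof -
  have "card N0 + card N1 = card (N0 \<union> N1) + card (N0 \<inter> N1)"
    by (rule card_Un_Int) (rule finite_N)+
  moreover have "card (N0 \<union> N1) \<le> card G" by (rule card_mono[OF finite_G]) (use N0_sub N1_sub in blast)
  ultimately show ?thesis by (simp add: card_N0 card_N1 card_G)
qed

abbreviation "k \<equiv> s ^ (n div 2) * c"

lemma Int_sub: "N0 \<inter> N1 \<subseteq> (*) k ` dih a b"
  using common_neighbour by blast

lemma card_k: "card ((*) k ` dih a b) = 2 * p"
  by (simp add: card_image inj_on_def D.card_dih)

lemma card_Int: "card (N0 \<inter> N1) \<le> 2 * p"
  using card_mono[OF _ Int_sub] card_k D.finite_dih by simp

text \<open>Inclusion and exclusion: \<open>n\<close> neighbours of each of two faces, at most one
  of them in common, among \<open>q\<close> faces in all.\<close>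

lemma p_le_q_aux: "2 * n \<le> q + 1"
proof -
  have "(n + n) * (2 * p) \<le> (q + 1) * (2 * p)"
    using card_union_bound card_Int by (simp add: add_mult_distrib)
  then have "n + n \<le> q + 1" using p_ge by (simp only: mult_le_cancel2)
  then show ?thesis by simp
qed

text \<open>Otherwise \<open>q + 1 = 2 * n\<close>, so the neighbours of the two faces cover all
  faces and share exactly one, the face of \<open>k\<close>. This face is fixed by \<open>c\<close>,
  so its set of neighbours is too. This leaves at most one face outside \<open>N0\<close>, too few
  when \<open>3 \<le> n\<close>.\<close>

lemma p_le_q: "p \<le> q"
proof (rule ccontr)
  assume "\<not> p \<le> q"
  then have q: "q + 1 = 2 * n" using p_le_q_aux p_n by simp
  define K where "K = N0 \<inter> N1"
  define T where "T = G - N0"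
  have "(n + n) * (2 * p) \<le> q * (2 * p) + card K"
    using card_union_bound by (simp add: add_mult_distrib K_def)
  moreover have "(n + n) * (2 * p) = q * (2 * p) + 2 * p" using q by (simp add: mult_2 flip: add_mult_distrib)
     (metis Suc_eq_plus1 add.commute mult_Suc)
  ultimately have "2 * p \<le> card K" by simp
  then have cK: "card K = 2 * p" using card_Int by (simp add: K_def)
  have Kk: "K = (*) k ` dih a b"
    unfolding K_def by (rule card_subset_eq) (use Int_sub cK card_k D.finite_dih in \<open>simp_all add: K_def\<close>)
  have "K \<noteq> {}" using cK p_ge by auto
  then have ev: "even n" using common_neighbour by (auto simp: K_def)
  have "card (N0 \<union> N1) + card K = card N0 + card N1"
    unfolding K_def by (rule card_Un_Int[symmetric]) (rule finite_N)+
  then have "card (N0 \<union> N1) = card G"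
    using cK \<open>(n + n) * (2 * p) = q * (2 * p) + 2 * p\<close> by (simp add: card_N0 card_N1 card_G add_mult_distrib)
  then have un: "N0 \<union> N1 = G" using N0_sub N1_sub finite_G by (intro card_subset_eq) auto
  have T: "T \<union> K = N1" "T \<inter> N0 = {}" using un by (auto simp: T_def K_def)
  have dT: "(*) d ` T = T" if "d \<in> dih a b" for d
  proof -
    have *: "(*) d ` T \<subseteq> T" if "d \<in> dih a b" for d
    proof
      fix g assume "g \<in> (*) d ` T"
      then obtain h where h: "h \<in> G" "h \<notin> N0" "g = d * h" by (auto simp: T_def)
      have "g \<notin> N0"
      proof
        assume "g \<in> N0"
        then have "inverse d * g \<in> N0" using N0_left D.dih_inverse that by blast
        then show False using h by simp
      qed
      moreover have "g \<in> G" using h that D_sub_G by (auto intro: mult_G)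
      ultimately show "g \<in> T" by (simp add: T_def)
    qed
    have "T \<subseteq> (*) d ` T"
    proof
      fix g assume "g \<in> T"
      then have "inverse d * g \<in> T" using *[OF D.dih_inverse[OF that]] by blast
      then show "g \<in> (*) d ` T" by (intro image_eqI[of _ _ "inverse d * g"]) simp_all
    qed
    then show ?thesis using *[OF that] by blast
  qed
  define h where "h = s ^ (n div 2)"
  have hD: "h \<in> dih a b" unfolding h_def by (rule dihI)
  have hh: "h * h = z" using ev by (simp add: h_def flip: power_add mult_2)
  have img: "(*) (g * g') ` X = (*) g ` ((*) g' ` X)" for g g' :: "'a perm" and X
    by (simp add: image_image mult.assoc)
  have kE: "k = h * c" by (simp add: h_def)
  have "h * k = c * (c * z * c)" using hh by (simp add: kE mult.assoc[symmetric])  (simp add: mult.assoc)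
  have hK: "(*) h ` K = (*) c ` dih a b"
  proof -
    have "(*) h ` K = (*) (h * k) ` dih a b" unfolding Kk img ..
    also have "\<dots> = (*) c ` ((*) (c * z * c) ` dih a b)" unfolding \<open>h * k = _\<close> img ..
    also have "(*) (c * z * c) ` dih a b = dih a b"
      using czc_D by (rule D.dih_translate)
    finally show ?thesis .
  qed
  have "(*) k ` N0 = (*) h ` (T \<union> K)" unfolding kE img T(1) ..
  \<comment> \<open>The neighbours of the common neighbour are the faces in \<open>T\<close> and the
    face of \<open>c\<close>. This set is invariant under \<open>c\<close>, while \<open>c\<close>
    sends \<open>T\<close> into \<open>N0\<close>, which is disjoint from \<open>T\<close>; so
    \<open>c\<close> sends \<open>T\<close> into the face of \<open>c\<close>.\<close>
  then have kN0: "(*) k ` N0 = T \<union> (*) c ` dih a b" by (simp add: image_Un dT[OF hD] hK)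
  have "k * 1 \<in> K" unfolding Kk using D.dih_1 by (rule imageI)
  then have "c * k \<in> K" using c_Int unfolding K_def by (metis imageI mult.right_neutral)
  then obtain d where d: "d \<in> dih a b" "c * k = k * d" unfolding Kk by blast
  have "(*) c ` ((*) k ` N0) = (*) k ` N0"
    unfolding img[symmetric] d(2) unfolding img D_N0[OF d(1)] ..
  then have "(*) c ` T \<subseteq> T \<union> (*) c ` dih a b" unfolding kN0 by blast
  moreover have "(*) c ` T \<subseteq> N0" using T(1) c_N1 by blast
  ultimately have "(*) c ` T \<subseteq> (*) c ` dih a b" using T(2) by blast
  moreover have "inj ((*) c)" by (simp add: inj_def)
  ultimately have "T \<subseteq> dih a b" using inj_image_subset_iff by metis
  then have "card T \<le> 2 * p" using card_mono[OF D.finite_dih] D.card_dih by metis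
  moreover have "card T = q * (2 * p) - n * (2 * p)"
    unfolding T_def using N0_sub finite_N card_G card_N0 by (simp add: card_Diff_subset)
  ultimately have "q * (2 * p) \<le> (n + 1) * (2 * p)" by (simp add: add_mult_distrib)
  then have "q \<le> n + 1" using p_ge by (simp only: mult_le_cancel2)
  then show False using q n3 by simp
qed

text \<open>If \<open>p = q\<close>, the graph of faces is bipartite, and \<open>c\<close> swaps its two sides while
  \<open>a\<close> and \<open>b\<close> preserve them.\<close>

lemma no_dual_exception:
  assumes "q = p" "a * t ^ n * a = t ^ n * c" shows False
proof -
  interpret du: tight_triple c b a q p by (rule dual)
  \<comment> \<open>A common neighbour would be fixed by \<open>c\<close>, so a conjugate of
    \<open>c\<close> under a power of \<open>t\<close> would lie in \<open>dih a b\<close>. Such a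
    conjugate is an odd power of \<open>t\<close> times \<open>b\<close>, and an odd power of
    \<open>t\<close> is nontrivial because \<open>q\<close> is even.\<close>
  have disj: "N0 \<inter> N1 = {}"
  proof (rule ccontr)
    assume "N0 \<inter> N1 \<noteq> {}"
    then obtain g where g: "g \<in> N0 \<inter> N1" by blast
    then have "c * g \<in> N0 \<inter> N1" using c_Int by blast
    then obtain d where d: "d \<in> dih a b" "c * g = k * d" using Int_sub by blast
    obtain d' where d': "d' \<in> dih a b" "g = k * d'" using Int_sub g by blast
    have "c * g = g * (inverse d' * d)"
      unfolding d(2) unfolding d'(2) by (simp only: mult.assoc perm_right_inverse_assoc)
    moreover have "g \<in> G" using g N0_sub by blast
    then obtain i e where e: "e \<in> dih a b" "g = t ^ i * e" using du.coset_rep_s unfolding G_dual by blast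
    ultimately have "c * t ^ i * e = t ^ i * (e * inverse d' * d)" by (simp add: mult.assoc)
    then have "inverse (t ^ i) * (c * t ^ i) * e = e * inverse d' * d" by (simp add: mult.assoc)
    moreover have "e * inverse d' * d \<in> dih a b" using d d' e D.dih_mult D.dih_inverse by blast
    ultimately have "inverse (t ^ i) * (c * t ^ i) \<in> dih a b" using D.dih_cancel_right e(1) by metis
    moreover have "c * t ^ i = inverse (t ^ i) * (t * b)" using E.x_pow by (simp add: mult.assoc bb)
    moreover have "inverse (t ^ i) * (inverse (t ^ i) * (t * b)) = t ^ ((q - 1) * i + (q - 1) * i + 1) * b"
      by (simp only: E.inverse_pow power_add power_one_right mult.assoc)
    ultimately have "t ^ ((q - 1) * i + (q - 1) * i + 1) * b \<in> dih a b" by simp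
    then have "t ^ ((q - 1) * i + (q - 1) * i + 1) \<in> dih a b" using D.dih_cancel_right D.dih_y by blast
    then have "q dvd (q - 1) * i + (q - 1) * i + 1" using du.pow_Int t_ord by blast
    moreover have "even q" using assms(1) p_n by simp
    ultimately have "even ((q - 1) * i + (q - 1) * i + 1)" using dvd_trans by blast
    then show False by simp
  qed
  have un: "N0 \<union> N1 = G"
  proof (rule card_subset_eq[OF finite_G])
    show "N0 \<union> N1 \<subseteq> G" using N0_sub N1_sub by blast
    have "card (N0 \<union> N1) = card N0 + card N1" by (rule card_Un_disjoint) (use finite_N disj in auto)
    then show "card (N0 \<union> N1) = card G" using assms(1) p_n by (simp add: card_N0 card_N1 card_G)
  qed
  have img: "(*) (g * g') ` X = (*) g ` ((*) g' ` X)" for g g' :: "'a perm" and X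
    by (simp add: image_image mult.assoc)
  have img1: "(*) (1 :: 'a perm) ` X = X" for X by simp
  have ne: "N0 \<noteq> N1" using disj N0I[OF D.dih_1] by blast
  have N1E: "N1 = G - N0" using un disj by blast
  have D_N1: "(*) d ` N1 = N1" if "d \<in> dih a b" for d
  proof -
    have "(*) d ` G = G"
    proof
      show "(*) d ` G \<subseteq> G" using that D_sub_G by (auto intro: mult_G)
      show "G \<subseteq> (*) d ` G"
      proof
        fix g assume "g \<in> G"
        then have "inverse d * g \<in> G" using that D_sub_G by (auto intro: mult_G inverse_G)
        then show "g \<in> (*) d ` G" by (intro image_eqI[of _ _ "inverse d * g"]) simp_all
      qed
    qed
    moreover have "(*) d ` (G - N0) = (*) d ` G - (*) d ` N0" by (rule image_set_diff) (simp add: inj_def)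
    ultimately show ?thesis unfolding N1E by (simp add: D_N0[OF that])
  qed
  have tN: "(*) t ` N0 = N1" "(*) t ` N1 = N0"
    unfolding img D_N0[OF D.dih_y] D_N1[OF D.dih_y] c_N1 by simp_all
  have "(*) (t ^ i) ` N0 = N0 \<and> (*) (t ^ i) ` N1 = N1 \<or> (*) (t ^ i) ` N0 = N1 \<and> (*) (t ^ i) ` N1 = N0" for i
  proof (induction i)
    case 0
    then show ?case by simp
  next
    case (Suc i)
    have "(*) (t ^ Suc i) ` X = (*) t ` ((*) (t ^ i) ` X)" for X unfolding power_Suc by (rule img)
    then show ?case using Suc tN by metis
  qed
  then have x: "(*) (t ^ n) ` N0 = N0 \<and> (*) (t ^ n) ` N1 = N1 \<or> (*) (t ^ n) ` N0 = N1 \<and> (*) (t ^ n) ` N1 = N0"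
    by blast
  have "(*) (a * t ^ n * a) ` N0 = (*) (t ^ n * c) ` N0" by (simp only: assms(2))
  then have "(*) a ` ((*) (t ^ n) ` N0) = (*) (t ^ n) ` N1"
    unfolding img D_N0[OF D.dih_x] .
  \<comment> \<open>\<open>a\<close> preserves both halves and \<open>c\<close> exchanges them, so
    the two sides of the relation act differently, whichever way \<open>t ^ n\<close> acts.\<close>
  then show False using x ne D_N0[OF D.dih_x] D_N1[OF D.dih_x] by metis
qed

end

context tight_triple begin

text \<open>For \<open>3 \<le> n\<close> one has \<open>p \<le> q\<close>, so the neighbour count
  applies to the triple itself. If some \<open>t ^ m\<close> generates a normal subgroup, the
  quotient is exceptional with the same \<open>n\<close>, hence \<open>p \<le> m\<close>, contrary
  to \<open>m < p\<close>. Otherwise the dual relation holds as well and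
  \<open>q = p\<close>.\<close>

lemma exceptional_p_eq_4:
  assumes "p = 2 * n" "c * s ^ n * c = s ^ n * a" shows "p = 4"
proof (rule ccontr)
  assume p4: "p \<noteq> 4"
  have "n \<noteq> 1"
  proof
    assume "n = 1"
    then have "c * s * c = s * a" using assms(2) by simp
    then have "a * (c * b * c) = a * (b * a)" by (simp add: mult.assoc cax)
    then have "c * b * c = b * a" by simp
    then have "a = b * (c * b * c)" by (simp add: mult.assoc)
    then show False using a_notin_E E.dih_mult E.dih_x E.dih_y by metis
  qed
  then have n3: "3 \<le> n" using p4 assms(1) p_ge by auto
  interpret ex: exceptional a b c p q n by unfold_locales (fact assms(1) n3 assms(2))+
  interpret du: tight_triple c b a q p by (rule dual)
  from vertex_multiplicity[OF ex.p_le_q] show False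
  proof (elim disjE exE conjE)
    fix m i assume m: "0 < m" "m < p" "m dvd q" "a * t ^ m * a = t ^ (m * i)"
    \<comment> \<open>For \<open>m\<close> at most 2 the conjugate \<open>c * s ^ n * c\<close>
      would agree with \<open>s ^ n\<close> up to a power of \<open>t ^ m\<close>, and the
      exceptional relation would make \<open>a\<close> such a power.\<close>
    have "2 < m"
    proof (rule ccontr)
      assume "\<not> 2 < m"
      then have "m = 1 \<or> m = 2" using m(1) by auto
      then have "m dvd 2" by auto
      then obtain l where l: "2 = m * l" by (rule dvdE)
      have tm: "t ^ (m * j) * a = a * t ^ (m * (i * j))" for j
      proof -
        have "a * t ^ (m * j) * a = (a * t ^ m * a) ^ j" by (simp add: invol_conj_power aa power_mult)
        also have "\<dots> = t ^ (m * (i * j))" unfolding m(4) by (simp only: power_mult[symmetric] mult.assoc)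
        finally show ?thesis by (metis D.x_x mult.assoc)
      qed
      have tb: "t ^ j * b = b * t ^ ((q - 1) * j)" for j
        using E.y_pow'[of j] by (metis E.y_y bb mult.assoc mult.right_neutral E.y_pow' E.inverse_pow E.y_pow perm_inverse_inverse)
      have "inverse (t ^ 2) = b * (c * (b * c))"
        by (rule perm_inverse_unique) (simp add: power2_eq_square mult.assoc cc)
      moreover have "(q - 1) * 2 = m * ((q - 1) * l)" unfolding l by (rule mult.left_commute)
      ultimately have x: "b * (c * (b * c)) = t ^ (m * ((q - 1) * l))" by (metis E.inverse_pow)
      have csc: "c * s * c = s * t ^ (m * ((q - 1) * l))"
        unfolding x[symmetric] by (simp add: mult.assoc cax)
      text \<open>Modulo \<open>\<langle>t ^ m\<rangle>\<close> the element \<open>c\<close> commutes with \<open>s\<close>.\<close>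
      have "\<exists>j. c * s ^ k * c = s ^ k * t ^ (m * j)" for k
      proof (induction k)
        case 0
        have "c * s ^ 0 * c = s ^ 0 * t ^ (m * 0)" by (simp add: cc)
        then show ?case by blast
      next
        case (Suc k)
        then obtain j where j: "c * s ^ k * c = s ^ k * t ^ (m * j)" by blast
        have "c * s ^ Suc k * c = (c * s ^ k * c) * (c * s * c)"
          by (simp only: power_Suc2 mult.assoc E.x_x)
        also have "\<dots> = s ^ k * ((t ^ (m * j) * a) * b * t ^ (m * ((q - 1) * l)))"
          unfolding j csc by (simp only: mult.assoc)
        also have "\<dots> = s ^ k * (a * (t ^ (m * (i * j)) * b) * t ^ (m * ((q - 1) * l)))"
          unfolding tm by (simp only: mult.assoc)
        also have "\<dots> = s ^ Suc k * (t ^ ((q - 1) * (m * (i * j))) * t ^ (m * ((q - 1) * l)))"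
          unfolding tb by (simp only: power_Suc2 mult.assoc)
        also have "t ^ ((q - 1) * (m * (i * j))) * t ^ (m * ((q - 1) * l)) =
            t ^ (m * ((q - 1) * (i * j) + (q - 1) * l))"
          by (simp only: power_add distrib_left mult.left_commute)
        finally show ?case by blast
      qed
      then obtain j where "c * s ^ n * c = s ^ n * t ^ (m * j)" by blast
      then have "a = t ^ (m * j)" using assms(2) by simp
      then show False using a_notin_E dihI(1)[of c b "m * j"] by metis
    qed
    then have "2 \<le> m" by simp
    obtain \<phi> :: "'x perm \<Rightarrow> nat perm" where q: "tight_triple (\<phi> a) (\<phi> b) (\<phi> c) p m"
      and homA: "\<forall>g\<in>G. \<forall>h\<in>G. \<phi> (g * h) = \<phi> g * \<phi> h"
      and powA: "\<forall>g\<in>G. \<forall>i. \<phi> (g ^ i) = \<phi> g ^ i"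
      by (rule quotient[OF m(3) \<open>2 \<le> m\<close> m(4)])
    have hom: "\<phi> (g * h) = \<phi> g * \<phi> h" if "g \<in> G" "h \<in> G" for g h using homA that by blast
    have pow: "\<phi> (g ^ i) = \<phi> g ^ i" if "g \<in> G" for g i using powA that by blast
    have sG: "s \<in> G" "s ^ n \<in> G" by (intro G_intros)+
    have \<phi>s: "\<phi> (s ^ n) = (\<phi> a * \<phi> b) ^ n" using pow[OF sG(1)] hom[OF a_G b_G] by metis
    have "\<phi> (c * s ^ n * c) = \<phi> (s ^ n * a)" by (simp only: assms(2))
    then have "\<phi> c * \<phi> (s ^ n) * \<phi> c = \<phi> (s ^ n) * \<phi> a"
      using hom[OF mult_G[OF c_G sG(2)] c_G] hom[OF c_G sG(2)] hom[OF sG(2) a_G] by metis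
    then interpret Q: exceptional "\<phi> a" "\<phi> b" "\<phi> c" p m n
      unfolding \<phi>s by (intro exceptional.intro[OF q] exceptional_axioms.intro assms(1) n3)
    show False using Q.p_le_q m(2) by simp
  next
    assume ex2: "even q" "q div 2 < p" "a * t ^ (q div 2) * a = t ^ (q div 2) * c"
    define n' where "n' = q div 2"
    have n': "q = 2 * n'" "a * t ^ n' * a = t ^ n' * c" using ex2 by (simp_all add: n'_def)
    then interpret du: exceptional c b a q p n'
      using ex.p_le_q ex.p_n n3 by unfold_locales auto
    have "q = p" using du.p_le_q ex.p_le_q by simp
    then show False using ex.no_dual_exception n' ex.p_n by simp
  qed
qed

end

section \<open>Cube-like triples\<close>

text \<open>For even \<open>q\<close> the power is the central involution of \<open>dih c b\<close>;
  the Boolean records whether this factor occurs in \<open>a\<close>.\<close>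

definition twist :: "'x perm \<Rightarrow> 'x perm \<Rightarrow> nat \<Rightarrow> bool \<Rightarrow> 'x perm" where
  "twist b c q \<epsilon> = (if \<epsilon> then (c * b) ^ (q div 2) else 1)"

text \<open>With \<open>u = b * v * b\<close>, conjugation by \<open>b\<close> exchanges
  \<open>v\<close> and \<open>u\<close>, and conjugation by \<open>c\<close> fixes \<open>v\<close>
  and exchanges \<open>u\<close> and \<open>v * u\<close>: together they permute the three
  involutions in all possible ways, as in the hemicube. The numerical conditions make the twist
  invert \<open>y\<close> when \<open>r \<noteq> 1\<close>. That \<open>y\<close> has order exactly
  \<open>r\<close> is not demanded here; for a tight triple it follows by counting.\<close>

definition cube_like :: "'x perm \<Rightarrow> 'x perm \<Rightarrow> 'x perm \<Rightarrow> nat \<Rightarrow> nat \<Rightarrow> bool \<Rightarrow> bool" where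
  "cube_like a b c r q \<epsilon> \<longleftrightarrow>
     3 dvd q \<and> odd r \<and> (\<epsilon> \<longrightarrow> even q) \<and> (r \<noteq> 1 \<longrightarrow> \<epsilon> \<and> odd (q div 2)) \<and>
     (\<exists>v y. v * v = 1 \<and> c * v = v * c \<and> b * v * b * v = v * (b * v * b) \<and>
        c * (v * (b * v * b)) * c = b * v * b \<and>
        c * y = y * c \<and> y * v = v * y \<and> b * y * b * y = 1 \<and> y ^ r = 1 \<and>
        a = v * y * twist b c q \<epsilon>)"

definition cube_type :: "'x perm \<Rightarrow> 'x perm \<Rightarrow> 'x perm \<Rightarrow> nat \<Rightarrow> nat \<Rightarrow> bool" where
  "cube_type a b c p q \<longleftrightarrow> (\<exists>r \<epsilon>. p = 4 * r \<and> cube_like a b c r q \<epsilon>)"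

lemma assoc_rule: "x * y = z \<Longrightarrow> x * (y * h) = z * (h :: 'g::monoid_mult)"
  by (simp flip: mult.assoc)

lemma mult_power_commuting: "x * y = y * (x :: 'g::monoid_mult) \<Longrightarrow> (x * y) ^ n = x ^ n * y ^ n"
proof (induction n)
  case (Suc n)
  have "x ^ n * y = y * x ^ n" by (rule power_commuting_commutes) (fact Suc.prems)
  then have "x * y * (x ^ n * y ^ n) = x * x ^ n * (y * y ^ n)" by (metis mult.assoc)
  then show ?case using Suc by simp
qed simp

text \<open>The relations of a cube-like triple as a rewrite system that moves \<open>b\<close> and \<open>c\<close> to the
  right, where \<open>u = b v b\<close> and \<open>y'\<close> is the inverse of \<open>y\<close>.\<close>

locale cube_relations =
  fixes b c v u y y' :: "'x perm"
  assumes bb: "b * b = 1" and cc: "c * c = 1" and vv: "v * v = 1" and uu: "u * u = 1"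
    and uv: "u * v = v * u" and bv: "b * v = u * b" and bu: "b * u = v * b"
    and cv: "c * v = v * c" and cu: "c * u = v * (u * c)"
    and cy: "c * y = y * c" and cy': "c * y' = y' * c" and yv: "y * v = v * y" and yu: "y * u = u * y"
    and y'v: "y' * v = v * y'" and y'u: "y' * u = u * y'"
    and b_y: "b * y = y' * b" and b_y': "b * y' = y * b" and yy': "y * y' = 1" and y'y: "y' * y = 1"
begin

lemmas rels = bb cc vv uu uv bv bu cv cu cy cy' yv yu y'v y'u b_y b_y' yy' y'y
lemmas rules = mult.assoc rels rels[THEN assoc_rule]

lemma t_v: "c * b * v = v * u * (c * b)" and t_u: "c * b * u = v * (c * b)"
  and t_y: "c * b * y = y' * (c * b)" and t_y': "c * b * y' = y * (c * b)"
  by (simp_all add: rules)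

lemma t3: "(c * b) ^ 3 * v = v * (c * b) ^ 3" "(c * b) ^ 3 * u = u * (c * b) ^ 3"
  by (simp_all add: rules eval_nat_numeral)

lemma t3_pow: "3 dvd n \<Longrightarrow> (c * b) ^ n * v = v * (c * b) ^ n" "3 dvd n \<Longrightarrow> (c * b) ^ n * u = u * (c * b) ^ n"
  by (auto elim!: dvdE simp: power_mult power_commute_elem[OF t3(1)] power_commute_elem[OF t3(2)])

lemma t2_y: "(c * b) ^ 2 * y = y * (c * b) ^ 2"
  by (simp add: rules eval_nat_numeral)

lemma t_odd_y: assumes "odd n" shows "(c * b) ^ n * y = y' * (c * b) ^ n"
proof -
  obtain k where k: "n = 2 * k + 1" using assms by (rule oddE)
  have "(c * b) ^ n = (c * b) * ((c * b) ^ 2) ^ k" by (simp add: k power_mult)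
  moreover have "((c * b) ^ 2) ^ k * y = y * ((c * b) ^ 2) ^ k" by (rule power_commute_elem[OF t2_y])
  ultimately have "(c * b) ^ n * y = (c * b * y) * ((c * b) ^ 2) ^ k" by (simp only: mult.assoc)
  then show ?thesis unfolding t_y using \<open>(c * b) ^ n = _\<close> by (simp only: mult.assoc)
qed

lemma b_pow: "(c * b) ^ n * b * (c * b) ^ n = b"
proof (induction n)
  case (Suc n)
  have "(c * b) ^ Suc n * b * (c * b) ^ Suc n = c * b * ((c * b) ^ n * b * (c * b) ^ n) * (c * b)"
    by (simp only: power_Suc power_Suc2[symmetric] mult.assoc)
  then show ?case unfolding Suc by (simp add: rules)
qed simp

end

text \<open>Conjugation by \<open>c * b\<close> moves \<open>v\<close> to \<open>v * u\<close>, this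
  to \<open>u\<close>, and \<open>u\<close> back to \<open>v\<close>. A power with exponent not
  divisible by 3 can centralise them only if they coincide, and then \<open>v = 1\<close>.\<close>

lemma (in cube_relations) three_dvd:
  assumes "(c * b) ^ n = 1" "v \<noteq> 1" shows "3 dvd n"
proof -
  define k where "k = n div 3"
  have com: "(c * b) ^ (3 * k) * v = v * (c * b) ^ (3 * k)" by (rule t3_pow) simp
  have "n = 3 * k \<or> n = 3 * k + 1 \<or> n = 3 * k + 2" unfolding k_def by presburger
  moreover have False if "n = 3 * k + 1"
  proof -
    have "(c * b) ^ n * v = c * b * v * (c * b) ^ (3 * k)" using com by (simp add: that mult.assoc)
    also have "\<dots> = v * u * (c * b) ^ n" unfolding t_v by (simp add: that mult.assoc)
    finally have "u = 1" using assms(1) by (simp add: mult.assoc) (metis mult.right_neutral perm_mult_left_cancel)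
    then show False using bu bb assms(2) by (metis mult.right_neutral perm_mult_right_cancel mult_1)
  qed
  moreover have False if "n = 3 * k + 2"
  proof -
    have "(c * b) ^ n * v = c * b * (c * b * v) * (c * b) ^ (3 * k)" using com by (simp add: that mult.assoc)
    also have "c * b * (c * b * v) = u * (c * b) * (c * b)" by (simp add: rules)
    finally have "(c * b) ^ n * v = u * (c * b) ^ n" by (simp add: that mult.assoc)
    then have "u = v" using assms(1) by simp
    then have "c * v = v * (v * c)" using cu by simp
    then have "v * c = c" using cv vv by (simp add: invol_cancel)
    then show False using assms(2) by (metis mult_1 perm_mult_right_cancel)
  qed
  ultimately show ?thesis by auto
qed

text \<open>For \<open>r > 1\<close> the twist \<open>w\<close> inverts \<open>y\<close>, so that \<open>a = v y w\<close> is an involution.\<close>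

locale cube_structure = cube_relations b c v u y y' for b c v u y y' :: "'x perm" +
  fixes r q :: nat and \<epsilon> :: bool
  assumes tq: "(c * b) ^ q = 1" and yr: "y ^ r = 1" and q3: "3 dvd q" and r_odd: "odd r"
    and q_even: "\<epsilon> \<Longrightarrow> even q" and r_cond: "r \<noteq> 1 \<Longrightarrow> \<epsilon> \<and> odd (q div 2)"
begin

abbreviation "w \<equiv> twist b c q \<epsilon>"
abbreviation "a \<equiv> v * y * w"
abbreviation "s \<equiv> a * b"

lemma w2: "w * w = 1" and wb: "w * b = b * w" and wc: "w * c = c * w" and wv: "w * v = v * w"
    and wu: "w * u = u * w" and wy: "w * y = y' * w"
  proof -
    have "w * w = 1 \<and> w * b * w = b \<and> w * v = v * w \<and> w * u = u * w"
    proof (cases \<epsilon>)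
      case True
      then have "3 dvd q div 2" and "q div 2 + q div 2 = q" using q3 q_even by presburger+
      then show ?thesis unfolding twist_def using True b_pow t3_pow tq by (simp flip: power_add)
    qed (simp add: twist_def)
    then show w2: "w * w = 1" and wv: "w * v = v * w" and wu: "w * u = u * w" and "w * b = b * w"
      by (auto, metis mult.assoc mult.right_neutral)
    show "w * y = y' * w"
    proof (cases "r = 1")
      case True
      then have "y = 1" using yr by simp
      then show ?thesis using y'y by simp
    next
      case False
      then show ?thesis using r_cond t_odd_y by (simp add: twist_def)
    qed
    have "w * (c * b) = (c * b) * w" by (simp add: twist_def power_commutes)
    then have "w * c * b * b = c * b * w * b" by (metis mult.assoc)
    also have "\<dots> = c * b * (b * w)" using \<open>w * b = b * w\<close> by (simp only: mult.assoc)
    finally show "w * c = c * w" by (simp add: rules)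
  qed
lemma wy': "w * y' = y * w"
  proof -
    have "y * (w * y) = w" unfolding wy by (simp add: rules)
    then have "y * (w * y) * y' = w * y'" by simp
    then show ?thesis by (simp add: rules)
  qed
lemmas twist_rels = w2 wb wc wv wu wy wy'
lemmas twist_rules = rules twist_rels twist_rels[THEN assoc_rule]

text \<open>Moving \<open>b\<close> across turns \<open>v * y\<close> into \<open>u * y'\<close>,
  the twist turns \<open>y'\<close> back into \<open>y\<close>, and the two twists cancel.\<close>

lemma s2: "s ^ 2 = v * u * (y * y)"
  by (simp add: twist_rules power2_eq_square)
lemma s4: "s ^ 4 = y * (y * (y * y))"
  proof -
    have "s ^ 4 = s ^ 2 * s ^ 2" by (simp flip: power_add)
    then show ?thesis unfolding s2 by (simp add: twist_rules)
  qed
lemma y4: "s ^ 4 = y ^ 4" unfolding s4 by (simp add: eval_nat_numeral mult.assoc)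
lemma s2r: "s ^ (2 * r) = v * u"
  proof -
    have com: "(v * u) * (y * y) = (y * y) * (v * u)" by (simp add: twist_rules)
    have "s ^ (2 * r) = (v * u * (y * y)) ^ r" by (simp only: power_mult s2)
    also have "\<dots> = (v * u) ^ r * (y * y) ^ r" using com by (rule mult_power_commuting)
    also have "(y * y) ^ r = 1" using mult_power_commuting[of y y r] yr by simp
    also have "(v * u) ^ r = v * u"
    proof -
      obtain k where "r = 2 * k + 1" using r_odd by (rule oddE)
      moreover have "(v * u) ^ 2 = 1" by (simp add: twist_rules power2_eq_square)
      ultimately show ?thesis by (simp add: power_mult)
    qed
    finally show ?thesis by simp
  qed
text \<open>\<open>s ^ 4\<close> equals \<open>y ^ 4\<close>, and 4 is invertible modulo the odd
  number \<open>r\<close>.\<close>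

lemma y_eq_pow_s: "\<exists>k. s ^ (4 * k) = y"
proof -
  obtain k i where k: "4 * k = r * i + 1"
  proof -
    have "r mod 4 = 1 \<or> r mod 4 = 3" using r_odd by presburger
    then show thesis
    proof
      assume "r mod 4 = 1"
      then have "4 * (3 * (r div 4) + 1) = r * 3 + 1" by presburger
      then show thesis by (rule that)
    next
      assume "r mod 4 = 3"
      then have "4 * (r div 4 + 1) = r * 1 + 1" by presburger
      then show thesis by (rule that)
    qed
  qed
  have "s ^ (4 * k) = y ^ (4 * k)" by (simp only: power_mult y4)
  also have "\<dots> = y" by (simp only: k power_add power_mult yr power_one mult_1 power_one_right)
  finally have "s ^ (4 * k) = y" .
  then show ?thesis ..
qed

text \<open>\<open>s ^ (2 * r)\<close> is \<open>v * u\<close> and its conjugate by \<open>c\<close>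
  is \<open>u\<close>, so their product is \<open>v\<close>. Expanded in the generators the
  right-hand side has an even number of letters, so the relation also witnesses
  non-orientability.\<close>

lemma a_word: "\<exists>k. a = s ^ (2 * r) * c * s ^ (2 * r) * c * s ^ (4 * k) * w"
proof -
  obtain k where "s ^ (4 * k) = y" using y_eq_pow_s by blast
  then have "a = s ^ (2 * r) * c * s ^ (2 * r) * c * s ^ (4 * k) * w"
    unfolding s2r by (simp add: twist_rules)
  then show ?thesis by blast
qed

lemma s4_c: "s ^ 4 * c = c * s ^ 4"
  unfolding s4 by (simp add: twist_rules)

end

section \<open>From the defining relations to the rewriting system\<close>

lemma cube_relationsI:
  assumes "b * b = 1" "c * c = 1" and v: "v * v = 1" "c * v = v * c" "b * v * b * v = v * (b * v * b)"
    "c * (v * (b * v * b)) * c = b * v * b" "c * y = y * c" "y * v = v * y" "b * y * b * y = 1"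
  shows "cube_relations b c v (b * v * b) y (inverse y)"
proof -
  define u where "u = b * v * b"
  define y' where "y' = inverse y"
  have bh: "b * (b * h) = h" and ch: "c * (c * h) = h" and vh: "v * (v * h) = h" for h
    using assms v(1) by (simp_all add: invol_cancel)
  have bv: "b * v = u * b" and bu: "b * u = v * b" and uu: "u * u = 1"
    by (simp_all add: u_def mult.assoc assms bh vh v(1))
  have "c * v * u * c = u" using v(4) by (simp add: u_def mult.assoc)
  then have "c * v * u = u * c" by (metis assms(2) mult.assoc mult.right_neutral)
  then have "v * (c * u) = u * c" using v(2) by (simp flip: mult.assoc)
  then have cu: "c * u = v * (u * c)" by (metis vh)
  have yby: "b * y * b = y'" unfolding y'_def using v(7) perm_inverse_unique[of "b * y * b" y] perm_inverse_inverse by metis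
  then have b_y: "b * y = y' * b" by (metis assms(1) mult.assoc mult.right_neutral)
  then have b_y': "b * y' = y * b" by (metis assms(1) bh mult.assoc mult.right_neutral)
  have comm: "y' * x = x * y'" if "y * x = x * y" for x
    using that unfolding y'_def by (metis mult.assoc perm_left_inverse perm_right_inverse mult.right_neutral mult_1)
  have "y * u = u * y"
  proof -
    have "y * u = y * b * v * b" by (simp add: u_def mult.assoc)
    also have "\<dots> = b * (y' * v) * b" by (simp add: mult.assoc flip: b_y')
    also have "\<dots> = b * v * (y' * b)" using comm[OF v(6)] by (simp add: mult.assoc)
    also have "\<dots> = u * y" by (simp add: u_def mult.assoc flip: b_y)
    finally show ?thesis .
  qed
  moreover from this have "y' * u = u * y'" by (rule comm)
  moreover have "c * y' = y' * c" using comm[of c] v(5) by simp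
  moreover have "y' * v = v * y'" using v(6) by (rule comm)
  moreover have "u * v = v * u" using v(3) unfolding u_def .
  moreover have "y * y' = 1" "y' * y = 1" by (simp_all add: y'_def)
  ultimately have "cube_relations b c v u y y'"
    using assms(1,2) v(1,2,5,6) bv bu uu cu b_y b_y' by (intro cube_relations.intro)
  then show ?thesis unfolding u_def y'_def .
qed

lemma cube_like_structure:
  assumes "b * b = 1" "c * c = 1" "cube_like a b c r q \<epsilon>" "(c * b) ^ q = 1"
  obtains v y where "cube_structure b c v (b * v * b) y (inverse y) r q \<epsilon>" "a = v * y * twist b c q \<epsilon>"
proof -
  obtain v y where v: "v * v = 1" "c * v = v * c" "b * v * b * v = v * (b * v * b)"
      "c * (v * (b * v * b)) * c = b * v * b" "c * y = y * c" "y * v = v * y" "b * y * b * y = 1"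
      "y ^ r = 1" "a = v * y * twist b c q \<epsilon>"
    using assms(3) unfolding cube_like_def by blast
  have "3 dvd q" "odd r" "\<epsilon> \<longrightarrow> even q" "r \<noteq> 1 \<longrightarrow> \<epsilon> \<and> odd (q div 2)"
    using assms(3) unfolding cube_like_def by blast+
  then have "cube_structure b c v (b * v * b) y (inverse y) r q \<epsilon>"
    using assms(4) v(8) by (intro cube_structure.intro cube_structure_axioms.intro cube_relationsI assms(1,2) v(1-7)) blast+
  then show thesis using that v(9) by blast
qed

text \<open>The existentially bound \<open>v\<close> and \<open>y\<close> are eliminated in favour
  of words in the generators, because relations between words can be lifted from a quotient along a
  homomorphism.\<close>

lemma cube_like_facts:
  assumes bb: "b * b = 1" and cc: "c * c = 1" and tq: "(c * b) ^ q = 1" and cube: "cube_like a b c r q \<epsilon>"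
  defines "w \<equiv> twist b c q \<epsilon>" and "s \<equiv> a * b"
  shows "w * w = 1" "w * b = b * w" "w * c = c * w"
    "s ^ 4 * c = c * s ^ 4"
    "\<exists>k. a = s ^ (2 * r) * c * s ^ (2 * r) * c * s ^ (4 * k) * w"
    "r = 1 \<Longrightarrow> w * s ^ 2 = s ^ 2 * w"
    "r = 1 \<Longrightarrow> b * (s ^ 2 * c * s ^ 2 * c) * b = c * s ^ 2 * c"
proof -
  obtain v y where cs: "cube_structure b c v (b * v * b) y (inverse y) r q \<epsilon>" and a_eq: "a = v * y * twist b c q \<epsilon>"
    using cube_like_structure[OF bb cc cube tq] by blast
  interpret S: cube_structure b c v "b * v * b" y "inverse y" r q \<epsilon> by (rule cs)
  show "w * w = 1" "w * b = b * w" "w * c = c * w" unfolding w_def by (fact S.w2 S.wb S.wc)+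
  show "s ^ 4 * c = c * s ^ 4" unfolding s_def a_eq by (rule S.s4_c)
  show "\<exists>k. a = s ^ (2 * r) * c * s ^ (2 * r) * c * s ^ (4 * k) * w"
    unfolding s_def w_def a_eq by (rule S.a_word)
  assume r1: "r = 1"
  have s2: "s ^ 2 = v * (b * v * b)" using S.s2r unfolding s_def a_eq r1 by simp
  show "w * s ^ 2 = s ^ 2 * w"
    unfolding s2 w_def using S.wv S.wu by (metis mult.assoc)
  show "b * (s ^ 2 * c * s ^ 2 * c) * b = c * s ^ 2 * c"
  proof -
    define u where "u = b * v * b"
    interpret U: cube_structure b c v u y "inverse y" r q \<epsilon> unfolding u_def by (rule cs)
    show ?thesis unfolding s2 u_def[symmetric] by (simp add: U.rules)
  qed
qed

section \<open>Classification of tight triples\<close>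

context tight_triple begin

lemma a_ne_1: "a \<noteq> 1"
  using a_notin_E E.dih_1 by auto

text \<open>For \<open>p = 4\<close> the elements \<open>a\<close> and \<open>u = b * a * b\<close>
  commute, and the exceptional relation is exactly the required action of \<open>c\<close>. So
  \<open>v = a\<close>, \<open>y = 1\<close>, and there is no twist.\<close>

lemma exceptional_cube_type:
  assumes "p = 2 * n" "c * s ^ n * c = s ^ n * a" shows "cube_type a b c p q"
proof -
  have p: "p = 4" using assms by (rule exceptional_p_eq_4)
  then have n: "n = 2" using assms(1) by simp
  define u where "u = b * a * b"
  have zz: "s ^ 2 * s ^ 2 = 1" using s_ord[of 4] p by (simp flip: power_add)
  have s2: "s ^ 2 = a * u" by (simp add: u_def power2_eq_square mult.assoc)
  have "u * a * (a * u) = 1" by (simp add: u_def mult.assoc bb)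
  moreover have "a * u * (a * u) = 1" using zz s2 by simp
  ultimately have ua: "u * a = a * u" by (metis perm_mult_right_cancel)
  have "c * (a * u) * c = a * u * a" using assms(2) n s2 by simp
  then have cau: "c * (a * u) * c = u" using ua by (simp add: mult.assoc)
  then have "c * (c * (a * u) * c) = c * u" by simp
  then have cu: "c * u = a * (u * c)" by (simp add: mult.assoc)
  interpret cube_relations b c a u 1 1
    by (intro cube_relations.intro) (simp_all add: u_def mult.assoc aa bb cc ca cu[unfolded u_def mult.assoc] ua[unfolded u_def mult.assoc])
  have "3 dvd q" using three_dvd t_ord[of q] a_ne_1 by simp
  then have "cube_like a b c 1 q False"
    unfolding cube_like_def twist_def using aa ca ua cau
    by (intro conjI exI[of _ a] exI[of _ 1]) (simp_all add: u_def bb)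
  then show ?thesis unfolding cube_type_def using p by auto
qed

text \<open>\<open>b\<close> inverts the powers of \<open>t ^ m\<close>, and \<open>a\<close> raises
  them to a fixed exponent whose square acts trivially. The two actions commute and have order at
  most 2, so \<open>s ^ 2\<close> acts trivially, and so do the conjugates of its powers by
  \<open>c\<close>.\<close>

lemma normal_power_commute:
  assumes conj: "a * t ^ m * a = t ^ (m * i)"
  shows "s ^ 2 * t ^ (m * l) = t ^ (m * l) * s ^ 2"
    and "c * s ^ (2 * k) * c * t ^ (m * l) = t ^ (m * l) * (c * s ^ (2 * k) * c)"
proof -
  define X where "X = t ^ m"
  define X' where "X' = inverse X"
  define Z where "Z = X ^ i"
  define Z' where "Z' = inverse Z"
  have aXa: "a * X * a = Z" using conj by (simp add: X_def Z_def power_mult)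
  then have aZa: "a * Z * a = X" by (metis D.x_x aa mult.assoc mult.right_neutral)
  have aX: "a * X = Z * a" "a * Z = X * a" using aXa aZa by (metis D.x_x aa mult.assoc mult.right_neutral)+
  have "a * X' * a = Z'" "a * Z' * a = X'"
    unfolding X'_def Z'_def using aXa aZa perm_inverse_mult D.inv_x by (metis mult.assoc)+
  then have aX': "a * X' = Z' * a" "a * Z' = X' * a" by (metis D.x_x aa mult.assoc mult.right_neutral)+
  have bX: "b * X = X' * b" "c * X = X' * c" unfolding X'_def X_def by (rule E.y_pow, rule E.x_pow)
  then have bX': "b * X' = X * b" "c * X' = X * c"
    by (metis D.y_y bb mult.assoc mult.right_neutral, metis E.x_x cc mult.assoc mult.right_neutral)
  have Zt: "Z = t ^ (m * i)" by (simp add: Z_def X_def power_mult)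
  have bZ: "b * Z = Z' * b" unfolding Z'_def Zt by (rule E.y_pow)
  then have bZ': "b * Z' = Z * b" by (metis D.y_y bb mult.assoc mult.right_neutral)
  note r = aX aX' bX bX' bZ bZ'
  have sX: "s ^ 2 * X = X * s ^ 2" and sX': "s ^ 2 * X' = X' * s ^ 2"
    by (simp_all add: power2_eq_square mult.assoc r r[THEN assoc_rule])
  have "(s ^ 2) ^ k * X' = X' * (s ^ 2) ^ k" by (rule power_commute_elem) (rule sX')
  then have k: "s ^ (2 * k) * X' = X' * s ^ (2 * k)" by (simp add: power_mult)
  have czc: "c * s ^ (2 * k) * c * X = X * (c * s ^ (2 * k) * c)"
  proof -
    have "c * s ^ (2 * k) * c * X = c * (s ^ (2 * k) * X') * c" by (simp add: mult.assoc bX(2))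
    also have "\<dots> = c * X' * s ^ (2 * k) * c" unfolding k by (simp add: mult.assoc)
    finally show ?thesis unfolding bX'(2) by (simp add: mult.assoc)
  qed
  have "g * X ^ l = X ^ l * g" if "g * X = X * g" for g
    using power_commute_elem[of X g l] that by simp
  then show "s ^ 2 * t ^ (m * l) = t ^ (m * l) * s ^ 2"
    "c * s ^ (2 * k) * c * t ^ (m * l) = t ^ (m * l) * (c * s ^ (2 * k) * c)"
    using sX czc by (simp_all add: X_def power_mult)
qed

text \<open>The relation that expresses \<open>a\<close> by \<open>s\<close> and \<open>c\<close> in
  the quotient lifts with an error factor, a power of \<open>t ^ m\<close>. This factor commutes
  with the rest of the word, and comparing squares shows that it is an involution; hence it is 1 or
  \<open>t ^ (q div 2)\<close>, which is a twist.\<close>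

lemma cube_like_of_hemicube_quotient:
  assumes p: "p = 4" and m: "3 dvd m" "m dvd q" and conj: "a * t ^ m * a = t ^ (m * i)"
    and word: "a = s ^ 2 * c * s ^ 2 * c * t ^ (m * j)"
  shows "\<exists>\<epsilon>. cube_like a b c 1 q \<epsilon>"
proof -
  define w where "w = t ^ (m * j)"
  define z where "z = s ^ 2"
  define k where "k = c * z * c"
  have zz: "z * z = 1" using s_ord[of 4] p by (simp add: z_def flip: power_add)
  have kk: "k * k = 1" by (simp add: k_def mult.assoc zz invol_cancel cc)
  have zw: "z * w = w * z" unfolding z_def w_def by (rule normal_power_commute(1)[OF conj])
  have kw: "k * w = w * k" using normal_power_commute(2)[OF conj, of 1 j] by (simp add: k_def z_def w_def)
  have az: "a * z = z * a"
    using D.x_pow[of 2] perm_inverse_unique[OF zz] by (simp add: z_def)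
  have a_eq: "a = z * k * w" using word by (simp add: z_def k_def w_def mult.assoc)
  have aw: "a * w = w * a" unfolding a_eq
    by (simp add: mult.assoc zw[symmetric] kw[symmetric] zw[symmetric, THEN assoc_rule] kw[symmetric, THEN assoc_rule])
  have zaw: "z * a = k * w" unfolding a_eq by (simp add: mult.assoc invol_cancel zz)
  have "w * w = (k * w) * (k * w)" using kw kk by (simp add: mult.assoc) (metis kk kw mult.assoc mult_1)
  also have "\<dots> = z * a * (z * a)" by (simp only: zaw)
  also have "\<dots> = 1" using az by (simp add: mult.assoc zz aa invol_cancel) (metis D.x_x zz mult.assoc)
  finally have ww: "w * w = 1" .
  have inv_w: "inverse w = w" using ww by (rule perm_inverse_unique)
  have bw: "b * w = w * b" and cw: "c * w = w * c"
    using E.y_pow[of "m * j"] E.x_pow[of "m * j"] inv_w by (simp_all add: w_def)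
  have "t ^ (m * j + m * j) = 1" using ww by (simp add: w_def power_add)
  then have "q dvd 2 * (m * j)" using t_ord by (simp add: mult_2)
  then obtain l where l: "2 * (m * j) = q * l" by (rule dvdE)
  have "\<exists>\<epsilon>. w = twist b c q \<epsilon> \<and> (\<epsilon> \<longrightarrow> even q)"
  proof (cases "even l")
    case True
    then have "m * j = q * (l div 2)" using l by auto
    then have "w = 1" unfolding w_def using t_ord by simp
    then show ?thesis by (auto simp: twist_def)
  next
    case False
    then have q: "even q" using l by (metis dvd_triv_left even_mult_iff)
    obtain l' where l': "l = 2 * l' + 1" using False by (rule oddE)
    obtain q' where q': "q = 2 * q'" using q by (rule evenE)
    have "m * j = q * l' + q'" using l unfolding l' q' by (simp add: algebra_simps)
    then have "w = t ^ q'" by (simp add: w_def power_add power_mult)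
    then show ?thesis using q q' by (auto simp: twist_def)
  qed
  then obtain \<epsilon> where \<epsilon>: "w = twist b c q \<epsilon>" "\<epsilon> \<Longrightarrow> even q" by blast
  define v where "v = a * w"
  have awh: "a * (w * h) = w * (a * h)" and bwh: "b * (w * h) = w * (b * h)"
    and cwh: "c * (w * h) = w * (c * h)" and wwh: "w * (w * h) = h" for h
    using aw bw cw ww by (metis mult.assoc mult_1)+
  have z1: "z = a * (b * (a * b))" by (simp add: z_def power2_eq_square mult.assoc)
  have "inverse z = b * (a * (b * a))" unfolding z1 by (rule perm_inverse_unique) (simp add: mult.assoc aa)
  then have z2: "b * (a * (b * a)) = a * (b * (a * b))" using perm_inverse_unique[OF zz] z1 by simp
  note r = mult.assoc aa bb cc ww aw bw cw awh bwh cwh wwh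
  have k_eq: "k = b * v * b"
  proof -
    have "k = z * a * w" using zaw by (simp add: mult.assoc ww)
    also have "\<dots> = b * (a * (b * a)) * a * w" using z1 z2 by simp
    finally show ?thesis by (simp add: v_def r)
  qed
  have "v * (b * v * b) = z" unfolding z1 by (simp add: v_def r)
  moreover have "b * v * b * v = z" unfolding z1 z2[symmetric] by (simp add: v_def r)
  ultimately have "b * v * b * v = v * (b * v * b)" "c * (v * (b * v * b)) * c = b * v * b"
    using k_eq by (simp_all add: k_def)
  moreover have "v * v = 1" "c * v = v * c" "a = v * 1 * twist b c q \<epsilon>"
    unfolding \<epsilon>(1)[symmetric] by (simp_all add: v_def r ca cax)
  moreover have "3 dvd q" using m by (rule dvd_trans)
  ultimately have "cube_like a b c 1 q \<epsilon>"
    unfolding cube_like_def using \<epsilon>(2) by (intro conjI exI[of _ v] exI[of _ 1]) (simp_all add: bb)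
  then show ?thesis by blast
qed

text \<open>Let \<open>X\<close> be the error in commuting \<open>c\<close> with
  \<open>Y = s ^ 4\<close>. By \<open>word\<close> it commutes with \<open>a\<close>. As
  \<open>a\<close> inverts \<open>Y\<close> and commutes with \<open>c\<close>, conjugating
  \<open>c * Y * c = Y * X\<close> by \<open>a\<close> yields \<open>X * X = 1\<close>. Since
  \<open>Y ^ r = 1\<close>, also \<open>X ^ r = 1\<close>, and \<open>r\<close> is odd.\<close>

lemma power4_commute_of_quotient:
  assumes p: "p = 4 * r" and r: "odd r" and conj: "a * t ^ m * a = t ^ (m * i)"
    and word: "a = s ^ (2 * r) * c * s ^ (2 * r) * c * s ^ (4 * k) * t ^ n"
    and s4: "s ^ 4 * c = c * s ^ 4 * t ^ (m * j)"
  shows "c * s ^ 4 * c = s ^ 4"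
proof -
  define X where "X = t ^ (m * j)"
  have sX: "s ^ (2 * h) * X = X * s ^ (2 * h)" for h
    using power_commute_elem[of "s ^ 2" X h] normal_power_commute(1)[OF conj, of j]
    by (simp add: X_def power_mult)
  have czX: "c * s ^ (2 * r) * c * X = X * (c * s ^ (2 * r) * c)"
    unfolding X_def by (rule normal_power_commute(2)[OF conj])
  have tX: "t ^ n * X = X * t ^ n" by (simp add: X_def add.commute flip: power_add)
  have s4k: "s ^ (4 * k) * X = X * s ^ (4 * k)" using sX[of "2 * k"] by simp
  define k1 where "k1 = c * s ^ (2 * r) * c"
  have "a = s ^ (2 * r) * k1 * s ^ (4 * k) * t ^ n"
    using word by (simp add: k1_def mult.assoc)
  then have "a * X = s ^ (2 * r) * k1 * s ^ (4 * k) * (t ^ n * X)" by (metis mult.assoc)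
  also have "\<dots> = s ^ (2 * r) * k1 * (s ^ (4 * k) * X) * t ^ n" unfolding tX by (simp only: mult.assoc)
  also have "\<dots> = s ^ (2 * r) * (k1 * X) * s ^ (4 * k) * t ^ n" unfolding s4k by (simp only: mult.assoc)
  also have "\<dots> = (s ^ (2 * r) * X) * k1 * s ^ (4 * k) * t ^ n"
    unfolding czX[folded k1_def] by (simp only: mult.assoc)
  also have "\<dots> = X * (s ^ (2 * r) * k1 * s ^ (4 * k) * t ^ n)" unfolding sX by (simp only: mult.assoc)
  finally have aX: "a * X = X * a" using \<open>a = s ^ (2 * r) * k1 * s ^ (4 * k) * t ^ n\<close> by simp
  define Y where "Y = s ^ 4"
  define Y' where "Y' = inverse Y"
  have YX: "Y * X = X * Y" using sX[of 2] by (simp add: Y_def)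
  have cYc: "c * Y * c = Y * X"
  proof -
    have "c * (Y * c) = c * (c * Y * X)" using s4 by (simp add: X_def Y_def)
    then show ?thesis by (simp add: mult.assoc)
  qed
  have aY: "a * Y * a = Y'"
    using D.x_pow[of 4] by (simp add: Y_def Y'_def mult.assoc aa)
  have "a * (c * Y * c) * a = c * (a * Y * a) * c" by (simp add: mult.assoc cax ca)
  also have "\<dots> = inverse (c * Y * c)"
    unfolding aY Y'_def by (simp only: perm_inverse_mult E.inv_x mult.assoc)
  finally have "a * (Y * X) * a = inverse (Y * X)" unfolding cYc .
  moreover have "a * (Y * X) * a = a * Y * a * (a * X * a)" by (simp add: mult.assoc)
  moreover have "a * X * a = X" unfolding aX by (simp add: mult.assoc aa)
  moreover have "inverse (Y * X) = Y' * inverse X"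
    unfolding YX perm_inverse_mult Y'_def ..
  ultimately have "Y' * X = Y' * inverse X" unfolding aY by metis
  then have XX: "X * X = 1" by (metis perm_mult_left_cancel perm_right_inverse)
  have "X ^ r = X"
  proof -
    obtain l where "r = 2 * l + 1" using r by (rule oddE)
    then show ?thesis using XX by (simp add: power_mult power2_eq_square)
  qed
  moreover have "Y ^ r = 1" using s_ord[of "4 * r"] p by (simp add: Y_def power_mult)
  then have "(c * Y * c) ^ r = 1" by (simp add: invol_conj_power cc)
  then have "Y ^ r * X ^ r = 1" unfolding cYc using mult_power_commuting[OF YX] by simp
  ultimately have "X = 1" using \<open>Y ^ r = 1\<close> by simp
  then show ?thesis using cYc by (simp add: Y_def)
qed

lemma twist_G: "twist b c q \<epsilon> \<in> G"
  by (simp add: twist_def G_intros)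

text \<open>Here \<open>y = s ^ 4\<close> is a central involution, and the hypotheses are the
  relations for \<open>p = 4\<close> up to powers of \<open>y\<close>. A suitable lift
  \<open>d\<close> of a generator of the Klein four-group is an involution, but its conjugate
  \<open>d2\<close> has square \<open>y\<close>.\<close>

lemma no_even_cover:
  assumes p: "p = 8" and w: "w = twist b c q \<epsilon>" "\<epsilon> \<Longrightarrow> even q"
    and word: "a = s ^ 2 * c * s ^ 2 * c * w * s ^ (4 * i)"
    and ws: "w * s ^ 2 = s ^ 2 * w * s ^ (4 * f)"
    and cs: "c * s ^ 4 * c = s ^ (4 * j)"
  shows False
proof -
  define y where "y = s ^ 4"
  define x where "x = s ^ 2"
  \<comment> \<open>The exponent is chosen so that \<open>d\<close> below picks up exactly one
    factor \<open>y\<close>. As \<open>y * x\<close> is the inverse of \<open>x\<close>, this makes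
    \<open>d\<close> a commutator of \<open>x\<close> and \<open>c\<close>, so that \<open>c\<close>
    conjugates \<open>d\<close> to its inverse.\<close>
  define e where "e = y ^ (i + 1)"
  define g where "g = y ^ f"
  have yy: "y * y = 1" and y1: "y \<noteq> 1"
    using s_ord[of 8] s_ord[of 4] p by (simp_all add: y_def flip: power_add)
  have xx: "x * x = y" by (simp add: x_def y_def flip: power_add)
  have y_pow: "y ^ n = (if even n then 1 else y)" for n
    by (induction n) (auto simp: yy)
  have cy: "c * y = y * c"
  proof -
    have "c * y * c = y ^ j" using cs by (simp add: y_def power_mult)
    moreover have "c * y * c \<noteq> 1" using y1 by (metis E.x_x cc mult.assoc mult.right_neutral)
    ultimately have "c * y * c = y" using y_pow by metis
    then show ?thesis by (metis cc mult.assoc mult.right_neutral)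
  qed
  have ay: "a * y = y * a" and b_y: "b * y = y * b"
    using D.x_pow[of 4] D.y_pow[of 4] perm_inverse_unique[OF yy] by (simp_all add: y_def)
  have yx: "y * x = x * y" by (simp add: y_def x_def flip: power_add)
  have wc: "w * c = c * w" and wb: "w * b = b * w" and ww: "w * w = 1" and wy: "w * y = y * w"
  proof -
    have ty: "t * y = y * t" using cy b_y by (metis mult.assoc)
    have "w * y = y * w \<and> w * w = 1 \<and> c * w = inverse w * c \<and> b * w = inverse w * b"
    proof (cases \<epsilon>)
      case True
      then have "q div 2 + q div 2 = q" using w(2) by auto
      then show ?thesis unfolding w twist_def
        using True t_ord[of q] E.x_pow[of "q div 2"] E.y_pow[of "q div 2"] power_commute_elem[OF ty]
        by (simp flip: power_add)
    qed (simp add: w twist_def)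
    moreover from this have "inverse w = w" by (intro perm_inverse_unique) blast
    ultimately show "w * c = c * w" "w * b = b * w" "w * w = 1" "w * y = y * w" by simp_all
  qed
  have "s ^ (4 * n) = y ^ n" for n by (simp add: y_def power_mult)
  then have word': "a = x * c * x * c * w * y ^ i" and ws': "w * x = x * w * g"
    using word ws by (simp_all add: x_def g_def)
  have com: "h * y ^ n = y ^ n * h" if "h * y = y * h" for h n
    using power_commute_elem[of y h n] that by simp
  have ee: "e * e = 1" and gg: "g * g = 1" by (auto simp: e_def g_def y_pow yy)
  have ce: "c * e = e * c" "b * e = e * b" "a * e = e * a" "w * e = e * w" "x * e = e * x"
    and cg: "c * g = g * c" "b * g = g * b" "a * g = g * a" "w * g = g * w" "x * g = g * x"
    using com cy b_y ay wy yx unfolding e_def g_def by metis+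
  define d where "d = a * w * e"
  have yi: "y ^ i * e = y" unfolding e_def by (simp add: y_pow yy)
  have x_inv: "x * (y * x) = 1" using xx yx yy by (metis mult.assoc)
  have d_eq: "d = y * (x * (c * (x * c)))"
  proof -
    have "d = x * (c * (x * (c * (w * (y ^ i * (w * e))))))" by (simp add: d_def word' mult.assoc)
    also have "w * e = e * w" by (fact ce)
    also have "y ^ i * (e * w) = y * w" using yi by (simp flip: mult.assoc)
    also have "w * (y * w) = y" using wy ww by (metis mult.assoc mult.right_neutral)
    also have "c * y = y * c" by (fact cy)
    finally show ?thesis using yx cy by (metis mult.assoc)
  qed
  have cd: "c * d = d * c" unfolding d_def
    by (simp add: mult.assoc ca wc[symmetric] ce(1) ca[THEN assoc_rule] wc[symmetric, THEN assoc_rule] ce(1)[THEN assoc_rule])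
  have "d * (c * d * c) = 1"
  proof -
    have "c * d * c = y * (c * (x * (c * x)))" unfolding d_eq by (simp add: mult.assoc cy cy[THEN assoc_rule] cc)
    then have "d * (c * d * c) = y * (x * (c * (x * (c * (y * (c * (x * (c * x))))))))"
      by (simp add: d_eq mult.assoc)
    also have "\<dots> = 1"
      by (simp add: mult.assoc cy cy[THEN assoc_rule] yx[symmetric] yx[symmetric, THEN assoc_rule]
          yy yy[THEN assoc_rule] xx xx[THEN assoc_rule] cc)
    finally show ?thesis .
  qed
  moreover have "c * d * c = d" unfolding cd by (simp add: mult.assoc cc)
  ultimately have dd: "d * d = 1" by simp
  have bdb: "b * d * b = d * x * g"
  proof -
    have "b * a * b = a * x" by (simp add: x_def power2_eq_square mult.assoc)
    have "b * d * b = b * a * (w * (e * b))" by (simp only: d_def mult.assoc)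
    also have "\<dots> = b * a * (w * b) * e" unfolding ce(2)[symmetric] by (simp only: mult.assoc)
    also have "\<dots> = b * a * b * w * e" unfolding wb by (simp only: mult.assoc)
    also have "\<dots> = a * (x * w) * e" unfolding \<open>b * a * b = a * x\<close> by (simp only: mult.assoc)
    also have "x * w = w * x * g" using ws' gg by (simp add: mult.assoc)
    also have "a * (w * x * g) * e = a * w * x * (g * e)" by (simp only: mult.assoc)
    also have "g * e = e * g" unfolding g_def e_def power_add[symmetric] by (simp only: ac_simps)
    also have "a * w * x * (e * g) = a * w * (x * e) * g" by (simp only: mult.assoc)
    also have "\<dots> = d * x * g" unfolding ce(5) d_def by (simp only: mult.assoc)
    finally show ?thesis .
  qed
  have cxc: "c * x * c = x * d"
  proof -
    have "x * d = (x * (y * x)) * (c * (x * c))" unfolding d_eq by (simp only: mult.assoc)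
    then show ?thesis using x_inv by (simp add: mult.assoc)
  qed
  define d2 where "d2 = c * (b * d * b) * c"
  have "d2 * d2 = 1" unfolding d2_def by (simp add: mult.assoc invol_cancel bb cc dd)
  have d2_eq: "d2 = d * (x * d) * g"
  proof -
    have "d2 = c * d * x * (g * c)" unfolding d2_def bdb by (simp only: mult.assoc)
    also have "\<dots> = d * (c * x * c) * g" unfolding cd cg(1)[symmetric] by (simp only: mult.assoc)
    finally show ?thesis unfolding cxc .
  qed
  have dg: "d * g = g * d" and dy: "d * y = y * d"
  proof -
    have "e * g = g * e" unfolding g_def e_def power_add[symmetric] by (simp only: ac_simps)
    moreover have "e * y = y * e" unfolding e_def by (rule power_commutes)
    ultimately show "d * g = g * d" "d * y = y * d"
      unfolding d_def
      by (simp_all add: mult.assoc cg(3,4) ay wy cg(3,4)[THEN assoc_rule] ay[THEN assoc_rule] wy[THEN assoc_rule])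
  qed
  have "d2 * d2 = d * (x * (d * d) * x) * d * (g * g)"
    unfolding d2_eq
    by (simp add: mult.assoc dg[symmetric] dg[symmetric, THEN assoc_rule] cg(5)[symmetric] cg(5)[symmetric, THEN assoc_rule])
  also have "\<dots> = d * y * d" by (simp add: dd gg xx)
  also have "\<dots> = y" using dy dd by (metis mult.assoc mult.right_neutral)
  finally show False using \<open>d2 * d2 = 1\<close> y1 by simp
qed

text \<open>The hypotheses are the relations for \<open>p = 4\<close>, up to powers of
  \<open>y = s ^ 4\<close>. As \<open>m\<close> is odd, \<open>s ^ 2\<close> is the involution
  \<open>z = s ^ (2 * m)\<close> times a power of \<open>y\<close>, and all errors collect into
  \<open>a = v * y ^ n * w\<close>. Since \<open>a\<close> inverts \<open>y\<close> and
  \<open>v\<close> centralises it, \<open>w\<close> inverts \<open>y\<close>; this forces the twist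
  and an odd \<open>q div 2\<close>.\<close>

lemma cube_like_of_odd_cover:
  assumes p: "p = 4 * m" and m: "odd m" "m > 1" and q3: "3 dvd q"
    and w: "w = twist b c q \<epsilon>" "\<epsilon> \<Longrightarrow> even q"
    and word: "a = s ^ 2 * c * s ^ 2 * c * w * s ^ (4 * i)"
    and cs: "c * s ^ 4 * c = s ^ (4 * j)"
    and bv: "b * (s ^ 2 * c * s ^ 2 * c) * b = c * s ^ 2 * c * s ^ (4 * g)"
  shows "cube_like a b c m q True"
proof -
  define y where "y = s ^ 4"
  define z where "z = s ^ (2 * m)"
  define k where "k = c * z * c"
  define v where "v = z * k"
  have yn: "s ^ (4 * n) = y ^ n" for n by (simp add: y_def power_mult)
  have y_one: "y ^ n = 1 \<longleftrightarrow> m dvd n" for n unfolding yn[symmetric] s_ord p by simp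
  have zz: "z * z = 1" using s_ord[of "2 * m + 2 * m"] p by (simp add: z_def flip: power_add)
  have inv_z: "inverse z = z" using zz by (rule perm_inverse_unique)
  have az: "a * z = z * a" and bz: "b * z = z * b"
    using D.x_pow[of "2 * m"] D.y_pow[of "2 * m"] inv_z by (simp_all add: z_def)
  have kk: "k * k = 1" by (simp add: k_def mult.assoc zz invol_cancel cc)
  have ak: "a * k = k * a"
    unfolding k_def using az by (simp add: mult.assoc ca cax[symmetric]) (metis az ca mult.assoc)
  have s2: "s ^ 2 = z * y ^ ((1 + m) div 2)"
  proof -
    \<comment> \<open>The division is exact because \<open>m\<close> is odd, and
      \<open>s ^ p\<close> is trivial.\<close>
    have "2 * m + 4 * ((1 + m) div 2) = p + 2" using m p by presburger
    then have "s ^ (2 * m) * s ^ (4 * ((1 + m) div 2)) = s ^ p * s ^ 2" by (simp only: power_add[symmetric])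
    then show ?thesis unfolding D.pow_n yn z_def by simp
  qed
  define e where "e = (1 + m) div 2"
  have zy: "z * y ^ n = y ^ n * z" for n
    unfolding z_def yn[symmetric] by (simp add: add.commute flip: power_add)
  have cyc: "c * y ^ n * c = y ^ (j * n)" for n
    using cs unfolding yn[of j] y_def[symmetric] by (simp add: invol_conj_power[OF cc, symmetric] power_mult)
  then have cy: "c * y ^ n = y ^ (j * n) * c" for n by (metis cc mult.assoc mult.right_neutral)
  have cjy: "c * y ^ (j * n) = y ^ n * c" for n
    using cyc[of n] by (metis E.x_x mult.assoc)
  have ky: "k * y ^ n = y ^ n * k" for n
  proof -
    have "k * y ^ n = c * z * (c * y ^ n)" by (simp only: k_def mult.assoc)
    also have "\<dots> = c * (z * y ^ (j * n)) * c" unfolding cy by (simp only: mult.assoc)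
    also have "\<dots> = c * y ^ (j * n) * (z * c)" unfolding zy by (simp only: mult.assoc)
    also have "\<dots> = y ^ n * k" unfolding cjy k_def by (simp only: mult.assoc)
    finally show ?thesis .
  qed
  have vy: "v * y ^ n = y ^ n * v" for n
    unfolding v_def using zy ky by (metis mult.assoc)
  have b_y: "b * y ^ n = inverse (y ^ n) * b" and a_y: "a * y ^ n = inverse (y ^ n) * a" for n
    unfolding yn[symmetric] by (rule D.y_pow, rule D.x_pow)
  have yp: "\<exists>n'. inverse (y ^ n) = y ^ n'" for n
    by (intro exI[of _ "(p - 1) * n"]) (simp add: D.inverse_pow mult.left_commute flip: yn)
  have wy: "\<exists>n'. w * y ^ n = y ^ n' * w" for n
  proof -
    have *: "\<exists>n'. t ^ l * y ^ n = y ^ n' * t ^ l" for l n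
    proof (induction l arbitrary: n)
      case (Suc l)
      obtain n1 where n1: "t ^ l * y ^ n = y ^ n1 * t ^ l" using Suc by blast
      obtain n2 where n2: "inverse (y ^ n1) = y ^ n2" using yp by blast
      have "t ^ Suc l * y ^ n = c * (b * y ^ n1) * t ^ l" using n1 by (simp add: mult.assoc)
      also have "\<dots> = c * y ^ n2 * b * t ^ l" unfolding b_y n2 by (simp only: mult.assoc)
      also have "\<dots> = y ^ (j * n2) * t ^ Suc l" unfolding cy by (simp add: mult.assoc)
      finally show ?case by blast
    qed auto
    show ?thesis unfolding w twist_def using *[of "q div 2"] by auto
  qed
  obtain n1 where "a = z * y ^ e * (c * z * y ^ e * c) * (w * y ^ i)" "w * y ^ i = y ^ n1 * w"
    using word wy[of i] unfolding s2 yn e_def by (auto simp: mult.assoc)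
  then have "a = z * y ^ e * (c * z * y ^ e * (c * y ^ n1)) * w" by (simp only: mult.assoc)
  also have "\<dots> = z * y ^ e * (c * z * (y ^ e * y ^ (j * n1)) * c) * w" unfolding cy by (simp only: mult.assoc)
  also have "\<dots> = z * y ^ e * (c * z * y ^ (e + j * n1) * c) * w" by (simp only: power_add)
  also have "c * z * y ^ (e + j * n1) * c = y ^ (j * (e + j * n1)) * k"
  proof -
    have "c * z * y ^ (e + j * n1) * c = c * y ^ (e + j * n1) * z * c"
      by (simp only: mult.assoc zy[THEN assoc_rule])
    then show ?thesis unfolding cy by (simp only: mult.assoc k_def)
  qed
  also have "z * y ^ e * (y ^ (j * (e + j * n1)) * k) * w = v * y ^ (e + j * (e + j * n1)) * w"
    unfolding v_def power_add using ky by (metis mult.assoc)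
  finally obtain n where a_eq: "a = v * y ^ n * w" by blast
  define x where "x = y ^ n"
  have vx: "v * x = x * v" unfolding x_def by (rule vy)
  have ww_inv: "w * y = inverse y * w"
  proof -
    have "a = v * x * w" unfolding x_def by (rule a_eq)
    then have a_x: "a = x * v * w" unfolding vx .
    have "x * v * (w * y) = a * y" by (simp only: a_x mult.assoc)
    also have "\<dots> = inverse y * a" using a_y[of 1] by simp
    also have "\<dots> = inverse y * x * v * w" by (simp only: a_x mult.assoc)
    also have "inverse y * x = x * inverse y"
      unfolding x_def by (metis perm_left_inverse perm_right_inverse mult.assoc mult_1 mult.right_neutral power_commutes)
    also have "x * inverse y * v * w = x * v * (inverse y * w)"
    proof -
      have "inverse y * v = v * inverse y"
        using vy[of 1] by simp (metis perm_left_inverse perm_right_inverse mult.assoc mult_1 mult.right_neutral)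
      then show ?thesis by (metis mult.assoc)
    qed
    finally show ?thesis by (simp only: mult.assoc perm_mult_left_cancel)
  qed
  have y_ne: "inverse y \<noteq> y"
  proof
    assume "inverse y = y"
    then have "y ^ 2 = 1" by (metis perm_left_inverse power2_eq_square)
    then have "m dvd 2" using y_one by simp
    then have "m = 2" using m(2) by (auto dest: dvd_imp_le)
    then show False using m(1) by simp
  qed
  have \<epsilon>: "\<epsilon>"
  proof (rule ccontr)
    assume "\<not> \<epsilon>"
    then have "w = 1" by (simp add: w twist_def)
    then show False using ww_inv y_ne by simp
  qed
  then have wt: "w = t ^ (q div 2)" by (simp add: w twist_def)
  \<comment> \<open>\<open>c\<close> raises \<open>y\<close> to the power \<open>j\<close> and
    \<open>b\<close> inverts it; both are involutions and these actions commute, so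
    \<open>t ^ 2\<close> acts trivially.\<close>
  have t2y: "t ^ 2 * y = y * t ^ 2"
  proof -
    obtain n' where n': "inverse y = y ^ n'" using yp[of 1] by auto
    have yn'': "inverse (y ^ n) * y ^ n = 1" for n by simp
    have by1: "b * y = y ^ n' * b" using b_y[of 1] n' by simp
    have "t ^ 2 * y = c * b * (c * (b * y))" by (simp add: power2_eq_square mult.assoc)
    also have "\<dots> = c * b * (c * y ^ n') * b" unfolding by1 by (simp only: mult.assoc)
    also have "\<dots> = c * (b * y ^ (j * n')) * (c * b)" unfolding cy by (simp only: mult.assoc)
    also have "y ^ (j * n') = inverse (y ^ j)"
      using n' by (metis mult.commute perm_power_inverse power_mult)
    also have "b * inverse (y ^ j) = y ^ j * b" using b_y[of j] by (metis D.y_y bb mult.assoc mult.right_neutral)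
    also have "c * (y ^ j * b) * (c * b) = y ^ 1 * c * b * (c * b)"
      using cjy[of 1] by (simp add: mult.assoc[symmetric])
    finally show ?thesis by (simp add: power2_eq_square mult.assoc)
  qed
  have odd: "odd (q div 2)"
  proof
    assume "even (q div 2)"
    then obtain l where "q div 2 = 2 * l" by (rule evenE)
    then have "w * y = y * w" using power_commute_elem[OF t2y, of l] wt by (simp add: power_mult)
    then show False using ww_inv y_ne by simp
  qed
  \<comment> \<open>With \<open>q div 2\<close> odd, \<open>t\<close> acts on \<open>y\<close> in
    the same way as \<open>w\<close>, by inversion. As \<open>b\<close> inverts \<open>y\<close>
    too, \<open>c\<close> centralises it.\<close>
  have cy1: "c * y = y * c"
  proof -
    obtain l where "q div 2 = 2 * l + 1" using odd by (rule oddE)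
    then have wl: "w = t * (t ^ 2) ^ l" by (simp add: wt power_mult)
    have "w * y = t * y * (t ^ 2) ^ l" unfolding wl using power_commute_elem[OF t2y, of l] by (simp only: mult.assoc)
    then have "inverse y * t * (t ^ 2) ^ l = t * y * (t ^ 2) ^ l" using ww_inv by (simp add: wl mult.assoc)
    then have "inverse y * t = t * y" by (simp only: perm_mult_right_cancel)
    also have "t * y = c * inverse y * b" using b_y[of 1] by (simp add: mult.assoc)
    finally have "inverse y * c = c * inverse y" by (simp add: mult.assoc[symmetric])
    then show ?thesis by (metis perm_left_inverse perm_right_inverse mult.assoc mult_1 mult.right_neutral)
  qed
  have cyn: "c * y ^ n = y ^ n * c" for n using power_commute_elem[of y c n] cy1 by simp
  have ww: "w * w = 1"
  proof -
    have "q div 2 + q div 2 = q" using w(2) \<epsilon> by auto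
    then show ?thesis using t_ord[of q] by (simp add: wt flip: power_add)
  qed
  have cw: "c * w = w * c" using E.x_pow[of "q div 2"] perm_inverse_unique[OF ww] by (simp add: wt)
  have "a * w = v * x" unfolding a_eq x_def by (simp add: mult.assoc ww)
  then have v_eq: "v = a * w * inverse x" by (metis mult.assoc mult.right_neutral perm_right_inverse)
  have cx: "c * inverse x = inverse x * c"
    using cyn[of n] unfolding x_def[symmetric] by (metis perm_left_inverse perm_right_inverse mult.assoc mult_1 mult.right_neutral)
  have cv: "c * v = v * c" unfolding v_eq
    by (simp add: mult.assoc ca cw cx ca[THEN assoc_rule] cw[THEN assoc_rule])
  have "v * (c * v * c) = 1" unfolding v_def k_def by (simp add: mult.assoc invol_cancel zz cc)
  then have vv: "v * v = 1" unfolding cv by (simp add: mult.assoc cc)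
  have kz: "k * z = v"
  proof -
    have "k * z * v = 1" unfolding v_def by (simp add: mult.assoc invol_cancel zz kk)
    then show ?thesis using vv by (metis perm_mult_right_cancel)
  qed
  obtain h where h: "b * v * b = k * y ^ h"
  proof -
    have "s ^ 2 * c * s ^ 2 * c = v * y ^ (e + e)"
    proof -
      have "s ^ 2 * c * s ^ 2 * c = z * (y ^ e * c) * (z * (y ^ e * c))"
        unfolding s2 e_def[symmetric] by (simp only: mult.assoc)
      also have "\<dots> = z * c * (y ^ e * z) * c * y ^ e" unfolding cyn[symmetric] by (simp only: mult.assoc)
      also have "\<dots> = z * c * z * (y ^ e * c) * y ^ e" unfolding zy[symmetric] by (simp only: mult.assoc)
      also have "\<dots> = v * (y ^ e * y ^ e)" unfolding cyn[symmetric] v_def k_def by (simp only: mult.assoc)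
      finally show ?thesis by (simp only: power_add)
    qed
    then have "b * (v * y ^ (e + e)) * b = c * (z * y ^ e) * c * y ^ g"
      using bv unfolding s2 yn e_def[symmetric] by (simp only:)
    also have "\<dots> = c * z * (y ^ e * c) * y ^ g" by (simp only: mult.assoc)
    also have "\<dots> = k * (y ^ e * y ^ g)" unfolding cyn[symmetric] k_def by (simp only: mult.assoc)
    finally have 1: "b * (v * y ^ (e + e)) * b = k * y ^ (e + g)" by (simp only: power_add)
    have "y ^ (e + e) * b = b * inverse (y ^ (e + e))" using b_y[of "e + e"]
      by (metis D.y_y bb mult.assoc mult.right_neutral)
    then have "b * (v * y ^ (e + e)) * b = b * v * b * inverse (y ^ (e + e))" by (simp add: mult.assoc)
    then have "b * v * b = k * y ^ (e + g) * y ^ (e + e)" using 1 by (metis mult.assoc mult.right_neutral perm_left_inverse)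
    then have "b * v * b = k * y ^ (e + g + (e + e))" by (simp only: power_add mult.assoc)
    then show thesis by (rule that)
  qed
  \<comment> \<open>The error \<open>y ^ h\<close> separates two involutions and commutes with one
    of them, so its square is trivial; the odd order of \<open>y\<close> then removes it.\<close>
  have "y ^ (h + h) = 1"
  proof -
    have "b * v * b * (b * v * b) = 1" by (simp add: mult.assoc vv invol_cancel bb)
    then have "k * (y ^ h * k) * y ^ h = 1" unfolding h by (simp only: mult.assoc)
    then have "k * k * y ^ h * y ^ h = 1" unfolding ky[symmetric] by (simp only: mult.assoc)
    then show ?thesis using kk by (simp add: power_add)
  qed
  then have "m dvd 2 * h" using y_one by (simp add: mult_2)
  then have "m dvd h" using m(1) coprime_dvd_mult_right_iff[of m 2 h] by simp
  then have "y ^ h = 1" using y_one by simp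
  then have u: "b * v * b = k" using h by simp
  have "v * k = z" unfolding v_def by (simp add: mult.assoc kk)
  moreover have "k * v = z" unfolding kz[symmetric] using kk by (simp add: invol_cancel)
  moreover have "x * v = v * x" using vx by simp
  moreover have "b * x * b * x = 1" using b_y[of n] by (simp add: x_def mult.assoc bb)
  moreover have "x ^ m = 1" unfolding x_def by (simp add: y_one flip: power_mult)
  moreover have "a = v * x * twist b c q True" using a_eq w \<epsilon> x_def by simp
  ultimately show ?thesis
    unfolding cube_like_def using q3 m w(2) \<epsilon> odd vv cv cyn[of n]
    by (intro conjI exI[of _ v] exI[of _ x]) (simp_all add: u k_def x_def)
qed

section \<open>Lifting relations through quotients and the induction\<close>

lemma word_image:
  fixes \<phi> :: "'x perm \<Rightarrow> 'y perm"
  assumes hom: "\<forall>g\<in>G. \<forall>h\<in>G. \<phi> (g * h) = \<phi> g * \<phi> h"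
    and pow: "\<forall>g\<in>G. \<forall>i. \<phi> (g ^ i) = \<phi> g ^ i"
  shows "\<phi> (s ^ i) = (\<phi> a * \<phi> b) ^ i" "\<phi> (t ^ i) = (\<phi> c * \<phi> b) ^ i"
    "\<phi> (twist b c q \<epsilon>) = twist (\<phi> b) (\<phi> c) q \<epsilon>"
    "\<phi> (s ^ i * c * s ^ i * c) = (\<phi> a * \<phi> b) ^ i * \<phi> c * (\<phi> a * \<phi> b) ^ i * \<phi> c"
proof -
  have "\<phi> 1 * \<phi> 1 = \<phi> 1 * 1" using hom one_G by (metis mult.right_neutral)
  then have one: "\<phi> 1 = 1" by (simp only: perm_mult_left_cancel)
  show s: "\<phi> (s ^ i) = (\<phi> a * \<phi> b) ^ i" and t: "\<phi> (t ^ i) = (\<phi> c * \<phi> b) ^ i" for i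
    by (simp_all add: hom pow G_intros)
  show "\<phi> (twist b c q \<epsilon>) = twist (\<phi> b) (\<phi> c) q \<epsilon>"
    unfolding twist_def using one t by simp
  show "\<phi> (s ^ i * c * s ^ i * c) = (\<phi> a * \<phi> b) ^ i * \<phi> c * (\<phi> a * \<phi> b) ^ i * \<phi> c"
    by (simp add: hom s G_intros)
qed

text \<open>The quotient by \<open>s ^ 4\<close> has \<open>p = 4\<close> and is cube-like by
  induction; its relations lift with errors that are powers of \<open>s ^ 4\<close>. For odd
  \<open>m\<close> these errors can be absorbed. For even \<open>m\<close> the lifted relations
  survive in the quotient by \<open>s ^ 8\<close>, where they are contradictory.\<close>

lemma cube_type_of_normal_power4:
  assumes nonor: "nonorientable_triple a b c" and p: "p = 4 * m" "m > 1"
    and cs: "c * s ^ 4 * c = s ^ (4 * j)"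
    and IH: "\<And>(a' :: nat perm) b' c'. tight_triple a' b' c' 4 q \<Longrightarrow> nonorientable_triple a' b' c' \<Longrightarrow>
      \<exists>\<epsilon>. cube_like a' b' c' 1 q \<epsilon>"
  shows "cube_type a b c p q"
proof -
  interpret du: tight_triple c b a q p by (rule dual)
  have "4 dvd p" using p by simp
  have "(2 :: nat) \<le> 4" by simp
  obtain \<phi> :: "'x perm \<Rightarrow> nat perm" where Q: "tight_triple (\<phi> c) (\<phi> b) (\<phi> a) q 4"
    and homA: "\<forall>g\<in>G. \<forall>h\<in>G. \<phi> (g * h) = \<phi> g * \<phi> h"
    and powA: "\<forall>g\<in>G. \<forall>i. \<phi> (g ^ i) = \<phi> g ^ i"
    and eqA: "\<forall>g\<in>G. \<forall>h\<in>G. \<phi> g = \<phi> h \<longleftrightarrow> (\<exists>i. g = h * s ^ (4 * i))"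
    and no: "nonorientable_triple c b a \<longrightarrow> nonorientable_triple (\<phi> c) (\<phi> b) (\<phi> a)"
    by (rule du.quotient[OF \<open>4 dvd p\<close> \<open>2 \<le> 4\<close> cs, unfolded G_dual])
  have hom: "\<phi> (g * h) = \<phi> g * \<phi> h" and eq: "\<phi> g = \<phi> h \<longleftrightarrow> (\<exists>i. g = h * s ^ (4 * i))"
    if "g \<in> G" "h \<in> G" for g h
    using homA eqA that by blast+
  interpret Q: tight_triple "\<phi> c" "\<phi> b" "\<phi> a" q 4 by (rule Q)
  obtain \<epsilon> where cube: "cube_like (\<phi> a) (\<phi> b) (\<phi> c) 1 q \<epsilon>"
    using IH[OF Q.dual nonorientable_triple_dual[OF mp[OF no nonorientable_triple_dual[OF nonor]]]] by blast
  define w where "w = twist b c q \<epsilon>"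
  note W = word_image[OF homA powA]
  have \<phi>w: "\<phi> w = twist (\<phi> b) (\<phi> c) q \<epsilon>" unfolding w_def by (rule W(3))
  have wG: "w \<in> G" unfolding w_def by (rule twist_G)
  have q: "3 dvd q" "\<epsilon> \<Longrightarrow> even q" using cube unfolding cube_like_def by blast+
  have tq: "(\<phi> c * \<phi> b) ^ q = 1" using Q.s_ord[of q] by simp
  note facts = cube_like_facts[OF Q.bb Q.aa tq cube]
  obtain k where k: "\<phi> a = (\<phi> a * \<phi> b) ^ (2 * 1) * \<phi> c * (\<phi> a * \<phi> b) ^ (2 * 1) * \<phi> c * (\<phi> a * \<phi> b) ^ (4 * k) * twist (\<phi> b) (\<phi> c) q \<epsilon>"
    using facts(5) by blast
  have s4: "(\<phi> a * \<phi> b) ^ (4 * k) = 1" using Q.t_ord by simp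
  have "\<phi> a = \<phi> (s ^ 2 * c * s ^ 2 * c) * \<phi> w"
    using k unfolding s4 \<phi>w W(4) by (simp only: mult.assoc mult_1 mult_1_right)
  then have "\<phi> a = \<phi> (s ^ 2 * c * s ^ 2 * c * w)" by (subst hom) (auto intro!: G_intros wG)
  moreover have "s ^ 2 * c * s ^ 2 * c * w \<in> G" by (intro G_intros wG)
  ultimately obtain i where H1: "a = s ^ 2 * c * s ^ 2 * c * w * s ^ (4 * i)" using eq a_G by metis
  have sG: "s ^ 2 \<in> G" by (intro G_intros)
  have "\<phi> (w * s ^ 2) = \<phi> (s ^ 2 * w)"
    using facts(6)[OF refl] unfolding hom[OF wG sG] hom[OF sG wG] W(1) \<phi>w .
  then obtain f where H2: "w * s ^ 2 = s ^ 2 * w * s ^ (4 * f)"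
    using eq[OF mult_G[OF wG sG] mult_G[OF sG wG]] by blast
  have xG: "s ^ 2 * c * s ^ 2 * c \<in> G" "b * (s ^ 2 * c * s ^ 2 * c) * b \<in> G" "c * s ^ 2 * c \<in> G"
    by (intro G_intros)+
  have "\<phi> (b * (s ^ 2 * c * s ^ 2 * c) * b) = \<phi> b * \<phi> (s ^ 2 * c * s ^ 2 * c) * \<phi> b"
    using xG by (simp add: hom G_intros del: perm_mult_left_cancel perm_mult_right_cancel)
  moreover have "\<phi> (c * s ^ 2 * c) = \<phi> c * \<phi> (s ^ 2) * \<phi> c"
    by (simp add: hom G_intros)
  ultimately have "\<phi> (b * (s ^ 2 * c * s ^ 2 * c) * b) = \<phi> (c * s ^ 2 * c)"
    using facts(7)[OF refl] unfolding W(4) W(1) by metis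
  then obtain g where H4: "b * (s ^ 2 * c * s ^ 2 * c) * b = c * s ^ 2 * c * s ^ (4 * g)"
    using eq[OF xG(2,3)] by blast
  show ?thesis
  proof (cases "odd m")
    case True
    then have "cube_like a b c m q True"
      using cube_like_of_odd_cover[OF p(1) _ p(2) q(1) w_def q(2) H1 cs H4] by blast
    then show ?thesis using p(1) unfolding cube_type_def by blast
  next
    case False
    then have "8 dvd p" using p(1) by (auto elim!: evenE)
    have cs8: "c * s ^ 8 * c = s ^ (8 * j)"
    proof -
      have "c * s ^ 8 * c = (c * s ^ 4 * c) ^ 2" by (simp add: invol_conj_power cc flip: power_mult)
      then show ?thesis unfolding cs by (simp flip: power_mult)
    qed
    have "(2 :: nat) \<le> 8" by simp
    obtain \<psi> :: "'x perm \<Rightarrow> nat perm" where R: "tight_triple (\<psi> c) (\<psi> b) (\<psi> a) q 8"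
      and homA: "\<forall>g\<in>G. \<forall>h\<in>G. \<psi> (g * h) = \<psi> g * \<psi> h"
      and powA: "\<forall>g\<in>G. \<forall>i. \<psi> (g ^ i) = \<psi> g ^ i"
      by (rule du.quotient[OF \<open>8 dvd p\<close> \<open>2 \<le> 8\<close> cs8, unfolded G_dual])
    have hom: "\<psi> (g * h) = \<psi> g * \<psi> h" if "g \<in> G" "h \<in> G" for g h
      using homA that by blast
    interpret R: tight_triple "\<psi> c" "\<psi> b" "\<psi> a" q 8 by (rule R)
    interpret R': tight_triple "\<psi> a" "\<psi> b" "\<psi> c" 8 q by (rule R.dual)
    note W = word_image[OF homA powA]
    have \<psi>w: "\<psi> w = twist (\<psi> b) (\<psi> c) q \<epsilon>" unfolding w_def by (rule W(3))
    have s4G: "s ^ 4 \<in> G" "s ^ (4 * n) \<in> G" for n by (intro G_intros)+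
    show ?thesis
    proof (rule FalseE, rule R'.no_even_cover[OF refl \<psi>w q(2)])
      show "\<psi> a = (\<psi> a * \<psi> b) ^ 2 * \<psi> c * (\<psi> a * \<psi> b) ^ 2 * \<psi> c * \<psi> w * (\<psi> a * \<psi> b) ^ (4 * i)"
        using arg_cong[OF H1, of \<psi>] unfolding hom[OF mult_G[OF xG(1) wG] s4G(2)] hom[OF xG(1) wG] W(4) W(1) .
      show "\<psi> w * (\<psi> a * \<psi> b) ^ 2 = (\<psi> a * \<psi> b) ^ 2 * \<psi> w * (\<psi> a * \<psi> b) ^ (4 * f)"
        using arg_cong[OF H2, of \<psi>] unfolding hom[OF wG sG] hom[OF mult_G[OF sG wG] s4G(2)] hom[OF sG wG] W(1) .
      show "\<psi> c * (\<psi> a * \<psi> b) ^ 4 * \<psi> c = (\<psi> a * \<psi> b) ^ (4 * j)"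
        using arg_cong[OF cs, of \<psi>] unfolding hom[OF mult_G[OF c_G s4G(1)] c_G] hom[OF c_G s4G(1)] W(1) .
    qed
  qed
qed

text \<open>Two word relations of the cube-like quotient, lifted with the unknown power of
  \<open>t ^ m\<close> made explicit. They feed the arguments that determine or remove this
  error.\<close>

lemma normal_of_cube_quotient:
  fixes \<phi> :: "'x perm \<Rightarrow> 'y perm"
  assumes Q: "tight_triple (\<phi> a) (\<phi> b) (\<phi> c) p m" and p: "p = 4 * r" and cube: "cube_like (\<phi> a) (\<phi> b) (\<phi> c) r m \<epsilon>"
    and homA: "\<forall>g\<in>G. \<forall>h\<in>G. \<phi> (g * h) = \<phi> g * \<phi> h"
    and powA: "\<forall>g\<in>G. \<forall>i. \<phi> (g ^ i) = \<phi> g ^ i"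
    and eqA: "\<forall>g\<in>G. \<forall>h\<in>G. \<phi> g = \<phi> h \<longleftrightarrow> (\<exists>i. g = h * t ^ (m * i))"
  shows "\<exists>i. s ^ 4 * c = c * s ^ 4 * t ^ (m * i)"
    and "\<exists>k i. a = s ^ (2 * r) * c * s ^ (2 * r) * c * s ^ (4 * k) * (twist b c m \<epsilon> * t ^ (m * i))"
proof -
  interpret Q: tight_triple "\<phi> a" "\<phi> b" "\<phi> c" p m by (rule Q)
  have tq: "(\<phi> c * \<phi> b) ^ m = 1" using Q.t_ord[of m] by simp
  note facts = cube_like_facts[OF Q.bb Q.cc tq cube]
  have hom: "\<phi> (g * h) = \<phi> g * \<phi> h" and eq: "\<phi> g = \<phi> h \<longleftrightarrow> (\<exists>i. g = h * t ^ (m * i))"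
    if "g \<in> G" "h \<in> G" for g h
    using homA eqA that by blast+
  note W = word_image[OF homA powA]
  have s4G: "s ^ n \<in> G" for n by (intro G_intros)
  have "\<phi> (s ^ 4 * c) = \<phi> (c * s ^ 4)"
    using facts(4) unfolding hom[OF s4G c_G] hom[OF c_G s4G] W(1) .
  then show "\<exists>i. s ^ 4 * c = c * s ^ 4 * t ^ (m * i)"
    using eq[OF mult_G[OF s4G c_G] mult_G[OF c_G s4G]] by blast
  have "\<phi> 1 * \<phi> 1 = \<phi> 1 * 1" using hom[OF one_G one_G] by simp
  then have one: "\<phi> 1 = 1" by (simp only: perm_mult_left_cancel)
  define w where "w = twist b c m \<epsilon>"
  have wG: "w \<in> G" by (simp add: w_def twist_def G_intros)
  have \<phi>w: "\<phi> w = twist (\<phi> b) (\<phi> c) m \<epsilon>"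
    unfolding w_def twist_def using one W(2) by simp
  obtain k where k: "\<phi> a = (\<phi> a * \<phi> b) ^ (2 * r) * \<phi> c * (\<phi> a * \<phi> b) ^ (2 * r) * \<phi> c * (\<phi> a * \<phi> b) ^ (4 * k) * twist (\<phi> b) (\<phi> c) m \<epsilon>"
    using facts(5) by blast
  have xG: "s ^ (2 * r) * c * s ^ (2 * r) * c \<in> G" by (intro G_intros)
  have "\<phi> a = \<phi> (s ^ (2 * r) * c * s ^ (2 * r) * c * s ^ (4 * k) * w)"
    using k unfolding hom[OF mult_G[OF xG s4G] wG] hom[OF xG s4G] W(4) W(1) \<phi>w .
  then obtain i where "a = s ^ (2 * r) * c * s ^ (2 * r) * c * s ^ (4 * k) * w * t ^ (m * i)"
    using eq[OF a_G mult_G[OF mult_G[OF xG s4G] wG]] by blast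
  then show "\<exists>k i. a = s ^ (2 * r) * c * s ^ (2 * r) * c * s ^ (4 * k) * (twist b c m \<epsilon> * t ^ (m * i))"
    unfolding w_def by (metis mult.assoc)
qed

text \<open>Apart from \<open>r = 1\<close>, where \<open>s ^ 4\<close> is trivial, both kinds of
  quotient lead to a normal subgroup generated by a fourth power: of \<open>s\<close> when the
  quotient is cube-like, of \<open>t\<close> when its dual is. From there only the case
  \<open>p = 4\<close> of the induction hypothesis is needed.\<close>

lemma classification_le:
  assumes nonor: "nonorientable_triple a b c" and le: "p \<le> q"
    and IH: "\<And>(a' :: nat perm) b' c' p' q'. p' + q' < p + q \<Longrightarrow> tight_triple a' b' c' p' q' \<Longrightarrow>
      nonorientable_triple a' b' c' \<Longrightarrow> cube_type a' b' c' p' q' \<or> cube_type c' b' a' q' p'"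
  shows "cube_type a b c p q \<or> cube_type c b a q p"
proof -
  interpret du: tight_triple c b a q p by (rule dual)
  have IH4: "\<exists>\<epsilon>. cube_like a' b' c' 1 n \<epsilon>"
    if "4 + n < p + q" "tight_triple a' b' c' 4 n" "nonorientable_triple a' b' c'" for a' b' c' :: "nat perm" and n
  proof -
    \<comment> \<open>The dual alternative would require that 3 divides 4.\<close>
    have "\<not> cube_type c' b' a' n 4" unfolding cube_type_def cube_like_def by auto
    then have "cube_type a' b' c' 4 n" using IH[OF that] by blast
    then show ?thesis unfolding cube_type_def by auto
  qed
  have p3: "3 \<le> p" using nonor by (rule p_ge_3)
  from vertex_multiplicity[OF le] show ?thesis
  proof (elim disjE exE conjE)
    assume "even q" "a * t ^ (q div 2) * a = t ^ (q div 2) * c"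
    then have "cube_type c b a q p" by (intro du.exceptional_cube_type[of "q div 2"]) auto
    then show ?thesis ..
  next
    fix m i assume m: "0 < m" "m < p" "m dvd q" "a * t ^ m * a = t ^ (m * i)"
    \<comment> \<open>If \<open>a\<close> normalised the powers of \<open>t\<close> themselves, then
      \<open>s ^ 2\<close> would lie in \<open>dih c b\<close> and \<open>p\<close> would divide
      2.\<close>
    have "m \<noteq> 1"
    proof
      assume "m = 1"
      then have "a * t * a = t ^ i" using m(4) by simp
      then have "c * (a * t * a) = c * t ^ i" by simp
      then have "a * b * a * b = c * t ^ i * b" by (simp add: mult.assoc cax)
      then have "s ^ 2 \<in> dih c b"
        using E.dih_mult[OF E.dih_x dihI(2)[of c b i]] by (simp add: power2_eq_square mult.assoc)
      then have "p dvd 2" using pow_Int s_ord by blast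
      then show False using p3 by (auto dest: dvd_imp_le)
    qed
    then have "2 \<le> m" using m(1) by simp
    obtain \<phi> :: "'x perm \<Rightarrow> nat perm" where Q: "tight_triple (\<phi> a) (\<phi> b) (\<phi> c) p m"
      and homA: "\<forall>g\<in>G. \<forall>h\<in>G. \<phi> (g * h) = \<phi> g * \<phi> h"
      and powA: "\<forall>g\<in>G. \<forall>i. \<phi> (g ^ i) = \<phi> g ^ i"
      and eqA: "\<forall>g\<in>G. \<forall>h\<in>G. \<phi> g = \<phi> h \<longleftrightarrow> (\<exists>i. g = h * t ^ (m * i))"
      and no: "nonorientable_triple a b c \<longrightarrow> nonorientable_triple (\<phi> a) (\<phi> b) (\<phi> c)"
      by (rule quotient[OF m(3) \<open>2 \<le> m\<close> m(4)])
    have hom: "\<phi> (g * h) = \<phi> g * \<phi> h" and eq: "\<phi> g = \<phi> h \<longleftrightarrow> (\<exists>i. g = h * t ^ (m * i))"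
      if "g \<in> G" "h \<in> G" for g h
      using homA eqA that by blast+
    interpret Q: tight_triple "\<phi> a" "\<phi> b" "\<phi> c" p m by (rule Q)
    have "p + m < p + q" using m(2) le by simp
    then have "cube_type (\<phi> a) (\<phi> b) (\<phi> c) p m \<or> cube_type (\<phi> c) (\<phi> b) (\<phi> a) m p"
      using IH Q mp[OF no nonor] by blast
    then show ?thesis
    proof
      assume "cube_type (\<phi> a) (\<phi> b) (\<phi> c) p m"
      then obtain r \<epsilon> where r: "p = 4 * r" "cube_like (\<phi> a) (\<phi> b) (\<phi> c) r m \<epsilon>"
        unfolding cube_type_def by blast
      have rodd: "odd r" and m3: "3 dvd m" using r(2) unfolding cube_like_def by blast+
      obtain l where l: "s ^ 4 * c = c * s ^ 4 * t ^ (m * l)"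
        using normal_of_cube_quotient(1)[OF Q r homA powA eqA] by blast
      obtain k j where kj: "a = s ^ (2 * r) * c * s ^ (2 * r) * c * s ^ (4 * k) * (twist b c m \<epsilon> * t ^ (m * j))"
        using normal_of_cube_quotient(2)[OF Q r homA powA eqA] by blast
      show ?thesis
      proof (cases "r = 1")
        case True
        \<comment> \<open>\<open>m\<close> is a multiple of 3 below \<open>p = 4\<close>. Being odd,
          it admits no twist in the quotient, so the error factor is a power of \<open>t ^ m\<close>
          only.\<close>
        then have "m = 3" using m(2) m3 m(1) r(1) by (auto elim!: dvdE)
        then have "\<epsilon> = False" using r(2) unfolding cube_like_def by auto
        moreover have "s ^ (4 * k) = 1" using s_ord r(1) True by simp
        ultimately have "a = s ^ 2 * c * s ^ 2 * c * t ^ (m * j)"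
          using kj True by (simp add: twist_def)
        then have "\<exists>\<epsilon>. cube_like a b c 1 q \<epsilon>"
          using cube_like_of_hemicube_quotient[OF _ m3 m(3,4)] r(1) True by simp
        then show ?thesis using r(1) True unfolding cube_type_def by auto
      next
        case False
        define n where "n = (if \<epsilon> then m div 2 else 0) + m * j"
        have "twist b c m \<epsilon> * t ^ (m * j) = t ^ n" by (simp add: twist_def n_def power_add)
        then have "c * s ^ 4 * c = s ^ 4"
          using power4_commute_of_quotient[OF r(1) rodd m(4) _ l, of k n] kj by simp
        then have cs: "c * s ^ 4 * c = s ^ (4 * 1)" by simp
        have "r > 1" using False p3 r(1) by (cases r) auto
        then have "\<exists>\<epsilon>. cube_like a' b' c' 1 q \<epsilon>"
          if "tight_triple a' b' c' 4 q" "nonorientable_triple a' b' c'" for a' b' c' :: "nat perm"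
          using IH4[OF _ that] r(1) by simp
        then have "cube_type a b c p q"
          using cube_type_of_normal_power4[OF nonor r(1) \<open>r > 1\<close> cs] by blast
        then show ?thesis ..
      qed
    next
      assume "cube_type (\<phi> c) (\<phi> b) (\<phi> a) m p"
      then obtain r \<epsilon> where r: "m = 4 * r" "cube_like (\<phi> c) (\<phi> b) (\<phi> a) r p \<epsilon>"
        unfolding cube_type_def by blast
      interpret Q': tight_triple "\<phi> c" "\<phi> b" "\<phi> a" m p by (rule Q.dual)
      have sp: "(\<phi> a * \<phi> b) ^ p = 1" using Q.s_ord[of p] by simp
      \<comment> \<open>In the quotient \<open>t ^ 4\<close> commutes with \<open>a\<close>, so
        before taking the quotient the conjugate by \<open>a\<close> differs from
        \<open>t ^ 4\<close> by a power of \<open>t ^ m\<close>. As 4 divides \<open>m\<close>, it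
        is still a power of \<open>t ^ 4\<close>.\<close>
      have "(\<phi> c * \<phi> b) ^ 4 * \<phi> a = \<phi> a * (\<phi> c * \<phi> b) ^ 4"
        by (rule cube_like_facts(4)[OF Q.bb Q.aa sp r(2)])
      moreover have tG: "t ^ 4 \<in> G" by (intro G_intros)
      ultimately have "\<phi> (a * t ^ 4) = \<phi> (t ^ 4 * a)"
        unfolding hom[OF a_G tG] hom[OF tG a_G] word_image(2)[OF homA powA] by simp
      then obtain l where "a * t ^ 4 = t ^ 4 * a * t ^ (m * l)"
        using eq[OF mult_G[OF a_G tG] mult_G[OF tG a_G]] by blast
      then have "a * t ^ 4 * a = t ^ 4 * (a * t ^ (m * l) * a)" by (simp add: mult.assoc)
      also have "a * t ^ (m * l) * a = t ^ (m * (i * l))"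
      proof -
        have "a * t ^ (m * l) * a = (a * t ^ m * a) ^ l" by (simp add: invol_conj_power aa power_mult)
        then show ?thesis unfolding m(4) by (simp only: power_mult[symmetric] mult.assoc)
      qed
      also have "t ^ 4 * t ^ (m * (i * l)) = t ^ (4 * (1 + r * (i * l)))"
        unfolding r(1) by (simp add: power_add[symmetric] algebra_simps)
      finally have a4: "a * t ^ 4 * a = t ^ (4 * (1 + r * (i * l)))" .
      obtain n where n: "q = m * n" using m(3) by (rule dvdE)
      then have q: "q = 4 * (r * n)" using r(1) by simp
      have "m < q" "0 < r" using m(1,2) le r(1) by simp_all
      then have "r < r * n" using q r(1) by simp
      with \<open>0 < r\<close> have "r * n > 1" by linarith
      then have "\<exists>\<epsilon>. cube_like a' b' c' 1 p \<epsilon>"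
        if "tight_triple a' b' c' 4 p" "nonorientable_triple a' b' c'" for a' b' c' :: "nat perm"
        using IH4[OF _ that] q by simp
      then have "cube_type c b a q p"
        using du.cube_type_of_normal_power4[OF nonorientable_triple_dual[OF nonor] q \<open>r * n > 1\<close> a4] by blast
      then show ?thesis ..
    qed
  qed
qed

lemma classification_step:
  assumes nonor: "nonorientable_triple a b c"
    and IH: "\<And>(a' :: nat perm) b' c' p' q'. p' + q' < p + q \<Longrightarrow> tight_triple a' b' c' p' q' \<Longrightarrow>
      nonorientable_triple a' b' c' \<Longrightarrow> cube_type a' b' c' p' q' \<or> cube_type c' b' a' q' p'"
  shows "cube_type a b c p q \<or> cube_type c b a q p"
proof (cases "p \<le> q")
  case True
  then show ?thesis using classification_le nonor IH by blast
next
  case False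
  interpret du: tight_triple c b a q p by (rule dual)
  have "cube_type c b a q p \<or> cube_type a b c p q"
  proof (rule du.classification_le)
    show "nonorientable_triple c b a" using nonor by (rule nonorientable_triple_dual)
    show "q \<le> p" using False by simp
  next
    fix a' b' c' :: "nat perm" and p' q'
    assume "p' + q' < q + p" "tight_triple a' b' c' p' q'" "nonorientable_triple a' b' c'"
    then show "cube_type a' b' c' p' q' \<or> cube_type c' b' a' q' p'" using IH by (simp add: add.commute)
  qed
  then show ?thesis by blast
qed

end

text \<open>Quotients live in \<open>nat perm\<close> whatever the type of the given triple, so the
  induction is carried out there; one further step of the same argument covers an arbitrary
  type.\<close>

theorem tight_classification:
  assumes "tight_triple (a :: 'x perm) b c p q" "nonorientable_triple a b c"
  shows "cube_type a b c p q \<or> cube_type c b a q p"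
proof -
  have nat: "cube_type a b c p q \<or> cube_type c b a q p"
    if "tight_triple a b c p q" "nonorientable_triple a b c" for a b c :: "nat perm" and p q
    using that
  proof (induction "p + q" arbitrary: a b c p q rule: less_induct)
    case less
    then show ?case using tight_triple.classification_step by blast
  qed
  show ?thesis by (rule tight_triple.classification_step[OF assms]) (rule nat)
qed

section \<open>Normal forms and trivial words\<close>

lemma intertwine_power: "x * g = h * (x :: 'g::monoid_mult) \<Longrightarrow> x * g ^ n = h ^ n * x"
proof (induction n)
  case (Suc n)
  have "x * g ^ Suc n = (x * g) * g ^ n" by (simp add: mult.assoc)
  also have "\<dots> = h * (x * g ^ n)" using Suc.prems by (simp add: mult.assoc)
  also have "\<dots> = h ^ Suc n * x" using Suc by (simp add: mult.assoc)
  finally show ?case .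
qed simp

type_synonym exponents = "nat \<times> nat \<times> nat \<times> nat \<times> nat"

text \<open>The exponents \<open>(i, k, l, j, d)\<close> stand for the group element \<open>y ^ i v ^ k u ^ l t ^ j b ^ d\<close>;
  left multiplication by a generator acts on them.\<close>

fun cube_step :: "nat \<Rightarrow> nat \<Rightarrow> bool \<Rightarrow> letter \<Rightarrow> exponents \<Rightarrow> exponents" where
  "cube_step r q \<epsilon> R0 (i, k, l, j, d) = (1 + (r - 1) * i, 1 + k, l, (if \<epsilon> then q div 2 else 0) + j, d)"
| "cube_step r q \<epsilon> R1 (i, k, l, j, d) = ((r - 1) * i, l, k, (q - 1) * j, 1 + d)"
| "cube_step r q \<epsilon> R2 (i, k, l, j, d) = (i, k + l, l, (q - 1) * j + 1, 1 + d)"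

definition cube_run :: "nat \<Rightarrow> nat \<Rightarrow> bool \<Rightarrow> letter list \<Rightarrow> exponents" where
  "cube_run r q \<epsilon> x = foldr (cube_step r q \<epsilon>) x (0, 0, 0, 0, 0)"

fun trivial_exponents :: "nat \<Rightarrow> nat \<Rightarrow> exponents \<Rightarrow> bool" where
  "trivial_exponents r q (i, k, l, j, d) \<longleftrightarrow> r dvd i \<and> even k \<and> even l \<and> q dvd j \<and> even d"

text \<open>The trivial words predicted by the normal form, computed from \<open>r\<close>,
  \<open>q\<close> and \<open>\<epsilon>\<close> without reference to any group. Exponents stay
  unreduced during the run and are compared with the orders only at the end.\<close>

definition cube_kernel :: "nat \<Rightarrow> nat \<Rightarrow> bool \<Rightarrow> letter list set" where
  "cube_kernel r q \<epsilon> = {x. trivial_exponents r q (cube_run r q \<epsilon> x)}"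

section \<open>Evaluation of words to normal forms\<close>

context cube_structure begin

fun nf :: "exponents \<Rightarrow> 'x perm" where
  "nf (i, k, l, j, d) = y ^ i * (v ^ k * (u ^ l * ((c * b) ^ j * b ^ d)))"

lemma r_pos: "r > 0" using r_odd by (rule odd_pos)

lemma y'_pow: "y' ^ i = y ^ ((r - 1) * i)"
proof -
  have "(y ^ i) * y ^ ((r - 1) * i) = y ^ (r * i)"
    using r_pos by (cases r) (simp_all add: algebra_simps flip: power_add)
  also have "\<dots> = 1" by (simp add: power_mult yr)
  finally have "y ^ i * y ^ ((r - 1) * i) = 1" .
  moreover have "y ^ i * y' ^ i = 1" using mult_power_commuting[of y y' i] yy' y'y by simp
  ultimately show ?thesis by (metis perm_mult_left_cancel)
qed

lemma inverse_t_pow: "q > 0 \<Longrightarrow> inverse ((c * b) ^ j) = (c * b) ^ ((q - 1) * j)"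
proof (rule perm_inverse_unique)
  assume "q > 0"
  then have "(c * b) ^ j * (c * b) ^ ((q - 1) * j) = (c * b) ^ (q * j)"
    by (cases q) (simp_all add: algebra_simps flip: power_add)
  then show "(c * b) ^ j * (c * b) ^ ((q - 1) * j) = 1" by (simp add: power_mult tq)
qed

lemma b_t_pow: "q > 0 \<Longrightarrow> b * (c * b) ^ j = (c * b) ^ ((q - 1) * j) * b"
proof -
  assume q: "q > 0"
  have "(c * b) ^ j * (b * (c * b) ^ j) = (c * b) ^ j * (inverse ((c * b) ^ j) * b)"
    using b_pow[of j] by (simp add: mult.assoc)
  then show ?thesis using inverse_t_pow[OF q] by (simp only: perm_mult_left_cancel)
qed

lemma b_nf: assumes "q > 0" shows "b * nf (i, k, l, j, d) = nf ((r - 1) * i, l, k, (q - 1) * j, 1 + d)"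
proof -
  have 1: "b * y ^ i = y ^ ((r - 1) * i) * b" "b * v ^ k = u ^ k * b" "b * u ^ l = v ^ l * b"
    using intertwine_power[OF b_y] intertwine_power[OF bv] intertwine_power[OF bu] y'_pow by simp_all
  have 2: "u ^ k * v ^ l = v ^ l * u ^ k"
    by (metis intertwine_power uv)
  show ?thesis
    by (simp add: 1[THEN assoc_rule] 2[THEN assoc_rule] b_t_pow[OF assms, THEN assoc_rule] mult.assoc)
qed

lemma c_nf: assumes "q > 0" shows "c * nf (i, k, l, j, d) = nf (i, k + l, l, (q - 1) * j + 1, 1 + d)"
proof -
  have 1: "c * y ^ i = y ^ i * c" "c * v ^ k = v ^ k * c"
    using intertwine_power[OF cy] intertwine_power[OF cv] by simp_all
  have "c * u = (v * u) * c" using cu by (simp add: mult.assoc)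
  then have "c * u ^ l = (v * u) ^ l * c" by (rule intertwine_power)
  then have 2: "c * u ^ l = v ^ l * (u ^ l * c)"
    using mult_power_commuting[of v u l] uv by (simp add: mult.assoc)
  have "c = c * b * b" by (simp add: mult.assoc bb)
  then have "c * (c * b) ^ j = c * b * (b * (c * b) ^ j)" by (simp add: mult.assoc[symmetric])
  also have "\<dots> = (c * b) ^ ((q - 1) * j + 1) * b"
    unfolding b_t_pow[OF assms] by (simp add: mult.assoc)
  finally have 3: "c * (c * b) ^ j = (c * b) ^ ((q - 1) * j + 1) * b" .
  show ?thesis
    by (simp only: nf.simps 1[THEN assoc_rule] 2[THEN assoc_rule] 3[THEN assoc_rule] mult.assoc power_add power_one_right)
qed

lemma a_nf: "a * nf (i, k, l, j, d) = nf (1 + (r - 1) * i, 1 + k, l, (if \<epsilon> then q div 2 else 0) + j, d)"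
proof -
  have 1: "w * y ^ i = y ^ ((r - 1) * i) * w" "w * v ^ k = v ^ k * w" "w * u ^ l = u ^ l * w"
    using intertwine_power[OF wy] intertwine_power[OF wv] intertwine_power[OF wu] y'_pow by simp_all
  have 2: "v * y ^ n = y ^ n * v" for n using intertwine_power[of v y y n] yv by simp
  have 3: "w * (c * b) ^ j = (c * b) ^ ((if \<epsilon> then q div 2 else 0) + j)"
    by (simp add: twist_def power_add)
  have "a * nf (i, k, l, j, d) = v * (y * y ^ ((r - 1) * i)) * (v ^ k * (u ^ l * (w * (c * b) ^ j * b ^ d)))"
    by (simp only: nf.simps mult.assoc 1[THEN assoc_rule])
  also have "v * (y * y ^ ((r - 1) * i)) = y ^ (1 + (r - 1) * i) * v"
    using 2[of "1 + (r - 1) * i"] by simp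
  finally show ?thesis unfolding 3 by (simp only: nf.simps mult.assoc power_add power_one_right)
qed

lemma ev_nf: assumes "q > 0" shows "ev a b c x = nf (cube_run r q \<epsilon> x)"
proof (induction x)
  case Nil
  then show ?case by (simp add: cube_run_def)
next
  case (Cons z x)
  obtain i k l j d where e: "cube_run r q \<epsilon> x = (i, k, l, j, d)" by (metis prod_cases5)
  have run: "cube_run r q \<epsilon> (z # x) = cube_step r q \<epsilon> z (i, k, l, j, d)"
    using e by (simp add: cube_run_def)
  have "ev a b c (z # x) = letter_val a b c z * nf (i, k, l, j, d)" using Cons e by simp
  then show ?case
    unfolding run by (cases z) (simp_all only: letter_val.simps cube_step.simps a_nf b_nf[OF assms] c_nf[OF assms])
qed

lemma power_of_one: "g ^ n = (1 :: 'g::monoid_mult) \<Longrightarrow> n dvd m \<Longrightarrow> g ^ m = 1"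
  by (auto simp: power_mult elim!: dvdE)

lemma nf_trivial: "trivial_exponents r q e \<Longrightarrow> nf e = 1"
proof -
  obtain i k l j d where e: "e = (i, k, l, j, d)" by (metis prod_cases5)
  assume "trivial_exponents r q e"
  then have "y ^ i = 1" "v ^ k = 1" "u ^ l = 1" "(c * b) ^ j = 1" "b ^ d = 1"
    using power_of_one[OF yr, of i] power_of_one[of v 2 k] power_of_one[of u 2 l] power_of_one[OF tq, of j]
      power_of_one[of b 2 d] vv uu bb by (simp_all add: e power2_eq_square)
  then show ?thesis by (simp add: e)
qed

definition hf :: "nat \<Rightarrow> nat \<Rightarrow> nat \<Rightarrow> 'x perm" where
  "hf i k l = y ^ i * (v ^ k * u ^ l)"

lemma nf_hf: "nf (i, k, l, j, d) = hf i k l * ((c * b) ^ j * b ^ d)"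
  by (simp add: hf_def mult.assoc)

end

text \<open>Uniqueness of normal forms as an assumption. It is discharged by counting when a tight
  triple is given, and by looking at moved points for the permutation model.\<close>

locale cube_exact = cube_structure b c v u y y' r q \<epsilon>
  for b c v u y y' :: "'x perm" and r q \<epsilon> +
  assumes exact: "nf e = 1 \<Longrightarrow> trivial_exponents r q e" and q_pos: "q > 0"
begin

lemma word_kernel_eq: "word_kernel a b c = cube_kernel r q \<epsilon>"
  unfolding word_kernel_def cube_kernel_def ev_nf[OF q_pos] using exact nf_trivial by blast

lemma s_even: "s ^ (2 * n) = hf (2 * n) n n"
proof -
  have "s ^ (2 * n) = (v * u * (y * y)) ^ n" by (simp only: power_mult s2)
  also have "\<dots> = (v * u) ^ n * (y * y) ^ n" by (rule mult_power_commuting) (simp add: rules)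
  also have "(v * u) ^ n = v ^ n * u ^ n" by (rule mult_power_commuting) (simp add: uv)
  also have "(y * y) ^ n = y ^ (2 * n)" by (simp add: power_mult power2_eq_square)
  also have "v ^ n * u ^ n * y ^ (2 * n) = y ^ (2 * n) * (v ^ n * u ^ n)"
  proof -
    have 1: "y * v ^ n = v ^ n * y" "y * u ^ n = u ^ n * y"
      using intertwine_power[OF yv] intertwine_power[OF yu] by simp_all
    have "y * (v ^ n * u ^ n) = (v ^ n * u ^ n) * y" using 1 by (metis mult.assoc)
    then have "y ^ (2 * n) * (v ^ n * u ^ n) = (v ^ n * u ^ n) * y ^ (2 * n)" by (rule power_commute_elem)
    then show ?thesis by simp
  qed
  finally show ?thesis by (simp only: hf_def)
qed

lemma s_odd: "s ^ (2 * n + 1) = hf (2 * n + 1) (n + 1) n * (w * b)"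
proof -
  have 1: "u ^ n * v = v * u ^ n" "v ^ n * y = y * v ^ n" "u ^ n * y = y * u ^ n"
    using power_commute_elem[OF uv] intertwine_power[OF yv, of n] intertwine_power[OF yu, of n] by simp_all
  have "s ^ (2 * n + 1) = hf (2 * n) n n * (v * y * w * b)"
    by (simp only: power_add power_one_right s_even)
  also have "\<dots> = y ^ (2 * n) * (v ^ n * (u ^ n * (v * (y * (w * b)))))"
    by (simp only: hf_def mult.assoc)
  also have "\<dots> = y ^ (2 * n) * (v ^ n * (v * (u ^ n * (y * (w * b)))))"
    by (simp only: 1(1)[THEN assoc_rule] mult.assoc)
  also have "\<dots> = y ^ (2 * n) * (v ^ n * (v * (y * (u ^ n * (w * b)))))"
    by (simp only: 1(3)[THEN assoc_rule] mult.assoc)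
  also have "\<dots> = y ^ (2 * n) * (v ^ n * (y * (v * (u ^ n * (w * b)))))"
    by (simp only: yv[symmetric, THEN assoc_rule] mult.assoc)
  also have "\<dots> = y ^ (2 * n) * (y * (v ^ n * (v * (u ^ n * (w * b)))))"
    by (simp only: 1(2)[THEN assoc_rule] mult.assoc)
  finally show ?thesis by (simp only: hf_def power_add power_one_right mult.assoc)
qed

lemma exact_hf: "hf i k l * ((c * b) ^ j * b ^ d) = 1 \<Longrightarrow> r dvd i \<and> even k \<and> even l \<and> q dvd j \<and> even d"
  using exact[of "(i, k, l, j, d)"] unfolding nf_hf by simp

lemma hf_trivial: "r dvd i \<Longrightarrow> even k \<Longrightarrow> even l \<Longrightarrow> hf i k l = 1"
  using nf_trivial[of "(i, k, l, 0, 0)"] unfolding nf_hf by simp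

text \<open>Uniqueness of normal forms says that the part generated by \<open>y\<close>,
  \<open>v\<close>, \<open>u\<close> meets \<open>dih c b\<close> only in the identity.\<close>

lemma hf_eq_E:
  assumes "hf i k l * e = e'" "e \<in> dih c b" "e' \<in> dih c b" "dihedral c b q"
  shows "r dvd i" "even k" "even l" "e = e'"
proof -
  interpret E: dihedral c b q by (fact assms(4))
  have 1: "hf i k l * (e * inverse e') = 1"
    by (simp only: mult.assoc[symmetric] assms(1) perm_right_inverse)
  have "e * inverse e' \<in> dih c b" using assms(2,3) E.dih_mult E.dih_inverse by blast
  then obtain j where "e * inverse e' = (c * b) ^ j \<or> e * inverse e' = (c * b) ^ j * b"
    unfolding dih_def by blast
  then have "e * inverse e' = (c * b) ^ j * b ^ 0 \<or> e * inverse e' = (c * b) ^ j * b ^ 1" by simp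
  then obtain d where "hf i k l * ((c * b) ^ j * b ^ d) = 1" using 1 by metis
  then show t: "r dvd i" "even k" "even l" using exact_hf by blast+
  then have "hf i k l = 1" by (rule hf_trivial)
  then show "e = e'" using assms(1) by simp
qed

lemma dihedral_cb: "dihedral c b q"
proof
  have h: "hf 0 0 0 = 1" by (rule hf_trivial) simp_all
  show "(c * b) ^ i = 1 \<longleftrightarrow> q dvd i" for i
    using exact_hf[of 0 0 0 i 0] nf_trivial[of "(0, 0, 0, i, 0)"] unfolding nf_hf h by auto
  show "(c * b) ^ i \<noteq> b" for i
  proof
    assume "(c * b) ^ i = b"
    then have "(c * b) ^ i * b = b * b" by (rule arg_cong)
    then have "hf 0 0 0 * ((c * b) ^ i * b ^ 1) = 1" unfolding h by (simp only: bb mult_1 power_one_right)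
    then show False using exact_hf by fastforce
  qed
qed (fact bb cc q_pos)+

text \<open>In the normal form of an odd power of \<open>s\<close> the exponents of \<open>v\<close>
  and \<open>u\<close> have different parity, so it is never in \<open>dih c b\<close>; an even
  power is in \<open>dih c b\<close> only if it is trivial. This gives the order of \<open>s\<close>
  and the intersection condition. The factorisation exists because \<open>y\<close> and
  \<open>v * u\<close> are powers of \<open>s\<close> and \<open>v\<close> is \<open>a * y\<close>
  times the twist.\<close>

lemma tight_triple: "tight_triple a b c (4 * r) q"
proof -
  interpret E: dihedral c b q by (rule dihedral_cb)
  have q2: "2 \<le> q" using q3 q_pos by (auto elim!: dvdE)
  have aa: "a * a = 1" by (simp add: twist_rules)
  have ca: "c * a = a * c" by (simp add: twist_rules)
  have parity: "\<exists>n. i = 2 * n \<or> i = 2 * n + 1" for i :: nat by presburger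
  have wE: "w \<in> dih c b" by (auto simp: twist_def intro: dihI(1) E.dih_1)
  have sE: "(\<exists>n. i = 2 * n \<and> s ^ i = hf (2 * n) n n) \<or>
      (\<exists>n. i = 2 * n + 1 \<and> s ^ i = hf (2 * n + 1) (n + 1) n * (w * b))" for i
    using parity[of i] s_even s_odd by metis
  have wbE: "w * b \<in> dih c b" using wE E.dih_y E.dih_mult by blast
  have dih_Int: "dih a b \<inter> dih c b \<subseteq> {1, b}"
  proof
    fix g assume "g \<in> dih a b \<inter> dih c b"
    then have gD: "g \<in> dih a b" and gE: "g \<in> dih c b" by simp_all
    obtain i where "g = s ^ i \<or> g = s ^ i * b" using gD unfolding dih_def by blast
    then obtain e where e: "s ^ i * e = g" "e = 1 \<or> e = b" by (metis mult.right_neutral)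
    then have eE: "e \<in> dih c b" using E.dih_1 E.dih_y by auto
    from sE[of i] have "e = g"
    proof
      assume "\<exists>n. i = 2 * n \<and> s ^ i = hf (2 * n) n n"
      then obtain n where n: "s ^ i = hf (2 * n) n n" by blast
      show "e = g" using hf_eq_E(4)[OF e(1)[unfolded n] eE gE dihedral_cb] .
    next
      assume "\<exists>n. i = 2 * n + 1 \<and> s ^ i = hf (2 * n + 1) (n + 1) n * (w * b)"
      then obtain n where n: "s ^ i = hf (2 * n + 1) (n + 1) n * (w * b)" by blast
      have "w * b * e \<in> dih c b" using wbE eE E.dih_mult by blast
      then have "even (n + 1)" "even n"
        using hf_eq_E(2,3)[OF e(1)[unfolded n mult.assoc[of "hf (2 * n + 1) (n + 1) n"]] _ gE dihedral_cb] by blast+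
      then show "e = g" by simp
    qed
    then show "g \<in> {1, b}" using e(2) by auto
  qed
  have s_ord: "s ^ i = 1 \<longleftrightarrow> 4 * r dvd i" for i
    using sE[of i]
  proof
    assume "\<exists>n. i = 2 * n \<and> s ^ i = hf (2 * n) n n"
    then obtain n where n: "i = 2 * n" "s ^ i = hf (2 * n) n n" by blast
    have "s ^ i = 1 \<longleftrightarrow> r dvd 2 * n \<and> even n"
      unfolding n(2) using exact_hf[of "2 * n" n n 0 0] hf_trivial[of "2 * n" n n] by auto
    also have "r dvd 2 * n \<longleftrightarrow> r dvd n" using r_odd coprime_dvd_mult_right_iff[of r 2 n] by simp
    also have "r dvd n \<and> even n \<longleftrightarrow> 2 * r dvd n"
      using r_odd by (metis coprime_left_2_iff_odd divides_mult dvd_mult_left dvd_mult_right)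
    also have "\<dots> \<longleftrightarrow> 2 * (2 * r) dvd 2 * n" by simp
    finally show ?thesis by (simp add: n(1))
  next
    assume "\<exists>n. i = 2 * n + 1 \<and> s ^ i = hf (2 * n + 1) (n + 1) n * (w * b)"
    then obtain n where n: "i = 2 * n + 1" "s ^ i = hf (2 * n + 1) (n + 1) n * (w * b)" by blast
    have "s ^ i \<noteq> 1"
    proof
      assume "s ^ i = 1"
      then have "even (n + 1)" "even n"
        using hf_eq_E(2,3)[OF _ wbE E.dih_1 dihedral_cb] n(2) by metis+
      then show False by simp
    qed
    moreover have "\<not> 4 * r dvd i"
    proof
      assume "4 * r dvd i"
      moreover have "2 dvd 4 * r" by simp
      ultimately have "even i" using dvd_trans by blast
      then show False using n(1) by simp
    qed
    ultimately show ?thesis by simp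
  qed
  have s_not_refl: "s ^ i \<noteq> b" for i
  proof
    assume sb: "s ^ i = b"
    from sE[of i] show False
    proof
      assume "\<exists>n. i = 2 * n \<and> s ^ i = hf (2 * n) n n"
      then obtain n where n: "s ^ i = hf (2 * n) n n" by blast
      have "hf (2 * n) n n * 1 = b" unfolding n[symmetric] mult_1_right by (rule sb)
      from hf_eq_E(4)[OF this E.dih_1 E.dih_y dihedral_cb] have "(c * b) ^ 0 = b" by simp
      then show False using E.not_refl by blast
    next
      assume "\<exists>n. i = 2 * n + 1 \<and> s ^ i = hf (2 * n + 1) (n + 1) n * (w * b)"
      then obtain n where n: "s ^ i = hf (2 * n + 1) (n + 1) n * (w * b)" by blast
      have 1: "hf (2 * n + 1) (n + 1) n * (w * b) = b" unfolding n[symmetric] by (rule sb)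
      from hf_eq_E(2,3)[OF 1 wbE E.dih_y dihedral_cb] show False by simp
    qed
  qed
  have rp: "4 * r > 0" using r_pos by simp
  interpret D: dihedral a b "4 * r" using aa bb rp s_ord s_not_refl by (intro dihedral.intro)
  have ev_dih: "\<exists>d\<in>dih a b. \<exists>e\<in>dih c b. ev a b c x = d * e" for x
  proof -
    obtain i k l j d where run: "cube_run r q \<epsilon> x = (i, k, l, j, d)" by (metis prod_cases5)
    obtain n where n: "s ^ (4 * n) = y" using y_eq_pow_s by blast
    have yD: "y ^ i \<in> dih a b" for i
      using dihI(1)[of a b "4 * n * i"] n by (simp add: power_mult)
    have zD: "v * u \<in> dih a b" using dihI(1)[of a b "2 * r"] s2r by simp
    have v_eq: "v = a * y * w" by (simp add: twist_rules)
    have ayD: "a * y \<in> dih a b" using D.dih_mult[OF D.dih_x yD[of 1]] by simp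
    have pw: "g ^ m = (if even m then 1 else g)" if "g * g = 1" for g :: "'x perm" and m
      using that by (induction m) auto
    have vu: "\<exists>d\<in>dih a b. \<exists>e\<in>dih c b. v ^ k * u ^ l = d * e"
    proof -
      \<comment> \<open>\<open>u\<close> is the rotation \<open>v * u\<close> followed by
        \<open>v\<close>, so the factorisation of \<open>v\<close> yields one of
        \<open>u\<close>.\<close>
      have "v * u * v = u" using uv vv by (metis mult.assoc mult.right_neutral)
      then have "u = v * u * (a * y) * w" using v_eq by (metis mult.assoc)
      moreover have "v * u * (a * y) \<in> dih a b" using D.dih_mult zD ayD by blast
      ultimately have u: "\<exists>d\<in>dih a b. \<exists>e\<in>dih c b. u = d * e" using wE by blast
      have v: "\<exists>d\<in>dih a b. \<exists>e\<in>dih c b. v = d * e" using v_eq ayD wE by blast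
      have "\<exists>d\<in>dih a b. \<exists>e\<in>dih c b. v * u = d * e" using zD E.dih_1 by (metis mult.right_neutral)
      moreover have "\<exists>d\<in>dih a b. \<exists>e\<in>dih c b. 1 = d * e" using D.dih_1 E.dih_1 by (metis mult.right_neutral)
      ultimately show ?thesis using u v by (simp add: pw[OF vv] pw[OF uu])
    qed
    then obtain d1 e1 where de: "d1 \<in> dih a b" "e1 \<in> dih c b" "v ^ k * u ^ l = d1 * e1" by blast
    have "(c * b) ^ j * b ^ d \<in> dih c b" using pw[OF bb, of d] dihI[of c b j] by simp
    moreover have "ev a b c x = y ^ i * d1 * (e1 * ((c * b) ^ j * b ^ d))"
      unfolding ev_nf[OF q_pos] run using de(3) by (simp add: mult.assoc) (metis mult.assoc)
    ultimately show ?thesis using D.dih_mult[OF yD de(1)] E.dih_mult[OF de(2)] by blast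
  qed
  show ?thesis
  proof
    show "2 \<le> 4 * r" using rp by simp
    show "dih a b \<inter> dih c b \<subseteq> {1, b}" by (rule dih_Int)
    show "\<exists>d\<in>dih a b. \<exists>e\<in>dih c b. ev a b c x = d * e" for x by (rule ev_dih)
  qed (fact aa bb cc ca q2 s_ord E.ord s_not_refl E.not_refl)+
qed

lemma ev_s_pow: "ev a b c (concat (replicate n [R0, R1])) = s ^ n"
  by (induction n) (simp_all add: ev_append mult.assoc)

lemma ev_t_pow: "ev a b c (concat (replicate n [R2, R1])) = (c * b) ^ n"
  by (induction n) (simp_all add: ev_append mult.assoc)

lemma nonorientable: "nonorientable_triple a b c"
proof -
  obtain k where k: "a = s ^ (2 * r) * c * s ^ (2 * r) * c * s ^ (4 * k) * w" using a_word by blast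
  define x where "x = concat (replicate (2 * r) [R0, R1]) @ [R2] @ concat (replicate (2 * r) [R0, R1]) @ [R2] @
      concat (replicate (4 * k) [R0, R1]) @ concat (replicate (if \<epsilon> then q div 2 else 0) [R2, R1])"
  have len: "even (length (concat (replicate n [z, z'])))" for n and z z' :: letter
    by (induction n) auto
  have "ev a b c x = s ^ (2 * r) * (c * (s ^ (2 * r) * (c * (s ^ (4 * k) * w))))"
    unfolding x_def ev_append ev_s_pow ev_t_pow by (simp add: twist_def)
  then have "ev a b c x = a" using k by (simp only: mult.assoc)
  then have "ev a b c (R0 # x) = a * a" by simp
  also have "\<dots> = 1" by (simp add: twist_rules)
  finally have "ev a b c (R0 # x) = 1" .
  moreover have "odd (length (R0 # x))" unfolding x_def using len by simp
  ultimately show ?thesis unfolding nonorientable_triple_def by blast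
qed

end

text \<open>Every group element has a normal form with reduced exponents. There are
  \<open>r * 2 * 2 * q * 2\<close> of these, exactly the order \<open>2 * (4 * r) * q\<close> of the
  group, so normal forms are unique and determine which words are trivial.\<close>

lemma cube_like_kernel:
  assumes "tight_triple (a :: 'x perm) b c (4 * r) q" "cube_like a b c r q \<epsilon>"
  shows "word_kernel a b c = cube_kernel r q \<epsilon>"
proof -
  interpret T: tight_triple a b c "4 * r" q by (fact assms(1))
  have tq: "(c * b) ^ q = 1" using T.t_ord by simp
  obtain v y where S: "cube_structure b c v (b * v * b) y (inverse y) r q \<epsilon>" and a: "a = v * y * twist b c q \<epsilon>"
    using cube_like_structure[OF T.bb T.cc assms(2) tq] by blast
  define u where "u = b * v * b"
  interpret S: cube_structure b c v u y "inverse y" r q \<epsilon> unfolding u_def by (fact S)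
  have q: "q > 0" using T.q_ge by simp
  define X where "X = {..<r} \<times> {..<2::nat} \<times> {..<2::nat} \<times> {..<q} \<times> {..<2::nat}"
  define md where "md = (\<lambda>(i :: nat, k :: nat, l :: nat, j :: nat, d :: nat). (i mod r, k mod 2, l mod 2, j mod q, d mod 2))"
  have pm: "g ^ (m mod n) = g ^ m" if "g ^ n = 1" for g :: "'x perm" and m n
  proof -
    have "g ^ m = g ^ (n * (m div n) + m mod n)" by simp
    also have "\<dots> = g ^ (m mod n)" by (simp only: power_add power_mult that power_one mult_1)
    finally show ?thesis by simp
  qed
  have md: "S.nf (md e) = S.nf e" for e
  proof -
    obtain i k l j d where e: "e = (i, k, l, j, d)" by (metis prod_cases5)
    show ?thesis unfolding e md_def
      using pm[OF S.yr] pm[OF tq] pm[of v 2] pm[of u 2] pm[of b 2] S.vv S.uu S.bb by (simp add: power2_eq_square)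
  qed
  have mdX: "md e \<in> X" for e
    using q S.r_pos by (cases e) (auto simp: md_def X_def)
  have G: "T.G = S.nf ` X"
  proof
    show "T.G \<subseteq> S.nf ` X"
    proof
      fix g assume "g \<in> T.G"
      then obtain x where "g = ev a b c x" by (auto simp: T.G_def)
      then have "g = S.nf (md (cube_run r q \<epsilon> x))" using S.ev_nf[OF q] md a by simp
      then show "g \<in> S.nf ` X" using mdX by blast
    qed
    have wG: "twist b c q \<epsilon> \<in> T.G" by (rule T.twist_G)
    obtain k where "S.s ^ (4 * k) = y" using S.y_eq_pow_s by blast
    then have yG: "y \<in> T.G" using T.pow_G[OF T.mult_G[OF T.a_G T.b_G]] a by metis
    have "v = a * twist b c q \<epsilon> * inverse y" unfolding a by (simp add: mult.assoc S.w2)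
    then have vG: "v \<in> T.G" using T.mult_G T.a_G wG T.inverse_G yG by metis
    then have uG: "u \<in> T.G" unfolding u_def by (intro T.mult_G T.b_G)
    show "S.nf ` X \<subseteq> T.G"
      using yG vG uG by (auto simp: X_def intro!: T.mult_G T.pow_G T.b_G T.c_G)
  qed
  have "card X = card (S.nf ` X)" unfolding G[symmetric] T.card_G by (simp add: X_def card_cartesian_product)
  moreover have "finite X" by (simp add: X_def)
  ultimately have inj: "inj_on S.nf X" by (metis eq_card_imp_inj_on)
  interpret X: cube_exact b c v u y "inverse y" r q \<epsilon>
  proof
    fix e assume "S.nf e = 1"
    then have "S.nf (md e) = S.nf (0, 0, 0, 0, 0)" using md by simp
    moreover have "(0, 0, 0, 0, 0) \<in> X" using q S.r_pos by (simp add: X_def)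
    ultimately have "md e = (0, 0, 0, 0, 0)" using inj_onD[OF inj _ mdX] by blast
    then show "trivial_exponents r q e" by (cases e) (auto simp: md_def)
  qed (fact q)
  show ?thesis using X.word_kernel_eq a by simp
qed

section \<open>Permutation models\<close>

text \<open>Three actions side by side on three copies of the integers, so that each can detect a
  different part of the normal form.\<close>

definition blocks :: "(int \<Rightarrow> int) \<Rightarrow> (int \<Rightarrow> int) \<Rightarrow> (int \<Rightarrow> int) \<Rightarrow> nat \<times> int \<Rightarrow> nat \<times> int" where
  "blocks f g h z = (fst z, if fst z = 0 then f (snd z) else if fst z = 1 then g (snd z)
     else if fst z = 2 then h (snd z) else snd z)"

lemma blocks_simps [simp]:
  "blocks f g h (0, x) = (0, f x)" "blocks f g h (Suc 0, x) = (Suc 0, g x)" "blocks f g h (2, x) = (2, h x)"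
  by (simp_all add: blocks_def)

lemma perm_block_eqI:
  assumes "\<And>x. apply g (0, x) = apply h (0, x)" "\<And>x. apply g (Suc 0, x) = apply h (Suc 0, x)"
    "\<And>x. apply g (2, x) = apply h (2, x)" "\<And>k x. k > 2 \<Longrightarrow> apply g (k, x) = apply h (k, x)"
  shows "g = (h :: (nat \<times> int) perm)"
proof (rule perm_eqI)
  fix z :: "nat \<times> int"
  obtain k x where z: "z = (k, x)" by (cases z)
  have "k = 0 \<or> k = Suc 0 \<or> k = 2 \<or> k > 2" by auto
  then show "apply g z = apply h z" using assms z by auto
qed

lemma blocks_outside: "k > 2 \<Longrightarrow> blocks f g h (k, x) = (k, x)"
  by (simp add: blocks_def)

lemma apply_block_perm:
  assumes "\<And>x. f (f' x) = x" "\<And>x. f' (f x) = x" "\<And>x. g (g' x) = x" "\<And>x. g' (g x) = x"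
    "\<And>x. h (h' x) = x" "\<And>x. h' (h x) = x"
    and fin: "\<And>x. f x \<noteq> x \<Longrightarrow> x \<in> {0..<N}" "\<And>x. g x \<noteq> x \<Longrightarrow> x \<in> {0..<N}" "\<And>x. h x \<noteq> x \<Longrightarrow> x \<in> {0..<N}"
  shows "apply (Perm (blocks f g h)) = blocks f g h"
proof (rule Perm_inverse)
  have "blocks f g h (blocks f' g' h' z) = z" "blocks f' g' h' (blocks f g h z) = z" for z
    by (simp_all add: blocks_def assms prod_eq_iff)
  then have "bij (blocks f g h)" by (intro o_bij[of "blocks f' g' h'"]) auto
  moreover have "{z. blocks f g h z \<noteq> z} \<subseteq> {0..2} \<times> {0..<N}"
  proof
    fix z assume "z \<in> {z. blocks f g h z \<noteq> z}"
    then have "fst z = 0 \<and> f (snd z) \<noteq> snd z \<or> fst z = 1 \<and> g (snd z) \<noteq> snd z \<or> fst z = 2 \<and> h (snd z) \<noteq> snd z"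
      by (auto simp: blocks_def prod_eq_iff split: if_splits)
    then show "z \<in> {0..2} \<times> {0..<N}" using fin by (auto simp: mem_Times_iff)
  qed
  then have "finite {z. blocks f g h z \<noteq> z}" by (rule finite_subset) simp
  ultimately show "blocks f g h \<in> {f. bij f \<and> finite {a. f a \<noteq> a}}" by simp
qed

text \<open>Residues modulo \<open>n\<close> are represented by \<open>0, ..., n - 1\<close>; all
  other integers are fixed in order to keep the support finite.\<close>

definition refl_mod :: "int \<Rightarrow> int \<Rightarrow> int \<Rightarrow> int" where
  "refl_mod n k x = (if 0 \<le> x \<and> x < n then (k - x) mod n else x)"

definition rot_mod :: "int \<Rightarrow> int \<Rightarrow> int \<Rightarrow> int" where
  "rot_mod n k x = (if 0 \<le> x \<and> x < n then (x + k) mod n else x)"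

lemma refl_refl: "refl_mod n k (refl_mod n l x) = rot_mod n (k - l) x"
  by (auto simp: refl_mod_def rot_mod_def mod_simps algebra_simps)

lemma rot_rot: "rot_mod n k (rot_mod n l x) = rot_mod n (k + l) x"
  by (auto simp: rot_mod_def mod_simps algebra_simps)

lemma refl_rot: "refl_mod n k (rot_mod n l x) = refl_mod n (k - l) x"
  by (auto simp: rot_mod_def refl_mod_def mod_simps algebra_simps)

lemma rot_refl: "rot_mod n k (refl_mod n l x) = refl_mod n (k + l) x"
  by (auto simp: rot_mod_def refl_mod_def mod_simps algebra_simps)

lemma rot_0: "rot_mod n 0 x = x"
  by (simp add: rot_mod_def)

lemma refl_involution: "refl_mod n k (refl_mod n k x) = x"
  by (simp add: refl_refl rot_0)

lemma mod_support: "refl_mod n k x \<noteq> x \<Longrightarrow> 0 \<le> x \<and> x < n" "rot_mod n k x \<noteq> x \<Longrightarrow> 0 \<le> x \<and> x < n"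
  by (auto simp: refl_mod_def rot_mod_def split: if_splits)

text \<open>On the four points \<open>0, \<dots>, 3\<close> the group acts as the group of the hemicube, with \<open>v\<close> in the
  Klein four-group.\<close>

definition v4 :: "int \<Rightarrow> int" where
  "v4 x = (if x = 0 then 1 else if x = 1 then 0 else if x = 2 then 3 else if x = 3 then 2 else x)"

definition b4 :: "int \<Rightarrow> int" where
  "b4 x = (if x = 1 then 2 else if x = 2 then 1 else x)"

definition c4 :: "int \<Rightarrow> int" where
  "c4 x = (if x = 2 then 3 else if x = 3 then 2 else x)"

lemma four_point_relations:
  "v4 (v4 x) = x" "b4 (b4 x) = x" "c4 (c4 x) = x" "c4 (v4 x) = v4 (c4 x)"
  "b4 (v4 (b4 (v4 x))) = v4 (b4 (v4 (b4 x)))" "v4 (c4 (b4 (v4 (b4 (c4 x))))) = b4 (v4 (b4 x))"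
  "c4 (b4 (c4 (b4 (c4 (b4 x))))) = x"
  by (simp_all add: v4_def b4_def c4_def)

lemma apply_power_fixed: "apply g z = z \<Longrightarrow> apply (g ^ n) z = z"
  by (induction n) (simp_all add: apply_times)

text \<open>Block 0 carries the symmetric group on four points, block 1 the dihedral group of
  \<open>b\<close> and \<open>c\<close> on the residues modulo \<open>q\<close>, and block 2 the
  dihedral group of \<open>y\<close> and \<open>b\<close> on the residues modulo \<open>r\<close>.
  Uniqueness of normal forms is read off block by block: block 1 determines \<open>j\<close> and
  \<open>d\<close>, block 0 then \<open>k\<close> and \<open>l\<close>, and block 2 finally
  \<open>i\<close>.\<close>

lemma cube_model:
  assumes q: "q > 0" "3 dvd q" and r: "odd r" and \<epsilon>: "\<epsilon> \<Longrightarrow> even q"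
    and cond: "r \<noteq> 1 \<Longrightarrow> \<epsilon> \<and> odd (q div 2)"
  shows "\<exists>(a :: (nat \<times> int) perm) b c. tight_triple a b c (4 * r) q \<and> nonorientable_triple a b c \<and>
    cube_like a b c r q \<epsilon>"
proof -
  have q3: "3 \<le> q" using q by (auto elim!: dvdE)
  have rp: "r > 0" using r by (rule odd_pos)
  \<comment> \<open>Any common bound on the points moved in the three blocks would do.\<close>
  define N :: int where "N = 4 + int q + int r"
  define v where "v = Perm (blocks v4 id id)"
  define b where "b = Perm (blocks b4 (refl_mod q 0) (refl_mod r 0))"
  define c where "c = Perm (blocks c4 (refl_mod q 1) id)"
  define y where "y = Perm (blocks id id (rot_mod r 1))"
  have app_v: "apply v = blocks v4 id id"
    unfolding v_def by (rule apply_block_perm[where N = N and f' = "v4" and g' = "id" and h' = "id"])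
      (auto simp: four_point_relations N_def v4_def split: if_splits)
  have app_b: "apply b = blocks b4 (refl_mod q 0) (refl_mod r 0)"
    unfolding b_def by (rule apply_block_perm[where N = N and f' = "b4" and g' = "refl_mod q 0" and h' = "refl_mod r 0"])
      (auto simp: four_point_relations refl_involution N_def b4_def dest!: mod_support split: if_splits)
  have app_c: "apply c = blocks c4 (refl_mod q 1) id"
    unfolding c_def by (rule apply_block_perm[where N = N and f' = "c4" and g' = "refl_mod q 1" and h' = "id"])
      (auto simp: four_point_relations refl_involution N_def c4_def dest!: mod_support split: if_splits)
  have app_y: "apply y = blocks id id (rot_mod r 1)"
    unfolding y_def by (rule apply_block_perm[where N = N and f' = "id" and g' = "id" and h' = "rot_mod r (- 1)"])
      (auto simp: rot_rot rot_0 N_def dest!: mod_support)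
  note app = app_v app_b app_c app_y
  note eqs = app apply_times blocks_outside four_point_relations refl_involution refl_refl rot_rot refl_rot rot_refl rot_0
  have bb: "b * b = 1" and cc: "c * c = 1" and vv: "v * v = 1" and cv: "c * v = v * c"
    and uv: "b * v * b * v = v * (b * v * b)" and cu: "c * (v * (b * v * b)) * c = b * v * b"
    and cy: "c * y = y * c" and yv: "y * v = v * y" and byby: "b * y * b * y = 1"
    by (rule perm_block_eqI; simp add: eqs)+
  have t1: "apply ((c * b) ^ n) (Suc 0, x) = (Suc 0, rot_mod q n x)" for n x
    by (induction n) (simp_all add: eqs add.commute)
  have y2: "apply (y ^ n) (2, x) = (2, rot_mod r n x)" for n x
    by (induction n) (simp_all add: eqs add.commute)
  have t0: "apply ((c * b) ^ 3) (0, x) = (0, x)" for x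
    by (simp add: eqs power3_eq_cube)
  have t2: "apply ((c * b) ^ 2) (2, x) = (2, x)" for x
    by (simp add: eqs power2_eq_square)
  have tk: "apply (c * b) (k, x) = (k, x)" if "k > 2" for k x
    using that by (simp add: eqs)
  have yr: "y ^ r = 1"
  proof (rule perm_block_eqI)
    show "apply (y ^ r) (2, x) = apply 1 (2, x)" for x
      using rp by (simp add: y2 rot_mod_def)
  qed (simp_all add: apply_power_fixed eqs)
  have tq: "(c * b) ^ q = 1"
  proof (rule perm_block_eqI)
    fix x
    obtain m where "q = 3 * m" using q(2) by (rule dvdE)
    then show "apply ((c * b) ^ q) (0, x) = apply 1 (0, x)"
      using apply_power_fixed[OF t0, of m x] by (simp add: power_mult)
    show "apply ((c * b) ^ q) (Suc 0, x) = apply 1 (Suc 0, x)"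
      using q(1) by (simp add: t1 rot_mod_def)
    \<comment> \<open>On this block \<open>t\<close> acts as the reflection \<open>b\<close>, so an
      even exponent is required unless the block is degenerate, which is the case
      \<open>r = 1\<close>.\<close>
    show "apply ((c * b) ^ q) (2, x) = apply 1 (2, x)"
    proof (cases "r = 1")
      case True
      then have "apply (c * b) (2, x) = (2, x)" by (auto simp: eqs refl_mod_def)
      then show ?thesis using apply_power_fixed by simp
    next
      case False
      then obtain m where "q = 2 * m" using cond \<epsilon> by blast
      then show ?thesis using apply_power_fixed[OF t2, of m x] by (simp add: power_mult)
    qed
  next
    fix k x assume "2 < (k :: nat)"
    then show "apply ((c * b) ^ q) (k, x) = apply 1 (k, x)" using apply_power_fixed[OF tk] by simp
  qed
  define a where "a = v * y * twist b c q \<epsilon>"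
  have cube: "cube_like a b c r q \<epsilon>"
    unfolding cube_like_def using q(2) r \<epsilon> cond vv cv uv cu cy yv byby yr a_def by blast
  define u where "u = b * v * b"
  define y' where "y' = inverse y"
  have "cube_relations b c v u y y'"
    unfolding u_def y'_def using bb cc vv cv uv cu cy yv byby by (rule cube_relationsI)
  then interpret S: cube_structure b c v u y y' r q \<epsilon>
    using tq yr q(2) r \<epsilon> cond by (intro cube_structure.intro cube_structure_axioms.intro) auto
  have app_u: "apply u = blocks (b4 \<circ> v4 \<circ> b4) id id"
    by (simp add: fun_eq_iff u_def apply_times app blocks_def refl_involution)
  interpret X: cube_exact b c v u y y' r q \<epsilon>
  proof
    fix e assume "S.nf e = 1"
    obtain i k l j d where e: "e = (i, k, l, j, d)" by (metis prod_cases5)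
    have H: "y ^ i * (v ^ k * (u ^ l * ((c * b) ^ j * b ^ d))) = 1" using \<open>S.nf e = 1\<close> by (simp add: e)
    have fix1: "apply (y ^ n) (Suc 0, x) = (Suc 0, x)" "apply (v ^ n) (Suc 0, x) = (Suc 0, x)"
      "apply (u ^ n) (Suc 0, x) = (Suc 0, x)" for n x
      by (rule apply_power_fixed, simp add: app app_u)+
    have parity: "g ^ n = (if even n then 1 else g)" if "g * g = 1" for g :: "(nat \<times> int) perm" and n
      using that by (induction n) auto
    have 1: "apply ((c * b) ^ j) (apply (b ^ d) (Suc 0, x)) = (Suc 0, x)" for x
    proof -
      have "\<exists>x'. apply (b ^ d) (Suc 0, x) = (Suc 0, x')" by (simp add: parity[OF bb] eqs)
      then obtain x' where x': "apply (b ^ d) (Suc 0, x) = (Suc 0, x')" by blast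
      have "apply (y ^ i * (v ^ k * (u ^ l * ((c * b) ^ j * b ^ d)))) (Suc 0, x) = (Suc 0, x)" using H by simp
      then show ?thesis unfolding apply_times comp_def x' t1 fix1 .
    qed
    have "q dvd j"
    proof -
      have "apply (b ^ d) (Suc 0, 0) = (Suc 0, 0)" by (simp add: parity[OF bb] eqs refl_mod_def)
      then have "rot_mod q j 0 = 0" using 1[of 0] by (simp add: t1)
      then have "int j mod int q = 0" using q(1) by (simp add: rot_mod_def)
      then show ?thesis by (metis of_nat_dvd_iff mod_0_imp_dvd)
    qed
    then have tj: "(c * b) ^ j = 1" using tq by (rule S.power_of_one[rotated])
    \<comment> \<open>Because \<open>q\<close> is at least 3, the residue 1 is moved by the
      reflection.\<close>
    have "even d"
    proof (rule ccontr)
      assume "odd d"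
      then have "refl_mod q 0 1 = 1" using 1[of 1] by (simp add: tj parity[OF bb] eqs)
      moreover have "(- 1) mod int q = int q - 1" using q(1) by (simp add: zmod_minus1)
      ultimately show False using q3 by (simp add: refl_mod_def)
    qed
    then have H': "y ^ i * (v ^ k * u ^ l) = 1" using H by (simp add: tj parity[OF bb])
    have "apply (y ^ i) (0, x) = (0, x)" for x by (rule apply_power_fixed) (simp add: app)
    moreover have "\<exists>x. apply (v ^ k * u ^ l) (0, 0) = (0, x)" by (simp add: parity[OF vv] parity[OF S.uu] eqs app_u)
    moreover have "apply (y ^ i) (apply (v ^ k * u ^ l) (0, 0)) = (0, 0)"
      using arg_cong[OF H', of "\<lambda>g. apply g (0, 0)"] by (simp add: apply_times)
    ultimately have "apply (v ^ k * u ^ l) (0, 0) = (0, 0)" by metis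
    then have kl: "even k \<and> even l"
      by (auto simp: parity[OF vv] parity[OF S.uu] eqs app_u v4_def b4_def split: if_splits)
    then have "y ^ i = 1" using H' by (simp add: parity[OF vv] parity[OF S.uu])
    then have "apply (y ^ i) (2, 0) = (2, 0)" by simp
    then have "int i mod int r = 0" using rp by (simp add: y2 rot_mod_def)
    then have "r dvd i" by (metis of_nat_dvd_iff mod_0_imp_dvd)
    then show "trivial_exponents r q e" using kl \<open>q dvd j\<close> \<open>even d\<close> by (simp add: e)
  qed (fact q(1))
  show ?thesis using X.tight_triple X.nonorientable cube unfolding a_def by blast
qed

section \<open>Flags of finite polyhedra\<close>

text \<open>Replaces the existence of an isomorphic graph by counting and connectedness conditions
  on the two layers. The hypotheses \<open>AB\<close> and \<open>BA\<close> exclude isolated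
  elements, so that an isomorphism cannot mix the layers.\<close>

lemma polygon_iff:
  fixes r :: "'a rel"
  assumes r: "r = Id_on (A \<union> B) \<union> {(x, y). x \<in> A \<and> y \<in> B \<and> (x, y) \<in> I}" and disj: "A \<inter> B = {}"
    and AB: "\<forall>x\<in>A. \<exists>y\<in>B. (x, y) \<in> I" and BA: "\<forall>y\<in>B. \<exists>x\<in>A. (x, y) \<in> I"
  defines "S \<equiv> {(x, x'). x \<in> A \<and> x' \<in> A \<and> (\<exists>y\<in>B. (x, y) \<in> I \<and> (x', y) \<in> I)}"
  shows "is_polygon r \<longleftrightarrow> A \<noteq> {} \<and> (\<forall>y\<in>B. card {x \<in> A. (x, y) \<in> I} = 2) \<and>
    (\<forall>x\<in>A. card {y \<in> B. (x, y) \<in> I} = 2) \<and> (\<forall>x\<in>A. \<forall>x'\<in>A. (x, x') \<in> S\<^sup>*)"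
    (is "_ \<longleftrightarrow> ?R")
proof
  have Field_r: "Field r = A \<union> B" unfolding r Field_def by auto
  have Field_inc: "Field (incidence_poset G) = gverts G <+> gedges G" for G :: "('a, 'a) multigraph"
    unfolding incidence_poset_def Field_def by auto
  {
    assume "is_polygon r"
    then obtain G :: "('a, 'a) multigraph" and f where G: "wf_multigraph G" "connected_multigraph G" "regular_multigraph 2 G"
      and f: "poset_iso_map r (incidence_poset G) f"
      unfolding is_polygon_def poset_isomorphic_def by blast
    have bij: "bij_betw f (A \<union> B) (gverts G <+> gedges G)"
      and ord: "\<And>x y. x \<in> A \<union> B \<Longrightarrow> y \<in> A \<union> B \<Longrightarrow> (x, y) \<in> r \<longleftrightarrow> (f x, f y) \<in> incidence_poset G"
      using f unfolding poset_iso_map_def Field_r Field_inc by blast+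
    have inj: "inj_on f (A \<union> B)" using bij by (rule bij_betw_imp_inj_on)
    have I_iff: "(x, y) \<in> I \<longleftrightarrow> (f x, f y) \<in> incidence_poset G" if "x \<in> A" "y \<in> B" for x y
      using ord[of x y] that disj unfolding r by auto
    \<comment> \<open>An element strictly below another one can only correspond to a vertex of the
      graph.\<close>
    have fA: "\<exists>p\<in>gverts G. f x = Inl p" if "x \<in> A" for x
    proof -
      obtain y where y: "y \<in> B" "(x, y) \<in> I" using AB \<open>x \<in> A\<close> by blast
      have "f x \<noteq> f y" using inj \<open>x \<in> A\<close> y(1) disj by (metis IntI UnI1 UnI2 empty_iff inj_onD)
      then show ?thesis using I_iff[OF \<open>x \<in> A\<close> y(1)] y(2) unfolding incidence_poset_def by auto
    qed
    have fB: "\<exists>e\<in>gedges G. f y = Inr e" if "y \<in> B" for y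
    proof -
      obtain x where x: "x \<in> A" "(x, y) \<in> I" using BA \<open>y \<in> B\<close> by blast
      have "f x \<noteq> f y" using inj \<open>y \<in> B\<close> x(1) disj by (metis IntI UnI1 UnI2 empty_iff inj_onD)
      then show ?thesis using I_iff[OF x(1) \<open>y \<in> B\<close>] x(2) unfolding incidence_poset_def by auto
    qed
    have ontoA: "\<exists>x\<in>A. f x = Inl p" if "p \<in> gverts G" for p
    proof -
      have "Inl p \<in> f ` (A \<union> B)" using bij that unfolding bij_betw_def by auto
      then show ?thesis using fB by force
    qed
    have ontoB: "\<exists>y\<in>B. f y = Inr e" if "e \<in> gedges G" for e
    proof -
      have "Inr e \<in> f ` (A \<union> B)" using bij that unfolding bij_betw_def by auto
      then show ?thesis using fA by force
    qed
    have inc: "(Inl p, Inr e) \<in> incidence_poset G \<longleftrightarrow> p \<in> gends G e" if "p \<in> gverts G" "e \<in> gedges G" for p e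
      using that unfolding incidence_poset_def by auto
    have injA: "inj_on f A" and injB: "inj_on f B" using inj by (auto simp: inj_on_def)
    have "A \<noteq> {}" using G(2) ontoA unfolding connected_multigraph_def by blast
    moreover have "card {x \<in> A. (x, y) \<in> I} = 2" if y: "y \<in> B" for y
    proof -
      obtain e where e: "e \<in> gedges G" "f y = Inr e" using fB y by blast
      have sub: "gends G e \<subseteq> gverts G" "card (gends G e) = 2" using G(1) e(1) unfolding wf_multigraph_def by blast+
      have "f ` {x \<in> A. (x, y) \<in> I} = Inl ` gends G e"
      proof
        show "f ` {x \<in> A. (x, y) \<in> I} \<subseteq> Inl ` gends G e"
          using fA I_iff[OF _ y] e inc by fastforce
        show "Inl ` gends G e \<subseteq> f ` {x \<in> A. (x, y) \<in> I}"
        proof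
          fix z :: "'a + 'a" assume "z \<in> Inl ` gends G e"
          then obtain p where p: "p \<in> gends G e" "z = Inl p" by blast
          then obtain x where x: "x \<in> A" "f x = Inl p" using ontoA sub(1) by blast
          then have "(x, y) \<in> I" using I_iff[OF x(1) y] inc[OF _ e(1)] p(1) e(2) sub(1) by auto
          then show "z \<in> f ` {x \<in> A. (x, y) \<in> I}" using x p(2) by force
        qed
      qed
      moreover have "card (f ` {x \<in> A. (x, y) \<in> I}) = card {x \<in> A. (x, y) \<in> I}"
        by (rule card_image) (rule inj_on_subset[OF injA], blast)
      ultimately show ?thesis using sub(2) by (simp add: card_image)
    qed
    moreover have "card {y \<in> B. (x, y) \<in> I} = 2" if x: "x \<in> A" for x
    proof -
      obtain p where p: "p \<in> gverts G" "f x = Inl p" using fA x by blast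
      have "f ` {y \<in> B. (x, y) \<in> I} = Inr ` {e \<in> gedges G. p \<in> gends G e}"
      proof
        show "f ` {y \<in> B. (x, y) \<in> I} \<subseteq> Inr ` {e \<in> gedges G. p \<in> gends G e}"
          using fB I_iff[OF x] p inc by fastforce
        show "Inr ` {e \<in> gedges G. p \<in> gends G e} \<subseteq> f ` {y \<in> B. (x, y) \<in> I}"
        proof
          fix z :: "'a + 'a" assume "z \<in> Inr ` {e \<in> gedges G. p \<in> gends G e}"
          then obtain e where e: "e \<in> gedges G" "p \<in> gends G e" "z = Inr e" by blast
          then obtain y where y: "y \<in> B" "f y = Inr e" using ontoB by blast
          then have "(x, y) \<in> I" using I_iff[OF x y(1)] inc[OF p(1) e(1)] p(2) e(2) by auto
          then show "z \<in> f ` {y \<in> B. (x, y) \<in> I}" using y e(3) by force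
        qed
      qed
      moreover have "card (f ` {y \<in> B. (x, y) \<in> I}) = card {y \<in> B. (x, y) \<in> I}"
        by (rule card_image) (rule inj_on_subset[OF injB], blast)
      moreover have "card {e \<in> gedges G. p \<in> gends G e} = 2"
        using G(3) p(1) unfolding regular_multigraph_def by blast
      ultimately show ?thesis by (simp add: card_image)
    qed
    moreover have "(x, x') \<in> S\<^sup>*" if x: "x \<in> A" "x' \<in> A" for x x'
    proof -
      obtain p p' where p: "p \<in> gverts G" "f x = Inl p" "p' \<in> gverts G" "f x' = Inl p'" using fA x by blast
      have "(p, p') \<in> (graph_adjacency G)\<^sup>*" using G(2) p unfolding connected_multigraph_def by blast
      then have "\<exists>x1\<in>A. f x1 = Inl p' \<and> (x, x1) \<in> S\<^sup>*"
      proof (induction rule: rtrancl_induct)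
        case base
        then show ?case using x p by blast
      next
        case (step p1 p2)
        then obtain x1 where x1: "x1 \<in> A" "f x1 = Inl p1" "(x, x1) \<in> S\<^sup>*" by blast
        obtain e where e: "e \<in> gedges G" "gends G e = {p1, p2}" using step(2) unfolding graph_adjacency_def by blast
        have ps: "p1 \<in> gverts G" "p2 \<in> gverts G" using G(1) e unfolding wf_multigraph_def by blast+
        obtain x2 where x2: "x2 \<in> A" "f x2 = Inl p2" using ontoA ps by blast
        obtain y where y: "y \<in> B" "f y = Inr e" using ontoB e(1) by blast
        have "(x1, y) \<in> I" "(x2, y) \<in> I"
          using I_iff[OF x1(1) y(1)] I_iff[OF x2(1) y(1)] inc[OF ps(1) e(1)] inc[OF ps(2) e(1)] x1 x2 y e(2) by auto
        then have "(x1, x2) \<in> S" using x1 x2 y unfolding S_def by blast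
        then show ?case using x1(3) x2 by (meson rtrancl.rtrancl_into_rtrancl)
      qed
      then obtain x1 where x1: "x1 \<in> A" "f x1 = Inl p'" "(x, x1) \<in> S\<^sup>*" by blast
      have "f x1 = f x'" using x1(2) p(4) by simp
      then have "x1 = x'" using inj_on_eq_iff[OF injA x1(1) x(2)] by blast
      then show ?thesis using x1(3) by simp
    qed
    ultimately show ?R by blast
  }
  {
    assume R: ?R
    define G where "G = \<lparr>gverts = A, gedges = B, gends = \<lambda>y. {x \<in> A. (x, y) \<in> I}\<rparr>"
    have "wf_multigraph G" using R unfolding wf_multigraph_def G_def by auto
    moreover have "regular_multigraph 2 G"
      unfolding regular_multigraph_def
    proof (intro ballI)
      fix x assume "x \<in> gverts G"
      then have x: "x \<in> A" by (simp add: G_def)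
      have "{e \<in> gedges G. x \<in> gends G e} = {y \<in> B. (x, y) \<in> I}" using x by (auto simp: G_def)
      moreover have "card {y \<in> B. (x, y) \<in> I} = 2" using R x by blast
      moreover from this have "finite {y \<in> B. (x, y) \<in> I}" by (intro card_ge_0_finite) simp
      ultimately show "finite {e \<in> gedges G. x \<in> gends G e} \<and> card {e \<in> gedges G. x \<in> gends G e} = 2" by simp
    qed
    moreover have "connected_multigraph G"
    proof -
      have "S \<subseteq> (graph_adjacency G)\<^sup>="
      proof
        fix z assume "z \<in> S"
        then obtain x x' y where z: "z = (x, x')" "x \<in> A" "x' \<in> A" "y \<in> B" "(x, y) \<in> I" "(x', y) \<in> I"
          unfolding S_def by blast
        show "z \<in> (graph_adjacency G)\<^sup>="
        proof (cases "x = x'")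
          case False
          have "card {x \<in> A. (x, y) \<in> I} = 2" using R z(4) by blast
          then have "{x \<in> A. (x, y) \<in> I} = {x, x'}"
            using z False by (intro card_seteq[symmetric]) (auto intro: card_ge_0_finite)
          then show ?thesis using z(1,4) unfolding graph_adjacency_def G_def by auto
        qed (simp add: z)
      qed
      then have "S\<^sup>* \<subseteq> (graph_adjacency G)\<^sup>*" by (metis rtrancl_mono rtrancl_reflcl)
      then have "(u, v) \<in> (graph_adjacency G)\<^sup>*" if "u \<in> A" "v \<in> A" for u v using R that by blast
      moreover have "gverts G = A" by (simp add: G_def)
      ultimately show ?thesis using R unfolding connected_multigraph_def by simp
    qed
    moreover have "poset_iso_map r (incidence_poset G) (\<lambda>z. if z \<in> A then Inl z else Inr z)"
    proof -
      have "bij_betw (\<lambda>z. if z \<in> A then Inl z else Inr z) (A \<union> B) (A <+> B)"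
        using disj by (auto simp: bij_betw_def inj_on_def image_iff)
      then show ?thesis
        unfolding poset_iso_map_def Field_r Field_inc using disj
        by (auto simp: r incidence_poset_def G_def Id_on_def)
    qed
    ultimately show "is_polygon r" unfolding is_polygon_def poset_isomorphic_def by blast
  }
qed

section \<open>Flags as triples in a finite ranked poset\<close>

type_synonym 'a triple = "'a \<times> 'a \<times> 'a"

definition tflags :: "'a ranked_poset \<Rightarrow> 'a triple set" where
  "tflags P = {(v, e, f). v \<in> vertices P \<and> e \<in> edges P \<and> f \<in> faces P \<and> (v, e) \<in> leq P \<and> (e, f) \<in> leq P}"

fun fset :: "'a triple \<Rightarrow> 'a set" where
  "fset (v, e, f) = {v, e, f}"

locale ranked =
  fixes P :: "'a ranked_poset"
  assumes wf: "wf_ranked_poset P" and finite_elems: "finite (elems P)"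
begin

lemma po: "Partial_order (leq P)" and rank: "x \<in> elems P \<Longrightarrow> rk P x \<in> {0, 1, 2}"
  and rank_less: "(x, y) \<in> leq P \<Longrightarrow> x \<noteq> y \<Longrightarrow> rk P x < rk P y"
  using wf unfolding wf_ranked_poset_def by blast+

lemma leq_trans: "(x, y) \<in> leq P \<Longrightarrow> (y, z) \<in> leq P \<Longrightarrow> (x, z) \<in> leq P"
  using po unfolding partial_order_on_def preorder_on_def by (meson transE)

lemma leq_refl: "x \<in> elems P \<Longrightarrow> (x, x) \<in> leq P"
  using po unfolding partial_order_on_def preorder_on_def elems_def refl_on_def by blast

lemma leq_elems: "(x, y) \<in> leq P \<Longrightarrow> x \<in> elems P \<and> y \<in> elems P"
  unfolding elems_def Field_def by auto

lemma elems_cases: "x \<in> elems P \<Longrightarrow> x \<in> vertices P \<or> x \<in> edges P \<or> x \<in> faces P"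
  using rank unfolding vertices_def edges_def faces_def by auto

lemma rank_simps:
  "v \<in> vertices P \<Longrightarrow> rk P v = 0" "v \<in> edges P \<Longrightarrow> rk P v = 1" "v \<in> faces P \<Longrightarrow> rk P v = 2"
  "v \<in> vertices P \<Longrightarrow> v \<in> elems P" "v \<in> edges P \<Longrightarrow> v \<in> elems P" "v \<in> faces P \<Longrightarrow> v \<in> elems P"
  by (auto simp: vertices_def edges_def faces_def)

lemma leq_same_rank: "(x, y) \<in> leq P \<Longrightarrow> rk P y \<le> rk P x \<Longrightarrow> x = y"
  using rank_less by (metis leD)

lemma finite_sets: "finite (vertices P)" "finite (edges P)" "finite (faces P)"
  using finite_elems by (auto simp: vertices_def edges_def faces_def)

lemma finite_tflags: "finite (tflags P)"
  by (rule finite_subset[of _ "vertices P \<times> edges P \<times> faces P"]) (auto simp: tflags_def finite_sets)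

lemma fset_flag: assumes "x \<in> tflags P" shows "fset x \<in> flags P"
proof -
  obtain v e f where x: "x = (v, e, f)" "v \<in> vertices P" "e \<in> edges P" "f \<in> faces P" "(v, e) \<in> leq P" "(e, f) \<in> leq P"
    using assms unfolding tflags_def by blast
  have vf: "(v, f) \<in> leq P" using x leq_trans by blast
  have "fset x \<in> Chains (leq P)"
    unfolding Chains_def x(1) using x vf leq_refl rank_simps by auto
  moreover have "D = fset x" if D: "D \<in> Chains (leq P)" "fset x \<subseteq> D" for D
  proof -
    have "d \<in> fset x" if "d \<in> D" for d
    proof -
      have cmp: "(d, y) \<in> leq P \<or> (y, d) \<in> leq P" if "y \<in> {v, e, f}" for y
        using D \<open>d \<in> D\<close> that x(1) unfolding Chains_def by auto
      have "d \<in> elems P" using cmp[of v] leq_elems by blast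
      then consider "d \<in> vertices P" | "d \<in> edges P" | "d \<in> faces P" using elems_cases by blast
      then show ?thesis
      proof cases
        case 1
        then have "d = v" using cmp[of v] leq_same_rank[of d v] leq_same_rank[of v d] x(2) by (auto simp: rank_simps)
        then show ?thesis by (simp add: x)
      next
        case 2
        then have "d = e" using cmp[of e] leq_same_rank[of d e] leq_same_rank[of e d] x(3) by (auto simp: rank_simps)
        then show ?thesis by (simp add: x)
      next
        case 3
        then have "d = f" using cmp[of f] leq_same_rank[of d f] leq_same_rank[of f d] x(4) by (auto simp: rank_simps)
        then show ?thesis by (simp add: x)
      qed
    qed
    then show ?thesis using D(2) by blast
  qed
  ultimately show ?thesis unfolding flags_def by blast
qed

lemma fset_inj: "inj_on fset (tflags P)"
proof (rule inj_onI)
  fix x x' assume x: "x \<in> tflags P" "x' \<in> tflags P" "fset x = fset x'"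
  obtain v e f v' e' f' where xs: "x = (v, e, f)" "x' = (v', e', f')" by (metis prod_cases3)
  have rk: "rk P v = 0" "rk P e = 1" "rk P f = 2" "rk P v' = 0" "rk P e' = 1" "rk P f' = 2"
    using x(1,2) unfolding xs tflags_def by (auto simp: rank_simps)
  have m: "v \<in> {v', e', f'}" "e \<in> {v', e', f'}" "f \<in> {v', e', f'}" using x(3) unfolding xs by auto
  have "v \<noteq> e'" "v \<noteq> f'" "e \<noteq> v'" "e \<noteq> f'" "f \<noteq> v'" "f \<noteq> e'" using rk by auto
  then show "x = x'" using m unfolding xs by auto
qed

lemma chain_extends: assumes "C \<in> Chains (leq P)" shows "\<exists>D\<in>flags P. C \<subseteq> D"
proof -
  have "D \<subseteq> elems P" if "D \<in> Chains (leq P)" for D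
    using that leq_elems unfolding Chains_def by blast
  then have "Chains (leq P) \<subseteq> Pow (elems P)" by blast
  then have "finite (Chains (leq P))" using finite_elems finite_subset by blast
  then obtain D where "D \<in> Chains (leq P)" "C \<subseteq> D" "\<forall>D'\<in>Chains (leq P). D \<subseteq> D' \<longrightarrow> D = D'"
    using finite_has_maximal2[OF _ assms] by metis
  then show ?thesis unfolding flags_def by blast
qed

lemma above_eq:
  assumes v: "v \<in> vertices P"
  defines "A \<equiv> {e \<in> edges P. (v, e) \<in> leq P}" and "B \<equiv> {f \<in> faces P. (v, f) \<in> leq P}"
  shows "above P v = Id_on (A \<union> B) \<union> {(x, y). x \<in> A \<and> y \<in> B \<and> (x, y) \<in> leq P}" "A \<inter> B = {}"
proof -
  have carrier: "{y. (v, y) \<in> leq P \<and> y \<noteq> v} = A \<union> B"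
  proof -
    have "y \<in> A \<union> B" if "(v, y) \<in> leq P" "y \<noteq> v" for y
    proof -
      have "rk P y \<noteq> 0" using rank_less[OF that(1)] that(2) by auto
      then show ?thesis using elems_cases[of y] leq_elems[OF that(1)] that(1) rank_simps(1)[of y] unfolding A_def B_def by auto
    qed
    then show ?thesis unfolding A_def B_def using v rank_simps by fastforce
  qed
  show "above P v = Id_on (A \<union> B) \<union> {(x, y). x \<in> A \<and> y \<in> B \<and> (x, y) \<in> leq P}"
    unfolding above_def carrier
  proof (rule Set.set_eqI)
    fix z show "z \<in> Restr (leq P) (A \<union> B) \<longleftrightarrow> z \<in> Id_on (A \<union> B) \<union> {(x, y). x \<in> A \<and> y \<in> B \<and> (x, y) \<in> leq P}"
      using leq_refl leq_same_rank[of "fst z" "snd z"] rank_simps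
      unfolding A_def B_def by (cases z) fastforce
  qed
  show "A \<inter> B = {}" unfolding A_def B_def using rank_simps by fastforce
qed

lemma below_eq:
  assumes f: "f \<in> faces P"
  defines "A \<equiv> {v \<in> vertices P. (v, f) \<in> leq P}" and "B \<equiv> {e \<in> edges P. (e, f) \<in> leq P}"
  shows "below P f = Id_on (A \<union> B) \<union> {(x, y). x \<in> A \<and> y \<in> B \<and> (x, y) \<in> leq P}" "A \<inter> B = {}"
proof -
  have carrier: "{y. (y, f) \<in> leq P \<and> y \<noteq> f} = A \<union> B"
  proof -
    have "y \<in> A \<union> B" if "(y, f) \<in> leq P" "y \<noteq> f" for y
    proof -
      have "rk P y \<noteq> 2" using rank_less[OF that(1)] that(2) rank_simps(3)[OF f] by auto
      then show ?thesis using elems_cases[of y] leq_elems[OF that(1)] that(1) rank_simps(3)[of y] unfolding A_def B_def by auto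
    qed
    then show ?thesis unfolding A_def B_def using f rank_simps by fastforce
  qed
  show "below P f = Id_on (A \<union> B) \<union> {(x, y). x \<in> A \<and> y \<in> B \<and> (x, y) \<in> leq P}"
    unfolding below_def carrier
  proof (rule Set.set_eqI)
    fix z show "z \<in> Restr (leq P) (A \<union> B) \<longleftrightarrow> z \<in> Id_on (A \<union> B) \<union> {(x, y). x \<in> A \<and> y \<in> B \<and> (x, y) \<in> leq P}"
      using leq_refl leq_same_rank[of "fst z" "snd z"] rank_simps
      unfolding A_def B_def by (cases z) fastforce
  qed
  show "A \<inter> B = {}" unfolding A_def B_def using rank_simps by fastforce
qed

end

section \<open>Incidence in a finite polyhedron\<close>

locale fin_polyhedron = ranked +
  assumes poly: "polyhedron P"
begin

lemma flags_eq: "flags P = fset ` tflags P"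
proof
  show "fset ` tflags P \<subseteq> flags P" using fset_flag by blast
  show "flags P \<subseteq> fset ` tflags P"
  proof
    fix C assume C: "C \<in> flags P"
    have all: "\<forall>C\<in>flags P. \<exists>v\<in>vertices P. \<exists>e\<in>edges P. \<exists>f\<in>faces P. C = {v, e, f}"
      using poly unfolding polyhedron_def by (elim conjE)
    from bspec[OF all C] obtain v e f where vef: "v \<in> vertices P" "e \<in> edges P" "f \<in> faces P" "C = {v, e, f}"
      by (elim bexE) (rule that)
    have "C \<in> Chains (leq P)" using C unfolding flags_def by blast
    then have cmp: "(v, e) \<in> leq P \<or> (e, v) \<in> leq P" "(e, f) \<in> leq P \<or> (f, e) \<in> leq P"
      unfolding vef(4) Chains_def by auto
    have "\<not> (e, v) \<in> leq P" "\<not> (f, e) \<in> leq P"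
      using leq_same_rank[of e v] leq_same_rank[of f e] vef rank_simps by fastforce+
    then have "(v, e, f) \<in> tflags P" using vef cmp unfolding tflags_def by blast
    then show "C \<in> fset ` tflags P" using vef(4) by force
  qed
qed

lemma card_flags: "card (flags P) = card (tflags P)"
  unfolding flags_eq by (rule card_image) (rule fset_inj)

lemma in_tflag: assumes "C \<in> Chains (leq P)" shows "\<exists>x\<in>tflags P. C \<subseteq> fset x"
  using chain_extends[OF assms] unfolding flags_eq by blast

lemma elem_in_tflag: assumes "z \<in> elems P" shows "\<exists>x\<in>tflags P. z \<in> fset x"
  using in_tflag[of "{z}"] leq_refl[OF assms] unfolding Chains_def by auto

lemma tflags_components:
  assumes "(v, e, f) \<in> tflags P"
  shows "v \<in> vertices P" "e \<in> edges P" "f \<in> faces P" "(v, e) \<in> leq P" "(e, f) \<in> leq P" "(v, f) \<in> leq P"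
  using assms leq_trans unfolding tflags_def by blast+

lemma tflag_iff: "(v, e, f) \<in> tflags P \<longleftrightarrow> v \<in> vertices P \<and> e \<in> edges P \<and> f \<in> faces P \<and> (v, e) \<in> leq P \<and> (e, f) \<in> leq P"
  unfolding tflags_def by blast

lemma vertex_face_tflag: assumes "v \<in> vertices P" "f \<in> faces P" "(v, f) \<in> leq P" shows "\<exists>e. (v, e, f) \<in> tflags P"
proof -
  have "{v, f} \<in> Chains (leq P)" using assms leq_refl rank_simps unfolding Chains_def by auto
  then obtain v' e' f' where x: "(v', e', f') \<in> tflags P" "{v, f} \<subseteq> {v', e', f'}" using in_tflag by fastforce
  note t = tflags_components[OF x(1)]
  have rk: "rk P v = 0" "rk P e' = 1" "rk P f' = 2" "rk P f = 2" "rk P v' = 0"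
    using t assms by (simp_all add: rank_simps)
  then have "v \<noteq> e'" "v \<noteq> f'" "f \<noteq> v'" "f \<noteq> e'" by auto
  then have "v = v'" "f = f'" using x(2) by auto
  then show ?thesis using x(1) by blast
qed

lemma two_vertices: "e \<in> edges P \<Longrightarrow> card {v \<in> vertices P. (v, e) \<in> leq P} = 2"
  and two_faces: "e \<in> edges P \<Longrightarrow> card {f \<in> faces P. (e, f) \<in> leq P} = 2"
  and skeleton_connected: "connected_multigraph (skeleton P)"
  using poly unfolding polyhedron_def by blast+

lemma edge_face_exists: "e \<in> edges P \<Longrightarrow> \<exists>f\<in>faces P. (e, f) \<in> leq P"
  and edge_vertex_exists: "e \<in> edges P \<Longrightarrow> \<exists>v\<in>vertices P. (v, e) \<in> leq P"
proof -
  assume e: "e \<in> edges P"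
  have "{f \<in> faces P. (e, f) \<in> leq P} \<noteq> {}" using two_faces[OF e] by (intro notI) simp
  then show "\<exists>f\<in>faces P. (e, f) \<in> leq P" by blast
  have "{v \<in> vertices P. (v, e) \<in> leq P} \<noteq> {}" using two_vertices[OF e] by (intro notI) simp
  then show "\<exists>v\<in>vertices P. (v, e) \<in> leq P" by blast
qed

lemma polygon_above:
  assumes v: "v \<in> vertices P"
  defines "A \<equiv> {e \<in> edges P. (v, e) \<in> leq P}" and "B \<equiv> {f \<in> faces P. (v, f) \<in> leq P}"
  shows "A \<noteq> {}" "f \<in> B \<Longrightarrow> card {e \<in> A. (e, f) \<in> leq P} = 2"
    "e \<in> A \<Longrightarrow> e' \<in> A \<Longrightarrow> (e, e') \<in> {(x, x'). x \<in> A \<and> x' \<in> A \<and> (\<exists>f\<in>B. (x, f) \<in> leq P \<and> (x', f) \<in> leq P)}\<^sup>*"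
proof -
  note ab = above_eq[OF v, folded A_def B_def]
  have 1: "\<forall>x\<in>A. \<exists>y\<in>B. (x, y) \<in> leq P" unfolding A_def B_def using edge_face_exists leq_trans by blast
  have 2: "\<forall>y\<in>B. \<exists>x\<in>A. (x, y) \<in> leq P"
  proof
    fix y assume "y \<in> B"
    then obtain e where "(v, e, y) \<in> tflags P" using vertex_face_tflag[OF v, of y] unfolding B_def by blast
    then show "\<exists>x\<in>A. (x, y) \<in> leq P" unfolding A_def tflag_iff by blast
  qed
  have "is_polygon (above P v)" using poly v unfolding polyhedron_def by blast
  then show "A \<noteq> {}" "f \<in> B \<Longrightarrow> card {e \<in> A. (e, f) \<in> leq P} = 2"
    "e \<in> A \<Longrightarrow> e' \<in> A \<Longrightarrow> (e, e') \<in> {(x, x'). x \<in> A \<and> x' \<in> A \<and> (\<exists>f\<in>B. (x, f) \<in> leq P \<and> (x', f) \<in> leq P)}\<^sup>*"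
    unfolding polygon_iff[OF ab 1 2] by blast+
qed

lemma polygon_below:
  assumes f: "f \<in> faces P"
  defines "A \<equiv> {v \<in> vertices P. (v, f) \<in> leq P}" and "B \<equiv> {e \<in> edges P. (e, f) \<in> leq P}"
  shows "A \<noteq> {}"
    "v \<in> A \<Longrightarrow> v' \<in> A \<Longrightarrow> (v, v') \<in> {(x, x'). x \<in> A \<and> x' \<in> A \<and> (\<exists>e\<in>B. (x, e) \<in> leq P \<and> (x', e) \<in> leq P)}\<^sup>*"
proof -
  note ab = below_eq[OF f, folded A_def B_def]
  have 1: "\<forall>x\<in>A. \<exists>y\<in>B. (x, y) \<in> leq P"
  proof
    fix x assume "x \<in> A"
    then obtain e where "(x, e, f) \<in> tflags P" using vertex_face_tflag[OF _ f, of x] unfolding A_def by blast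
    then show "\<exists>y\<in>B. (x, y) \<in> leq P" unfolding B_def tflag_iff by blast
  qed
  have 2: "\<forall>y\<in>B. \<exists>x\<in>A. (x, y) \<in> leq P" unfolding A_def B_def using edge_vertex_exists leq_trans by blast
  have "is_polygon (below P f)" using poly f unfolding polyhedron_def by blast
  then show "A \<noteq> {}"
    "v \<in> A \<Longrightarrow> v' \<in> A \<Longrightarrow> (v, v') \<in> {(x, x'). x \<in> A \<and> x' \<in> A \<and> (\<exists>e\<in>B. (x, e) \<in> leq P \<and> (x', e) \<in> leq P)}\<^sup>*"
    unfolding polygon_iff[OF ab 1 2] by blast+
qed

text \<open>For vertices and faces the corresponding counts are axioms. For edges the number comes
  from the vertex figure, in which a face corresponds to an edge of a graph and so has two
  ends.\<close>

lemma two_edges: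
  assumes "(v, e, f) \<in> tflags P" shows "card {e. (v, e, f) \<in> tflags P} = 2"
proof -
  have "{e. (v, e, f) \<in> tflags P} = {e' \<in> {e \<in> edges P. (v, e) \<in> leq P}. (e', f) \<in> leq P}"
    using tflags_components[OF assms] unfolding tflags_def by auto
  then show ?thesis using polygon_above(2)[of v f] tflags_components[OF assms] by simp
qed

lemma adjacent_exists:
  assumes "(v, e, f) \<in> tflags P"
  shows "\<exists>!v'. v' \<noteq> v \<and> (v', e, f) \<in> tflags P" "\<exists>!e'. e' \<noteq> e \<and> (v, e', f) \<in> tflags P"
    "\<exists>!f'. f' \<noteq> f \<and> (v, e, f') \<in> tflags P"
proof -
  have *: "\<exists>!y. y \<noteq> x \<and> y \<in> X" if "card X = 2" "x \<in> X" for x :: 'a and X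
    using that unfolding card_2_iff by auto
  note t = tflags_components[OF assms]
  have "\<exists>!v'. v' \<noteq> v \<and> v' \<in> {v \<in> vertices P. (v, e) \<in> leq P}" by (rule *) (use t two_vertices in auto)
  then show "\<exists>!v'. v' \<noteq> v \<and> (v', e, f) \<in> tflags P" unfolding tflag_iff using t by auto
  have "\<exists>!e'. e' \<noteq> e \<and> e' \<in> {e. (v, e, f) \<in> tflags P}" by (rule *) (use assms two_edges in auto)
  then show "\<exists>!e'. e' \<noteq> e \<and> (v, e', f) \<in> tflags P" by simp
  have "\<exists>!f'. f' \<noteq> f \<and> f' \<in> {f \<in> faces P. (e, f) \<in> leq P}" by (rule *) (use t two_faces in auto)
  then show "\<exists>!f'. f' \<noteq> f \<and> (v, e, f') \<in> tflags P" unfolding tflag_iff using t by auto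
qed

end

section \<open>Monodromy groups\<close>

text \<open>Only some exponent with trivial power is assumed, because the exact order of a product
  of two flag involutions is found later, from the number of elements.\<close>

lemma dih_left_closed:
  assumes xx: "x * x = 1" and yy: "y * (y :: 'x perm) = 1" and n: "n > 0" "(x * y) ^ n = 1" and g: "g \<in> dih x y"
  shows "x * g \<in> dih x y" "y * g \<in> dih x y"
proof -
  have inv: "inverse ((x * y) ^ i) = (x * y) ^ ((n - 1) * i)" for i
  proof (rule perm_inverse_unique)
    have "(x * y) ^ i * (x * y) ^ ((n - 1) * i) = (x * y) ^ (n * i)"
      using n(1) by (cases n) (simp_all flip: power_add)
    then show "(x * y) ^ i * (x * y) ^ ((n - 1) * i) = 1" by (simp add: power_mult n(2))
  qed
  have yi: "y * (x * y) ^ i = (x * y) ^ ((n - 1) * i) * y" for i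
  proof -
    have "(y * (x * y) * y) ^ i = y * (x * y) ^ i * y" by (rule invol_conj_power[OF yy])
    moreover have "y * (x * y) * y = inverse (x * y)"
      by (rule perm_inverse_unique[symmetric]) (simp add: mult.assoc xx yy invol_cancel)
    ultimately have "y * (x * y) ^ i * y = (x * y) ^ ((n - 1) * i)"
      by (simp only: perm_power_inverse inv)
    then have "y * (x * y) ^ i * y * y = (x * y) ^ ((n - 1) * i) * y" by simp
    then show ?thesis by (simp add: mult.assoc yy)
  qed
  have y: "y * h \<in> dih x y" if "h \<in> dih x y" for h
  proof -
    obtain i where "h = (x * y) ^ i \<or> h = (x * y) ^ i * y" using \<open>h \<in> dih x y\<close> unfolding dih_def by blast
    then have "y * h = (x * y) ^ ((n - 1) * i) * y \<or> y * h = (x * y) ^ ((n - 1) * i)"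
      using yi[of i] yy by (metis mult.assoc mult.right_neutral)
    then show ?thesis using dihI by metis
  qed
  then show "y * g \<in> dih x y" using g .
  have "x * g = x * y * (y * g)" by (simp add: mult.assoc yy invol_cancel)
  moreover have "x * y * h \<in> dih x y" if "h \<in> dih x y" for h
  proof -
    obtain i where "h = (x * y) ^ i \<or> h = (x * y) ^ i * y" using \<open>h \<in> dih x y\<close> unfolding dih_def by blast
    then have "x * y * h = (x * y) ^ (i + 1) \<or> x * y * h = (x * y) ^ (i + 1) * y" by (auto simp: mult.assoc)
    then show ?thesis using dihI by metis
  qed
  ultimately show "x * g \<in> dih x y" using y[OF g] by simp
qed

text \<open>If \<open>y\<close> were a power of \<open>x * y\<close>, the two would commute, so
  \<open>x * y\<close> would have order at most 2 and there would be at most two elements, fewer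
  than \<open>2 * n\<close>. Otherwise a dihedral group with \<open>2 * n\<close> elements has
  rotations of order \<open>n\<close>.\<close>

lemma dihedral_of_card:
  assumes xx: "x * x = 1" and yy: "y * (y :: 'x perm) = 1" and card: "card (dih x y) = 2 * n" and n: "2 \<le> n"
    and o: "m > 0" "(x * y) ^ m = 1"
  shows "dihedral x y n"
proof -
  define o' where "o' = (LEAST k. k > 0 \<and> (x * y) ^ k = 1)"
  have o': "o' > 0" "(x * y) ^ o' = 1"
    unfolding o'_def using LeastI[of "\<lambda>k. k > 0 \<and> (x * y) ^ k = 1" m] o by blast+
  have least: "k = 0 \<or> o' \<le> k" if "(x * y) ^ k = 1" for k
    unfolding o'_def using Least_le[of "\<lambda>k. k > 0 \<and> (x * y) ^ k = 1" k] that by auto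
  have pm: "(x * y) ^ (k mod o') = (x * y) ^ k" for k
  proof -
    have "(x * y) ^ k = (x * y) ^ (o' * (k div o') + k mod o')" by simp
    also have "\<dots> = (x * y) ^ (k mod o')" by (simp only: power_add power_mult o'(2) power_one mult_1)
    finally show ?thesis by simp
  qed
  have ord: "(x * y) ^ k = 1 \<longleftrightarrow> o' dvd k" for k
  proof
    assume "(x * y) ^ k = 1"
    then have "k mod o' = 0" using least[of "k mod o'"] pm[of k] mod_less_divisor[OF o'(1), of k] by auto
    then show "o' dvd k" by auto
  qed (auto simp: power_mult o'(2) elim!: dvdE)
  have "(x * y) ^ i \<noteq> y" for i
  proof
    assume yi: "(x * y) ^ i = y"
    have "y * (x * y) = (x * y) * y"
      using power_commute_elem[of "x * y" "x * y" i] yi by simp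
    then have "y * (x * y) = x" by (simp add: mult.assoc yy)
    then have "(x * y) * (x * y) = 1" using xx by (simp add: mult.assoc)
    then have "(x * y) ^ 2 = 1" by (simp only: power2_eq_square)
    then have "o' dvd 2" using ord by blast
    then have "o' \<le> 2" by (auto dest: dvd_imp_le)
    have "dih x y \<subseteq> (\<lambda>k. (x * y) ^ k) ` {..<o'}"
    proof
      fix g assume "g \<in> dih x y"
      then obtain j where "g = (x * y) ^ j \<or> g = (x * y) ^ j * y" unfolding dih_def by blast
      then have "\<exists>j. g = (x * y) ^ j" using yi by (metis power_add)
      then show "g \<in> (\<lambda>k. (x * y) ^ k) ` {..<o'}" using pm mod_less_divisor[OF o'(1)] by (metis image_eqI lessThan_iff)
    qed
    then have "card (dih x y) \<le> o'" by (metis card_image_le card_lessThan card_mono finite_imageI finite_lessThan le_trans)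
    then show False using card n \<open>o' \<le> 2\<close> by simp
  qed
  then interpret dihedral x y o' using xx yy o'(1) ord by (intro dihedral.intro)
  have "o' = n" using card card_dih by simp
  then show ?thesis using dihedral_axioms by simp
qed

section \<open>Adjacent flags and the monodromy action\<close>

fun pick :: "letter \<Rightarrow> 'a triple \<Rightarrow> 'a" where
  "pick R0 (v, e, f) = v" | "pick R1 (v, e, f) = e" | "pick R2 (v, e, f) = f"

lemma letter_all: "(\<forall>j. Q j) \<longleftrightarrow> Q R0 \<and> Q R1 \<and> Q R2"
  by (metis letter.exhaust)

lemma triple_eqI: "(\<And>i. pick i x = pick i y) \<Longrightarrow> x = y"
proof -
  assume *: "\<And>i. pick i x = pick i y"
  show ?thesis using *[of R0] *[of R1] *[of R2] by (cases x; cases y) simp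
qed

definition adj_to :: "letter \<Rightarrow> 'a triple \<Rightarrow> 'a triple \<Rightarrow> bool" where
  "adj_to i x y \<longleftrightarrow> pick i y \<noteq> pick i x \<and> (\<forall>j. j \<noteq> i \<longrightarrow> pick j y = pick j x)"

lemma adj_to_simps:
  "adj_to R0 (v, e, f) (v', e', f') \<longleftrightarrow> v' \<noteq> v \<and> e' = e \<and> f' = f"
  "adj_to R1 (v, e, f) (v', e', f') \<longleftrightarrow> v' = v \<and> e' \<noteq> e \<and> f' = f"
  "adj_to R2 (v, e, f) (v', e', f') \<longleftrightarrow> v' = v \<and> e' = e \<and> f' \<noteq> f"
  unfolding adj_to_def letter_all by auto

definition adj :: "'a ranked_poset \<Rightarrow> letter \<Rightarrow> 'a triple \<Rightarrow> 'a triple" where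
  "adj P i x = (if x \<in> tflags P then THE y. y \<in> tflags P \<and> adj_to i x y else x)"

definition mon :: "'a ranked_poset \<Rightarrow> letter \<Rightarrow> 'a triple perm" where
  "mon P i = Perm (adj P i)"

abbreviation mon_word :: "'a ranked_poset \<Rightarrow> letter list \<Rightarrow> 'a triple perm" where
  "mon_word P \<equiv> ev (mon P R0) (mon P R1) (mon P R2)"

context fin_polyhedron begin

abbreviation "T \<equiv> tflags P"

lemma adj_ex1: assumes "x \<in> T" shows "\<exists>!y. y \<in> T \<and> adj_to i x y"
proof -
  obtain v e f where x: "x = (v, e, f)" by (metis prod_cases3)
  note ex = adjacent_exists[OF assms[unfolded x]]
  show ?thesis
  proof (cases i)
    case R0
    obtain v' where v': "v' \<noteq> v" "(v', e, f) \<in> T" "\<And>v''. v'' \<noteq> v \<Longrightarrow> (v'', e, f) \<in> T \<Longrightarrow> v'' = v'" using ex(1) by blast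
    show ?thesis unfolding R0 x 
    proof (rule ex1I[of _ "(v', e, f)"])
      show "(v', e, f) \<in> T \<and> adj_to R0 (v, e, f) (v', e, f)" using v'(1,2) by (simp add: adj_to_simps)
      fix y assume y: "y \<in> T \<and> adj_to R0 (v, e, f) y"
      show "y = (v', e, f)"
      proof (cases y)
        case (fields a b c)
        then show ?thesis using y v'(3)[of a] unfolding fields adj_to_simps by blast
      qed
    qed
  next
    case R1
    obtain e' where e': "e' \<noteq> e" "(v, e', f) \<in> T" "\<And>e''. e'' \<noteq> e \<Longrightarrow> (v, e'', f) \<in> T \<Longrightarrow> e'' = e'" using ex(2) by blast
    show ?thesis unfolding R1 x 
    proof (rule ex1I[of _ "(v, e', f)"])
      show "(v, e', f) \<in> T \<and> adj_to R1 (v, e, f) (v, e', f)" using e'(1,2) by (simp add: adj_to_simps)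
      fix y assume y: "y \<in> T \<and> adj_to R1 (v, e, f) y"
      show "y = (v, e', f)"
      proof (cases y)
        case (fields a b c)
        then show ?thesis using y e'(3)[of b] unfolding fields adj_to_simps by blast
      qed
    qed
  next
    case R2
    obtain f' where f': "f' \<noteq> f" "(v, e, f') \<in> T" "\<And>f''. f'' \<noteq> f \<Longrightarrow> (v, e, f'') \<in> T \<Longrightarrow> f'' = f'" using ex(3) by blast
    show ?thesis unfolding R2 x 
    proof (rule ex1I[of _ "(v, e, f')"])
      show "(v, e, f') \<in> T \<and> adj_to R2 (v, e, f) (v, e, f')" using f'(1,2) by (simp add: adj_to_simps)
      fix y assume y: "y \<in> T \<and> adj_to R2 (v, e, f) y"
      show "y = (v, e, f')"
      proof (cases y)
        case (fields a b c)
        then show ?thesis using y f'(3)[of c] unfolding fields adj_to_simps by blast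
      qed
    qed
  qed
qed

lemma adj_spec:
  assumes "x \<in> T"
  shows "adj P i x \<in> T" "adj_to i x (adj P i x)"
  using theI'[OF adj_ex1[OF assms, of i]] assms unfolding adj_def by auto

lemma adj_pick: assumes "x \<in> T" "j \<noteq> i" shows "pick j (adj P i x) = pick j x"
  using adj_spec(2)[OF assms(1), of i] assms(2) unfolding adj_to_def by blast

lemma adj_unique: assumes "x \<in> T" "y \<in> T" "adj_to i x y" shows "y = adj P i x"
  using adj_ex1[OF assms(1), of i] adj_spec[OF assms(1), of i] assms(2,3) by blast

lemma adj_adj: "adj P i (adj P i x) = x"
proof (cases "x \<in> T")
  case True
  have "adj_to i (adj P i x) x" using adj_spec(2)[OF True, of i] unfolding adj_to_def by auto
  then have "x = adj P i (adj P i x)" using adj_unique adj_spec(1) True by blast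
  then show ?thesis by simp
qed (simp add: adj_def)

text \<open>A flag only requires the incidences of its edge with its vertex and with its face, so
  the latter two can be replaced independently.\<close>

lemma adj_02: "adj P R0 (adj P R2 x) = adj P R2 (adj P R0 x)"
proof (cases "x \<in> T")
  case True
  obtain v e f where x: "x = (v, e, f)" by (metis prod_cases3)
  obtain v' e' f' where y: "adj P R0 x = (v', e', f')" by (metis prod_cases3)
  obtain v'' e'' f'' where z: "adj P R2 x = (v'', e'', f'')" by (metis prod_cases3)
  note a = adj_spec[OF True, of R0] adj_spec[OF True, of R2]
  have e: "e' = e" "f' = f" "e'' = e" "v'' = v" "v' \<noteq> v" "f'' \<noteq> f"
    using a(2,4) unfolding y z unfolding x adj_to_simps by blast+
  have w: "(v', e, f'') \<in> T" using a(1,3) unfolding y z e tflag_iff by blast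
  have "(v', e, f'') = adj P R0 (adj P R2 x)"
    by (rule adj_unique[OF a(3) w]) (simp add: z e adj_to_simps)
  moreover have "(v', e, f'') = adj P R2 (adj P R0 x)"
    by (rule adj_unique[OF a(1) w]) (simp add: y e adj_to_simps)
  ultimately show ?thesis by simp
qed (simp add: adj_def)

lemma apply_mon: "apply (mon P i) = adj P i"
  unfolding mon_def
proof (rule Perm_inverse)
  have "bij (adj P i)" by (rule o_bij[of "adj P i"]) (auto simp: adj_adj)
  moreover have "{x. adj P i x \<noteq> x} \<subseteq> T" unfolding adj_def by (auto split: if_splits)
  ultimately show "adj P i \<in> {f. bij f \<and> finite {a. f a \<noteq> a}}" using finite_tflags finite_subset by auto
qed

lemma mon_mon: "mon P i * mon P i = 1"
  by (rule perm_eqI) (simp add: apply_times apply_mon adj_adj)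

lemma mon_20: "mon P R2 * mon P R0 = mon P R0 * mon P R2"
  by (rule perm_eqI) (simp add: apply_times apply_mon adj_02)

lemma letter_mon: "letter_val (mon P R0) (mon P R1) (mon P R2) i = mon P i"
  by (cases i) simp_all

lemma mon_word_Cons: "apply (mon_word P (i # w)) x = adj P i (apply (mon_word P w) x)"
  by (simp add: letter_mon apply_times apply_mon)

lemma mon_word_T: "x \<in> T \<Longrightarrow> apply (mon_word P w) x \<in> T"
  by (induction w) (simp_all only: mon_word_Cons adj_spec, simp)

lemma mon_word_outside: "x \<notin> T \<Longrightarrow> apply (mon_word P w) x = x"
proof (induction w)
  case (Cons i w)
  then show ?case unfolding mon_word_Cons by (simp add: adj_def)
qed simp

lemma mon_word_pick: "x \<in> T \<Longrightarrow> i \<notin> set w \<Longrightarrow> pick i (apply (mon_word P w) x) = pick i x"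
proof (induction w)
  case (Cons j w)
  then show ?case unfolding mon_word_Cons using adj_pick[OF mon_word_T] by auto
qed simp

lemma mon_word_rev: "apply (mon_word P (rev w)) (apply (mon_word P w) x) = x"
proof -
  have "mon_word P (rev w) * mon_word P w = 1"
    by (induction w) (simp_all add: ev_append letter_mon mult.assoc invol_cancel mon_mon)
  then have "apply (mon_word P (rev w) * mon_word P w) x = x" by (simp only: apply_one id_apply)
  then show ?thesis by (simp only: apply_times comp_apply)
qed

lemma mon_word_append: "apply (mon_word P (u @ w)) x = apply (mon_word P u) (apply (mon_word P w) x)"
  by (simp add: ev_append apply_times)

definition reach :: "letter set \<Rightarrow> 'a triple rel" where
  "reach J = {(x, y). \<exists>w. set w \<subseteq> J \<and> y = apply (mon_word P w) x}"

lemma reach_refl: "(x, x) \<in> reach J"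
  unfolding reach_def by (auto intro: exI[of _ "[]"])

lemma reach_trans: assumes "(x, y) \<in> reach J" "(y, z) \<in> reach J" shows "(x, z) \<in> reach J"
proof -
  obtain w u where "set w \<subseteq> J" "y = apply (mon_word P w) x" "set u \<subseteq> J" "z = apply (mon_word P u) y"
    using assms unfolding reach_def by blast
  then have "set (u @ w) \<subseteq> J \<and> z = apply (mon_word P (u @ w)) x" by (simp add: mon_word_append)
  then show ?thesis unfolding reach_def by blast
qed

lemma reach_mono: "(x, y) \<in> reach J \<Longrightarrow> J \<subseteq> J' \<Longrightarrow> (x, y) \<in> reach J'"
  unfolding reach_def by blast

lemma reach_adj: "i \<in> J \<Longrightarrow> (x, adj P i x) \<in> reach J"
  unfolding reach_def by (auto intro!: exI[of _ "[i]"] simp: letter_mon apply_mon)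

lemma reach_one:
  assumes x: "x \<in> T" "y \<in> T" "\<forall>j. j \<noteq> i \<longrightarrow> pick j y = pick j x" and i: "i \<in> J"
  shows "(x, y) \<in> reach J"
proof (cases "pick i y = pick i x")
  case True
  then have "y = x" using x(3) by (intro triple_eqI) metis
  then show ?thesis by (simp add: reach_refl)
next
  case False
  then have "y = adj P i x" using adj_unique x unfolding adj_to_def by blast
  then show ?thesis using reach_adj i by simp
qed

lemma reach_vertex_edge:
  assumes "(v, e, f) \<in> T" "(v, e, f') \<in> T" "R2 \<in> J" shows "((v, e, f), (v, e, f')) \<in> reach J"
  by (rule reach_one[OF assms(1,2) _ assms(3)]) (simp add: letter_all)

lemma reach_edge_face:
  assumes "(v, e, f) \<in> T" "(v', e, f) \<in> T" "R0 \<in> J" shows "((v, e, f), (v', e, f)) \<in> reach J"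
  by (rule reach_one[OF assms(1,2) _ assms(3)]) (simp add: letter_all)

lemma reach_vertex_face:
  assumes "(v, e, f) \<in> T" "(v, e', f) \<in> T" "R1 \<in> J" shows "((v, e, f), (v, e', f)) \<in> reach J"
  by (rule reach_one[OF assms(1,2) _ assms(3)]) (simp add: letter_all)

text \<open>The vertex figure is connected, so one passes from edge to edge around the vertex, each
  time through a common face.\<close>

lemma reach_vertex:
  assumes x: "(v, e, f) \<in> T" "(v, e', f') \<in> T" shows "((v, e, f), (v, e', f')) \<in> reach {R1, R2}"
proof -
  note t = tflags_components[OF x(1)] and t' = tflags_components[OF x(2)]
  define A where "A = {e \<in> edges P. (v, e) \<in> leq P}"
  have "(e, e') \<in> {(x, x'). x \<in> A \<and> x' \<in> A \<and> (\<exists>f\<in>{f \<in> faces P. (v, f) \<in> leq P}. (x, f) \<in> leq P \<and> (x', f) \<in> leq P)}\<^sup>*"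
    unfolding A_def by (rule polygon_above(3)[OF t(1)]) (use t t' in auto)
  then have "\<forall>f'. (v, e', f') \<in> T \<longrightarrow> ((v, e, f), (v, e', f')) \<in> reach {R1, R2}"
  proof (induction rule: rtrancl_induct)
    case base
    then show ?case using reach_vertex_edge[OF x(1)] by blast
  next
    case (step e1 e2)
    then obtain g where g: "e1 \<in> A" "e2 \<in> A" "g \<in> faces P" "(e1, g) \<in> leq P" "(e2, g) \<in> leq P" by blast
    have T12: "(v, e1, g) \<in> T" "(v, e2, g) \<in> T" using g t(1) unfolding tflag_iff A_def by blast+
    have 1: "((v, e, f), (v, e1, g)) \<in> reach {R1, R2}" using step.IH T12(1) by blast
    have 2: "((v, e1, g), (v, e2, g)) \<in> reach {R1, R2}" using reach_vertex_face[OF T12] by blast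
    show ?case using reach_trans[OF 1 reach_trans[OF 2]] reach_vertex_edge[OF T12(2)] by blast
  qed
  then show ?thesis using x(2) by blast
qed

lemma reach_face:
  assumes x: "(v, e, f) \<in> T" "(v', e', f) \<in> T" shows "((v, e, f), (v', e', f)) \<in> reach {R0, R1}"
proof -
  note t = tflags_components[OF x(1)] and t' = tflags_components[OF x(2)]
  define A where "A = {v \<in> vertices P. (v, f) \<in> leq P}"
  have "(v, v') \<in> {(x, x'). x \<in> A \<and> x' \<in> A \<and> (\<exists>e\<in>{e \<in> edges P. (e, f) \<in> leq P}. (x, e) \<in> leq P \<and> (x', e) \<in> leq P)}\<^sup>*"
    unfolding A_def by (rule polygon_below(2)[OF t(3)]) (use t t' in auto)
  then have "\<forall>e'. (v', e', f) \<in> T \<longrightarrow> ((v, e, f), (v', e', f)) \<in> reach {R0, R1}"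
  proof (induction rule: rtrancl_induct)
    case base
    then show ?case using reach_vertex_face[OF x(1)] by blast
  next
    case (step v1 v2)
    then obtain g where g: "v1 \<in> A" "v2 \<in> A" "g \<in> edges P" "(v1, g) \<in> leq P" "(v2, g) \<in> leq P" "(g, f) \<in> leq P" by blast
    have T12: "(v1, g, f) \<in> T" "(v2, g, f) \<in> T" using g t(3) unfolding tflag_iff A_def by blast+
    have 1: "((v, e, f), (v1, g, f)) \<in> reach {R0, R1}" using step.IH T12(1) by blast
    have 2: "((v1, g, f), (v2, g, f)) \<in> reach {R0, R1}" using reach_edge_face[OF T12] by blast
    show ?case using reach_trans[OF 1 reach_trans[OF 2]] reach_vertex_face[OF T12(2)] by blast
  qed
  then show ?thesis using x(2) by blast
qed

lemma reach_edge:
  assumes x: "(v, e, f) \<in> T" "(v', e, f') \<in> T" shows "((v, e, f), (v', e, f')) \<in> reach {R0, R2}"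
proof -
  have y: "(v', e, f) \<in> T" using x unfolding tflag_iff by blast
  show ?thesis by (rule reach_trans[OF reach_edge_face[OF x(1) y] reach_vertex_edge[OF y x(2)]]) simp_all
qed

text \<open>Follow a path in the vertex-edge graph, changing the vertex along each edge and turning
  around each vertex in between.\<close>

lemma reach_all: assumes x: "x \<in> T" "y \<in> T" shows "(x, y) \<in> reach UNIV"
proof -
  obtain v e f where xs: "x = (v, e, f)" by (metis prod_cases3)
  obtain v' e' f' where ys: "y = (v', e', f')" by (metis prod_cases3)
  have "v \<in> vertices P" "v' \<in> vertices P" using x unfolding xs ys tflag_iff by blast+
  then have "(v, v') \<in> (graph_adjacency (skeleton P))\<^sup>*"
    using skeleton_connected unfolding connected_multigraph_def skeleton_def by simp
  then have "\<forall>e' f'. (v', e', f') \<in> T \<longrightarrow> (x, (v', e', f')) \<in> reach UNIV"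
  proof (induction rule: rtrancl_induct)
    case base
    then show ?case using reach_vertex x(1) reach_mono unfolding xs by blast
  next
    case (step v1 v2)
    then obtain g where g: "g \<in> edges P" "{v \<in> vertices P. (v, g) \<in> leq P} = {v1, v2}"
      unfolding graph_adjacency_def skeleton_def by auto
    obtain h where h: "h \<in> faces P" "(g, h) \<in> leq P" using edge_face_exists[OF g(1)] by blast
    have T12: "(v1, g, h) \<in> T" "(v2, g, h) \<in> T" using g h unfolding tflag_iff by blast+
    have 1: "(x, (v1, g, h)) \<in> reach UNIV" using step.IH T12(1) by blast
    have 2: "((v1, g, h), (v2, g, h)) \<in> reach UNIV" by (rule reach_edge_face[OF T12]) simp
    show ?case using reach_trans[OF 1 reach_trans[OF 2]] reach_vertex[OF T12(2)] reach_mono by blast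
  qed
  then show ?thesis using x(2) unfolding ys by blast
qed

lemma tflags_nonempty: "T \<noteq> {}"
proof -
  have "vertices P \<noteq> {}" using skeleton_connected unfolding connected_multigraph_def skeleton_def by simp
  then show ?thesis using elem_in_tflag rank_simps(4) by blast
qed

end

section \<open>Regular polyhedra and tight triples\<close>

definition tmap :: "('a \<Rightarrow> 'b) \<Rightarrow> 'a triple \<Rightarrow> 'b triple" where
  "tmap h = map_prod h (map_prod h h)"

lemma tmap_simp [simp]: "tmap h (v, e, f) = (h v, h e, h f)"
  by (simp add: tmap_def)

lemma pick_tmap: "pick i (tmap h x) = h (pick i x)"
  by (cases x; cases i) simp_all

lemma fset_tmap: "fset (tmap h x) = h ` fset x"
  by (cases x) simp

lemma fset_pick: "z \<in> fset x \<longleftrightarrow> (\<exists>j. z = pick j x)"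
proof -
  have "z \<in> fset x \<longleftrightarrow> z = pick R0 x \<or> z = pick R1 x \<or> z = pick R2 x" by (cases x) auto
  then show ?thesis by (metis letter.exhaust)
qed

lemma fin_polyhedronI: "polyhedron P \<Longrightarrow> finite (elems P) \<Longrightarrow> fin_polyhedron P"
  by unfold_locales (auto simp: polyhedron_def)

locale poly_iso = P: fin_polyhedron P + Q: fin_polyhedron Q
  for P :: "'a ranked_poset" and Q :: "'b ranked_poset" +
  fixes h :: "'a \<Rightarrow> 'b"
  assumes iso: "poset_iso_map (leq P) (leq Q) h"
begin

lemma inj: "inj_on h (elems P)"
  using iso unfolding poset_iso_map_def elems_def bij_betw_def by blast

lemma leq: "(x, y) \<in> leq P \<Longrightarrow> (h x, h y) \<in> leq Q"
  using iso unfolding poset_iso_map_def by (meson FieldI1 FieldI2)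

text \<open>An isomorphism is only required to respect the order. Three elements in a strict chain
  have strictly increasing ranks, however, and these can only be 0, 1, 2.\<close>

lemma tmap_tflags: assumes "x \<in> tflags P" shows "tmap h x \<in> tflags Q"
proof -
  obtain v e f where x: "x = (v, e, f)" by (metis prod_cases3)
  note t = P.tflags_components[OF assms[unfolded x]]
  have ne: "v \<noteq> e" "e \<noteq> f" using P.rank_simps t by fastforce+
  have "h v \<noteq> h e" "h e \<noteq> h f" using inj ne t P.rank_simps(4-6) unfolding inj_on_def by blast+
  then have lt: "rk Q (h v) < rk Q (h e)" "rk Q (h e) < rk Q (h f)"
    using Q.leq_same_rank[OF leq[OF t(4)]] Q.leq_same_rank[OF leq[OF t(5)]] by (meson not_le_imp_less)+
  have el: "h v \<in> elems Q" "h e \<in> elems Q" "h f \<in> elems Q"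
    using Q.leq_elems[OF leq[OF t(4)]] Q.leq_elems[OF leq[OF t(5)]] by blast+
  have "rk Q (h v) = 0" "rk Q (h e) = 1" "rk Q (h f) = 2"
    using lt Q.rank[OF el(1)] Q.rank[OF el(2)] Q.rank[OF el(3)] by auto
  then show ?thesis unfolding x tmap_simp Q.tflag_iff vertices_def edges_def faces_def
    using el leq[OF t(4)] leq[OF t(5)] by simp
qed

lemma pick_elems: assumes "x \<in> tflags P" shows "pick i x \<in> elems P"
proof -
  obtain v e f where x: "x = (v, e, f)" by (metis prod_cases3)
  show ?thesis using P.tflags_components[OF assms[unfolded x]] P.rank_simps(4-6) unfolding x by (cases i) simp_all
qed

lemma tmap_adj: assumes x: "x \<in> tflags P" shows "tmap h (adj P i x) = adj Q i (tmap h x)"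
proof (rule Q.adj_unique)
  note a = P.adj_spec[OF x, of i]
  show "tmap h x \<in> tflags Q" "tmap h (adj P i x) \<in> tflags Q" using tmap_tflags x a(1) by blast+
  have "h (pick i (adj P i x)) \<noteq> h (pick i x)"
    using a(2) inj pick_elems[OF x] pick_elems[OF a(1)] unfolding adj_to_def inj_on_def by blast
  then show "adj_to i (tmap h x) (tmap h (adj P i x))" using a(2) unfolding adj_to_def pick_tmap by simp
qed

lemma tmap_mon_word:
  assumes x: "x \<in> tflags P" shows "tmap h (apply (mon_word P w) x) = apply (mon_word Q w) (tmap h x)"
proof (induction w)
  case (Cons i w)
  then show ?case unfolding P.mon_word_Cons Q.mon_word_Cons by (simp only: tmap_adj[OF P.mon_word_T[OF x]])
qed simp

end

section \<open>Flag counts and automorphisms\<close>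

fun rank_of :: "letter \<Rightarrow> nat" where
  "rank_of R0 = 0" | "rank_of R1 = 1" | "rank_of R2 = 2"

lemma rank_of_inj: "rank_of i = rank_of j \<longleftrightarrow> i = j"
  by (cases i; cases j) simp_all

context fin_polyhedron begin

lemma rank_pick: assumes "x \<in> T" shows "rk P (pick i x) = rank_of i"
proof -
  obtain v e f where x: "x = (v, e, f)" by (metis prod_cases3)
  show ?thesis using tflags_components[OF assms[unfolded x]] rank_simps(1-3) unfolding x by (cases i) simp_all
qed

lemma adj_neq: assumes "x \<in> T" shows "adj P i x \<noteq> x" "i \<noteq> j \<Longrightarrow> adj P i x \<noteq> adj P j x"
proof -
  show 1: "adj P i x \<noteq> x" using adj_spec(2)[OF assms, of i] unfolding adj_to_def by auto
  assume "i \<noteq> j"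
  then have "pick i (adj P j x) = pick i x" using adj_pick[OF assms] by blast
  then show "adj P i x \<noteq> adj P j x" using adj_spec(2)[OF assms, of i] unfolding adj_to_def by auto
qed

lemma rank_neq_eq:
  assumes x: "x \<in> T" and y: "y \<in> T"
  shows "{z \<in> fset y. rk P z \<noteq> rank_of i} = {z \<in> fset x. rk P z \<noteq> rank_of i} \<longleftrightarrow> (\<forall>j. j \<noteq> i \<longrightarrow> pick j y = pick j x)"
proof
  assume eq: "{z \<in> fset y. rk P z \<noteq> rank_of i} = {z \<in> fset x. rk P z \<noteq> rank_of i}"
  show "\<forall>j. j \<noteq> i \<longrightarrow> pick j y = pick j x"
  proof (intro allI impI)
    fix j assume "j \<noteq> i"
    then have "rk P (pick j y) \<noteq> rank_of i" by (simp add: rank_pick[OF y] rank_of_inj)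
    moreover have "pick j y \<in> fset y" unfolding fset_pick by blast
    ultimately have "pick j y \<in> fset x" using eq by blast
    then obtain k where k: "pick j y = pick k x" unfolding fset_pick by blast
    then have "rank_of j = rank_of k" using rank_pick[OF x, of k] rank_pick[OF y, of j] by simp
    then show "pick j y = pick j x" using k rank_of_inj by simp
  qed
next
  assume eq: "\<forall>j. j \<noteq> i \<longrightarrow> pick j y = pick j x"
  have *: "{z \<in> fset y. rk P z \<noteq> rank_of i} = {pick j y | j. j \<noteq> i}" if "y \<in> T" for y
    unfolding fset_pick using rank_pick[OF that] rank_of_inj by auto
  show "{z \<in> fset y. rk P z \<noteq> rank_of i} = {z \<in> fset x. rk P z \<noteq> rank_of i}"
    unfolding *[OF x] *[OF y] using eq by metis
qed

lemma adjacent_flag_eq: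
  assumes x: "x \<in> T" shows "adjacent_flag P (rank_of i) (fset x) = fset (adj P i x)"
  unfolding adjacent_flag_def
proof (rule the_equality)
  note a = adj_spec[OF x, of i]
  have "fset (adj P i x) \<noteq> fset x" using adj_neq(1)[OF x] fset_inj a(1) x unfolding inj_on_def by blast
  moreover have "\<forall>j. j \<noteq> i \<longrightarrow> pick j (adj P i x) = pick j x" using a(2) unfolding adj_to_def by blast
  ultimately show "fset (adj P i x) \<in> flags P \<and> fset (adj P i x) \<noteq> fset x \<and>
      {z \<in> fset (adj P i x). rk P z \<noteq> rank_of i} = {z \<in> fset x. rk P z \<noteq> rank_of i}"
    using fset_flag[OF a(1)] rank_neq_eq[OF x a(1)] by blast
next
  fix \<Psi> assume \<Psi>: "\<Psi> \<in> flags P \<and> \<Psi> \<noteq> fset x \<and> {z \<in> \<Psi>. rk P z \<noteq> rank_of i} = {z \<in> fset x. rk P z \<noteq> rank_of i}"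
  then obtain y where y: "y \<in> T" "\<Psi> = fset y" unfolding flags_eq by blast
  have eq: "\<forall>j. j \<noteq> i \<longrightarrow> pick j y = pick j x" using \<Psi> rank_neq_eq[OF x y(1)] y(2) by blast
  have "pick i y \<noteq> pick i x"
  proof
    assume "pick i y = pick i x"
    then have "y = x" using eq by (intro triple_eqI) metis
    then show False using \<Psi> y by simp
  qed
  then have "y = adj P i x" using adj_unique[OF x y(1)] eq unfolding adj_to_def by blast
  then show "\<Psi> = fset (adj P i x)" using y by simp
qed

lemma card_face_flags:
  assumes f: "f \<in> faces P" shows "card {y \<in> T. pick R2 y = f} = 2 * card {e \<in> edges P. (e, f) \<in> leq P}"
proof -
  define E where "E = {e \<in> edges P. (e, f) \<in> leq P}"
  have E: "finite E" unfolding E_def using finite_sets by simp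
  have S: "{y \<in> T. pick R2 y = f} = (\<lambda>(e, v). (v, e, f)) ` (SIGMA e : E. {v \<in> vertices P. (v, e) \<in> leq P})"
    unfolding E_def using f by (auto simp: tflag_iff image_iff)
  have "card {y \<in> T. pick R2 y = f} = card (SIGMA e : E. {v \<in> vertices P. (v, e) \<in> leq P})"
    unfolding S by (rule card_image) (auto simp: inj_on_def)
  also have "\<dots> = 2 * card E" using E finite_sets two_vertices by (subst card_SigmaI) (auto simp: E_def)
  finally show ?thesis unfolding E_def .
qed

lemma card_vertex_flags:
  assumes v: "v \<in> vertices P" shows "card {y \<in> T. pick R0 y = v} = 2 * card {e \<in> edges P. (v, e) \<in> leq P}"
proof -
  define E where "E = {e \<in> edges P. (v, e) \<in> leq P}"
  have E: "finite E" unfolding E_def using finite_sets by simp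
  have S: "{y \<in> T. pick R0 y = v} = (\<lambda>(e, f). (v, e, f)) ` (SIGMA e : E. {f \<in> faces P. (e, f) \<in> leq P})"
    unfolding E_def using v by (auto simp: tflag_iff image_iff)
  have "card {y \<in> T. pick R0 y = v} = card (SIGMA e : E. {f \<in> faces P. (e, f) \<in> leq P})"
    unfolding S by (rule card_image) (auto simp: inj_on_def)
  also have "\<dots> = 2 * card E" using E finite_sets two_faces by (subst card_SigmaI) (auto simp: E_def)
  finally show ?thesis unfolding E_def .
qed

abbreviation "Aut \<equiv> carrier (aut_group P)"

lemma Aut_iff: "\<gamma> \<in> Aut \<longleftrightarrow> \<gamma> \<in> Bij (elems P) \<and> poset_iso_map (leq P) (leq P) \<gamma>"
  unfolding aut_group_def by simp

lemma Aut_iso: "\<gamma> \<in> Aut \<Longrightarrow> poly_iso P P \<gamma>"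
  using fin_polyhedron_axioms unfolding Aut_iff by (intro poly_iso.intro poly_iso_axioms.intro) auto

lemma Aut_tmap: assumes "\<gamma> \<in> Aut" "x \<in> T" shows "tmap \<gamma> x \<in> T"
  "tmap \<gamma> (apply (mon_word P w) x) = apply (mon_word P w) (tmap \<gamma> x)"
  using poly_iso.tmap_tflags[OF Aut_iso[OF assms(1)] assms(2)] poly_iso.tmap_mon_word[OF Aut_iso[OF assms(1)] assms(2)] by blast+

text \<open>Automorphisms commute with the monodromy action, which is transitive on flags; so the
  image of one flag determines all others.\<close>

lemma Aut_eqI:
  assumes \<gamma>: "\<gamma> \<in> Aut" and \<delta>: "\<delta> \<in> Aut" and x: "x \<in> T" and eq: "tmap \<gamma> x = tmap \<delta> x"
  shows "\<gamma> = \<delta>"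
proof (rule extensionalityI[of _ "elems P"])
  show "\<gamma> \<in> extensional (elems P)" "\<delta> \<in> extensional (elems P)" using \<gamma> \<delta> unfolding Aut_iff Bij_def by blast+
  fix z assume "z \<in> elems P"
  then obtain y where y: "y \<in> T" "z \<in> fset y" using elem_in_tflag by blast
  obtain w where "y = apply (mon_word P w) x" using reach_all[OF x y(1)] unfolding reach_def by blast
  then have eqy: "tmap \<gamma> y = tmap \<delta> y" using Aut_tmap(2)[OF \<gamma> x] Aut_tmap(2)[OF \<delta> x] eq by simp
  obtain j where "z = pick j y" using y(2) unfolding fset_pick by blast
  then show "\<gamma> z = \<delta> z" using eqy pick_tmap by metis
qed

lemma tmap_compose: assumes "x \<in> T" shows "tmap (compose (elems P) \<gamma> \<delta>) x = tmap \<gamma> (tmap \<delta> x)"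
  and "tmap (\<lambda>z\<in>elems P. z) x = x"
proof -
  obtain v e f where x: "x = (v, e, f)" by (metis prod_cases3)
  have "v \<in> elems P" "e \<in> elems P" "f \<in> elems P"
    using tflags_components[OF assms[unfolded x]] rank_simps(4-6) by blast+
  then show "tmap (compose (elems P) \<gamma> \<delta>) x = tmap \<gamma> (tmap \<delta> x)" "tmap (\<lambda>z\<in>elems P. z) x = x"
    unfolding x by (simp_all add: compose_def)
qed

lemma Aut_mult:
  assumes \<gamma>: "\<gamma> \<in> Aut" and \<delta>: "\<delta> \<in> Aut"
  shows "\<gamma> \<otimes>\<^bsub>aut_group P\<^esub> \<delta> \<in> Aut" "x \<in> T \<Longrightarrow> tmap (\<gamma> \<otimes>\<^bsub>aut_group P\<^esub> \<delta>) x = tmap \<gamma> (tmap \<delta> x)"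
proof -
  have B: "\<gamma> \<in> Bij (elems P)" "\<delta> \<in> Bij (elems P)" using \<gamma> \<delta> unfolding Aut_iff by blast+
  have eq: "\<gamma> \<otimes>\<^bsub>aut_group P\<^esub> \<delta> = compose (elems P) \<gamma> \<delta>"
    unfolding aut_group_def BijGroup_def using B by simp
  have \<delta>e: "\<delta> z \<in> elems P" if "z \<in> elems P" for z using B(2) that unfolding Bij_def bij_betw_def by blast
  have c: "compose (elems P) \<gamma> \<delta> \<in> Bij (elems P)" using B by (rule compose_Bij)
  have "\<forall>z\<in>elems P. \<forall>z'\<in>elems P. (z, z') \<in> leq P \<longleftrightarrow> (\<gamma> (\<delta> z), \<gamma> (\<delta> z')) \<in> leq P"
    using \<gamma> \<delta> \<delta>e unfolding Aut_iff poset_iso_map_def elems_def[symmetric] by metis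
  then have "poset_iso_map (leq P) (leq P) (compose (elems P) \<gamma> \<delta>)"
    using c unfolding poset_iso_map_def elems_def[symmetric] Bij_def by (simp add: compose_def)
  then show "\<gamma> \<otimes>\<^bsub>aut_group P\<^esub> \<delta> \<in> Aut" using c unfolding eq Aut_iff by blast
  show "x \<in> T \<Longrightarrow> tmap (\<gamma> \<otimes>\<^bsub>aut_group P\<^esub> \<delta>) x = tmap \<gamma> (tmap \<delta> x)" unfolding eq by (rule tmap_compose(1))
qed

lemma Aut_one: "\<one>\<^bsub>aut_group P\<^esub> \<in> Aut" "x \<in> T \<Longrightarrow> tmap \<one>\<^bsub>aut_group P\<^esub> x = x"
proof -
  have eq: "\<one>\<^bsub>aut_group P\<^esub> = (\<lambda>z\<in>elems P. z)" unfolding aut_group_def BijGroup_def by simp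
  show "\<one>\<^bsub>aut_group P\<^esub> \<in> Aut" unfolding eq Aut_iff
    using id_Bij[of "elems P"] by (simp add: poset_iso_map_def Bij_def elems_def[symmetric])
  show "x \<in> T \<Longrightarrow> tmap \<one>\<^bsub>aut_group P\<^esub> x = x" unfolding eq by (rule tmap_compose(2))
qed

end

section \<open>The monodromy group of a regular polyhedron acts freely on flags\<close>

locale reg_polyhedron = fin_polyhedron +
  assumes regular: "regular_polyhedron P"
begin

lemma Aut_transitive: assumes x: "x \<in> T" and y: "y \<in> T" shows "\<exists>\<gamma>\<in>Aut. tmap \<gamma> x = y"
proof -
  obtain \<gamma> where \<gamma>: "\<gamma> \<in> Aut" "\<gamma> ` fset x = fset y"
    using regular fset_flag[OF x] fset_flag[OF y] unfolding regular_polyhedron_def by blast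
  then have "fset (tmap \<gamma> x) = fset y" by (simp add: fset_tmap)
  then have "tmap \<gamma> x = y" using fset_inj Aut_tmap(1)[OF \<gamma>(1) x] y unfolding inj_on_def by blast
  then show ?thesis using \<gamma> by blast
qed

text \<open>A word that fixes one flag fixes all its images under automorphisms, hence by regularity
  every flag.\<close>

lemma mon_word_one: assumes x: "x \<in> T" and fix_x: "apply (mon_word P w) x = x" shows "mon_word P w = 1"
proof (rule perm_eqI)
  fix y show "apply (mon_word P w) y = apply 1 y"
  proof (cases "y \<in> T")
    case True
    then obtain \<gamma> where "\<gamma> \<in> Aut" "tmap \<gamma> x = y" using Aut_transitive x by blast
    then show ?thesis using Aut_tmap(2)[of \<gamma> x w] x fix_x by simp
  qed (simp add: mon_word_outside)
qed

lemma mon_word_rev_mult: "mon_word P (rev w) * mon_word P w = 1"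
  by (rule perm_eqI) (simp add: apply_times mon_word_rev)

lemma mon_word_eqI: assumes x: "x \<in> T" and eq: "apply (mon_word P u) x = apply (mon_word P w) x"
  shows "mon_word P u = mon_word P w"
proof -
  have "apply (mon_word P (rev w @ u)) x = x" by (simp only: mon_word_append eq mon_word_rev)
  then have "mon_word P (rev w) * mon_word P u = 1" using mon_word_one[OF x, of "rev w @ u"] by (simp add: ev_append)
  then show ?thesis using mon_word_rev_mult[of w] perm_mult_left_cancel by metis
qed

lemma word_power: "\<exists>u. set u \<subseteq> {i, j} \<and> mon_word P u = (mon P i * mon P j) ^ k"
proof (induction k)
  case 0
  show ?case by (rule exI[of _ "[]"]) simp
next
  case (Suc k)
  then obtain u where "set u \<subseteq> {i, j}" "mon_word P u = (mon P i * mon P j) ^ k" by blast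
  then show ?case by (intro exI[of _ "i # j # u"]) (simp add: letter_mon mult.assoc)
qed

lemma finite_words: "finite (range (mon_word P))"
proof -
  obtain x where x: "x \<in> T" using tflags_nonempty by blast
  have "inj_on (\<lambda>g. apply g x) (range (mon_word P))" using mon_word_eqI[OF x] unfolding inj_on_def by blast
  moreover have "(\<lambda>g. apply g x) ` range (mon_word P) \<subseteq> T" using mon_word_T[OF x] by blast
  ultimately show ?thesis using finite_tflags inj_on_finite by blast
qed

lemma finite_order: "\<exists>m>0. (mon P i * mon P j) ^ m = 1"
proof -
  have "range (\<lambda>k::nat. (mon P i * mon P j) ^ k) \<subseteq> range (mon_word P)"
    using word_power[of i j] by (metis (no_types, lifting) image_subset_iff rangeI)
  then have "finite (range (\<lambda>k::nat. (mon P i * mon P j) ^ k))" using finite_words finite_subset by blast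
  then have "\<not> inj (\<lambda>k::nat. (mon P i * mon P j) ^ k)" using finite_imageD by blast
  then obtain k l :: nat where kl: "k < l" "(mon P i * mon P j) ^ k = (mon P i * mon P j) ^ l"
    unfolding inj_on_def by (metis linorder_neqE_nat)
  have "(mon P i * mon P j) ^ l = (mon P i * mon P j) ^ k * (mon P i * mon P j) ^ (l - k)"
    using kl(1) by (simp flip: power_add)
  then have "(mon P i * mon P j) ^ k * (mon P i * mon P j) ^ (l - k) = (mon P i * mon P j) ^ k * 1" using kl(2) by simp
  then have "(mon P i * mon P j) ^ (l - k) = 1" unfolding perm_mult_left_cancel .
  then show ?thesis using kl(1) by (intro exI[of _ "l - k"]) simp
qed

lemma dih_words: "dih (mon P i) (mon P j) = mon_word P ` {w. set w \<subseteq> {i, j}}"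
proof
  show "dih (mon P i) (mon P j) \<subseteq> mon_word P ` {w. set w \<subseteq> {i, j}}"
  proof
    fix g assume "g \<in> dih (mon P i) (mon P j)"
    then obtain k where k: "g = (mon P i * mon P j) ^ k \<or> g = (mon P i * mon P j) ^ k * mon P j" unfolding dih_def by blast
    obtain u where u: "set u \<subseteq> {i, j}" "mon_word P u = (mon P i * mon P j) ^ k" using word_power by blast
    then have "g = mon_word P u \<or> g = mon_word P (u @ [j])" using k by (simp add: ev_append letter_mon)
    moreover have "set (u @ [j]) \<subseteq> {i, j}" using u(1) by simp
    ultimately show "g \<in> mon_word P ` {w. set w \<subseteq> {i, j}}" using u(1) by blast
  qed
  show "mon_word P ` {w. set w \<subseteq> {i, j}} \<subseteq> dih (mon P i) (mon P j)"
  proof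
    fix g assume "g \<in> mon_word P ` {w. set w \<subseteq> {i, j}}"
    then obtain w where w: "set w \<subseteq> {i, j}" "g = mon_word P w" by blast
    obtain m where m: "m > 0" "(mon P i * mon P j) ^ m = 1" using finite_order by blast
    note cl = dih_left_closed[OF mon_mon mon_mon m]
    have "mon_word P w \<in> dih (mon P i) (mon P j)" using w(1)
    proof (induction w)
      case Nil
      show ?case using dihI(1)[of "mon P i" "mon P j" 0] by simp
    next
      case (Cons k w)
      then have "k = i \<or> k = j" "mon_word P w \<in> dih (mon P i) (mon P j)" by auto
      then show ?case using cl by (auto simp: letter_mon)
    qed
    then show "g \<in> dih (mon P i) (mon P j)" using w(2) by simp
  qed
qed

text \<open>Distinct group elements move a flag to distinct flags, so the order of the dihedral
  group is the size of its orbit \<open>S\<close>.\<close>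

lemma bij_dih:
  assumes x: "x \<in> T" and S: "S \<subseteq> T" and reach: "\<And>y. y \<in> S \<Longrightarrow> (x, y) \<in> reach {i, j}"
    and closed: "\<And>w. set w \<subseteq> {i, j} \<Longrightarrow> apply (mon_word P w) x \<in> S"
  shows "card (dih (mon P i) (mon P j)) = card S"
proof (rule bij_betw_same_card)
  show "bij_betw (\<lambda>g. apply g x) (dih (mon P i) (mon P j)) S"
    unfolding bij_betw_def
  proof
    show "inj_on (\<lambda>g. apply g x) (dih (mon P i) (mon P j))"
      unfolding dih_words inj_on_def using mon_word_eqI[OF x] by blast
    show "(\<lambda>g. apply g x) ` dih (mon P i) (mon P j) = S"
    proof
      show "(\<lambda>g. apply g x) ` dih (mon P i) (mon P j) \<subseteq> S" unfolding dih_words using closed by blast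
      show "S \<subseteq> (\<lambda>g. apply g x) ` dih (mon P i) (mon P j)"
      proof
        fix y assume "y \<in> S"
        then obtain w where "set w \<subseteq> {i, j}" "y = apply (mon_word P w) x" using reach unfolding reach_def by blast
        then show "y \<in> (\<lambda>g. apply g x) ` dih (mon P i) (mon P j)" unfolding dih_words by blast
      qed
    qed
  qed
qed

lemma dihedral_mon:
  assumes "card (dih (mon P i) (mon P j)) = 2 * n" and ij: "i \<noteq> j"
  shows "dihedral (mon P i) (mon P j) n" "2 \<le> n"
proof -
  obtain x where x: "x \<in> T" using tflags_nonempty by blast
  obtain m where m: "m > 0" "(mon P i * mon P j) ^ m = 1" using finite_order by blast
  let ?D = "dih (mon P i) (mon P j)"
  have sub: "{1, mon P i, mon P j} \<subseteq> ?D"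
    using dihI[of "mon P i" "mon P j" 0] dihI(2)[of "mon P i" "mon P j" 1] by (simp add: mult.assoc mon_mon)
  have ne: "mon P k \<noteq> 1" "k \<noteq> l \<Longrightarrow> mon P k \<noteq> mon P l" for k l
    using adj_neq[OF x, of k] apply_mon by (metis apply_one id_apply)+
  have fin: "finite ?D" unfolding dih_words by (rule finite_subset[OF _ finite_words]) blast
  have "card {1, mon P i, mon P j} = 3" using ne ij by simp
  then have "3 \<le> card ?D" using card_mono[OF fin sub] by simp
  then show n: "2 \<le> n" using assms(1) by simp
  show "dihedral (mon P i) (mon P j) n" by (rule dihedral_of_card[OF mon_mon mon_mon assms(1) n m])
qed

lemma dih_pick: assumes "x \<in> T" "k \<noteq> i" "k \<noteq> j" "g \<in> dih (mon P i) (mon P j)" shows "pick k (apply g x) = pick k x"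
  using assms mon_word_pick[OF assms(1), of k] unfolding dih_words by blast

text \<open>A face lies in \<open>2 * p\<close> flags and a vertex in \<open>2 * q\<close>, which
  gives the two dihedral groups. The \<open>p\<close> rotations of the base face, multiplied by the
  \<open>2 * q\<close> elements of the vertex group, move the base flag to \<open>2 * p * q\<close>
  distinct flags. By tightness these are all flags, and freeness turns this into the
  factorisation.\<close>

theorem tight_triple_mon:
  assumes type: "has_type P p q" and flags: "card (flags P) = 2 * p * q"
  shows "tight_triple (mon P R0) (mon P R1) (mon P R2) p q"
proof -
  obtain x where x: "x \<in> T" using tflags_nonempty by blast
  obtain v e f where xs: "x = (v, e, f)" by (metis prod_cases3)
  note t = tflags_components[OF x[unfolded xs]]
  define E where "E = {e \<in> edges P. (e, f) \<in> leq P}"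
  define E' where "E' = {e \<in> edges P. (v, e) \<in> leq P}"
  have E: "finite E" "card E = p" "finite E'" "card E' = q"
    using type t unfolding has_type_def E_def E'_def by blast+
  let ?S = "{y \<in> T. pick R2 y = f}" and ?S' = "{y \<in> T. pick R0 y = v}"
  have cS: "card ?S = 2 * p" and cS': "card ?S' = 2 * q"
    using card_face_flags[OF t(3)] card_vertex_flags[OF t(1)] E unfolding E_def E'_def by simp_all
  have d: "card (dih (mon P R0) (mon P R1)) = 2 * p" unfolding cS[symmetric]
  proof (rule bij_dih[OF x])
    show "y \<in> ?S \<Longrightarrow> (x, y) \<in> reach {R0, R1}" for y
      using reach_face x unfolding xs by (cases y) auto
    show "set w \<subseteq> {R0, R1} \<Longrightarrow> apply (mon_word P w) x \<in> ?S" for w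
      using mon_word_T[OF x, of w] mon_word_pick[OF x, of R2 w] by (auto simp: xs)
  qed blast
  have d': "card (dih (mon P R2) (mon P R1)) = 2 * q" unfolding cS'[symmetric]
  proof (rule bij_dih[OF x])
    show "y \<in> ?S' \<Longrightarrow> (x, y) \<in> reach {R2, R1}" for y
      using reach_vertex x unfolding xs by (cases y) (auto simp: insert_commute)
    show "set w \<subseteq> {R2, R1} \<Longrightarrow> apply (mon_word P w) x \<in> ?S'" for w
      using mon_word_T[OF x, of w] mon_word_pick[OF x, of R0 w] by (auto simp: xs)
  qed blast
  interpret A: dihedral "mon P R0" "mon P R1" p using dihedral_mon(1)[OF d] by simp
  interpret B: dihedral "mon P R2" "mon P R1" q using dihedral_mon(1)[OF d'] by simp
  have p2: "2 \<le> p" and q2: "2 \<le> q" using dihedral_mon(2)[OF d] dihedral_mon(2)[OF d'] by simp_all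
  let ?a = "mon P R0" and ?b = "mon P R1" and ?c = "mon P R2"
  have words: "\<exists>w. g = mon_word P w" if "g \<in> dih (mon P i) (mon P j)" for g i j using that unfolding dih_words by blast
  have int: "dih ?a ?b \<inter> dih ?c ?b \<subseteq> {1, ?b}"
  proof
    fix g assume g: "g \<in> dih ?a ?b \<inter> dih ?c ?b"
    then obtain w where w: "g = mon_word P w" using words by blast
    have pk: "pick R0 (apply g x) = pick R0 x" "pick R2 (apply g x) = pick R2 x"
      using dih_pick[OF x, of R0 R2 R1 g] dih_pick[OF x, of R2 R0 R1 g] g by simp_all
    have gx: "apply g x \<in> T" using mon_word_T[OF x] w by blast
    show "g \<in> {1, ?b}"
    proof (cases "pick R1 (apply g x) = pick R1 x")
      case True
      then have "apply g x = x" using pk by (intro triple_eqI) (metis letter.exhaust)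
      then show ?thesis using mon_word_one[OF x] w by blast
    next
      case False
      then have "adj_to R1 x (apply g x)" using pk unfolding adj_to_def letter_all by simp
      then have "apply (mon_word P w) x = apply (mon_word P [R1]) x"
        using adj_unique[OF x gx] w by (simp add: apply_mon)
      then have "g = mon_word P [R1]" using mon_word_eqI[OF x] w by blast
      then show ?thesis by simp
    qed
  qed
  define F where "F = (\<lambda>(i, g). apply ((?a * ?b) ^ i * g) x)"
  have wd: "\<exists>w. (?a * ?b) ^ i * g = mon_word P w" if g: "g \<in> dih ?c ?b" for i g
  proof -
    obtain u w where "(?a * ?b) ^ i = mon_word P u" "g = mon_word P w" using words[OF g] words[OF dihI(1)] by blast
    then have "(?a * ?b) ^ i * g = mon_word P (u @ w)" by (simp add: ev_append)
    then show ?thesis by blast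
  qed
  have le: "i = j" if "i \<le> j" "j < p" "g \<in> dih ?c ?b" "g' \<in> dih ?c ?b" "(?a * ?b) ^ i * g = (?a * ?b) ^ j * g'" for i j g g'
  proof -
    have "(?a * ?b) ^ j = (?a * ?b) ^ i * (?a * ?b) ^ (j - i)" using that(1) by (simp flip: power_add)
    then have "g = (?a * ?b) ^ (j - i) * g'" using that(5) by (simp add: mult.assoc)
    then have "(?a * ?b) ^ (j - i) = g * inverse g'" by (simp add: mult.assoc)
    then have "(?a * ?b) ^ (j - i) \<in> dih ?c ?b" using that(3,4) B.dih_mult B.dih_inverse by simp
    then have "(?a * ?b) ^ (j - i) \<in> {1, ?b}" using int dihI(1) by blast
    then have "p dvd (j - i)" using A.ord A.not_refl by blast
    then show "i = j" using that(1,2) by (metis diff_is_0_eq dvd_imp_le le_antisym less_imp_diff_less not_gr_zero not_less)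
  qed
  have inj: "inj_on F ({..<p} \<times> dih ?c ?b)"
  proof (rule inj_onI)
    fix s s' assume s: "s \<in> {..<p} \<times> dih ?c ?b" "s' \<in> {..<p} \<times> dih ?c ?b" "F s = F s'"
    obtain i g where 1: "s = (i, g)" by (cases s)
    obtain j g' where 2: "s' = (j, g')" by (cases s')
    have m: "i < p" "j < p" "g \<in> dih ?c ?b" "g' \<in> dih ?c ?b" using s unfolding 1 2 by auto
    obtain u w where uw: "(?a * ?b) ^ i * g = mon_word P u" "(?a * ?b) ^ j * g' = mon_word P w" using wd m by metis
    have "apply (mon_word P u) x = apply (mon_word P w) x" using s(3) unfolding 1 2 F_def by (simp add: uw)
    then have eq: "(?a * ?b) ^ i * g = (?a * ?b) ^ j * g'" using mon_word_eqI[OF x] uw by simp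
    have "i = j" using le[OF _ m(2,3,4) eq] le[OF _ m(1,4,3) eq[symmetric]] by linarith
    then show "s = s'" using eq unfolding 1 2 by simp
  qed
  have "F ` ({..<p} \<times> dih ?c ?b) \<subseteq> T"
  proof
    fix y assume "y \<in> F ` ({..<p} \<times> dih ?c ?b)"
    then obtain i g where g: "g \<in> dih ?c ?b" "y = F (i, g)" by blast
    obtain w where "(?a * ?b) ^ i * g = mon_word P w" using wd[OF g(1)] by blast
    then have "y = apply (mon_word P w) x" unfolding g(2) F_def by simp
    then show "y \<in> T" using mon_word_T[OF x] by blast
  qed
  moreover have "card (F ` ({..<p} \<times> dih ?c ?b)) = card T"
    using card_image[OF inj] d' flags card_flags by (simp add: card_cartesian_product)
  ultimately have surj: "F ` ({..<p} \<times> dih ?c ?b) = T" using finite_tflags card_subset_eq by blast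
  have ev: "\<forall>w. \<exists>d\<in>dih ?a ?b. \<exists>e\<in>dih ?c ?b. mon_word P w = d * e"
  proof
    fix w
    have "apply (mon_word P w) x \<in> F ` ({..<p} \<times> dih ?c ?b)" unfolding surj by (rule mon_word_T[OF x])
    then obtain i g where g: "g \<in> dih ?c ?b" "apply (mon_word P w) x = F (i, g)" by blast
    obtain u where u: "(?a * ?b) ^ i * g = mon_word P u" using wd[OF g(1)] by blast
    then have "apply (mon_word P w) x = apply (mon_word P u) x" using g(2) unfolding F_def by simp
    then have "mon_word P w = (?a * ?b) ^ i * g" using mon_word_eqI[OF x] u by simp
    then show "\<exists>d\<in>dih ?a ?b. \<exists>e\<in>dih ?c ?b. mon_word P w = d * e" using g(1) dihI(1)[of ?a ?b i] by blast
  qed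
  show ?thesis
    by unfold_locales (use mon_mon mon_20 p2 q2 A.ord B.ord A.not_refl B.not_refl int ev in \<open>auto simp: subset_iff\<close>)
qed

end

section \<open>Automorphisms and orientability\<close>

context reg_polyhedron begin

text \<open>Links an automorphism to a word through their common effect on the flag
  \<open>x\<close>. Every automorphism follows some word and every word is followed by exactly one
  automorphism, so questions about the automorphism group become questions about words.\<close>

definition follows :: "'a triple \<Rightarrow> ('a \<Rightarrow> 'a) \<Rightarrow> letter list \<Rightarrow> bool" where
  "follows x \<gamma> w \<longleftrightarrow> \<gamma> \<in> Aut \<and> tmap \<gamma> x = apply (mon_word P w) x"

lemma follows_Aut: "follows x \<gamma> w \<Longrightarrow> \<gamma> \<in> Aut"
  unfolding follows_def by blast

text \<open>Automorphisms commute with the monodromy group, so the order of the words is reversed.\<close>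

lemma follows_mult:
  assumes x: "x \<in> T" and \<gamma>: "follows x \<gamma> w" and \<delta>: "follows x \<delta> u"
  shows "follows x (\<gamma> \<otimes>\<^bsub>aut_group P\<^esub> \<delta>) (u @ w)"
  unfolding follows_def
proof
  show "\<gamma> \<otimes>\<^bsub>aut_group P\<^esub> \<delta> \<in> Aut" using Aut_mult(1) \<gamma> \<delta> follows_Aut by blast
  have "tmap (\<gamma> \<otimes>\<^bsub>aut_group P\<^esub> \<delta>) x = tmap \<gamma> (tmap \<delta> x)"
    using Aut_mult(2)[OF _ _ x] \<gamma> \<delta> follows_Aut by blast
  also have "\<dots> = apply (mon_word P u) (tmap \<gamma> x)"
    using Aut_tmap(2)[OF follows_Aut[OF \<gamma>] x] \<delta> unfolding follows_def by simp
  also have "\<dots> = apply (mon_word P (u @ w)) x" using \<gamma> unfolding follows_def mon_word_append by simp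
  finally show "tmap (\<gamma> \<otimes>\<^bsub>aut_group P\<^esub> \<delta>) x = apply (mon_word P (u @ w)) x" .
qed

lemma follows_unique:
  "x \<in> T \<Longrightarrow> follows x \<gamma> w \<Longrightarrow> follows x \<delta> u \<Longrightarrow> mon_word P w = mon_word P u \<Longrightarrow> \<gamma> = \<delta>"
  unfolding follows_def using Aut_eqI[of \<gamma> \<delta> x] by simp

lemma follows_one: "x \<in> T \<Longrightarrow> follows x \<one>\<^bsub>aut_group P\<^esub> []"
  unfolding follows_def using Aut_one by simp

lemma follows_exists: "x \<in> T \<Longrightarrow> \<exists>\<gamma>. follows x \<gamma> w"
  using Aut_transitive[OF _ mon_word_T] unfolding follows_def by blast

lemma word_exists: assumes x: "x \<in> T" and \<gamma>: "\<gamma> \<in> Aut" shows "\<exists>w. follows x \<gamma> w"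
  using reach_all[OF x Aut_tmap(1)[OF \<gamma> x]] \<gamma> unfolding follows_def reach_def by blast

lemma mon_word_mult_rev: "mon_word P w * mon_word P (rev w) = 1"
  using mon_word_rev_mult[of "rev w"] by simp

text \<open>The laws are inherited from concatenation of words, since an automorphism is determined
  by the value of a word that it follows.\<close>

lemma group_aut: "group (aut_group P)"
proof (rule groupI)
  obtain x where x: "x \<in> T" using tflags_nonempty by blast
  show "\<gamma> \<otimes>\<^bsub>aut_group P\<^esub> \<delta> \<in> Aut" if "\<gamma> \<in> Aut" "\<delta> \<in> Aut" for \<gamma> \<delta> using Aut_mult(1) that by blast
  show "\<one>\<^bsub>aut_group P\<^esub> \<in> Aut" by (rule Aut_one)
  fix \<gamma> assume \<gamma>: "\<gamma> \<in> Aut"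
  obtain w where w: "follows x \<gamma> w" using word_exists[OF x \<gamma>] by blast
  show "\<one>\<^bsub>aut_group P\<^esub> \<otimes>\<^bsub>aut_group P\<^esub> \<gamma> = \<gamma>"
    by (rule follows_unique[OF x follows_mult[OF x follows_one[OF x] w] w]) simp
  obtain \<delta> where \<delta>: "follows x \<delta> (rev w)" using follows_exists[OF x] by blast
  have "\<delta> \<otimes>\<^bsub>aut_group P\<^esub> \<gamma> = \<one>\<^bsub>aut_group P\<^esub>"
    by (rule follows_unique[OF x follows_mult[OF x \<delta> w] follows_one[OF x]]) (simp add: ev_append mon_word_mult_rev)
  then show "\<exists>\<delta>\<in>Aut. \<delta> \<otimes>\<^bsub>aut_group P\<^esub> \<gamma> = \<one>\<^bsub>aut_group P\<^esub>" using follows_Aut[OF \<delta>] by blast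
  fix \<eta> \<theta> assume \<eta>: "\<eta> \<in> Aut" "\<theta> \<in> Aut"
  obtain u where u: "follows x \<eta> u" using word_exists[OF x \<eta>(1)] by blast
  obtain v where v: "follows x \<theta> v" using word_exists[OF x \<eta>(2)] by blast
  show "\<gamma> \<otimes>\<^bsub>aut_group P\<^esub> \<eta> \<otimes>\<^bsub>aut_group P\<^esub> \<theta> = \<gamma> \<otimes>\<^bsub>aut_group P\<^esub> (\<eta> \<otimes>\<^bsub>aut_group P\<^esub> \<theta>)"
    by (rule follows_unique[OF x follows_mult[OF x follows_mult[OF x w u] v] follows_mult[OF x w follows_mult[OF x u v]]]) simp
qed

sublocale A: group "aut_group P"
  by (rule group_aut)

lemma follows_inv: assumes x: "x \<in> T" and w: "follows x \<gamma> w" shows "follows x (inv\<^bsub>aut_group P\<^esub> \<gamma>) (rev w)"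
proof -
  obtain \<delta> where \<delta>: "follows x \<delta> (rev w)" using follows_exists[OF x] by blast
  have "\<delta> \<otimes>\<^bsub>aut_group P\<^esub> \<gamma> = \<one>\<^bsub>aut_group P\<^esub>"
    by (rule follows_unique[OF x follows_mult[OF x \<delta> w] follows_one[OF x]]) (simp add: ev_append mon_word_mult_rev)
  then have "inv\<^bsub>aut_group P\<^esub> \<gamma> = \<delta>" using A.inv_equality follows_Aut w \<delta> by blast
  then show ?thesis using \<delta> by simp
qed

lemma flag_reflection_follows:
  assumes x: "x \<in> T" shows "follows x (flag_reflection P (fset x) (rank_of i)) [i]"
proof -
  obtain \<gamma> where \<gamma>: "follows x \<gamma> [i]" using follows_exists[OF x] by blast
  have iff: "\<delta> \<in> Aut \<and> \<delta> ` fset x = fset (adj P i x) \<longleftrightarrow> follows x \<delta> [i]" for \<delta>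
  proof
    assume \<delta>: "\<delta> \<in> Aut \<and> \<delta> ` fset x = fset (adj P i x)"
    then have "fset (tmap \<delta> x) = fset (adj P i x)" by (simp add: fset_tmap)
    then have "tmap \<delta> x = adj P i x"
      using fset_inj Aut_tmap(1)[of \<delta> x] adj_spec(1)[OF x] \<delta> x unfolding inj_on_def by blast
    then show "follows x \<delta> [i]" using \<delta> unfolding follows_def mon_word_Cons by simp
  next
    assume "follows x \<delta> [i]"
    then show "\<delta> \<in> Aut \<and> \<delta> ` fset x = fset (adj P i x)"
      unfolding follows_def mon_word_Cons fset_tmap[symmetric] by simp
  qed
  have "flag_reflection P (fset x) (rank_of i) = \<gamma>"
    unfolding flag_reflection_def adjacent_flag_eq[OF x] iff
    using \<gamma> follows_unique[OF x _ \<gamma>] by (intro the_equality) blast+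
  then show ?thesis using \<gamma> by simp
qed

text \<open>An even word splits into pairs of letters. Each pair gives a product of two reflections,
  and all of these are products of the two generators and their inverses; the reflections of ranks 0
  and 2 are paired by multiplying both generators.\<close>

lemma rotation_subgroup_eq:
  assumes x: "x \<in> T" shows "rotation_subgroup P (fset x) = {\<gamma>. \<exists>w. even (length w) \<and> follows x \<gamma> w}"
proof -
  let ?M = "aut_group P"
  define \<rho> where "\<rho> = (\<lambda>i. flag_reflection P (fset x) (rank_of i))"
  define H where "H = {\<rho> R0 \<otimes>\<^bsub>?M\<^esub> \<rho> R1, \<rho> R1 \<otimes>\<^bsub>?M\<^esub> \<rho> R2}"
  have \<rho>: "follows x (\<rho> i) [i]" for i unfolding \<rho>_def by (rule flag_reflection_follows[OF x])
  have \<rho>\<rho>: "follows x (\<rho> i \<otimes>\<^bsub>?M\<^esub> \<rho> j) [j, i]" for i j using follows_mult[OF x \<rho> \<rho>, of i j] by simp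
  have rot: "rotation_subgroup P (fset x) = generate ?M H"
    unfolding rotation_subgroup_def H_def \<rho>_def by simp
  have H: "\<exists>w. even (length w) \<and> follows x \<gamma> w" if "\<gamma> \<in> H" for \<gamma>
  proof -
    have "even (length [R1, R0])" "even (length [R2, R1])" by simp_all
    then show ?thesis using that \<rho>\<rho>[of R0 R1] \<rho>\<rho>[of R1 R2] unfolding H_def by blast
  qed
  have 1: "\<exists>w. even (length w) \<and> follows x \<gamma> w" if "\<gamma> \<in> generate ?M H" for \<gamma>
    using that
  proof (induction rule: generate.induct)
    case one
    show ?case by (rule exI[of _ "[]"]) (simp add: follows_one[OF x])
  next
    case (incl h)
    then show ?case by (rule H)
  next
    case (inv h)
    then obtain w where "even (length w)" "follows x h w" using H by blast
    then have "even (length (rev w)) \<and> follows x (inv\<^bsub>?M\<^esub> h) (rev w)" using follows_inv[OF x] by simp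
    then show ?case by blast
  next
    case (eng h1 h2)
    then obtain w u where "even (length w)" "follows x h1 w" "even (length u)" "follows x h2 u" by blast
    then have "even (length (u @ w)) \<and> follows x (h1 \<otimes>\<^bsub>?M\<^esub> h2) (u @ w)" using follows_mult[OF x] by simp
    then show ?case by blast
  qed
  have g\<rho>: "\<rho> i \<in> Aut" for i using follows_Aut[OF \<rho>] .
  have sq: "\<rho> i \<otimes>\<^bsub>?M\<^esub> \<rho> i = \<one>\<^bsub>?M\<^esub>" for i
    by (rule follows_unique[OF x \<rho>\<rho> follows_one[OF x]]) (simp add: letter_mon mon_mon)
  have inv: "inv\<^bsub>?M\<^esub> (\<rho> i \<otimes>\<^bsub>?M\<^esub> \<rho> j) = \<rho> j \<otimes>\<^bsub>?M\<^esub> \<rho> i" for i j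
    using A.inv_mult_group[OF g\<rho> g\<rho>] A.inv_equality[OF sq g\<rho> g\<rho>] by simp
  have H_sub: "H \<subseteq> Aut" unfolding H_def using g\<rho> by simp
  have gen_inv: "inv\<^bsub>?M\<^esub> h \<in> generate ?M H" if "h \<in> generate ?M H" for h
    using A.generate_m_inv_closed[OF H_sub that] .
  have s: "\<rho> R0 \<otimes>\<^bsub>?M\<^esub> \<rho> R1 \<in> generate ?M H" and t: "\<rho> R1 \<otimes>\<^bsub>?M\<^esub> \<rho> R2 \<in> generate ?M H"
    unfolding H_def by (rule generate.incl, simp)+
  have "\<rho> R0 \<otimes>\<^bsub>?M\<^esub> \<rho> R2 = (\<rho> R0 \<otimes>\<^bsub>?M\<^esub> \<rho> R1) \<otimes>\<^bsub>?M\<^esub> (\<rho> R1 \<otimes>\<^bsub>?M\<^esub> \<rho> R2)"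
    by (rule follows_unique[OF x \<rho>\<rho> follows_mult[OF x \<rho>\<rho> \<rho>\<rho>]]) (simp add: letter_mon mon_mon invol_cancel)
  then have st: "\<rho> R0 \<otimes>\<^bsub>?M\<^esub> \<rho> R2 \<in> generate ?M H" using generate.eng[OF s t] by simp
  have pair: "\<rho> i \<otimes>\<^bsub>?M\<^esub> \<rho> j \<in> generate ?M H" for i j
    using s t st gen_inv[OF s] gen_inv[OF t] gen_inv[OF st] generate.one[of ?M H]
    unfolding inv by (cases i; cases j) (simp_all add: sq)
  have 2: "\<forall>\<gamma>. even (length w) \<longrightarrow> follows x \<gamma> w \<longrightarrow> \<gamma> \<in> generate ?M H" for w
  proof (induction w rule: induct_list012)
    case 1
    show ?case using follows_unique[OF x _ follows_one[OF x]] generate.one[of ?M H] by fastforce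
  next
    case (3 i j w)
    show ?case
    proof (intro allI impI)
      fix \<gamma> assume ev: "even (length (i # j # w))" and \<gamma>: "follows x \<gamma> (i # j # w)"
      obtain \<delta> where \<delta>: "follows x \<delta> w" using follows_exists[OF x] by blast
      then have "\<delta> \<in> generate ?M H" using "3.IH"(1) ev by simp
      moreover have "\<gamma> = \<delta> \<otimes>\<^bsub>?M\<^esub> (\<rho> j \<otimes>\<^bsub>?M\<^esub> \<rho> i)"
        by (rule follows_unique[OF x \<gamma> follows_mult[OF x \<delta> \<rho>\<rho>]]) simp
      ultimately show "\<gamma> \<in> generate ?M H" using generate.eng pair by metis
    qed
  qed simp
  show ?thesis unfolding rot using 1 2 by blast
qed

text \<open>If every automorphism is a rotation, the reflection of rank 0 also follows an even word,
  and comparing the two words gives a trivial word of odd length. Conversely such a word can be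
  appended to any word to change its parity.\<close>

theorem nonorientably_regular_iff:
  "nonorientably_regular P \<longleftrightarrow> nonorientable_triple (mon P R0) (mon P R1) (mon P R2)"
proof
  assume N: "nonorientably_regular P"
  obtain x where x: "x \<in> T" using tflags_nonempty by blast
  obtain \<gamma> where \<gamma>: "follows x \<gamma> [R0]" using follows_exists[OF x] by blast
  have "rotation_subgroup P (fset x) = Aut" using N fset_flag[OF x] unfolding nonorientably_regular_def by blast
  then obtain w where w: "even (length w)" "follows x \<gamma> w"
    using rotation_subgroup_eq[OF x] follows_Aut[OF \<gamma>] by blast
  have "apply (mon_word P w) x = apply (mon_word P [R0]) x" using w(2) \<gamma> unfolding follows_def by simp
  then have "mon_word P w = mon_word P [R0]" by (rule mon_word_eqI[OF x])
  then have "mon_word P (R0 # w) = 1" by (simp add: mon_mon)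
  moreover have "odd (length (R0 # w))" using w(1) by simp
  ultimately show "nonorientable_triple (mon P R0) (mon P R1) (mon P R2)" unfolding nonorientable_triple_def by blast
next
  assume "nonorientable_triple (mon P R0) (mon P R1) (mon P R2)"
  then obtain u where u: "odd (length u)" "mon_word P u = 1" unfolding nonorientable_triple_def by blast
  have "rotation_subgroup P (fset x) = Aut" if x: "x \<in> T" for x
  proof -
    have "\<exists>w. even (length w) \<and> follows x \<gamma> w" if \<gamma>: "\<gamma> \<in> Aut" for \<gamma>
    proof -
      obtain w where w: "follows x \<gamma> w" using word_exists[OF x \<gamma>] by blast
      then have "follows x \<gamma> (w @ u)" unfolding follows_def mon_word_append by (simp add: u(2))
      moreover have "even (length w) \<or> even (length (w @ u))" using u(1) by simp
      ultimately show ?thesis using w by blast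
    qed
    then show ?thesis unfolding rotation_subgroup_eq[OF x] using follows_Aut by blast
  qed
  then show "nonorientably_regular P" unfolding nonorientably_regular_def flags_eq using regular by blast
qed

end

section \<open>The set of trivial words as a complete isomorphism invariant\<close>

abbreviation mon_kernel :: "'a ranked_poset \<Rightarrow> letter list set" where
  "mon_kernel P \<equiv> word_kernel (mon P R0) (mon P R1) (mon P R2)"

text \<open>The same words fix a flag and its image under the isomorphism, and by regularity a word
  that fixes one flag is trivial.\<close>

lemma kernel_of_iso:
  assumes P: "reg_polyhedron P" and Q: "reg_polyhedron Q" and iso: "poset_isomorphic (leq P) (leq Q)"
  shows "mon_kernel P = mon_kernel Q"
proof -
  interpret P: reg_polyhedron P by (rule P)
  interpret Q: reg_polyhedron Q by (rule Q)
  obtain h where h: "poset_iso_map (leq P) (leq Q) h" using iso unfolding poset_isomorphic_def by blast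
  interpret poly_iso P Q h by unfold_locales (rule h)
  obtain x where x: "x \<in> tflags P" using P.tflags_nonempty by blast
  have inj_T: "y = y'" if "y \<in> tflags P" "y' \<in> tflags P" "tmap h y = tmap h y'" for y y'
  proof (rule triple_eqI)
    fix i
    have "h (pick i y) = h (pick i y')" using that(3) pick_tmap by metis
    then show "pick i y = pick i y'" using inj pick_elems[OF that(1)] pick_elems[OF that(2)] unfolding inj_on_def by blast
  qed
  have "mon_word P w = 1 \<longleftrightarrow> mon_word Q w = 1" for w
  proof
    assume "mon_word P w = 1"
    then have "apply (mon_word Q w) (tmap h x) = tmap h x" using tmap_mon_word[OF x, of w] by simp
    then show "mon_word Q w = 1" by (rule Q.mon_word_one[OF tmap_tflags[OF x]])
  next
    assume "mon_word Q w = 1"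
    then have "tmap h (apply (mon_word P w) x) = tmap h x" using tmap_mon_word[OF x, of w] by simp
    then show "mon_word P w = 1" using P.mon_word_one[OF x] inj_T P.mon_word_T[OF x] x by blast
  qed
  then show ?thesis unfolding word_kernel_def by blast
qed

context fin_polyhedron begin

text \<open>Elements of rank \<open>k\<close> are thereby identified with orbits of flags under the
  words that avoid the letter \<open>k\<close>. Connectedness of vertex figures and faces enters
  here, and it allows the poset to be recovered from the flag action.\<close>

lemma pick_eq_iff:
  assumes x: "x \<in> T" and y: "y \<in> T"
  shows "pick k x = pick k y \<longleftrightarrow> (\<exists>w. k \<notin> set w \<and> y = apply (mon_word P w) x)"
proof
  assume eq: "pick k x = pick k y"
  obtain v e f where xs: "x = (v, e, f)" by (metis prod_cases3)
  obtain v' e' f' where ys: "y = (v', e', f')" by (metis prod_cases3)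
  have "\<exists>J. k \<notin> J \<and> (x, y) \<in> reach J"
  proof (cases k)
    case R0
    then have "(x, y) \<in> reach {R1, R2}" using eq reach_vertex x y unfolding xs ys by simp
    then show ?thesis using R0 by (intro exI[of _ "{R1, R2}"]) simp
  next
    case R1
    then have "(x, y) \<in> reach {R0, R2}" using eq reach_edge x y unfolding xs ys by simp
    then show ?thesis using R1 by (intro exI[of _ "{R0, R2}"]) simp
  next
    case R2
    then have "(x, y) \<in> reach {R0, R1}" using eq reach_face x y unfolding xs ys by simp
    then show ?thesis using R2 by (intro exI[of _ "{R0, R1}"]) simp
  qed
  then show "\<exists>w. k \<notin> set w \<and> y = apply (mon_word P w) x" unfolding reach_def by blast
next
  assume "\<exists>w. k \<notin> set w \<and> y = apply (mon_word P w) x"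
  then show "pick k x = pick k y" using mon_word_pick[OF x] by metis
qed

lemma elem_pick: assumes "z \<in> elems P" shows "\<exists>k. \<exists>x\<in>T. z = pick k x"
  using elem_in_tflag[OF assms] unfolding fset_pick by blast

lemma pick_leq: assumes x: "x \<in> T" and le: "rank_of k \<le> rank_of l" shows "(pick k x, pick l x) \<in> leq P"
proof -
  obtain v e f where xs: "x = (v, e, f)" by (metis prod_cases3)
  note t = tflags_components[OF x[unfolded xs]]
  have "(v, v) \<in> leq P" "(e, e) \<in> leq P" "(f, f) \<in> leq P" using leq_refl rank_simps(4-6) t by blast+
  then show ?thesis using t le unfolding xs by (cases k; cases l) simp_all
qed

lemma leq_iff_pick:
  "(z, z') \<in> leq P \<longleftrightarrow> (\<exists>x\<in>T. \<exists>k l. rank_of k \<le> rank_of l \<and> z = pick k x \<and> z' = pick l x)"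
proof
  assume le: "(z, z') \<in> leq P"
  then have "{z, z'} \<in> Chains (leq P)" unfolding Chains_def using leq_refl leq_elems[OF le] by auto
  then obtain x where x: "x \<in> T" "{z, z'} \<subseteq> fset x" using in_tflag by blast
  then obtain k l where kl: "z = pick k x" "z' = pick l x" using fset_pick by (metis insert_subset)
  have "rk P z \<le> rk P z'" using leq_same_rank[OF le] by fastforce
  then have "rank_of k \<le> rank_of l" unfolding kl rank_pick[OF x(1)] .
  then show "\<exists>x\<in>T. \<exists>k l. rank_of k \<le> rank_of l \<and> z = pick k x \<and> z' = pick l x" using x(1) kl by blast
qed (use pick_leq in blast)

end

text \<open>Equal kernels give a bijection \<open>F\<close> between the flags that commutes with all
  words. As elements are orbits of words avoiding one letter, \<open>F\<close> induces a map
  \<open>h\<close> on elements; the order is preserved because two elements are comparable precisely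
  when some flag contains both.\<close>

lemma iso_of_kernel:
  assumes P: "reg_polyhedron P" and Q: "reg_polyhedron Q" and ker: "mon_kernel P = mon_kernel Q"
  shows "poset_isomorphic (leq P) (leq Q)"
proof -
  interpret P: reg_polyhedron P by (rule P)
  interpret Q: reg_polyhedron Q by (rule Q)
  obtain x where x: "x \<in> tflags P" using P.tflags_nonempty by blast
  obtain x' where x': "x' \<in> tflags Q" using Q.tflags_nonempty by blast
  have one: "mon_word P w = 1 \<longleftrightarrow> mon_word Q w = 1" for w using ker unfolding word_kernel_def by blast
  have eq_iff: "apply (mon_word P w) x = apply (mon_word P u) x \<longleftrightarrow> apply (mon_word Q w) x' = apply (mon_word Q u) x'" for w u
  proof -
    have "apply (mon_word P w) x = apply (mon_word P u) x \<longleftrightarrow> mon_word P (rev u @ w) = 1"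
    proof
      assume "apply (mon_word P w) x = apply (mon_word P u) x"
      then show "mon_word P (rev u @ w) = 1"
        by (intro P.mon_word_one[OF x]) (simp only: P.mon_word_append P.mon_word_rev)
    next
      assume "mon_word P (rev u @ w) = 1"
      then have "mon_word P w = mon_word P u" using P.mon_word_rev_mult[of u] perm_mult_left_cancel by (metis ev_append)
      then show "apply (mon_word P w) x = apply (mon_word P u) x" by simp
    qed
    moreover have "apply (mon_word Q w) x' = apply (mon_word Q u) x' \<longleftrightarrow> mon_word Q (rev u @ w) = 1"
    proof
      assume "apply (mon_word Q w) x' = apply (mon_word Q u) x'"
      then show "mon_word Q (rev u @ w) = 1"
        by (intro Q.mon_word_one[OF x']) (simp only: Q.mon_word_append Q.mon_word_rev)
    next
      assume "mon_word Q (rev u @ w) = 1"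
      then have "mon_word Q w = mon_word Q u" using Q.mon_word_rev_mult[of u] perm_mult_left_cancel by (metis ev_append)
      then show "apply (mon_word Q w) x' = apply (mon_word Q u) x'" by simp
    qed
    ultimately show ?thesis using one by simp
  qed
  define F where "F y = apply (mon_word Q (SOME w. y = apply (mon_word P w) x)) x'" for y
  have F: "F (apply (mon_word P w) x) = apply (mon_word Q w) x'" for w
    unfolding F_def using someI[of "\<lambda>u. apply (mon_word P w) x = apply (mon_word P u) x" w] eq_iff by metis
  have wP: "\<exists>w. y = apply (mon_word P w) x" if "y \<in> tflags P" for y
    using P.reach_all[OF x that] unfolding P.reach_def by blast
  have wQ: "\<exists>w. y = apply (mon_word Q w) x'" if "y \<in> tflags Q" for y
    using Q.reach_all[OF x' that] unfolding Q.reach_def by blast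
  have F_T: "F y \<in> tflags Q" if "y \<in> tflags P" for y
    unfolding F_def by (rule Q.mon_word_T[OF x'])
  have F_surj: "\<exists>y\<in>tflags P. F y = y'" if "y' \<in> tflags Q" for y'
    using wQ[OF that] F P.mon_word_T[OF x] by metis
  have F_word: "y' = apply (mon_word P w) y \<longleftrightarrow> F y' = apply (mon_word Q w) (F y)"
    if y: "y \<in> tflags P" "y' \<in> tflags P" for y y' w
  proof -
    obtain u u' where u: "y = apply (mon_word P u) x" "y' = apply (mon_word P u') x" using wP y by metis
    show ?thesis unfolding u F P.mon_word_append[symmetric] Q.mon_word_append[symmetric] by (rule eq_iff)
  qed
  have F_pick: "pick k y = pick k y' \<longleftrightarrow> pick k (F y) = pick k (F y')"
    if y: "y \<in> tflags P" "y' \<in> tflags P" for y y' k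
    unfolding P.pick_eq_iff[OF y] Q.pick_eq_iff[OF F_T[OF y(1)] F_T[OF y(2)]] using F_word[OF y] by blast
  define h where "h z = (case SOME (k, y). y \<in> tflags P \<and> z = pick k y of (k, y) \<Rightarrow> pick k (F y))" for z
  have h: "h (pick k y) = pick k (F y)" if y: "y \<in> tflags P" for k y
  proof -
    obtain k' y' where s: "(SOME (k', y'). y' \<in> tflags P \<and> pick k y = pick k' y') = (k', y')" by (rule prod.exhaust)
    have "case (k', y') of (k', y') \<Rightarrow> y' \<in> tflags P \<and> pick k y = pick k' y'"
      unfolding s[symmetric] by (rule someI[of _ "(k, y)"]) (simp add: y)
    then have y': "y' \<in> tflags P" "pick k y = pick k' y'" by simp_all
    have "k = k'" using P.rank_pick[OF y, of k] P.rank_pick[OF y'(1), of k'] y'(2) rank_of_inj by simp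
    then have "pick k (F y) = pick k' (F y')" using F_pick[OF y y'(1)] y'(2) by simp
    then show ?thesis unfolding h_def s by simp
  qed
  have h_inj: "z = z'" if z: "z \<in> elems P" "z' \<in> elems P" "h z = h z'" for z z'
  proof -
    obtain k y where y: "y \<in> tflags P" "z = pick k y" using P.elem_pick[OF z(1)] by blast
    obtain k' y' where y': "y' \<in> tflags P" "z' = pick k' y'" using P.elem_pick[OF z(2)] by blast
    have eq: "pick k (F y) = pick k' (F y')" using z(3) h y y' by simp
    then have "k = k'" using Q.rank_pick[OF F_T[OF y(1)], of k] Q.rank_pick[OF F_T[OF y'(1)], of k'] rank_of_inj by simp
    then show ?thesis using F_pick[OF y(1) y'(1)] eq y y' by simp
  qed
  have pick_el: "pick k y \<in> elems P" if "y \<in> tflags P" for k y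
    using P.leq_elems[OF P.pick_leq[OF that, of k k]] by simp
  have pick_el': "pick k y \<in> elems Q" if "y \<in> tflags Q" for k y
    using Q.leq_elems[OF Q.pick_leq[OF that, of k k]] by simp
  have "bij_betw h (elems P) (elems Q)"
    unfolding bij_betw_def
  proof
    show "inj_on h (elems P)" using h_inj by (rule inj_onI)
    show "h ` elems P = elems Q"
    proof
      show "h ` elems P \<subseteq> elems Q" using P.elem_pick h F_T pick_el' by (metis image_subsetI)
      show "elems Q \<subseteq> h ` elems P"
      proof
        fix z assume "z \<in> elems Q"
        then obtain k y where y: "y \<in> tflags Q" "z = pick k y" using Q.elem_pick by blast
        then obtain y' where "y' \<in> tflags P" "F y' = y" using F_surj by blast
        then have "z = h (pick k y')" "pick k y' \<in> elems P" using h y pick_el by simp_all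
        then show "z \<in> h ` elems P" by blast
      qed
    qed
  qed
  moreover have "(z, z') \<in> leq P \<longleftrightarrow> (h z, h z') \<in> leq Q" if z: "z \<in> elems P" "z' \<in> elems P" for z z'
  proof
    assume "(z, z') \<in> leq P"
    then obtain y k l where y: "y \<in> tflags P" "rank_of k \<le> rank_of l" "z = pick k y" "z' = pick l y"
      unfolding P.leq_iff_pick by blast
    then show "(h z, h z') \<in> leq Q" using Q.pick_leq[OF F_T[OF y(1)] y(2)] h by simp
  next
    assume "(h z, h z') \<in> leq Q"
    then obtain y k l where y: "y \<in> tflags Q" "rank_of k \<le> rank_of l" "h z = pick k y" "h z' = pick l y"
      unfolding Q.leq_iff_pick by blast
    obtain y' where y': "y' \<in> tflags P" "F y' = y" using F_surj[OF y(1)] by blast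
    have "h z = h (pick k y')" "h z' = h (pick l y')" using h[OF y'(1)] y y' by simp_all
    then have "z = pick k y'" "z' = pick l y'" using h_inj z pick_el[OF y'(1)] by blast+
    then show "(z, z') \<in> leq P" using P.pick_leq[OF y'(1) y(2)] by simp
  qed
  ultimately have "poset_iso_map (leq P) (leq Q) h" unfolding poset_iso_map_def elems_def[symmetric] by blast
  then show ?thesis unfolding poset_isomorphic_def by blast
qed

section \<open>Coset geometries\<close>

context tight_triple begin

abbreviation "lv \<equiv> letter_val a b c"

text \<open>The stabiliser in \<open>G\<close> of the base element of the given rank.\<close>

definition stab :: "letter \<Rightarrow> 'x perm set" where
  "stab k = ev a b c ` {w. k \<notin> set w}"

section \<open>Stabilisers of the base elements and their intersections\<close>

lemma ev_G: "ev a b c w \<in> G"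
  unfolding G_def by blast

lemma stab_G: "x \<in> stab k \<Longrightarrow> x \<in> G"
  unfolding stab_def G_def by blast

lemma stab_one: "1 \<in> stab k"
  unfolding stab_def by (rule image_eqI[of _ _ "[]"]) simp_all

lemma stab_mult: "g \<in> stab k \<Longrightarrow> h \<in> stab k \<Longrightarrow> g * h \<in> stab k"
proof -
  assume "g \<in> stab k" "h \<in> stab k"
  then obtain u w where "g = ev a b c u" "h = ev a b c w" "k \<notin> set u" "k \<notin> set w" unfolding stab_def by blast
  then have "g * h = ev a b c (u @ w)" "k \<notin> set (u @ w)" by (simp_all add: ev_append)
  then show ?thesis unfolding stab_def by blast
qed

lemma lv_lv: "lv k * lv k = 1"
  by (cases k) (simp_all add: aa bb cc)

lemma ev_rev: "ev a b c (rev w) = inverse (ev a b c w)"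
proof -
  have "ev a b c w * ev a b c (rev w) = 1"
    by (induction w) (simp_all add: ev_append mult.assoc, metis lv_lv mult.assoc mult.right_neutral)
  then show ?thesis by (rule perm_inverse_unique[symmetric])
qed

lemma stab_inverse: "g \<in> stab k \<Longrightarrow> inverse g \<in> stab k"
proof -
  assume "g \<in> stab k"
  then obtain w where w: "g = ev a b c w" "k \<notin> set w" unfolding stab_def by blast
  then have "inverse g = ev a b c (rev w)" "k \<notin> set (rev w)" by (simp_all add: ev_rev)
  then show ?thesis unfolding stab_def by blast
qed

lemma lv_stab: "j \<noteq> k \<Longrightarrow> lv j \<in> stab k"
  unfolding stab_def by (rule image_eqI[of _ _ "[j]"]) simp_all

lemma abc_stab: "a \<in> stab R1" "a \<in> stab R2" "b \<in> stab R0" "b \<in> stab R2" "c \<in> stab R0" "c \<in> stab R1"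
  using lv_stab[of R0 R1] lv_stab[of R0 R2] lv_stab[of R1 R0] lv_stab[of R1 R2] lv_stab[of R2 R0] lv_stab[of R2 R1] by simp_all

lemma stab_sub:
  assumes "\<And>g h. g \<in> S \<Longrightarrow> h \<in> S \<Longrightarrow> g * h \<in> S" "1 \<in> S" "\<And>j. j \<noteq> k \<Longrightarrow> lv j \<in> S"
  shows "stab k \<subseteq> S"
proof
  fix g assume "g \<in> stab k"
  then obtain w where w: "k \<notin> set w" "g = ev a b c w" unfolding stab_def by blast
  have "ev a b c w \<in> S" using w(1) assms by (induction w) auto
  then show "g \<in> S" using w by simp
qed

lemma stab_power: "g \<in> stab k \<Longrightarrow> g ^ n \<in> stab k"
  by (induction n) (simp_all add: stab_one stab_mult)

lemma stab_R0: "stab R0 = dih c b"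
proof
  have bc: "b \<in> dih c b" "c \<in> dih c b" "1 \<in> dih c b"
    using dihI(2)[of c b 0] dihI(2)[of c b 1] dihI(1)[of c b 0] by (simp_all add: mult.assoc bb)
  show "stab R0 \<subseteq> dih c b"
  proof (rule stab_sub)
    show "lv j \<in> dih c b" if "j \<noteq> R0" for j using that bc by (cases j) simp_all
  qed (use E.dih_mult bc in auto)
  show "dih c b \<subseteq> stab R0" unfolding dih_def using abc_stab stab_mult stab_power by auto
qed

lemma stab_R2: "stab R2 = dih a b"
proof
  have bc: "b \<in> dih a b" "a \<in> dih a b" "1 \<in> dih a b"
    using dihI(2)[of a b 0] dihI(2)[of a b 1] dihI(1)[of a b 0] by (simp_all add: mult.assoc bb)
  show "stab R2 \<subseteq> dih a b"
  proof (rule stab_sub)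
    show "lv j \<in> dih a b" if "j \<noteq> R2" for j using that bc by (cases j) simp_all
  qed (use D.dih_mult bc in auto)
  show "dih a b \<subseteq> stab R2" unfolding dih_def using abc_stab stab_mult stab_power by auto
qed

lemma stab_R1: "stab R1 \<subseteq> {1, a, c, a * c}"
proof (rule stab_sub)
  show "g * h \<in> {1, a, c, a * c}" if "g \<in> {1, a, c, a * c}" "h \<in> {1, a, c, a * c}" for g h
    using that by (elim insertE emptyE) (simp_all add: mult.assoc cax ca aa cc)
  show "lv j \<in> {1, a, c, a * c}" if "j \<noteq> R1" for j using that by (cases j) simp_all
qed simp

lemma abc_neq: "a \<noteq> 1" "b \<noteq> 1" "c \<noteq> 1" "a \<noteq> b" "c \<noteq> b"
  using s_not_refl[of 1] t_not_refl[of 1] s_not_refl[of 0] s_ord[of 1] t_ord[of 1] p_ge q_ge bb by auto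

lemma not_stab: "a \<notin> stab R0" "b \<notin> stab R1" "c \<notin> stab R2"
proof -
  have Int: "stab R2 \<inter> stab R0 \<subseteq> {1, b}" using dih_Int unfolding stab_R0 stab_R2 .
  show "a \<notin> stab R0" "c \<notin> stab R2" using Int abc_stab abc_neq by auto
  show "b \<notin> stab R1"
  proof
    assume "b \<in> stab R1"
    then have "b = a * c" using stab_R1 abc_neq by auto
    then have "a * b = c" using aa by (simp flip: mult.assoc)
    moreover have "a * b \<in> stab R2" using abc_stab stab_mult by blast
    ultimately show False using Int abc_stab(5) abc_neq by auto
  qed
qed

lemma lv_not_stab: "lv k \<notin> stab k"
  using not_stab by (cases k) simp_all

lemma stab_Int: "stab R0 \<inter> stab R1 \<subseteq> {1, c}" "stab R0 \<inter> stab R2 \<subseteq> {1, b}" "stab R1 \<inter> stab R2 \<subseteq> {1, a}"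
proof -
  show "stab R0 \<inter> stab R2 \<subseteq> {1, b}" using dih_Int unfolding stab_R0 stab_R2 by blast
  have "a * c \<notin> stab R0"
  proof
    assume "a * c \<in> stab R0"
    then have "a * c * c \<in> stab R0" using abc_stab stab_mult by blast
    then show False using not_stab by (simp add: mult.assoc cc)
  qed
  then show "stab R0 \<inter> stab R1 \<subseteq> {1, c}" using stab_R1 not_stab by auto
  have "a * c \<notin> stab R2"
  proof
    assume "a * c \<in> stab R2"
    then have "a * (a * c) \<in> stab R2" using abc_stab stab_mult by blast
    then show False using not_stab by (simp add: aa flip: mult.assoc)
  qed
  then show "stab R1 \<inter> stab R2 \<subseteq> {1, a}" using stab_R1 not_stab by auto
qed

lemma stab_all: "(\<And>k. g \<in> stab k) \<Longrightarrow> g = 1"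
  using stab_Int(1) not_stab(3) by blast

end

text \<open>\<open>el k g\<close> is a name for the coset of \<open>g\<close> modulo
  \<open>stab k\<close>; the axiom says that different cosets get different names. Leaving the
  naming abstract allows the polyhedron to be built in any type with enough elements.\<close>

locale coset_geometry = tight_triple a b c p q for a b c :: "'x perm" and p q +
  fixes el :: "letter \<Rightarrow> 'x perm \<Rightarrow> 'a"
  assumes el_eq: "\<And>k l g h. g \<in> G \<Longrightarrow> h \<in> G \<Longrightarrow> el k g = el l h \<longleftrightarrow> k = l \<and> inverse g * h \<in> stab k"
begin

text \<open>Cosets are incident when they have a common representative. The rank is read off the
  name, which determines it by \<open>el_eq\<close>.\<close>

definition P :: "'a ranked_poset" where
  "P = \<lparr>leq = {(z, z'). \<exists>k l. \<exists>g\<in>G. rank_of k \<le> rank_of l \<and> z = el k g \<and> z' = el l g},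
    rk = (\<lambda>z. THE i. \<exists>k. \<exists>g\<in>G. z = el k g \<and> i = rank_of k)\<rparr>"

lemma el_mult: "g \<in> G \<Longrightarrow> x \<in> stab k \<Longrightarrow> el k (g * x) = el k g"
  using el_eq[of g "g * x" k k] mult_G[of g x] stab_G[of x] by simp

lemma el_same: assumes "g \<in> G" "h \<in> G" "el k g = el k h" obtains x where "x \<in> stab k" "h = g * x"
proof -
  have "inverse g * h \<in> stab k" using el_eq assms by blast
  moreover have "h = g * (inverse g * h)" by simp
  ultimately show ?thesis using that by blast
qed

lemma rk_el: assumes "g \<in> G" shows "rk P (el k g) = rank_of k"
proof -
  have "(THE i. \<exists>l. \<exists>h\<in>G. el k g = el l h \<and> i = rank_of l) = rank_of k"
  proof (rule the_equality)
    show "\<exists>l. \<exists>h\<in>G. el k g = el l h \<and> rank_of k = rank_of l" using assms by blast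
    fix i assume "\<exists>l. \<exists>h\<in>G. el k g = el l h \<and> i = rank_of l"
    then obtain l h where "h \<in> G" "el k g = el l h" "i = rank_of l" by blast
    then show "i = rank_of k" using el_eq[OF assms, of h k l] by simp
  qed
  then show ?thesis unfolding P_def by simp
qed

lemma leq_iff: "(z, z') \<in> leq P \<longleftrightarrow> (\<exists>k l. \<exists>g\<in>G. rank_of k \<le> rank_of l \<and> z = el k g \<and> z' = el l g)"
  unfolding P_def by simp

lemma leqE:
  assumes "(z, z') \<in> leq P"
  obtains k l g where "g \<in> G" "rank_of k \<le> rank_of l" "z = el k g" "z' = el l g"
  using assms unfolding leq_iff by blast

lemma leqI: "g \<in> G \<Longrightarrow> rank_of k \<le> rank_of l \<Longrightarrow> (el k g, el l g) \<in> leq P"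
  unfolding leq_iff by blast

lemma elems_iff: "z \<in> elems P \<longleftrightarrow> (\<exists>k. \<exists>g\<in>G. z = el k g)"
  unfolding elems_def Field_def using leqI by (fastforce elim: leqE)

lemma rank_of_simps: "rank_of k = 0 \<longleftrightarrow> k = R0" "rank_of k = 1 \<longleftrightarrow> k = R1" "rank_of k = 2 \<longleftrightarrow> k = R2"
  by (cases k; simp)+

lemma layers: "vertices P = el R0 ` G" "edges P = el R1 ` G" "faces P = el R2 ` G"
  unfolding vertices_def edges_def faces_def elems_iff
  using rk_el rank_of_simps by (auto 4 4 simp: image_iff)

lemma leq_ranks:
  assumes "(z, z') \<in> leq P" "z \<in> el k ` G" "z' \<in> el l ` G"
  obtains g where "g \<in> G" "z = el k g" "z' = el l g"
proof -
  obtain k' l' g where g: "g \<in> G" "z = el k' g" "z' = el l' g" using assms(1) by (rule leqE)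
  have "k' = k" "l' = l" using g assms(2,3) el_eq by blast+
  then show ?thesis using that g by blast
qed

text \<open>Each of the four possible elements \<open>1\<close>, \<open>a\<close>, \<open>c\<close>,
  \<open>a * c\<close> of the edge stabiliser is a product of one that fixes the vertex and one that
  fixes the face. So the two representatives of the edge can be replaced by one representative of
  all three elements; transitivity of the order rests on this.\<close>

lemma tri:
  assumes "v \<in> vertices P" "e \<in> edges P" "f \<in> faces P" "(v, e) \<in> leq P" "(e, f) \<in> leq P"
  obtains g where "g \<in> G" "v = el R0 g" "e = el R1 g" "f = el R2 g"
proof -
  obtain u where u: "u \<in> G" "v = el R0 u" "e = el R1 u" using leq_ranks assms unfolding layers by metis
  obtain u' where u': "u' \<in> G" "e = el R1 u'" "f = el R2 u'" using leq_ranks assms unfolding layers by metis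
  obtain x where x: "x \<in> stab R1" "u' = u * x" using el_same[OF u(1) u'(1)] u u' by metis
  have "\<exists>y z. y \<in> stab R0 \<and> y \<in> stab R1 \<and> z \<in> stab R2 \<and> x = y * z"
  proof -
    have "x = 1 * 1 \<or> x = 1 * a \<or> x = c * 1 \<or> x = c * a" using stab_R1 x(1) ca by auto
    then show ?thesis using abc_stab stab_one by blast
  qed
  then obtain y z where yz: "y \<in> stab R0" "y \<in> stab R1" "z \<in> stab R2" "x = y * z" by blast
  have uy: "u * y \<in> G" using mult_G[OF u(1) stab_G[OF yz(1)]] .
  have u'z: "u' = u * y * z" using x(2) yz(4) by (simp add: mult.assoc)
  show ?thesis
  proof (rule that[OF uy])
    show "v = el R0 (u * y)" "e = el R1 (u * y)" using el_mult[OF u(1)] yz u by simp_all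
    show "f = el R2 (u * y)" using el_mult[OF uy yz(3)] u'(3) unfolding u'z by simp
  qed
qed

lemma leq_rank: "(z, z') \<in> leq P \<Longrightarrow> rk P z \<le> rk P z' \<and> (rk P z = rk P z' \<longrightarrow> z = z')"
  using rk_el rank_of_inj by (elim leqE) simp

lemma wf_P: "wf_ranked_poset P"
  unfolding wf_ranked_poset_def
proof (intro conjI ballI allI impI)
  show "rk P z \<in> {0, 1, 2}" if z: "z \<in> elems P" for z
  proof -
    obtain k g where "g \<in> G" "z = el k g" using z unfolding elems_iff by blast
    then show ?thesis using rk_el by (cases k) simp_all
  qed
  show "rk P z < rk P z'" if "(z, z') \<in> leq P \<and> z \<noteq> z'" for z z' using leq_rank that by (meson le_neq_implies_less)
  have tr: "(z, z'') \<in> leq P" if le: "(z, z') \<in> leq P" "(z', z'') \<in> leq P" for z z' z''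
  proof -
    obtain k l g where g: "g \<in> G" "rank_of k \<le> rank_of l" "z = el k g" "z' = el l g" using le(1) by (rule leqE)
    obtain l' m h where h: "h \<in> G" "rank_of l' \<le> rank_of m" "z' = el l' h" "z'' = el m h" using le(2) by (rule leqE)
    have ll: "l' = l" using el_eq[OF g(1) h(1), of l l'] g(4) h(3) by simp
    show ?thesis
    proof (cases "z = z' \<or> z' = z''")
      case True
      then show ?thesis using le by blast
    next
      case False
      then have "k \<noteq> l" "l \<noteq> m" using g h ll by blast+
      then have "k = R0" "l = R1" "m = R2" using g(2) h(2) ll by (cases k; cases l; cases m; simp)+
      then have "z \<in> vertices P" "z' \<in> edges P" "z'' \<in> faces P" using g h ll unfolding layers by blast+
      then obtain u where "u \<in> G" "z = el R0 u" "z'' = el R2 u" using tri le by metis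
      then show ?thesis using leqI[of u R0 R2] by simp
    qed
  qed
  show "Partial_order (leq P)"
    unfolding partial_order_on_def preorder_on_def
  proof (intro conjI)
    show "Refl (leq P)" unfolding refl_on_def elems_def[symmetric]
      using leqI by (auto simp: elems_iff)
    show "trans (leq P)" using tr by (rule transI)
    show "antisym (leq P)"
    proof (rule antisymI)
      fix z z' assume "(z, z') \<in> leq P" "(z', z) \<in> leq P"
      then show "z = z'" using leq_rank by (meson le_antisym)
    qed
    show "leq P \<subseteq> Field (leq P) \<times> Field (leq P)" unfolding Field_def by auto
  qed
qed

lemma letter_ex: "(\<exists>k. Q k) \<longleftrightarrow> Q R0 \<or> Q R1 \<or> Q R2"
  by (metis letter.exhaust)

lemma finite_P: "finite (elems P)"
proof -
  have "elems P = el R0 ` G \<union> el R1 ` G \<union> el R2 ` G"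
    by (auto simp: elems_iff letter_ex)
  then show ?thesis using finite_G by simp
qed

sublocale ranked P
  by unfold_locales (rule wf_P finite_P)+

section \<open>Flags and local structure of the coset geometry\<close>

definition fl :: "'x perm \<Rightarrow> 'a triple" where
  "fl g = (el R0 g, el R1 g, el R2 g)"

lemma pick_fl: "pick k (fl g) = el k g"
  by (cases k) (simp_all add: fl_def)

lemma tflags_P: "tflags P = fl ` G"
proof
  show "tflags P \<subseteq> fl ` G"
  proof
    fix y assume y: "y \<in> tflags P"
    obtain v e f where ys: "y = (v, e, f)" by (metis prod_cases3)
    then have "v \<in> vertices P" "e \<in> edges P" "f \<in> faces P" "(v, e) \<in> leq P" "(e, f) \<in> leq P" using y unfolding tflags_def by auto
    then obtain g where "g \<in> G" "v = el R0 g" "e = el R1 g" "f = el R2 g" by (rule tri)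
    then show "y \<in> fl ` G" unfolding ys fl_def by blast
  qed
  show "fl ` G \<subseteq> tflags P" unfolding fl_def tflags_def layers using leqI[of _ R0 R1] leqI[of _ R1 R2] by auto
qed

lemma fl_inj: "inj_on fl G"
proof (rule inj_onI)
  fix g h assume gh: "g \<in> G" "h \<in> G" "fl g = fl h"
  then have "inverse g * h \<in> stab k" for k using pick_fl el_eq by metis
  then have "inverse g * h = 1" by (rule stab_all)
  then have "g * (inverse g * h) = g" by simp
  then show "g = h" by simp
qed

lemma edge_vertices: assumes g: "g \<in> G"
  shows "{v \<in> vertices P. (v, el R1 g) \<in> leq P} = {el R0 g, el R0 (g * a)}" "el R0 g \<noteq> el R0 (g * a)"
proof -
  have ga: "g * a \<in> G" using g mult_G a_G by blast
  show "el R0 g \<noteq> el R0 (g * a)" using el_eq[OF g ga] not_stab by simp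
  have "v \<in> {el R0 g, el R0 (g * a)}" if v: "v \<in> vertices P" "(v, el R1 g) \<in> leq P" for v
  proof -
    obtain u where u: "u \<in> G" "v = el R0 u" "el R1 g = el R1 u" using leq_ranks[OF v(2)] v(1) g unfolding layers by blast
    obtain x where x: "x \<in> stab R1" "u = g * x" using el_same[OF g u(1) u(3)] .
    then have "u = g \<or> u = g * a \<or> u = g * c \<or> u = g * a * c" using stab_R1 by (auto simp: mult.assoc)
    then show ?thesis using u(2) el_mult[OF g abc_stab(5)] el_mult[OF ga abc_stab(5)] by auto
  qed
  moreover have "el R1 (g * a) = el R1 g" using el_mult g abc_stab by blast
  ultimately show "{v \<in> vertices P. (v, el R1 g) \<in> leq P} = {el R0 g, el R0 (g * a)}"
    using leqI[of g R0 R1] leqI[of "g * a" R0 R1] g ga unfolding layers by auto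
qed

lemma edge_faces: assumes g: "g \<in> G"
  shows "{f \<in> faces P. (el R1 g, f) \<in> leq P} = {el R2 g, el R2 (g * c)}" "el R2 g \<noteq> el R2 (g * c)"
proof -
  have ga: "g * c \<in> G" using g mult_G c_G by blast
  show "el R2 g \<noteq> el R2 (g * c)" using el_eq[OF g ga] not_stab by simp
  have "v \<in> {el R2 g, el R2 (g * c)}" if v: "v \<in> faces P" "(el R1 g, v) \<in> leq P" for v
  proof -
    obtain u where u: "u \<in> G" "v = el R2 u" "el R1 g = el R1 u" using leq_ranks[OF v(2)] v(1) g unfolding layers by blast
    obtain x where x: "x \<in> stab R1" "u = g * x" using el_same[OF g u(1) u(3)] .
    then have "u = g \<or> u = g * a \<or> u = g * c \<or> u = g * c * a" using stab_R1 ca by (auto simp: mult.assoc)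
    then show ?thesis using u(2) el_mult[OF g abc_stab(2)] el_mult[OF ga abc_stab(2)] by auto
  qed
  moreover have "el R1 (g * c) = el R1 g" using el_mult g abc_stab by blast
  ultimately show "{f \<in> faces P. (el R1 g, f) \<in> leq P} = {el R2 g, el R2 (g * c)}"
    using leqI[of g R1 R2] leqI[of "g * c" R1 R2] g ga unfolding layers by auto
qed

text \<open>Representatives that share both vertex and face differ by an element of
  \<open>dih a b \<inter> dih c b\<close>; this is where the intersection condition enters.\<close>

lemma corner_edges: assumes g: "g \<in> G"
  shows "{e \<in> edges P. (el R0 g, e) \<in> leq P \<and> (e, el R2 g) \<in> leq P} = {el R1 g, el R1 (g * b)}" "el R1 g \<noteq> el R1 (g * b)"
proof -
  have ga: "g * b \<in> G" using g mult_G b_G by blast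
  show "el R1 g \<noteq> el R1 (g * b)" using el_eq[OF g ga] not_stab by simp
  have "e \<in> {el R1 g, el R1 (g * b)}" if e: "e \<in> edges P" "(el R0 g, e) \<in> leq P" "(e, el R2 g) \<in> leq P" for e
  proof -
    have "el R0 g \<in> vertices P" "el R2 g \<in> faces P" using g unfolding layers by blast+
    then obtain u where u: "u \<in> G" "el R0 g = el R0 u" "e = el R1 u" "el R2 g = el R2 u" using tri e by metis
    have "inverse g * u \<in> stab R0 \<inter> stab R2" using u el_eq g by blast
    then have "inverse g * u = 1 \<or> inverse g * u = b" using stab_Int(2) by blast
    then have "u = g * 1 \<or> u = g * b" using perm_right_inverse_assoc[of g u] by metis
    then show ?thesis using u(3) by auto
  qed
  moreover have "el R0 (g * b) = el R0 g" "el R2 (g * b) = el R2 g" using el_mult g abc_stab by blast+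
  ultimately show "{e \<in> edges P. (el R0 g, e) \<in> leq P \<and> (e, el R2 g) \<in> leq P} = {el R1 g, el R1 (g * b)}"
    using leqI[of g R0 R1] leqI[of g R1 R2] leqI[of "g * b" R0 R1] leqI[of "g * b" R1 R2] g ga unfolding layers by auto
qed

text \<open>Induction along a word avoiding the letter \<open>k\<close>, common to vertex figures
  and faces. The set \<open>H\<close> describes the representatives of the fixed element, and
  \<open>F\<close> gives the element that moves.\<close>

lemma connect:
  assumes step: "\<And>g j. g \<in> G \<Longrightarrow> g \<in> H \<Longrightarrow> j \<noteq> k \<Longrightarrow> g * lv j \<in> H \<and> (F g, F (g * lv j)) \<in> R\<^sup>*"
    and g: "g \<in> G" "g \<in> H" and w: "k \<notin> set w"
  shows "g * ev a b c w \<in> H \<and> (F g, F (g * ev a b c w)) \<in> R\<^sup>*"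
  using w
proof (induction w rule: rev_induct)
  case (snoc j w)
  then have IH: "g * ev a b c w \<in> H" "(F g, F (g * ev a b c w)) \<in> R\<^sup>*" by simp_all
  have "g * ev a b c w * lv j \<in> H \<and> (F (g * ev a b c w), F (g * ev a b c w * lv j)) \<in> R\<^sup>*"
    by (rule step) (use IH g ev_G mult_G snoc.prems in auto)
  moreover have "g * ev a b c w * lv j = g * ev a b c (w @ [j])" by (simp add: ev_append mult.assoc)
  ultimately show ?case using IH(2) by (metis rtrancl_trans)
qed (use g in simp)

lemma vertex_polygon: assumes v: "v \<in> vertices P" shows "is_polygon (above P v)"
proof -
  define A where "A = {e \<in> edges P. (v, e) \<in> leq P}"
  define B where "B = {f \<in> faces P. (v, f) \<in> leq P}"
  note ab = above_eq[OF v, folded A_def B_def]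
  obtain g0 where g0: "g0 \<in> G" "v = el R0 g0" using v unfolding layers by blast
  have A: "\<exists>g\<in>G. v = el R0 g \<and> e = el R1 g" if "e \<in> A" for e
    using leq_ranks[of v e R0 R1] that v unfolding A_def layers by blast
  have B: "\<exists>g\<in>G. v = el R0 g \<and> f = el R2 g" if "f \<in> B" for f
    using leq_ranks[of v f R0 R2] that v unfolding B_def layers by blast
  have A': "el R1 g \<in> A" and B': "el R2 g \<in> B" if "g \<in> G" "v = el R0 g" for g
    using that leqI[of g R0 R1] leqI[of g R0 R2] unfolding A_def B_def layers by auto
  have AB: "\<forall>x\<in>A. \<exists>y\<in>B. (x, y) \<in> leq P"
  proof
    fix x assume "x \<in> A"
    then obtain g where g: "g \<in> G" "v = el R0 g" "x = el R1 g" using A by blast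
    then show "\<exists>y\<in>B. (x, y) \<in> leq P" using B' leqI[of g R1 R2] by auto
  qed
  have BA: "\<forall>y\<in>B. \<exists>x\<in>A. (x, y) \<in> leq P"
  proof
    fix y assume "y \<in> B"
    then obtain g where g: "g \<in> G" "v = el R0 g" "y = el R2 g" using B by blast
    then show "\<exists>x\<in>A. (x, y) \<in> leq P" using A' leqI[of g R1 R2] by auto
  qed
  have 1: "card {x \<in> A. (x, y) \<in> leq P} = 2" if yB: "y \<in> B" for y
  proof -
    obtain g where g: "g \<in> G" "v = el R0 g" "y = el R2 g" using B yB by blast
    have "{x \<in> A. (x, y) \<in> leq P} = {el R1 g, el R1 (g * b)}"
      unfolding A_def corner_edges(1)[OF g(1), symmetric] g by blast
    then show ?thesis using corner_edges(2)[OF g(1)] by simp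
  qed
  have 2: "card {y \<in> B. (x, y) \<in> leq P} = 2" if xA: "x \<in> A" for x
  proof -
    obtain g where g: "g \<in> G" "v = el R0 g" "x = el R1 g" using A xA by blast
    have "{y \<in> B. (x, y) \<in> leq P} = {f \<in> faces P. (el R1 g, f) \<in> leq P}"
      unfolding B_def g using leq_trans leqI[OF g(1), of R0 R1] by auto
    then show ?thesis using edge_faces[OF g(1)] by simp
  qed
  have 3: "(x, x') \<in> {(x, x'). x \<in> A \<and> x' \<in> A \<and> (\<exists>y\<in>B. (x, y) \<in> leq P \<and> (x', y) \<in> leq P)}\<^sup>*" (is "_ \<in> ?R\<^sup>*")
    if x: "x \<in> A" "x' \<in> A" for x x'
  proof -
    obtain g where g: "g \<in> G" "v = el R0 g" "x = el R1 g" using A x by blast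
    obtain h where h: "h \<in> G" "v = el R0 h" "x' = el R1 h" using A x by blast
    obtain y where y: "y \<in> stab R0" "h = g * y" using el_same[OF g(1) h(1)] g h by metis
    then obtain w where w: "R0 \<notin> set w" "y = ev a b c w" unfolding stab_def by blast
    have "g * ev a b c w \<in> {u. el R0 u = v} \<and> (el R1 g, el R1 (g * ev a b c w)) \<in> ?R\<^sup>*"
    proof (rule connect)
      fix u j assume u: "u \<in> G" "u \<in> {u. el R0 u = v}" and j: "j \<noteq> R0"
      have uj: "u * lv j \<in> G" "el R0 (u * lv j) = v" using u j lv_stab[OF j] stab_G el_mult mult_G by auto
      have "(el R1 u, el R1 (u * lv j)) \<in> ?R\<^sup>*"
      proof (cases "j = R2")
        case True
        then show ?thesis using el_mult[OF u(1) lv_stab[of j R1]] by simp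
      next
        case False
        have eq: "el R2 (u * lv j) = el R2 u" using el_mult[OF u(1) lv_stab[OF False]] .
        have "(el R1 u, el R2 u) \<in> leq P" "(el R1 (u * lv j), el R2 u) \<in> leq P"
          using leqI[OF u(1), of R1 R2] leqI[OF uj(1), of R1 R2] eq by simp_all
        moreover have "el R1 u \<in> A" "el R1 (u * lv j) \<in> A" "el R2 u \<in> B"
          using A'[OF u(1)] A'[OF uj(1)] B'[OF u(1)] u(2) uj(2) by simp_all
        ultimately have "(el R1 u, el R1 (u * lv j)) \<in> ?R" by blast
        then show ?thesis by blast
      qed
      then show "u * lv j \<in> {u. el R0 u = v} \<and> (el R1 u, el R1 (u * lv j)) \<in> ?R\<^sup>*" using uj by blast
    qed (use g w in auto)
    then show ?thesis using g h y w by simp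
  qed
  have "A \<noteq> {}" using A'[OF g0] by blast
  then show ?thesis unfolding polygon_iff[OF ab AB BA] using 1 2 3 by blast
qed

lemma face_polygon: assumes f: "f \<in> faces P" shows "is_polygon (below P f)"
proof -
  define A where "A = {v \<in> vertices P. (v, f) \<in> leq P}"
  define B where "B = {e \<in> edges P. (e, f) \<in> leq P}"
  note ab = below_eq[OF f, folded A_def B_def]
  obtain g0 where g0: "g0 \<in> G" "f = el R2 g0" using f unfolding layers by blast
  have A: "\<exists>g\<in>G. f = el R2 g \<and> v = el R0 g" if "v \<in> A" for v
    using leq_ranks[of v f R0 R2] that f unfolding A_def layers by blast
  have B: "\<exists>g\<in>G. f = el R2 g \<and> e = el R1 g" if "e \<in> B" for e
    using leq_ranks[of e f R1 R2] that f unfolding B_def layers by blast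
  have A': "el R0 g \<in> A" and B': "el R1 g \<in> B" if "g \<in> G" "f = el R2 g" for g
    using that leqI[of g R0 R2] leqI[of g R1 R2] unfolding A_def B_def layers by auto
  have AB: "\<forall>x\<in>A. \<exists>y\<in>B. (x, y) \<in> leq P"
  proof
    fix x assume "x \<in> A"
    then obtain g where g: "g \<in> G" "f = el R2 g" "x = el R0 g" using A by blast
    then show "\<exists>y\<in>B. (x, y) \<in> leq P" using B' leqI[of g R0 R1] by auto
  qed
  have BA: "\<forall>y\<in>B. \<exists>x\<in>A. (x, y) \<in> leq P"
  proof
    fix y assume "y \<in> B"
    then obtain g where g: "g \<in> G" "f = el R2 g" "y = el R1 g" using B by blast
    then show "\<exists>x\<in>A. (x, y) \<in> leq P" using A' leqI[of g R0 R1] by auto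
  qed
  have 1: "card {x \<in> A. (x, y) \<in> leq P} = 2" if yB: "y \<in> B" for y
  proof -
    obtain g where g: "g \<in> G" "f = el R2 g" "y = el R1 g" using B yB by blast
    have "{x \<in> A. (x, y) \<in> leq P} = {v \<in> vertices P. (v, el R1 g) \<in> leq P}"
      unfolding A_def g using leq_trans leqI[OF g(1), of R1 R2] by auto
    then show ?thesis using edge_vertices[OF g(1)] by simp
  qed
  have 2: "card {y \<in> B. (x, y) \<in> leq P} = 2" if xA: "x \<in> A" for x
  proof -
    obtain g where g: "g \<in> G" "f = el R2 g" "x = el R0 g" using A xA by blast
    have "{y \<in> B. (x, y) \<in> leq P} = {el R1 g, el R1 (g * b)}"
      unfolding B_def corner_edges(1)[OF g(1), symmetric] g by blast
    then show ?thesis using corner_edges(2)[OF g(1)] by simp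
  qed
  have 3: "(x, x') \<in> {(x, x'). x \<in> A \<and> x' \<in> A \<and> (\<exists>y\<in>B. (x, y) \<in> leq P \<and> (x', y) \<in> leq P)}\<^sup>*" (is "_ \<in> ?R\<^sup>*")
    if x: "x \<in> A" "x' \<in> A" for x x'
  proof -
    obtain g where g: "g \<in> G" "f = el R2 g" "x = el R0 g" using A x by blast
    obtain h where h: "h \<in> G" "f = el R2 h" "x' = el R0 h" using A x by blast
    obtain y where y: "y \<in> stab R2" "h = g * y" using el_same[OF g(1) h(1)] g h by metis
    then obtain w where w: "R2 \<notin> set w" "y = ev a b c w" unfolding stab_def by blast
    have "g * ev a b c w \<in> {u. el R2 u = f} \<and> (el R0 g, el R0 (g * ev a b c w)) \<in> ?R\<^sup>*"
    proof (rule connect)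
      fix u j assume u: "u \<in> G" "u \<in> {u. el R2 u = f}" and j: "j \<noteq> R2"
      have uj: "u * lv j \<in> G" "el R2 (u * lv j) = f" using u j lv_stab[OF j] stab_G el_mult mult_G by auto
      have "(el R0 u, el R0 (u * lv j)) \<in> ?R\<^sup>*"
      proof (cases "j = R1")
        case True
        then show ?thesis using el_mult[OF u(1) lv_stab[of j R0]] by simp
      next
        case False
        have eq: "el R1 (u * lv j) = el R1 u" using el_mult[OF u(1) lv_stab[OF False]] .
        have "(el R0 u, el R1 u) \<in> leq P" "(el R0 (u * lv j), el R1 u) \<in> leq P"
          using leqI[OF u(1), of R0 R1] leqI[OF uj(1), of R0 R1] eq by simp_all
        moreover have "el R0 u \<in> A" "el R0 (u * lv j) \<in> A" "el R1 u \<in> B"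
          using A'[OF u(1)] A'[OF uj(1)] B'[OF u(1)] u(2) uj(2) by simp_all
        ultimately have "(el R0 u, el R0 (u * lv j)) \<in> ?R" by blast
        then show ?thesis by blast
      qed
      then show "u * lv j \<in> {u. el R2 u = f} \<and> (el R0 u, el R0 (u * lv j)) \<in> ?R\<^sup>*" using uj by blast
    qed (use g w in auto)
    then show ?thesis using g h y w by simp
  qed
  have "A \<noteq> {}" using A'[OF g0] by blast
  then show ?thesis unfolding polygon_iff[OF ab AB BA] using 1 2 3 by blast
qed

lemma skeleton_P: "connected_multigraph (skeleton P)"
  unfolding connected_multigraph_def
proof (intro conjI ballI)
  show "gverts (skeleton P) \<noteq> {}" unfolding skeleton_def using one_G by (auto simp: layers)
  fix v v' assume "v \<in> gverts (skeleton P)" "v' \<in> gverts (skeleton P)"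
  then obtain g h where g: "g \<in> G" "v = el R0 g" and h: "h \<in> G" "v' = el R0 h" by (auto simp: skeleton_def layers)
  let ?R = "graph_adjacency (skeleton P)"
  obtain w where w: "inverse g * h = ev a b c w" using mult_G[OF inverse_G[OF g(1)] h(1)] unfolding G_def by blast
  have "(el R0 g, el R0 (g * ev a b c w)) \<in> ?R\<^sup>*"
  proof (induction w rule: rev_induct)
    case (snoc j w)
    let ?u = "g * ev a b c w"
    have u: "?u \<in> G" using g ev_G mult_G by blast
    have "(el R0 ?u, el R0 (?u * lv j)) \<in> ?R\<^sup>*"
    proof (cases "j = R0")
      case True
      have "el R1 ?u \<in> edges P" using u unfolding layers by blast
      then have "(el R0 ?u, el R0 (?u * a)) \<in> ?R"
        unfolding graph_adjacency_def skeleton_def using edge_vertices(1)[OF u] by auto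
      then show ?thesis using True by auto
    next
      case False
      then show ?thesis using el_mult[OF u lv_stab] by simp
    qed
    moreover have "?u * lv j = g * ev a b c (w @ [j])" by (simp add: ev_append mult.assoc)
    ultimately show ?case using snoc by (metis rtrancl_trans)
  qed simp
  then show "(v, v') \<in> ?R\<^sup>*" using g h w[symmetric] by simp
qed

text \<open>A chain has at most one element of each rank. Three elements have a common
  representative by \<open>tri\<close>, and two by the definition of the order; so every chain is
  contained in the flag of some group element, and a maximal one equals it.\<close>

lemma flags_P: assumes C: "C \<in> flags P" shows "\<exists>v\<in>vertices P. \<exists>e\<in>edges P. \<exists>f\<in>faces P. C = {v, e, f}"
proof -
  have chain: "(z, z') \<in> leq P \<or> (z', z) \<in> leq P" if "z \<in> C" "z' \<in> C" for z z'
    using C that unfolding flags_def Chains_def by blast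
  have sub: "C \<subseteq> elems P" using chain leq_elems by blast
  have finC: "finite C" using sub finite_P finite_subset by blast
  have inj: "inj_on (rk P) C"
    using chain leq_rank by (intro inj_onI) metis
  have rkC: "rk P ` C \<subseteq> {0, 1, 2}" using sub rank by (intro image_subsetI) blast
  have "\<exists>g\<in>G. C \<subseteq> fset (fl g)"
  proof (cases "rk P ` C = {0, 1, 2}")
    case True
    then have "0 \<in> rk P ` C" "1 \<in> rk P ` C" "2 \<in> rk P ` C" by simp_all
    then obtain v e f where z: "v \<in> C" "e \<in> C" "f \<in> C" "rk P v = 0" "rk P e = 1" "rk P f = 2"
      unfolding image_iff by metis
    have Cs: "C \<subseteq> {v, e, f}"
    proof
      fix z assume "z \<in> C"
      then have "rk P z \<in> {rk P v, rk P e, rk P f}" using rkC z by auto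
      then show "z \<in> {v, e, f}" using inj z \<open>z \<in> C\<close> unfolding inj_on_def by blast
    qed
    have l: "v \<in> vertices P" "e \<in> edges P" "f \<in> faces P" using z sub unfolding vertices_def edges_def faces_def by auto
    have "(v, e) \<in> leq P" "(e, f) \<in> leq P" using chain z leq_rank by (metis one_neq_zero le_zero_eq, metis not_less one_less_numeral_iff semiring_norm(76))
    then obtain g where "g \<in> G" "v = el R0 g" "e = el R1 g" "f = el R2 g" using tri l by metis
    then show ?thesis using Cs by (auto simp: fl_def)
  next
    case False
    then have "card (rk P ` C) < card {0, 1, 2 :: nat}" using rkC by (intro psubset_card_mono) auto
    then have "card C \<le> 2" using card_image[OF inj] by simp
    then consider "card C = 0" | "card C = 1" | "card C = 2" by linarith
    then have "C = {} \<or> (\<exists>z z'. C = {z, z'})"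
    proof cases
      case 2
      then obtain z where "C = {z}" by (rule card_1_singletonE)
      then have "C = {z, z}" by simp
      then show ?thesis by blast
    qed (use finC in \<open>auto simp: card_2_iff\<close>)
    then show ?thesis
    proof
      assume "\<exists>z z'. C = {z, z'}"
      then obtain z z' where zz: "C = {z, z'}" by blast
      then have "(z, z') \<in> leq P \<or> (z', z) \<in> leq P" using chain by blast
      then have "\<exists>k l. \<exists>g\<in>G. C = {el k g, el l g}"
      proof
        assume "(z, z') \<in> leq P"
        then obtain k l g where "g \<in> G" "z = el k g" "z' = el l g" by (rule leqE)
        then show ?thesis using zz by blast
      next
        assume "(z', z) \<in> leq P"
        then obtain k l g where "g \<in> G" "z' = el k g" "z = el l g" by (rule leqE)
        then show ?thesis using zz by blast
      qed
      then obtain k l g where "g \<in> G" "C = {el k g, el l g}" by blast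
      then show ?thesis unfolding fset_pick subset_iff using pick_fl by (metis insertE singletonD)
    qed (use one_G in blast)
  qed
  then obtain g where g: "g \<in> G" "C \<subseteq> fset (fl g)" by blast
  have "fset (fl g) \<in> flags P" using g(1) tflags_P fset_flag by blast
  then have "C = fset (fl g)" using C g(2) unfolding flags_def by blast
  then show ?thesis using g(1) unfolding fl_def layers by auto
qed

lemma polyhedron_P: "polyhedron P"
  unfolding polyhedron_def
proof (intro conjI ballI)
  fix e assume "e \<in> edges P"
  then obtain g where g: "g \<in> G" "e = el R1 g" unfolding layers by blast
  show "card {v \<in> vertices P. (v, e) \<in> leq P} = 2" unfolding g(2) edge_vertices(1)[OF g(1)] using edge_vertices(2)[OF g(1)] by simp
  show "card {f \<in> faces P. (e, f) \<in> leq P} = 2" unfolding g(2) edge_faces(1)[OF g(1)] using edge_faces(2)[OF g(1)] by simp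
qed (use wf_P flags_P skeleton_P vertex_polygon face_polygon in auto)

sublocale fin_polyhedron P
  by unfold_locales (rule polyhedron_P)

lemma card_stab_flags: assumes g: "g \<in> G" shows "card {y \<in> T. pick k y = el k g} = card (stab k)"
proof (rule bij_betw_same_card[symmetric])
  have "inj_on (\<lambda>x. fl (g * x)) (stab k)"
    using fl_inj mult_G[OF g] stab_G unfolding inj_on_def by (metis perm_mult_left_cancel)
  moreover have "(\<lambda>x. fl (g * x)) ` stab k = {y \<in> T. pick k y = el k g}"
  proof
    show "(\<lambda>x. fl (g * x)) ` stab k \<subseteq> {y \<in> T. pick k y = el k g}"
      using el_mult[OF g] mult_G[OF g] stab_G by (auto simp: tflags_P pick_fl)
    show "{y \<in> T. pick k y = el k g} \<subseteq> (\<lambda>x. fl (g * x)) ` stab k"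
    proof
      fix y assume "y \<in> {y \<in> T. pick k y = el k g}"
      then obtain h where h: "h \<in> G" "y = fl h" "el k g = el k h" unfolding tflags_P by (auto simp: pick_fl)
      then obtain x where "x \<in> stab k" "h = g * x" using el_same[OF g] by metis
      then show "y \<in> (\<lambda>x. fl (g * x)) ` stab k" using h by blast
    qed
  qed
  ultimately show "bij_betw (\<lambda>x. fl (g * x)) (stab k) {y \<in> T. pick k y = el k g}" unfolding bij_betw_def by blast
qed

section \<open>Type, automorphisms and monodromy of the coset geometry\<close>

lemma tight_P: "tight P p q"
proof -
  have "has_type P p q" unfolding has_type_def
  proof (intro conjI ballI)
    show "finite {e \<in> edges P. (e, f) \<in> leq P}" "finite {e \<in> edges P. (f, e) \<in> leq P}" for f using finite_sets by simp_all
    fix f assume f: "f \<in> faces P"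
    then obtain g where "g \<in> G" "f = el R2 g" unfolding layers by blast
    then have "2 * card {e \<in> edges P. (e, f) \<in> leq P} = card (dih a b)"
      using card_face_flags[OF f] card_stab_flags[of g R2] unfolding stab_R2 by simp
    then show "card {e \<in> edges P. (e, f) \<in> leq P} = p" using D.card_dih by simp
  next
    fix v assume v: "v \<in> vertices P"
    then obtain g where "g \<in> G" "v = el R0 g" unfolding layers by blast
    then have "2 * card {e \<in> edges P. (v, e) \<in> leq P} = card (dih c b)"
      using card_vertex_flags[OF v] card_stab_flags[of g R0] unfolding stab_R0 by simp
    then show "card {e \<in> edges P. (v, e) \<in> leq P} = q" using E.card_dih by simp
  qed
  moreover have "card (flags P) = 2 * p * q"
    unfolding card_flags unfolding tflags_P card_image[OF fl_inj] card_G by simp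
  ultimately show ?thesis unfolding tight_def using polyhedron_P finite_P by blast
qed

text \<open>Left multiplication on cosets, restricted to \<open>elems P\<close> because
  \<open>Bij\<close> contains only extensional functions.\<close>

definition translate :: "'x perm \<Rightarrow> 'a \<Rightarrow> 'a" where
  "translate h = (\<lambda>z\<in>elems P. THE z'. \<exists>k. \<exists>g\<in>G. z = el k g \<and> z' = el k (h * g))"

lemma translate_el: assumes h: "h \<in> G" and g: "g \<in> G" shows "translate h (el k g) = el k (h * g)"
proof -
  have *: "el k (h * g) = el l (h * g')" if g': "g' \<in> G" "el k g = el l g'" for l g'
  proof -
    have "k = l" using el_eq g' g by blast
    moreover obtain x where "x \<in> stab k" "g' = g * x" using el_same[OF g g'(1)] g'(2) \<open>k = l\<close> by metis
    ultimately show ?thesis using el_mult[OF mult_G[OF h g]] by (simp add: mult.assoc[symmetric])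
  qed
  have "el k g \<in> elems P" using g elems_iff by blast
  then have "translate h (el k g) = (THE z'. \<exists>l. \<exists>g'\<in>G. el k g = el l g' \<and> z' = el l (h * g'))" unfolding translate_def by simp
  also have "\<dots> = el k (h * g)" using g * by (intro the_equality) (blast, metis)
  finally show ?thesis .
qed

lemma translate_inverse: assumes h: "h \<in> G" and z: "z \<in> elems P"
  shows "translate h z \<in> elems P" "translate (inverse h) (translate h z) = z"
proof -
  obtain k g where g: "g \<in> G" "z = el k g" using z elems_iff by blast
  show "translate h z \<in> elems P" unfolding g translate_el[OF h g(1)] using mult_G[OF h g(1)] elems_iff by blast
  show "translate (inverse h) (translate h z) = z"
    unfolding g translate_el[OF h g(1)] translate_el[OF inverse_G[OF h] mult_G[OF h g(1)]] by simp
qed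

lemma translate_leq: assumes h: "h \<in> G" and "(z, z') \<in> leq P" shows "(translate h z, translate h z') \<in> leq P"
proof -
  obtain k l g where g: "g \<in> G" "rank_of k \<le> rank_of l" "z = el k g" "z' = el l g" using assms(2) by (rule leqE)
  show ?thesis unfolding g translate_el[OF h g(1)] by (rule leqI[OF mult_G[OF h g(1)] g(2)])
qed

lemma translate_Aut: assumes h: "h \<in> G" shows "translate h \<in> Aut"
proof -
  note h' = inverse_G[OF h]
  have "bij_betw (translate h) (elems P) (elems P)"
    by (rule bij_betw_byWitness[of _ "translate (inverse h)"])
      (use translate_inverse[OF h] translate_inverse[OF h'] in auto)
  moreover have "translate h \<in> extensional (elems P)" unfolding translate_def by simp
  moreover have "(z, z') \<in> leq P \<longleftrightarrow> (translate h z, translate h z') \<in> leq P" if "z \<in> elems P" "z' \<in> elems P" for z z'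
    using translate_leq[OF h, of z z'] translate_leq[OF h', of "translate h z" "translate h z'"] translate_inverse[OF h] that by auto
  ultimately show ?thesis unfolding Aut_iff Bij_def poset_iso_map_def elems_def[symmetric] by blast
qed

lemma regular_P: "regular_polyhedron P"
  unfolding regular_polyhedron_def
proof (intro conjI ballI)
  fix \<Phi> \<Psi> assume "\<Phi> \<in> flags P" "\<Psi> \<in> flags P"
  then obtain g h where g: "g \<in> G" "\<Phi> = fset (fl g)" and h: "h \<in> G" "\<Psi> = fset (fl h)"
    unfolding flags_eq tflags_P by blast
  let ?k = "h * inverse g"
  have k: "?k \<in> G" using g h mult_G inverse_G by blast
  have "translate ?k (el l g) = el l h" for l unfolding translate_el[OF k g(1)] by (simp add: mult.assoc)
  then have "translate ?k ` \<Phi> = \<Psi>" unfolding g(2) h(2) fl_def by simp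
  then show "\<exists>\<gamma>\<in>Aut. \<gamma> ` \<Phi> = \<Psi>" using translate_Aut[OF k] by blast
qed (rule polyhedron_P)

sublocale reg_polyhedron P
  by unfold_locales (rule regular_P)

text \<open>The monodromy action is right multiplication of representatives, while automorphisms are
  left multiplications. Hence words are reversed when applied to the base flag; the kernel is not
  affected, as reversal inverts the value of a word.\<close>

lemma adj_fl: assumes g: "g \<in> G" shows "adj P i (fl g) = fl (g * lv i)"
proof (rule adj_unique[symmetric])
  have lvG: "lv i \<in> G" using a_G b_G c_G by (cases i) simp_all
  show "fl g \<in> T" "fl (g * lv i) \<in> T" using g lvG mult_G unfolding tflags_P by blast+
  have "el i g \<noteq> el i (g * lv i)" using el_eq[OF g mult_G[OF g lvG]] lv_not_stab by simp
  moreover have "el j (g * lv i) = el j g" if "j \<noteq> i" for j by (rule el_mult[OF g lv_stab]) (use that in blast)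
  ultimately show "adj_to i (fl g) (fl (g * lv i))" unfolding adj_to_def pick_fl by auto
qed

lemma mon_word_fl: "apply (mon_word P w) (fl 1) = fl (ev a b c (rev w))"
proof (induction w)
  case (Cons i w)
  then show ?case unfolding mon_word_Cons using adj_fl[OF ev_G] by (simp add: ev_append)
qed simp

lemma kernel_P: "mon_kernel P = word_kernel a b c"
proof -
  have fl1: "fl 1 \<in> T" using one_G tflags_P by blast
  have "mon_word P w = 1 \<longleftrightarrow> ev a b c w = 1" for w
  proof -
    have "mon_word P w = 1 \<longleftrightarrow> fl (ev a b c (rev w)) = fl 1"
      using mon_word_one[OF fl1, of w] unfolding mon_word_fl by (metis apply_one id_apply mon_word_fl)
    also have "\<dots> \<longleftrightarrow> ev a b c (rev w) = 1" by (rule inj_on_eq_iff[OF fl_inj ev_G one_G])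
    also have "\<dots> \<longleftrightarrow> ev a b c w = 1" unfolding ev_rev using perm_inverse_inverse perm_inverse_one by metis
    finally show ?thesis .
  qed
  then show ?thesis unfolding word_kernel_def by blast
qed

end

text \<open>There are only finitely many pairs of a letter and a coset, so they can be named
  injectively by elements of an infinite type.\<close>

theorem polyhedron_of_triple:
  assumes "tight_triple (a :: 'x perm) b c p q"
  shows "\<exists>P :: 'a::infinite ranked_poset. tight P p q \<and> regular_polyhedron P \<and> mon_kernel P = word_kernel a b c"
proof -
  interpret tight_triple a b c p q by (rule assms)
  define K where "K = (\<lambda>(k, g). (k, (*) g ` stab k)) ` (UNIV \<times> G)"
  have "UNIV = {R0, R1, R2}" using letter.exhaust by auto
  then have "finite (UNIV :: letter set)" by (metis finite.emptyI finite.insertI)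
  then have finK: "finite K" unfolding K_def using finite_G by simp
  obtain B :: "'a set" where B: "finite B" "card B = card K"
    using infinite_arbitrarily_large[OF infinite_UNIV] by metis
  obtain \<phi> where \<phi>: "bij_betw \<phi> K B" using finite_same_card_bij[OF finK B(1)] B(2) by auto
  have K_in: "(k, (*) g ` stab k) \<in> K" if "g \<in> G" for k g
    unfolding K_def using that by (intro image_eqI[of _ _ "(k, g)"]) auto
  define el where "el k g = \<phi> (k, (*) g ` stab k)" for k g
  have el: "el k g = el l h \<longleftrightarrow> k = l \<and> inverse g * h \<in> stab k" if "g \<in> G" "h \<in> G" for k l g h
  proof -
    have "el k g = el l h \<longleftrightarrow> (k, (*) g ` stab k) = (l, (*) h ` stab l)"
      unfolding el_def by (rule inj_on_eq_iff[OF _ K_in[OF that(1)] K_in[OF that(2)]]) (use \<phi> bij_betw_def in blast)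
    also have "\<dots> \<longleftrightarrow> k = l \<and> (*) g ` stab k = (*) h ` stab k" by (cases "k = l") simp_all
    also have "(*) g ` stab k = (*) h ` stab k \<longleftrightarrow> inverse g * h \<in> stab k"
    proof
      assume eq: "(*) g ` stab k = (*) h ` stab k"
      have "h * 1 \<in> (*) h ` stab k" using stab_one by blast
      then obtain s where "s \<in> stab k" "h = g * s" using eq by auto
      then show "inverse g * h \<in> stab k" by simp
    next
      assume s: "inverse g * h \<in> stab k"
      have "(*) h ` stab k \<subseteq> (*) g ` stab k"
      proof
        fix y assume "y \<in> (*) h ` stab k"
        then obtain x where x: "x \<in> stab k" "y = h * x" by blast
        then have "y = g * (inverse g * h * x)" by (simp add: mult.assoc)
        then show "y \<in> (*) g ` stab k" using stab_mult[OF s x(1)] by blast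
      qed
      moreover have "(*) g ` stab k \<subseteq> (*) h ` stab k"
      proof
        fix y assume "y \<in> (*) g ` stab k"
        then obtain x where x: "x \<in> stab k" "y = g * x" by blast
        then have "y = h * (inverse (inverse g * h) * x)" by (simp add: mult.assoc perm_inverse_mult)
        then show "y \<in> (*) h ` stab k" using stab_mult[OF stab_inverse[OF s] x(1)] by blast
      qed
      ultimately show "(*) g ` stab k = (*) h ` stab k" by blast
    qed
    finally show ?thesis by blast
  qed
  interpret coset_geometry a b c p q el by unfold_locales (rule el)
  show ?thesis using tight_P regular_P kernel_P by blast
qed

section \<open>Isomorphism types\<close>

definition cube_params :: "nat \<Rightarrow> nat \<Rightarrow> bool \<Rightarrow> bool" where
  "cube_params r q \<epsilon> \<longleftrightarrow> 0 < q \<and> 3 dvd q \<and> odd r \<and> (\<epsilon> \<longrightarrow> even q) \<and> (r \<noteq> 1 \<longrightarrow> \<epsilon> \<and> odd (q div 2))"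

text \<open>A set of kernels rather than of parameters, because kernels correspond to isomorphism
  types. That the two values of \<open>\<epsilon>\<close> give different kernels then has to be
  proved.\<close>

definition cube_kernels :: "nat \<Rightarrow> nat \<Rightarrow> letter list set set" where
  "cube_kernels p q = {K. \<exists>r \<epsilon>. K = cube_kernel r q \<epsilon> \<and> p = 4 * r \<and> cube_params r q \<epsilon>}"

text \<open>The word represents \<open>a v\<close>, since \<open>(a b)\<^sup>2 = v (b v b)\<close> when \<open>r = 1\<close>.\<close>

lemma cube_kernel_neq:
  assumes "0 < q" "even q" shows "cube_kernel 1 q False \<noteq> cube_kernel 1 q True"
proof -
  define x where "x = [R0, R1, R2, R0, R1, R0, R1, R2, R1]"
  obtain h where h: "q = 2 * h" using assms(2) by blast
  define m where "m = q - 1"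
  obtain n where n: "q = n + 2" using assms h by (metis add.commute dvd_imp_le le_Suc_ex)
  \<comment> \<open>Modulo \<open>q\<close> the number \<open>m\<close> is \<open>- 1\<close>, so
    \<open>m * (m * m) + 1\<close> vanishes; writing \<open>q = n + 2\<close> makes the cofactor
    explicit without subtraction.\<close>
  have "m * (m * (m * m) + 1) = q * ((n + 1) * (n * n + n + 1))"
    unfolding m_def n by (simp add: algebra_simps)
  then have F: "q dvd m * (m * (m * m) + 1)" by simp
  have "x \<in> cube_kernel 1 q False"
    using F unfolding cube_kernel_def cube_run_def x_def m_def by simp
  moreover have "x \<notin> cube_kernel 1 q True"
  proof
    assume "x \<in> cube_kernel 1 q True"
    then have "q dvd h + m * (1 + m * (h + m * (h + m)))"
      unfolding cube_kernel_def cube_run_def x_def m_def using h by (simp add: ac_simps)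
    \<comment> \<open>Each letter \<open>R0\<close> contributes the twist exponent \<open>h\<close>.
      The part without \<open>h\<close> is the multiple of \<open>q\<close> met above, and what
      remains is \<open>h\<close> times an odd number, which is not divisible by
      \<open>2 * h\<close>.\<close>
    also have "h + m * (1 + m * (h + m * (h + m))) = m * (m * (m * m) + 1) + h * (m * m * m + m * m + 1)"
      by (simp add: algebra_simps)
    finally have "2 * h dvd h * (m * m * m + m * m + 1)" using F h by (simp add: dvd_add_right_iff)
    then have "even (m * m * m + m * m + 1)"
      using dvd_times_left_cancel_iff[of h 2] mult.commute[of 2 h] assms(1) h by (metis mult_0_right neq0_conv)
    then show False by simp
  qed
  ultimately show ?thesis by blast
qed

lemma cube_kernels_4:
  "cube_kernels 4 q = (if 0 < q \<and> 3 dvd q then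
     (if even q then {cube_kernel 1 q False, cube_kernel 1 q True} else {cube_kernel 1 q False}) else {})"
proof (rule Set.set_eqI)
  fix K
  have "K \<in> cube_kernels 4 q \<longleftrightarrow> (\<exists>\<epsilon>. K = cube_kernel 1 q \<epsilon> \<and> cube_params 1 q \<epsilon>)"
    unfolding cube_kernels_def by auto
  then show "K \<in> cube_kernels 4 q \<longleftrightarrow> K \<in> (if 0 < q \<and> 3 dvd q then
     (if even q then {cube_kernel 1 q False, cube_kernel 1 q True} else {cube_kernel 1 q False}) else {})"
    unfolding cube_params_def ex_bool_eq by auto
qed

lemma cube_kernels_gt4:
  assumes "r \<noteq> 1"
  shows "cube_kernels (4 * r) q =
    (if odd r \<and> 0 < q \<and> 3 dvd q \<and> even q \<and> odd (q div 2) then {cube_kernel r q True} else {})"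
proof (rule Set.set_eqI)
  fix K
  have "K \<in> cube_kernels (4 * r) q \<longleftrightarrow> (\<exists>\<epsilon>. K = cube_kernel r q \<epsilon> \<and> cube_params r q \<epsilon>)"
    unfolding cube_kernels_def by auto
  then show "K \<in> cube_kernels (4 * r) q \<longleftrightarrow>
      K \<in> (if odd r \<and> 0 < q \<and> 3 dvd q \<and> even q \<and> odd (q div 2) then {cube_kernel r q True} else {})"
    unfolding cube_params_def ex_bool_eq using assms by auto
qed

section \<open>Arithmetic of the admissible types\<close>

definition admissible_part :: "nat \<Rightarrow> nat \<Rightarrow> bool" where
  "admissible_part p q \<longleftrightarrow> (\<exists>k r. k > 0 \<and> r > 0 \<and>
     (p = 4 \<and> q = 3 * k \<or> p = 4 * r \<and> q = 6 * k \<and> r > 1 \<and> odd r \<and> odd k))"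

lemma admissible_type_iff: "admissible_type p q \<longleftrightarrow> admissible_part p q \<or> admissible_part q p"
  unfolding admissible_type_def admissible_part_def by blast

text \<open>Two kernels occur only for \<open>r = 1\<close> and even \<open>q\<close>, where the
  twist may be present or absent. For odd \<open>q\<close> it is excluded, and for
  \<open>r > 1\<close> it is forced.\<close>

lemma card_cube_kernels:
  "finite (cube_kernels p q)"
  "card (cube_kernels p q) = (if \<exists>k>0. p = 4 \<and> q = 6 * k then 2 else if admissible_part p q then 1 else 0)"
proof -
  have six: "(\<exists>k>0. q = 6 * k) \<longleftrightarrow> 0 < q \<and> 3 dvd q \<and> even q"
  proof
    assume *: "0 < q \<and> 3 dvd q \<and> even q"
    then have "6 dvd q" by presburger
    then show "\<exists>k>0. q = 6 * k" using * by (auto elim!: dvdE)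
  qed auto
  have six': "(\<exists>k>0. q = 6 * k \<and> odd k) \<longleftrightarrow> 0 < q \<and> 3 dvd q \<and> even q \<and> odd (q div 2)"
  proof
    assume *: "0 < q \<and> 3 dvd q \<and> even q \<and> odd (q div 2)"
    then obtain k where k: "k > 0" "q = 6 * k" using six by blast
    then have "q div 2 = 3 * k" by simp
    then show "\<exists>k>0. q = 6 * k \<and> odd k" using * k by auto
  qed auto
  have three: "(\<exists>k>0. q = 3 * k) \<longleftrightarrow> 0 < q \<and> 3 dvd q" by (auto elim!: dvdE)
  have "finite (cube_kernels p q) \<and>
    card (cube_kernels p q) = (if \<exists>k>0. p = 4 \<and> q = 6 * k then 2 else if admissible_part p q then 1 else 0)"
  proof (cases "p = 4")
    case True
    have "admissible_part 4 q \<longleftrightarrow> (\<exists>k>0. q = 3 * k)" unfolding admissible_part_def by auto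
    then show ?thesis using cube_kernel_neq[of q] unfolding True cube_kernels_4 three
      by (simp add: six[simplified])
  next
    case p4: False
    show ?thesis
    proof (cases "\<exists>r. p = 4 * r")
      case True
      then obtain r where r: "p = 4 * r" "r \<noteq> 1" using p4 by auto
      have "admissible_part p q \<longleftrightarrow> odd r \<and> (\<exists>k>0. q = 6 * k \<and> odd k)"
      proof
        assume "odd r \<and> (\<exists>k>0. q = 6 * k \<and> odd k)"
        moreover from this have "r > 1" using r(2) odd_pos[of r] by linarith
        ultimately show "admissible_part p q" unfolding admissible_part_def r(1) by auto
      qed (use r in \<open>auto simp: admissible_part_def\<close>)
      then show ?thesis using p4 unfolding six' r(1) cube_kernels_gt4[OF r(2)] by simp
    next
      case False
      then have "cube_kernels p q = {}" "\<not> admissible_part p q"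
        unfolding cube_kernels_def admissible_part_def using p4 by auto
      then show ?thesis using p4 by simp
    qed
  qed
  then show "finite (cube_kernels p q)"
    "card (cube_kernels p q) = (if \<exists>k>0. p = 4 \<and> q = 6 * k then 2 else if admissible_part p q then 1 else 0)"
    by blast+
qed

text \<open>Both conditions together would make \<open>p\<close> and \<open>q\<close> divisible by 3
  and by 4. A first parameter other than 4 requires the second to be 6 times an odd number, which 4
  does not divide; and 4 is not divisible by 3. So the numbers of types found for the two families
  can be added.\<close>

lemma admissible_part_exclusive: "\<not> (admissible_part p q \<and> admissible_part q p)"
proof
  assume *: "admissible_part p q \<and> admissible_part q p"
  have A: "4 dvd p \<and> 3 dvd q \<and> (p = 4 \<or> \<not> 4 dvd q)" if adm: "admissible_part p q" for p q :: nat
  proof -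
    obtain k r where "p = 4 \<and> q = 3 * k \<or> p = 4 * r \<and> q = 6 * k \<and> odd k" using adm unfolding admissible_part_def by blast
    moreover have "\<not> 4 dvd 6 * k" if "odd k" using that by presburger
    ultimately show ?thesis by auto
  qed
  have "4 dvd p" "3 dvd q" "4 dvd q" "3 dvd p" "p = 4 \<or> \<not> 4 dvd q" using A[of p q] A[of q p] * by blast+
  then show False by auto
qed

lemma inj_word_dual: "inj ((`) word_dual)"
proof (rule injI)
  fix A B assume "word_dual ` A = word_dual ` B"
  then have "word_dual ` word_dual ` A = word_dual ` word_dual ` B" by simp
  then show "A = B" by (simp add: image_image)
qed

lemma word_kernel_dual: "word_kernel a b c = word_dual ` word_kernel c b a"
proof
  have *: "ev c b a (word_dual w) = ev a b c w" for w by (rule ev_dual)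
  show "word_dual ` word_kernel c b a \<subseteq> word_kernel a b c"
    unfolding word_kernel_def using ev_dual[of a b c] by auto
  show "word_kernel a b c \<subseteq> word_dual ` word_kernel c b a"
  proof
    fix w assume "w \<in> word_kernel a b c"
    then have "word_dual w \<in> word_kernel c b a" unfolding word_kernel_def using * by simp
    then have "word_dual (word_dual w) \<in> word_dual ` word_kernel c b a" by (rule imageI)
    then show "w \<in> word_dual ` word_kernel c b a" by simp
  qed
qed

section \<open>Counting isomorphism types by kernels\<close>

lemma reg_polyhedronI: "tight P p q \<Longrightarrow> regular_polyhedron P \<Longrightarrow> reg_polyhedron P"
  unfolding tight_def by (intro reg_polyhedron.intro fin_polyhedronI reg_polyhedron_axioms.intro) auto

lemma tight_nonorientableD:
  assumes "P \<in> tight_nonorientable p q"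
  shows "reg_polyhedron P" "tight_triple (mon P R0) (mon P R1) (mon P R2) p q"
    "nonorientable_triple (mon P R0) (mon P R1) (mon P R2)"
proof -
  have t: "tight P p q" and n: "nonorientably_regular P" using assms unfolding tight_nonorientable_def by blast+
  show r: "reg_polyhedron P" using reg_polyhedronI t n unfolding nonorientably_regular_def by blast
  interpret reg_polyhedron P by (rule r)
  show "tight_triple (mon P R0) (mon P R1) (mon P R2) p q" using tight_triple_mon t unfolding tight_def by blast
  show "nonorientable_triple (mon P R0) (mon P R1) (mon P R2)" using n nonorientably_regular_iff by blast
qed

lemma word_kernel_cube_type:
  assumes "tight_triple a b c p q" "cube_type a b c p q" shows "word_kernel a b c \<in> cube_kernels p q"
proof -
  obtain r \<epsilon> where r: "p = 4 * r" "cube_like a b c r q \<epsilon>" using assms(2) unfolding cube_type_def by blast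
  have "0 < q" using tight_triple.q_ge[OF assms(1)] by simp
  then have "cube_params r q \<epsilon>" using r(2) unfolding cube_params_def cube_like_def by blast
  then show ?thesis using cube_like_kernel assms(1) r unfolding cube_kernels_def by blast
qed

lemma cube_kernels_realised:
  assumes "K \<in> cube_kernels p q"
  shows "\<exists>(a :: (nat \<times> int) perm) b c. tight_triple a b c p q \<and> nonorientable_triple a b c \<and> word_kernel a b c = K"
proof -
  obtain r \<epsilon> where r: "K = cube_kernel r q \<epsilon>" "p = 4 * r" "cube_params r q \<epsilon>" using assms unfolding cube_kernels_def by blast
  then obtain a b c :: "(nat \<times> int) perm" where
    "tight_triple a b c (4 * r) q" "nonorientable_triple a b c" "cube_like a b c r q \<epsilon>"
    using cube_model[of q r \<epsilon>] unfolding cube_params_def by blast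
  then show ?thesis using cube_like_kernel r by blast
qed

lemma polyhedron_of_nonorientable_triple:
  assumes "tight_triple (a :: 'x perm) b c p q" "nonorientable_triple a b c"
  shows "word_kernel a b c \<in> mon_kernel ` (tight_nonorientable p q :: 'a::infinite ranked_poset set)"
proof -
  obtain P :: "'a ranked_poset" where P: "tight P p q" "regular_polyhedron P" "mon_kernel P = word_kernel a b c"
    using polyhedron_of_triple[OF assms(1)] by blast
  interpret reg_polyhedron P using reg_polyhedronI P by blast
  have "nonorientable_triple (mon P R0) (mon P R1) (mon P R2)"
    using assms(2) P(3) unfolding nonorientable_triple_def word_kernel_def by blast
  then have "P \<in> tight_nonorientable p q" using P(1) nonorientably_regular_iff unfolding tight_nonorientable_def by blast
  then show ?thesis using P(3) by blast
qed

text \<open>One inclusion is the classification of tight triples, the other comes from the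
  permutation models and their coset geometries. The second family consists of the dual polyhedra,
  whose trivial words have the letters \<open>R0\<close> and \<open>R2\<close> exchanged.\<close>

lemma kernels_tight_nonorientable:
  "mon_kernel ` (tight_nonorientable p q :: 'a::infinite ranked_poset set) =
     cube_kernels p q \<union> (`) word_dual ` cube_kernels q p"
proof
  show "mon_kernel ` (tight_nonorientable p q :: 'a ranked_poset set) \<subseteq> cube_kernels p q \<union> (`) word_dual ` cube_kernels q p"
  proof
    fix K assume "K \<in> mon_kernel ` (tight_nonorientable p q :: 'a ranked_poset set)"
    then obtain P :: "'a ranked_poset" where P: "P \<in> tight_nonorientable p q" "K = mon_kernel P" by blast
    note t = tight_nonorientableD[OF P(1)]
    consider "cube_type (mon P R0) (mon P R1) (mon P R2) p q" | "cube_type (mon P R2) (mon P R1) (mon P R0) q p"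
      using tight_classification[OF t(2,3)] by blast
    then show "K \<in> cube_kernels p q \<union> (`) word_dual ` cube_kernels q p"
    proof cases
      case 1
      then show ?thesis using word_kernel_cube_type[OF t(2)] P(2) by blast
    next
      case 2
      then have "word_kernel (mon P R2) (mon P R1) (mon P R0) \<in> cube_kernels q p"
        by (rule word_kernel_cube_type[OF tight_triple.dual[OF t(2)]])
      then show ?thesis unfolding P(2) word_kernel_dual[of "mon P R0"] by blast
    qed
  qed
  show "cube_kernels p q \<union> (`) word_dual ` cube_kernels q p \<subseteq> mon_kernel ` (tight_nonorientable p q :: 'a ranked_poset set)"
  proof (intro Un_least subsetI)
    fix K assume "K \<in> cube_kernels p q"
    then obtain a b c :: "(nat \<times> int) perm" where "tight_triple a b c p q" "nonorientable_triple a b c" "word_kernel a b c = K"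
      using cube_kernels_realised by blast
    then show "K \<in> mon_kernel ` (tight_nonorientable p q :: 'a ranked_poset set)"
      using polyhedron_of_nonorientable_triple by blast
  next
    fix K assume "K \<in> (`) word_dual ` cube_kernels q p"
    then obtain L where L: "L \<in> cube_kernels q p" "K = word_dual ` L" by blast
    obtain a b c :: "(nat \<times> int) perm" where abc: "tight_triple a b c q p" "nonorientable_triple a b c" "word_kernel a b c = L"
      using cube_kernels_realised[OF L(1)] by blast
    have K: "word_kernel c b a = K" unfolding L(2) abc(3)[symmetric] by (rule word_kernel_dual)
    show "K \<in> mon_kernel ` (tight_nonorientable p q :: 'a ranked_poset set)"
      unfolding K[symmetric]
      by (rule polyhedron_of_nonorientable_triple[OF tight_triple.dual[OF abc(1)] nonorientable_triple_dual[OF abc(2)]])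
  qed
qed

lemma card_quotient_kernel: "card (A // {(x, y). x \<in> A \<and> y \<in> A \<and> f x = f y}) = card (f ` A)"
proof (rule bij_betw_same_card[symmetric])
  let ?R = "{(x, y). x \<in> A \<and> y \<in> A \<and> f x = f y}"
  let ?h = "\<lambda>k. {y \<in> A. f y = k}"
  have R: "?R `` {x} = ?h (f x)" if "x \<in> A" for x using that by auto
  have "inj_on ?h (f ` A)"
  proof (rule inj_onI)
    fix k l assume "k \<in> f ` A" "l \<in> f ` A" "?h k = ?h l"
    then show "k = l" by blast
  qed
  moreover have "?h ` f ` A = A // ?R" unfolding quotient_def using R by auto
  ultimately show "bij_betw ?h (f ` A) (A // ?R)" unfolding bij_betw_def by blast
qed

theorem theorem5p10:
  fixes p q :: nat
  shows "((\<exists>P :: 'a::infinite ranked_poset. tight P p q \<and> nonorientably_regular P)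
            \<longleftrightarrow> admissible_type p q) \<and>
         (admissible_type p q \<longrightarrow>
            card (isomorphism_types (tight_nonorientable p q :: 'a ranked_poset set)) =
              (if \<exists>k>0. p = 4 \<and> q = 6 * k \<or> q = 4 \<and> p = 6 * k then 2 else 1))"
proof -
  let ?X = "tight_nonorientable p q :: 'a ranked_poset set"
  let ?K = "cube_kernels p q \<union> (`) word_dual ` cube_kernels q p"
  have empty: "cube_kernels p q = {} \<longleftrightarrow> \<not> admissible_part p q" for p q
  proof -
    have "admissible_part p q" if "p = 4" "q = 6 * k" "k > 0" for k
      using that unfolding admissible_part_def by (intro exI[of _ "2 * k"]) auto
    then show ?thesis using card_cube_kernels[of p q] card_0_eq[of "cube_kernels p q"] by (auto split: if_splits)
  qed
  \<comment> \<open>As equality of kernels is the same as isomorphism, counting classes amounts to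
    counting kernels.\<close>
  have "isomorphism_types ?X = ?X // {(P, Q). P \<in> ?X \<and> Q \<in> ?X \<and> mon_kernel P = mon_kernel Q}"
    unfolding isomorphism_types_def
    using kernel_of_iso iso_of_kernel tight_nonorientableD(1) by (metis (no_types, lifting))
  then have "card (isomorphism_types ?X) = card (mon_kernel ` ?X)" by (simp only: card_quotient_kernel)
  then have card: "card (isomorphism_types ?X) = card ?K" unfolding kernels_tight_nonorientable .
  have dual: "card ((`) word_dual ` cube_kernels q p) = card (cube_kernels q p)"
    by (rule card_image) (rule inj_on_subset[OF inj_word_dual], simp)
  have "cube_kernels p q = {} \<or> cube_kernels q p = {}" using empty admissible_part_exclusive by blast
  then have sum: "card ?K = card (cube_kernels p q) + card (cube_kernels q p)" using dual by auto
  have "(\<exists>P :: 'a ranked_poset. tight P p q \<and> nonorientably_regular P) \<longleftrightarrow> mon_kernel ` ?X \<noteq> {}"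
    unfolding tight_nonorientable_def by blast
  also have "\<dots> \<longleftrightarrow> admissible_type p q"
    unfolding kernels_tight_nonorientable admissible_type_iff using empty by blast
  finally have 1: "(\<exists>P :: 'a ranked_poset. tight P p q \<and> nonorientably_regular P) \<longleftrightarrow> admissible_type p q" .
  have "card ?K = (if \<exists>k>0. p = 4 \<and> q = 6 * k \<or> q = 4 \<and> p = 6 * k then 2 else 1)" if adm: "admissible_type p q"
  proof -
    have c0: "card (cube_kernels p q) = 0" if "\<not> admissible_part p q" for p q
      using empty[of p q] that by simp
    have c6: "admissible_part p q" if "\<exists>k>0. p = 4 \<and> q = 6 * k" for p q
      using that card_cube_kernels(2)[of p q] empty[of p q] by fastforce
    have iff: "(\<exists>k>0. p = 4 \<and> q = 6 * k \<or> q = 4 \<and> p = 6 * k) \<longleftrightarrow>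
        (\<exists>k>0. p = 4 \<and> q = 6 * k) \<or> (\<exists>k>0. q = 4 \<and> p = 6 * k)" by blast
    show ?thesis
    proof (cases "admissible_part p q")
      case True
      then have "\<not> admissible_part q p" using admissible_part_exclusive by blast
      moreover from this have "\<not> (\<exists>k>0. q = 4 \<and> p = 6 * k)" using c6[of q p] by blast
      ultimately show ?thesis using True c0[of q p] card_cube_kernels(2)[of p q] unfolding sum iff by simp blast
    next
      case False
      then have "admissible_part q p" using adm unfolding admissible_type_iff by blast
      moreover have "\<not> (\<exists>k>0. p = 4 \<and> q = 6 * k)" using c6[of p q] False by blast
      ultimately show ?thesis using False c0[of p q] card_cube_kernels(2)[of q p] unfolding sum iff by simp blast
    qed
  qed
  then show ?thesis using 1 card by simp
qed

end
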